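(* Let $n\ge 1$, let $c>0$, and let $u$ be a solution of $$u_t-\Delta u=\chi_{\{u>0\}}\quad\text{in } Q_1\subset\mathbb{R}^n\times\mathbb{R}$$ such that $u(x,t_2)-u(x,t_1)\ge c\,(t_2-t_1)$ whenever $(x,t_1),(x,t_2)\in Q_1$ and $t_1\le t_2$. Then for every $0<\alpha<1$ the free boundary $\Gamma=\partial\{u>0\}\cap Q_1$ is locally the graph of a $C^{1,\alpha/2}$ function of the spatial variable $x$; that is, for every $(x_0,t_0)\in\Gamma$ there are a neighborhood $U\times I\subset Q_1$ of $(x_0,t_0)$ (with $U\subset\mathbb{R}^n$ an open ball centered at $x_0$ and $I$ an open interval containing $t_0$) and a function $H\in C^{1,\alpha/2}(U)$ such that $\Gamma\cap(U\times I)=\{(x,H(x)):x\in U\}$.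
   Context: Here $Q_r(x,t)=\{(y,s)\in\mathbb{R}^n\times\mathbb{R}: |x-y|+|t-s|^{1/2}<r\}$ and $Q_r=Q_r(0,0)$. $\nabla$, $D^2$ and $\Delta$ act in the spatial variable $x\in\mathbb{R}^n$ only. A solution of $u_t-\Delta u=\chi_{\{u>0\}}$ is a strong solution: $u$ is continuous, its weak derivatives $u_t,\nabla u,D^2u$ belong to $L^p_{\rm loc}$ for every $1\le p<\infty$, and the equation holds almost everywhere. $\chi_A$ is the characteristic function of $A$. The boundary $\partial\{u>0\}$ is taken in space-time. $C^{1,\beta}(U)$ denotes differentiable functions whose gradient is locally Hölder continuous with exponent $\beta$. *)

theory Defs
  imports "HOL-Analysis.Analysis"
begin

definition parabolic_cylinder :: "real \<Rightarrow> real^'n \<Rightarrow> real \<Rightarrow> ((real^'n) \<times> real) set" where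
  "parabolic_cylinder r x t = {(y, s). norm (x - y) + sqrt \<bar>t - s\<bar> < r}"

text \<open>The classes \<open>C\<^sup>k\<close> on the whole space, with derivatives taken along the standard basis.\<close>

fun C_k :: "nat \<Rightarrow> ('a::euclidean_space \<Rightarrow> real) \<Rightarrow> bool" where
  "C_k 0 f \<longleftrightarrow> continuous_on UNIV f"
| "C_k (Suc k) f \<longleftrightarrow> (\<forall>x. f differentiable (at x)) \<and>
     (\<forall>b\<in>Basis. C_k k (\<lambda>x. frechet_derivative f (at x) b))"

definition test_function :: "'a::euclidean_space set \<Rightarrow> ('a \<Rightarrow> real) \<Rightarrow> bool" where
  "test_function \<Omega> \<phi> \<longleftrightarrow> (\<forall>k. C_k k \<phi>) \<and>
     compact (closure {z. \<phi> z \<noteq> 0}) \<and> closure {z. \<phi> z \<noteq> 0} \<subseteq> \<Omega>"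

definition Lp_loc :: "real \<Rightarrow> 'a::euclidean_space set \<Rightarrow> ('a \<Rightarrow> real) \<Rightarrow> bool" where
  "Lp_loc p \<Omega> f \<longleftrightarrow> f \<in> borel_measurable (lebesgue_on \<Omega>) \<and>
     (\<forall>K. compact K \<and> K \<subseteq> \<Omega> \<longrightarrow> (\<lambda>z. \<bar>f z\<bar> powr p) absolutely_integrable_on K)"

text \<open>\<open>g\<close> is (a representative of) the weak derivative of \<open>f\<close> on \<open>\<Omega>\<close> in the direction \<open>v\<close>.\<close>

definition has_weak_deriv ::
    "'a::euclidean_space set \<Rightarrow> ('a \<Rightarrow> real) \<Rightarrow> 'a \<Rightarrow> ('a \<Rightarrow> real) \<Rightarrow> bool" where
  "has_weak_deriv \<Omega> f v g \<longleftrightarrow> Lp_loc 1 \<Omega> f \<and> Lp_loc 1 \<Omega> g \<and>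
     (\<forall>\<phi>. test_function \<Omega> \<phi> \<longrightarrow>
        (LINT z|lebesgue_on \<Omega>. f z * frechet_derivative \<phi> (at z) v)
          = - (LINT z|lebesgue_on \<Omega>. g z * \<phi> z))"

text \<open>Strong solutions of \<open>u\<^sub>t - \<Delta>u = f\<close>. Points are pairs \<open>(x, t)\<close>, so \<open>(0, 1)\<close> is the
  time direction and \<open>(axis i 1, 0)\<close> is the \<open>i\<close>-th spatial direction; \<open>Du i\<close> and \<open>D2u i j\<close>
  represent the first and second weak spatial derivatives.\<close>

definition strong_heat_solution ::
    "((real^'n) \<times> real) set \<Rightarrow> ((real^'n) \<times> real \<Rightarrow> real) \<Rightarrow> ((real^'n) \<times> real \<Rightarrow> real) \<Rightarrow> bool" where
  "strong_heat_solution \<Omega> f u \<longleftrightarrow> continuous_on \<Omega> u \<and>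
     (\<exists>ut Du D2u.
        has_weak_deriv \<Omega> u (0, 1) ut \<and>
        (\<forall>i. has_weak_deriv \<Omega> u (axis i 1, 0) (Du i)) \<and>
        (\<forall>i j. has_weak_deriv \<Omega> (Du i) (axis j 1, 0) (D2u i j)) \<and>
        (\<forall>p\<ge>1. Lp_loc p \<Omega> ut \<and> (\<forall>i. Lp_loc p \<Omega> (Du i)) \<and> (\<forall>i j. Lp_loc p \<Omega> (D2u i j))) \<and>
        (AE z in lebesgue_on \<Omega>. ut z - (\<Sum>i\<in>UNIV. D2u i i z) = f z))"

definition positivity_set :: "'a set \<Rightarrow> ('a \<Rightarrow> real) \<Rightarrow> 'a set" where
  "positivity_set \<Omega> u = {z \<in> \<Omega>. u z > 0}"

definition free_boundary :: "'a::topological_space set \<Rightarrow> ('a \<Rightarrow> real) \<Rightarrow> 'a set" where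
  "free_boundary \<Omega> u = frontier (positivity_set \<Omega> u) \<inter> \<Omega>"

definition locally_holder_on :: "real \<Rightarrow> 'a::metric_space set \<Rightarrow> ('a \<Rightarrow> 'b::metric_space) \<Rightarrow> bool" where
  "locally_holder_on \<beta> U g \<longleftrightarrow>
     (\<forall>K. compact K \<and> K \<subseteq> U \<longrightarrow>
        (\<exists>C. \<forall>x\<in>K. \<forall>y\<in>K. dist (g x) (g y) \<le> C * dist x y powr \<beta>))"

definition C1_holder_on :: "real \<Rightarrow> 'a::real_inner set \<Rightarrow> ('a \<Rightarrow> real) \<Rightarrow> bool" where
  "C1_holder_on \<beta> U H \<longleftrightarrow>
     (\<exists>G. (\<forall>x\<in>U. GDERIV H x :> G x) \<and> locally_holder_on \<beta> U G)"

end

theory Submission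
  imports Defs
begin

text \<open>
  By the growth in time, the free boundary is locally a Lipschitz graph \<open>t = H x\<close> on which \<open>u\<close>
  vanishes. Testing the equation with the heat kernel times a cutoff represents \<open>u\<close> as the truncated
  heat potential of \<open>{u > 0}\<close> minus a smooth function. Hence the spatial gradient \<open>D\<close> of \<open>u\<close> is
  parabolically Hoelder continuous of every exponent \<open>a < 1\<close>, while the derivative of \<open>u\<close> in time is,
  up to a smooth function, the integral of the kernel over the graph of \<open>H\<close>. This derivative \<open>W\<close> is
  at least \<open>c\<close>, but it may be infinite where \<open>D\<close> vanishes.

  Let \<open>p\<close> be the size of \<open>D\<close> at a point of the graph. In a parabolic neighbourhood of radius comparable
  to \<open>p\<^bsup>1/a\<^esup>\<close> the gradient does not change much, so \<open>u\<close> is strictly monotone in a coordinate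
  direction. Integrating the kernel along that direction shows that \<open>W\<close> is Hoelder continuous
  there with a constant of order \<open>1/p\<close>. Expanding \<open>u (x, H x) = 0\<close> yields \<open>\<nabla>H = - D / W\<close>, which is to
  be read as \<open>0\<close> where \<open>D\<close> vanishes. For two points within that radius the factor \<open>D\<close>
  compensates the loss \<open>1/p\<close> in the regularity of \<open>W\<close>; for points further apart \<open>norm (\<nabla>H) \<le> p / c\<close> suffices.
\<close>

section \<open>Smooth functions and powers of the heat kernel\<close>

text \<open>The time derivative on the graph is a borderline quantity. In n space dimensions the
  kernel has size |y|^(-n) where s - H y is of size |y|^2, so its integral over the graph may
  diverge logarithmically. Where \<open>u\<close> has spatial slope p, the Gaussian factors of the n
  - 1 other directions give back t^((n - 1)/2), and the remaining t^(-1/2) can be integrated along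
  the direction of growth. Making this quantitative costs the factor 1/p. All statements about
  \<open>W\<close> are therefore conditional on an extended real weight being finite, and that
  weight carries the exponent n/2 + \<gamma> instead of n/2, so that one bound pays both for
  integrability and for the Hoelder quotient. The exponent \<alpha>/2 comes from moving along the
  graph: \<open>D\<close> has an exponent just below 1 in space but only half of it in time, and a
  priori \<open>H\<close> is no better than Lipschitz, so the time exponent decides. The same half
  appears when p is compared with the parabolic distance. Growth in time is used three times: for
  the graph itself, for its Lipschitz bound, and for the lower bound on \<open>W\<close> that
  permits the division.\<close>

fun C_k_on :: "nat \<Rightarrow> 'a::euclidean_space set \<Rightarrow> ('a \<Rightarrow> real) \<Rightarrow> bool" where
  "C_k_on 0 S f \<longleftrightarrow> continuous_on S f"
| "C_k_on (Suc k) S f \<longleftrightarrow> (\<forall>x\<in>S. f differentiable (at x)) \<and>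
     (\<forall>b\<in>Basis. C_k_on k S (\<lambda>x. frechet_derivative f (at x) b))"

text \<open>\<open>C_k\<close> lives on the whole space, but the heat kernel is smooth only away
  from the origin. The local classes allow test functions to be assembled from pieces and then
  returned to \<open>C_k\<close>.\<close>

lemma C_k_eq_C_k_on_UNIV: "C_k k f \<longleftrightarrow> C_k_on k UNIV f"
  by (induction k arbitrary: f) auto

lemma C_k_on_cong:
  assumes "open S" "\<And>x. x \<in> S \<Longrightarrow> f x = g x"
  shows "C_k_on k S f \<longleftrightarrow> C_k_on k S g"
  using assms(2)
proof (induction k arbitrary: f g)
  case 0
  then show ?case by (auto cong: continuous_on_cong)
next
  case (Suc k)
  have d: "f differentiable (at x) \<longleftrightarrow> g differentiable (at x)" if "x \<in> S" for x
    unfolding differentiable_def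
    using has_derivative_transform_within_open[OF _ \<open>open S\<close> that, of f _ UNIV g]
      has_derivative_transform_within_open[OF _ \<open>open S\<close> that, of g _ UNIV f] Suc.prems by auto
  have e: "frechet_derivative f (at x) = frechet_derivative g (at x)"
    if "x \<in> S" "f differentiable (at x)" for x
    using frechet_derivative_transform_within_open[OF that(2) \<open>open S\<close> that(1)] Suc.prems by auto
  show ?case
  proof (cases "\<forall>x\<in>S. f differentiable (at x)")
    case True
    then have "C_k_on k S (\<lambda>x. frechet_derivative f (at x) b) \<longleftrightarrow>
               C_k_on k S (\<lambda>x. frechet_derivative g (at x) b)" for b
      using e by (intro Suc.IH) auto
    then show ?thesis using True d by auto
  next
    case False then show ?thesis using d by auto
  qed
qed

lemma C_k_on_subset: "C_k_on k S f \<Longrightarrow> T \<subseteq> S \<Longrightarrow> C_k_on k T f"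
  by (induction k arbitrary: f) (auto intro: continuous_on_subset)

text \<open>Gluing: the kernels below are smooth off the origin by computation, and smooth near it
  because they vanish there, on a ball or on a half-space.\<close>

lemma C_k_on_Un:
  assumes "open S" "open T" "C_k_on k S f" "C_k_on k T f"
  shows "C_k_on k (S \<union> T) f"
  using assms(3,4) by (induction k arbitrary: f) (auto intro: continuous_on_open_Un[OF assms(1,2)])

lemma C_k_on_SucD:
  assumes "C_k_on (Suc k) S f" shows "C_k_on k S f"
  using assms
proof (induction k arbitrary: f)
  case 0
  then show ?case
    by (auto intro!: continuous_at_imp_continuous_on differentiable_imp_continuous_within)
next
  case (Suc k)
  then show ?case by (metis C_k_on.simps(2))
qed

lemma C_k_on_SucI:
  assumes "open S" "\<And>x. x \<in> S \<Longrightarrow> (f has_derivative f' x) (at x)"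
    "\<And>b. b \<in> Basis \<Longrightarrow> C_k_on k S (\<lambda>x. f' x b)"
  shows "C_k_on (Suc k) S f"
proof -
  have "C_k_on k S (\<lambda>x. frechet_derivative f (at x) b)" if "b \<in> Basis" for b
    using assms(3)[OF that] C_k_on_cong[OF assms(1), of "\<lambda>x. frechet_derivative f (at x) b" "\<lambda>x. f' x b"]
      frechet_derivative_at[OF assms(2)] by metis
  then show ?thesis using assms(2) by (auto simp: differentiable_def)
qed

lemma C_k_on_has_derivative:
  assumes "C_k_on (Suc k) S f" "x \<in> S"
  shows "(f has_derivative frechet_derivative f (at x)) (at x)"
  using assms by (auto simp: frechet_derivative_works)

lemma C_k_on_const [simp]: "C_k_on k S (\<lambda>_. c)"
proof (induction k arbitrary: c)
  case (Suc k)
  have "frechet_derivative (\<lambda>_::'a. c) (at x) = (\<lambda>_. 0)" for x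
    by (simp add: frechet_derivative_const)
  then show ?case using Suc by simp
qed simp

lemma C_k_on_bounded_linear:
  assumes "open S" "bounded_linear f" shows "C_k_on k S f"
proof (cases k)
  case 0 then show ?thesis using assms by (simp add: linear_continuous_on)
next
  case (Suc j)
  show ?thesis unfolding Suc
    by (rule C_k_on_SucI[OF assms(1), where f'="\<lambda>_. f"])
       (use assms(2) in \<open>auto intro: bounded_linear_imp_has_derivative\<close>)
qed

lemma C_k_on_add:
  assumes "open S" "C_k_on k S f" "C_k_on k S g" shows "C_k_on k S (\<lambda>x. f x + g x)"
  using assms(2,3)
proof (induction k arbitrary: f g)
  case (Suc k)
  show ?case
    by (rule C_k_on_SucI[OF assms(1), where
          f'="\<lambda>x h. frechet_derivative f (at x) h + frechet_derivative g (at x) h"])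
      (use Suc in \<open>auto intro!: has_derivative_add simp: frechet_derivative_works[symmetric]\<close>)
qed (auto intro: continuous_intros)

lemma C_k_on_mult:
  assumes "open S" "C_k_on k S f" "C_k_on k S g" shows "C_k_on k S (\<lambda>x. f x * g x)"
  using assms(2,3)
proof (induction k arbitrary: f g)
  case (Suc k)
  note fg = C_k_on_SucD[OF Suc.prems(1)] C_k_on_SucD[OF Suc.prems(2)]
  show ?case
  proof (rule C_k_on_SucI[OF assms(1), where
          f'="\<lambda>x h. f x * frechet_derivative g (at x) h + frechet_derivative f (at x) h * g x"])
    show "((\<lambda>x. f x * g x) has_derivative
         (\<lambda>h. f x * frechet_derivative g (at x) h + frechet_derivative f (at x) h * g x)) (at x)"
      if "x \<in> S" for x
      using Suc.prems that by (auto intro!: has_derivative_mult simp: frechet_derivative_works[symmetric])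
    show "C_k_on k S (\<lambda>x. f x * frechet_derivative g (at x) b + frechet_derivative f (at x) b * g x)"
      if "b \<in> Basis" for b
      by (intro C_k_on_add[OF assms(1)] Suc.IH fg) (use Suc.prems that in auto)
  qed
qed (auto intro: continuous_intros)

lemma C_k_on_cmult: "open S \<Longrightarrow> C_k_on k S f \<Longrightarrow> C_k_on k S (\<lambda>x. c * f x)"
  by (rule C_k_on_mult[OF _ C_k_on_const])

lemma C_k_on_diff:
  assumes "open S" "C_k_on k S f" "C_k_on k S g" shows "C_k_on k S (\<lambda>x. f x - g x)"
  using C_k_on_add[OF assms(1,2) C_k_on_cmult[OF assms(1,3), of "-1"]] by simp

lemma C_k_on_sum:
  assumes "open S" "\<And>i. i \<in> I \<Longrightarrow> C_k_on k S (f i)" shows "C_k_on k S (\<lambda>x. \<Sum>i\<in>I. f i x)"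
  using assms(2) by (induction I rule: infinite_finite_induct) (auto intro: C_k_on_add[OF assms(1)])

text \<open>The induction runs over all \<open>g\<close>, since the chain rule brings in the
  derivative of \<open>g\<close> composed with the same \<open>f\<close>.\<close>

lemma C_k_on_compose:
  fixes g :: "real \<Rightarrow> real"
  assumes "open S" "open T" "f ` S \<subseteq> T" "C_k_on k S f" "C_k_on k T g"
  shows "C_k_on k S (\<lambda>x. g (f x))"
  using assms(4,5)
proof (induction k arbitrary: g)
  case 0
  then show ?case using continuous_on_compose2[of T g S f] assms(3) by auto
next
  case (Suc k)
  show ?case
  proof (rule C_k_on_SucI[OF assms(1), where
          f'="\<lambda>x h. frechet_derivative f (at x) h * frechet_derivative g (at (f x)) 1"])
    fix x assume x: "x \<in> S"
    have g: "(g has_derivative frechet_derivative g (at (f x))) (at (f x))"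
      using C_k_on_has_derivative[OF Suc.prems(2)] x assms(3) by auto
    have f: "(f has_derivative frechet_derivative f (at x)) (at x)"
      using C_k_on_has_derivative[OF Suc.prems(1) x] .
    have lin: "frechet_derivative g (at (f x)) r = r * frechet_derivative g (at (f x)) 1" for r
      using linear_cmul[OF has_derivative_linear[OF g], of r 1] by simp
    show "((\<lambda>x. g (f x)) has_derivative
         (\<lambda>h. frechet_derivative f (at x) h * frechet_derivative g (at (f x)) 1)) (at x)"
      by (rule has_derivative_eq_rhs[OF has_derivative_compose[OF f g]]) (rule ext, rule lin)
  next
    fix b :: 'a assume b: "b \<in> Basis"
    show "C_k_on k S (\<lambda>x. frechet_derivative f (at x) b * frechet_derivative g (at (f x)) 1)"
    proof (rule C_k_on_mult[OF assms(1)])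
      show "C_k_on k S (\<lambda>x. frechet_derivative f (at x) b)" using Suc.prems b by auto
      show "C_k_on k S (\<lambda>x. frechet_derivative g (at (f x)) 1)"
        by (rule Suc.IH[OF C_k_on_SucD[OF Suc.prems(1)]]) (use Suc.prems in auto)
    qed
  qed
qed

lemma C_k_on_affine:
  fixes A :: "'a::euclidean_space \<Rightarrow> 'b::euclidean_space"
  assumes "open S" "open T" "bounded_linear A" "(\<lambda>x. z0 + A x) ` S \<subseteq> T" "C_k_on k T g"
  shows "C_k_on k S (\<lambda>x. g (z0 + A x))"
  using assms(5)
proof (induction k arbitrary: g)
  case 0
  have "continuous_on S (\<lambda>x. z0 + A x)"
    using assms(3) by (intro continuous_intros linear_continuous_on)
  then show ?case using continuous_on_compose2[of T g S "\<lambda>x. z0 + A x"] assms(4) 0 by auto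
next
  case (Suc k)
  show ?case
  proof (rule C_k_on_SucI[OF assms(1), where
          f'="\<lambda>x h. \<Sum>b\<in>Basis. (A h \<bullet> b) * frechet_derivative g (at (z0 + A x)) b"])
    fix x assume x: "x \<in> S"
    have g: "(g has_derivative frechet_derivative g (at (z0 + A x))) (at (z0 + A x))"
      using C_k_on_has_derivative[OF Suc.prems] x assms(4) by auto
    have f: "((\<lambda>x. z0 + A x) has_derivative A) (at x)"
      using bounded_linear_imp_has_derivative[OF assms(3)] by (auto intro!: derivative_eq_intros)
    have lin: "frechet_derivative g (at (z0 + A x)) v = (\<Sum>b\<in>Basis. (v \<bullet> b) * frechet_derivative g (at (z0 + A x)) b)" for v
      by (subst euclidean_representation[of v, symmetric])
         (simp only: linear_sum[OF has_derivative_linear[OF g]] linear_cmul[OF has_derivative_linear[OF g]] real_scaleR_def)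
    show "((\<lambda>x. g (z0 + A x)) has_derivative
         (\<lambda>h. \<Sum>b\<in>Basis. (A h \<bullet> b) * frechet_derivative g (at (z0 + A x)) b)) (at x)"
      by (rule has_derivative_eq_rhs[OF has_derivative_compose[OF f g]]) (rule ext, rule lin)
  next
    fix b :: 'a assume b: "b \<in> Basis"
    show "C_k_on k S (\<lambda>x. \<Sum>c\<in>Basis. (A b \<bullet> c) * frechet_derivative g (at (z0 + A x)) c)"
      by (rule C_k_on_sum[OF assms(1)], rule C_k_on_cmult[OF assms(1)], rule Suc.IH)
         (use Suc.prems in auto)
  qed
qed

lemma C_k_on_inverse: "C_k_on k {0<..} (inverse :: real \<Rightarrow> real)"
proof (induction k)
  case 0 then show ?case by (auto intro!: continuous_intros)
next
  case (Suc k)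
  show ?case
    by (rule C_k_on_SucI[where f'="\<lambda>x h. - (inverse x * h * inverse x)"])
       (use Suc in \<open>auto intro!: has_derivative_inverse' C_k_on_mult C_k_on_cmult[where c="-1", simplified]\<close>)
qed

text \<open>This is q / b <= exp (q / b) raised to the power \<open>b\<close>. It is the device by
  which Gaussian decay is traded for powers; the sharp constant would be (b / e)^b.\<close>

lemma powr_mult_exp_le:
  fixes q b :: real assumes "q \<ge> 0" "b > 0" shows "q powr b * exp (- q) \<le> b powr b"
proof (cases "q = 0")
  case False
  then have q: "q > 0" using assms by auto
  have "q / b \<le> exp (q / b)" using exp_ge_add_one_self[of "q/b"] by linarith
  then have "(q / b) powr b \<le> exp (q / b) powr b"
    using q assms by (intro powr_mono2) auto
  also have "\<dots> = exp q" using assms by (simp add: powr_def)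
  finally have "q powr b \<le> exp q * b powr b"
    using q assms by (simp add: powr_divide field_simps)
  then show ?thesis by (simp add: exp_minus field_simps)
qed (use assms in auto)

text \<open>For m = n/2 this is the fundamental solution of the heat equation without its factor (4
  \<pi>)^(-n/2). The exponent is free because differentiation produces the same function with
  \<open>m + 1\<close> and \<open>m + 2\<close>.\<close>

definition heat_power :: "real \<Rightarrow> 'a::euclidean_space \<times> real \<Rightarrow> real" where
  "heat_power m = (\<lambda>(y, t). if t > 0 then t powr (- m) * exp (- (norm y)\<^sup>2 / (4 * t)) else 0)"

definition heat_power_deriv :: "real \<Rightarrow> 'a::euclidean_space \<times> real \<Rightarrow> 'a \<times> real \<Rightarrow> real" where
  "heat_power_deriv m z h = - (fst z \<bullet> fst h) / 2 * heat_power (m + 1) z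
     + (- m * heat_power (m + 1) z + (norm (fst z))\<^sup>2 / 4 * heat_power (m + 2) z) * snd h"

lemma heat_power_nonneg: "heat_power m z \<ge> 0"
  by (auto simp: heat_power_def split: prod.splits)

lemma powr_mult_exp_inverse_le:
  assumes "t > 0" "c > 0" "m > (0::real)"
  shows "t powr (- m) * exp (- (c / t)) \<le> (m / c) powr m"
proof -
  have "(c / t) powr m * exp (- (c / t)) \<le> m powr m" using powr_mult_exp_le[of "c/t" m] assms by auto
  then show ?thesis using assms by (simp add: powr_divide powr_minus field_simps)
qed

text \<open>Serves the points (y, 0) with y nonzero, where the kernel vanishes to infinite order
  from the future and is 0 in the past.\<close>

lemma has_derivative_zero_quadratic:
  fixes f :: "'a::real_normed_vector \<Rightarrow> real"
  assumes "d > 0" "\<And>y. norm (y - x) < d \<Longrightarrow> \<bar>f y\<bar> \<le> C * (norm (y - x))\<^sup>2"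
  shows "(f has_derivative (\<lambda>_. 0)) (at x)"
proof -
  have fx: "f x = 0" using assms(2)[of x] assms(1) by auto
  show ?thesis unfolding has_derivative_at_alt fx
  proof (intro conjI allI impI)
    fix e :: real assume e: "e > 0"
    define d' where "d' = min d (e / (\<bar>C\<bar> + 1))"
    have "norm (f y - 0 - 0) \<le> e * norm (y - x)" if y: "norm (y - x) < d'" for y
    proof -
      have "\<bar>f y\<bar> \<le> C * (norm (y - x))\<^sup>2" using assms(2)[of y] y by (simp add: d'_def)
      also have "\<dots> \<le> (\<bar>C\<bar> + 1) * (norm (y - x))\<^sup>2" by (intro mult_right_mono) auto
      also have "\<dots> = ((\<bar>C\<bar> + 1) * norm (y - x)) * norm (y - x)" by (simp add: power2_eq_square)
      also have "\<dots> \<le> e * norm (y - x)"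
        using y by (intro mult_right_mono) (auto simp: d'_def field_simps)
      finally show ?thesis by simp
    qed
    moreover have "d' > 0" using assms(1) e by (simp add: d'_def)
    ultimately show "\<exists>d>0. \<forall>y. norm (y - x) < d \<longrightarrow> norm (f y - 0 - 0) \<le> e * norm (y - x)" by blast
  qed simp
qed

lemma heat_power_has_derivative:
  assumes "z \<noteq> 0"
  shows "(heat_power m has_derivative heat_power_deriv m z) (at z)"
proof -
  obtain y t where z: "z = (y, t)" by (cases z)
  consider "t > 0" | "t < 0" | "t = 0" "y \<noteq> 0" using assms z by (cases "t = 0"; cases "t > 0") (auto simp: zero_prod_def)
  then show ?thesis
  proof cases
    case 1
    have p: "t powr (- m - 1) = t powr (-m) / t" "t powr (- (m+2)) = t powr (-m) / (t * t)"
      "t powr (- m - 2) = t powr (-m) / (t * t)"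
      "t powr (- (m + 1)) = t powr (-m) / t" "t powr (- 1 - m) = t powr (-m) / t"
      using 1 by (simp_all add: powr_diff powr_minus powr_add field_simps power2_eq_square)
    have a: "((\<lambda>w. snd w powr (- m)) has_derivative (\<lambda>h. snd h * (- m * t powr (- m - 1)))) (at z)"
      by (rule DERIV_compose_FDERIV[where g=snd and f="\<lambda>t. t powr (- m)"])
        (use 1 z has_real_derivative_powr[of t "-m"] in \<open>auto intro!: bounded_linear_imp_has_derivative bounded_linear_intros\<close>)
    have b: "((\<lambda>w. - (fst w \<bullet> fst w) / (4 * snd w)) has_derivative
       (\<lambda>h. - (y \<bullet> fst h) / (2 * t) + (y \<bullet> y) / (4 * t * t) * snd h)) (at z)"
    proof -
      have n: "((\<lambda>w. fst w \<bullet> fst w) has_derivative (\<lambda>h. 2 * (y \<bullet> fst h))) (at z)"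
        using z by (auto intro!: derivative_eq_intros simp: inner_commute)
      have d: "((\<lambda>w. inverse (snd w)) has_derivative (\<lambda>h. snd h * - (inverse t)\<^sup>2)) (at z)"
        using 1 z DERIV_compose_FDERIV[where g=snd and f=inverse and x=z and s=UNIV and g'=snd, OF DERIV_inverse]
        by (simp add: bounded_linear_imp_has_derivative bounded_linear_snd power2_eq_square)
      have "((\<lambda>w. (- 1/4) * ((fst w \<bullet> fst w) * inverse (snd w))) has_derivative
         (\<lambda>h. (- 1/4) * ((y \<bullet> y) * (snd h * - (inverse t)\<^sup>2) + 2 * (y \<bullet> fst h) * inverse t))) (at z)"
        using has_derivative_mult_right[OF has_derivative_mult[OF n d], of "-1/4"] z by simp
      moreover have "(\<lambda>w::'a \<times> real. - (fst w \<bullet> fst w) / (4 * snd w)) =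
          (\<lambda>w. (- 1/4) * ((fst w \<bullet> fst w) * inverse (snd w)))"
      proof
        have "- p / (4 * q) = (- 1/4) * (p * inverse q)" for p q :: real by (cases "q = 0") (simp_all add: field_simps)
        then show "- (fst w \<bullet> fst w) / (4 * snd w) = (- 1/4) * ((fst w \<bullet> fst w) * inverse (snd w))" for w :: "'a \<times> real" .
      qed
      moreover have "(\<lambda>h::'a \<times> real. - (y \<bullet> fst h) / (2 * t) + (y \<bullet> y) / (4 * t * t) * snd h) =
          (\<lambda>h. (- 1/4) * ((y \<bullet> y) * (snd h * - (inverse t)\<^sup>2) + 2 * (y \<bullet> fst h) * inverse t))"
      proof
        have "- p / (2 * t) + q / (4 * t * t) * r = (- 1/4) * (q * (r * - (inverse t)\<^sup>2) + 2 * p * inverse t)" for p q r :: real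
          using 1 by (simp add: field_simps power2_eq_square)
        then show "- (y \<bullet> fst h) / (2 * t) + (y \<bullet> y) / (4 * t * t) * snd h =
          (- 1/4) * ((y \<bullet> y) * (snd h * - (inverse t)\<^sup>2) + 2 * (y \<bullet> fst h) * inverse t)" for h :: "'a \<times> real" .
      qed
      ultimately show ?thesis by simp
    qed
    have c: "((\<lambda>w. exp (- (fst w \<bullet> fst w) / (4 * snd w))) has_derivative
       (\<lambda>h. (- (y \<bullet> fst h) / (2 * t) + (y \<bullet> y) / (4 * t * t) * snd h) * exp (- (y \<bullet> y) / (4 * t)))) (at z)"
      using DERIV_compose_FDERIV[OF DERIV_exp b] z by simp
    have "((\<lambda>w. snd w powr (- m) * exp (- (fst w \<bullet> fst w) / (4 * snd w))) has_derivative heat_power_deriv m z) (at z)"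
      by (rule has_derivative_eq_rhs[OF has_derivative_mult[OF a c]])
        (use 1 in \<open>simp add: fun_eq_iff z heat_power_deriv_def heat_power_def p power2_norm_eq_inner field_simps\<close>)
    then show ?thesis
      by (rule has_derivative_transform_within_open[where s="UNIV \<times> {0<..}"])
         (use 1 z in \<open>auto simp: open_Times heat_power_def power2_norm_eq_inner\<close>)
  next
    case 2
    have "heat_power_deriv m z = (\<lambda>_. 0)" using 2 z by (auto simp: heat_power_deriv_def heat_power_def)
    then have "((\<lambda>_. 0) has_derivative heat_power_deriv m z) (at z)" by simp
    then show ?thesis
      by (rule has_derivative_transform_within_open[where s="UNIV \<times> {..<0}"])
         (use 2 z in \<open>auto simp: open_Times heat_power_def\<close>)
  next
    case 3
    have e: "heat_power_deriv m z = (\<lambda>_. 0)" using 3 z by (auto simp: heat_power_deriv_def heat_power_def)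
    \<comment> \<open>The two extra powers in \<open>M\<close> supply the quadratic bound: for 0 < s
      < 1 one has s^(-m) <= s^(2 - M) whatever the sign of \<open>m\<close>, and exp (- c / s)
      absorbs s^(-M).\<close>
    define M where "M = \<bar>m\<bar> + 2"
    define c where "c = (norm y / 2)\<^sup>2 / 4"
    have c: "c > 0" using 3 by (simp add: c_def)
    show ?thesis unfolding e
    proof (rule has_derivative_zero_quadratic[where d="min 1 (norm y / 2)" and C="(M / c) powr M"])
      show "min 1 (norm y / 2) > 0" using 3 by auto
      fix w :: "'a \<times> real" assume w: "norm (w - z) < min 1 (norm y / 2)"
      obtain x s where ws: "w = (x, s)" by (cases w)
      have nx: "norm (x - y) < norm y / 2" and ns: "\<bar>s\<bar> < 1" and s2: "\<bar>s\<bar> \<le> norm (w - z)"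
        using w z ws 3 norm_fst_le[of "x - y" s] norm_snd_le[of s "x - y"] by auto
      have x: "norm x \<ge> norm y / 2" using nx norm_triangle_ineq2[of y x] by (simp add: norm_minus_commute)
      show "\<bar>heat_power m w\<bar> \<le> (M / c) powr M * (norm (w - z))\<^sup>2"
      proof (cases "s > 0")
        case True
        have "c \<le> (norm x)\<^sup>2 / 4" unfolding c_def using x by (simp add: power_mono)
        then have "exp (- (norm x)\<^sup>2 / (4 * s)) \<le> exp (- (c / s))" using True by (simp add: field_simps)
        then have "\<bar>heat_power m w\<bar> \<le> s powr (- m) * exp (- (c / s))"
          using True by (simp add: heat_power_def ws)
        also have "\<dots> \<le> s powr (2 - M) * exp (- (c / s))"
          using ns True by (intro mult_right_mono powr_mono') (auto simp: M_def)
        also have "\<dots> = s\<^sup>2 * (s powr (- M) * exp (- (c / s)))"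
          using True by (simp add: powr_diff powr_minus powr_numeral field_simps)
        also have "\<dots> \<le> s\<^sup>2 * (M / c) powr M"
          using True c by (intro mult_left_mono powr_mult_exp_inverse_le) (auto simp: M_def)
        also have "\<dots> \<le> (norm (w - z))\<^sup>2 * (M / c) powr M"
          using s2 by (intro mult_right_mono) (auto simp: abs_le_square_iff[symmetric])
        finally show ?thesis by (simp add: mult.commute)
      qed (simp add: heat_power_def ws)
    qed
  qed
qed

text \<open>The induction generalises over \<open>m\<close>: a derivative is a combination of powers
  with larger exponents, with coefficients polynomial in the space variable.\<close>

lemma C_k_on_heat_power: "C_k_on k (- {0}) (heat_power m)"
proof (induction k arbitrary: m)
  case 0
  then show ?case
    by (auto intro!: continuous_at_imp_continuous_on has_derivative_continuous heat_power_has_derivative)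
next
  case (Suc k)
  have o: "open (- {0::'a \<times> real})" by (rule open_Compl) simp
  show ?case
  proof (rule C_k_on_SucI[OF o, where f'="heat_power_deriv m"])
    fix b :: "'a \<times> real"
    have sq: "C_k_on k (- {0}) (\<lambda>z::'a \<times> real. (norm (fst z))\<^sup>2)"
    proof -
      have "(norm (fst z))\<^sup>2 = (\<Sum>i\<in>Basis. (fst z \<bullet> i) * (fst z \<bullet> i))" for z :: "'a \<times> real"
        unfolding power2_norm_eq_inner by (rule euclidean_inner)
      moreover have "C_k_on k (- {0}) (\<lambda>z::'a \<times> real. fst z \<bullet> i)" for i :: 'a
        by (intro C_k_on_bounded_linear o bounded_linear_intros)
      ultimately show ?thesis
        by (auto intro!: C_k_on_sum C_k_on_mult o)
    qed
    have "C_k_on k (- {0}) (\<lambda>z. (- 1/2) * (fst z \<bullet> fst b) * heat_power (m + 1) z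
        + (- m * heat_power (m + 1) z + 1/4 * (norm (fst z))\<^sup>2 * heat_power (m + 2) z) * snd b)"
      by (intro C_k_on_add C_k_on_mult o C_k_on_const Suc sq C_k_on_bounded_linear bounded_linear_intros)
    then show "C_k_on k (- {0}) (\<lambda>z. heat_power_deriv m z b)"
      by (simp add: heat_power_deriv_def)
  qed (use heat_power_has_derivative in auto)
qed

text \<open>The one-dimensional kernel with exponent 0 at the space point 1 is exp (-1 / (4 s)) for
  s > 0 and 0 otherwise, the usual flat function. The quotient is the standard smooth transition
  from 0 to 1, and its smoothness is inherited from \<open>C_k_on_heat_power\<close>.\<close>

definition smooth_step :: "real \<Rightarrow> real" where
  "smooth_step t = (let e = (\<lambda>s. heat_power 0 (1::real, s)) in e t / (e t + e (1 - t)))"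

lemma heat_power_pos: "t > 0 \<Longrightarrow> heat_power m (y, t) > 0"
  by (simp add: heat_power_def)

lemma smooth_step_denominator: "heat_power 0 (1::real, t) + heat_power 0 (1::real, 1 - t) > 0"
proof (cases "t > 0")
  case True
  show ?thesis by (rule add_pos_nonneg[OF heat_power_pos[OF True] heat_power_nonneg])
next
  case False
  then have "1 - t > 0" by simp
  from add_nonneg_pos[OF heat_power_nonneg heat_power_pos[OF this]] show ?thesis .
qed

lemma C_k_on_smooth_step: "C_k_on k UNIV smooth_step"
proof -
  have 1: "C_k_on k UNIV (\<lambda>t. heat_power 0 ((1::real, 0) + (0, t)))"
    by (rule C_k_on_affine[OF _ _ _ _ C_k_on_heat_power]) (auto intro!: bounded_linear_intros bounded_linear_minus[OF bounded_linear_ident] simp: zero_prod_def)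
  have "C_k_on k UNIV (\<lambda>t. heat_power 0 ((1::real, 1) + (0, - t)))"
    by (rule C_k_on_affine[OF _ _ _ _ C_k_on_heat_power]) (auto intro!: bounded_linear_intros bounded_linear_minus[OF bounded_linear_ident] simp: zero_prod_def)
  then have 2: "C_k_on k UNIV (\<lambda>t. heat_power 0 (1::real, 1 - t))" by simp
  have "C_k_on k UNIV (\<lambda>t. heat_power 0 (1::real, t) *
          inverse (heat_power 0 (1::real, t) + heat_power 0 (1::real, 1 - t)))"
    by (intro C_k_on_mult open_UNIV C_k_on_compose[OF _ _ _ _ C_k_on_inverse] C_k_on_add)
      (use 1 2 smooth_step_denominator in auto)
  then show ?thesis by (simp add: smooth_step_def[abs_def] divide_inverse Let_def)
qed

lemma smooth_step_0: "t \<le> 0 \<Longrightarrow> smooth_step t = 0"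
  by (simp add: smooth_step_def heat_power_def)

lemma smooth_step_1: "t \<ge> 1 \<Longrightarrow> smooth_step t = 1"
  by (simp add: smooth_step_def heat_power_def)

lemma smooth_step_nonneg: "smooth_step t \<ge> 0"
  unfolding smooth_step_def Let_def using smooth_step_denominator[of t] heat_power_nonneg[of 0 "(1::real, t)"] by (auto intro!: divide_nonneg_pos)

lemma smooth_step_le_1: "smooth_step t \<le> 1"
  unfolding smooth_step_def Let_def using smooth_step_denominator[of t] heat_power_nonneg[of 0 "(1::real, 1 - t)"] by (auto simp: divide_le_eq)

section \<open>Pointwise estimates for the kernels\<close>

lemma powr_diff_half: "t > 0 \<Longrightarrow> t powr (m - 1/2) = t powr m / sqrt t"
  by (simp add: powr_diff powr_half_sqrt)

text \<open>A shift of length at most 1 costs half of the Gaussian exponent, because |x|^2 <= 2 |x +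
  s v|^2 + 2; the leftover exp (1/8) is below 2.\<close>

lemma gauss_segment_le:
  fixes x v :: "'a::euclidean_space"
  assumes "norm v \<le> 1" "0 \<le> s" "s \<le> 1"
  shows "exp (- (norm (x + s *\<^sub>R v))\<^sup>2 / 8) \<le> 2 * exp (- (norm x)\<^sup>2 / 16)"
proof -
  have sv: "norm (s *\<^sub>R v) \<le> 1" using assms mult_mono[of s 1 "norm v" 1] by auto
  have "norm x \<le> norm (x + s *\<^sub>R v) + norm (s *\<^sub>R v)" using norm_triangle_ineq4[of "x + s *\<^sub>R v" "s *\<^sub>R v"] by simp
  then have "norm x \<le> norm (x + s *\<^sub>R v) + 1" using sv by linarith
  then have "(norm x)\<^sup>2 \<le> (norm (x + s *\<^sub>R v) + 1)\<^sup>2" by (intro power_mono) auto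
  also have "\<dots> \<le> 2 * (norm (x + s *\<^sub>R v))\<^sup>2 + 2"
    using sum_squares_bound[of "norm (x + s *\<^sub>R v)" 1] by (simp add: power2_eq_square algebra_simps)
  finally have "exp (- (norm (x + s *\<^sub>R v))\<^sup>2 / 8) \<le> exp (1/8 + - (norm x)\<^sup>2 / 16)"
    by simp
  also have "\<dots> = exp (1/8) * exp (- (norm x)\<^sup>2 / 16)" by (rule exp_add)
  also have "\<dots> \<le> 2 * exp (- (norm x)\<^sup>2 / 16)"
  proof (intro mult_right_mono)
    have "exp (1/8) \<le> (1 + 1/8 + (1/8)\<^sup>2 :: real)" by (rule exp_bound) auto
    then show "exp (1/8) \<le> (2::real)" by (simp add: power2_eq_square)
  qed simp
  finally show ?thesis .
qed

text \<open>All exponents in [0, 1] come from one dichotomy. At distance d <= 1 the mean value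
  inequality is combined with d <= d^a; at larger distance the two values are estimated separately
  and 1 <= d^a.\<close>

lemma holder_of_gauss_derivative:
  fixes f :: "'a::euclidean_space \<Rightarrow> 'b::real_normed_vector"
  assumes "\<And>x. (f has_derivative f' x) (at x)"
    and "\<And>x h. norm (f' x h) \<le> C * exp (- (norm x)\<^sup>2 / 8) * norm h"
    and "\<And>x. norm (f x) \<le> C * exp (- (norm x)\<^sup>2 / 8)"
    and "C \<ge> 0" "0 \<le> a" "a \<le> 1"
  shows "norm (f x - f y) \<le> 2 * C * norm (x - y) powr a * (exp (- (norm x)\<^sup>2 / 16) + exp (- (norm y)\<^sup>2 / 16))"
proof (cases "norm (x - y) \<le> 1")
  case True
  have "norm (f (y + (x - y)) - f y) \<le> norm (x - y) * (C * (2 * exp (- (norm y)\<^sup>2 / 16)))"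
  proof (rule differentiable_bound_segment[where G=UNIV and f'=f'])
    fix s :: real assume s: "s \<in> {0..1}"
    have "C * exp (- (norm (y + s *\<^sub>R (x - y)))\<^sup>2 / 8) \<le> C * (2 * exp (- (norm y)\<^sup>2 / 16))"
      by (intro mult_left_mono gauss_segment_le) (use True s assms in auto)
    then show "onorm (f' (y + s *\<^sub>R (x - y))) \<le> C * (2 * exp (- (norm y)\<^sup>2 / 16))"
      using order_trans[OF onorm_le[OF assms(2)]] by blast
  qed (use assms in auto)
  also have "\<dots> \<le> norm (x - y) powr a * (C * (2 * exp (- (norm y)\<^sup>2 / 16)))"
    using True assms powr_mono'[of a 1 "norm (x - y)"] by (intro mult_right_mono) auto
  also have "\<dots> \<le> 2 * C * norm (x - y) powr a * (exp (- (norm x)\<^sup>2 / 16) + exp (- (norm y)\<^sup>2 / 16))"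
    using assms by (simp add: algebra_simps)
  finally show ?thesis by simp
next
  case False
  have e: "exp (- (norm x)\<^sup>2 / 8) \<le> exp (- (norm x)\<^sup>2 / 16)" for x :: 'a by (simp add: field_simps)
  have "norm (f x - f y) \<le> C * exp (- (norm x)\<^sup>2 / 8) + C * exp (- (norm y)\<^sup>2 / 8)"
    using norm_triangle_ineq4[of "f x" "f y"] assms(3)[of x] assms(3)[of y] by linarith
  also have "\<dots> \<le> C * (exp (- (norm x)\<^sup>2 / 16) + exp (- (norm y)\<^sup>2 / 16))"
    unfolding distrib_left using e assms by (intro add_mono mult_left_mono) auto
  also have "\<dots> \<le> (2 * norm (x - y) powr a) * (C * (exp (- (norm x)\<^sup>2 / 16) + exp (- (norm y)\<^sup>2 / 16)))"
  proof -
    have "norm (x - y) powr a \<ge> 1" using False assms by (intro ge_one_powr_ge_zero) auto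
    then have 1: "1 \<le> 2 * norm (x - y) powr a" by simp
    show ?thesis
      using mult_right_mono[OF 1, of "C * (exp (- (norm x)\<^sup>2 / 16) + exp (- (norm y)\<^sup>2 / 16))"] assms by simp
  qed
  finally show ?thesis by (simp add: algebra_simps)
qed

lemma power2_mult_exp_le: "(r::real)\<^sup>2 * exp (- r\<^sup>2 / 8) \<le> 8"
proof -
  have "r\<^sup>2 / 8 \<le> exp (r\<^sup>2 / 8)" using exp_ge_add_one_self[of "r\<^sup>2/8"] by linarith
  then show ?thesis by (simp add: exp_minus field_simps)
qed

lemma power2_mult_exp4_le: "(r::real)\<^sup>2 * exp (- r\<^sup>2 / 4) \<le> 8 * exp (- r\<^sup>2 / 8)"
proof -
  have "exp (- r\<^sup>2 / 4) = exp (- r\<^sup>2 / 8) * exp (- r\<^sup>2 / 8)" by (simp flip: exp_add)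
  then show ?thesis using mult_right_mono[OF power2_mult_exp_le[of r], of "exp (- r\<^sup>2 / 8)"] by (simp add: mult.assoc)
qed

lemma mult_exp4_le: "(r::real) * exp (- r\<^sup>2 / 4) \<le> 5 * exp (- r\<^sup>2 / 8)"
proof -
  have "2 * r \<le> 1 + r\<^sup>2" using sum_squares_bound[of r 1] by (simp add: power2_eq_square)
  then have "2 * r * exp (- r\<^sup>2 / 4) \<le> (1 + r\<^sup>2) * exp (- r\<^sup>2 / 4)" by (intro mult_right_mono) auto
  also have "\<dots> = exp (- r\<^sup>2 / 4) + r\<^sup>2 * exp (- r\<^sup>2 / 4)" by (simp add: algebra_simps)
  also have "\<dots> \<le> exp (- r\<^sup>2 / 8) + 8 * exp (- r\<^sup>2 / 8)" using power2_mult_exp4_le[of r] by (intro add_mono) auto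
  finally show ?thesis using exp_gt_zero[of "- r\<^sup>2 / 8"] by linarith
qed

section \<open>The Gaussian profile at unit time\<close>

definition gauss :: "'a::euclidean_space \<Rightarrow> real" where "gauss x = exp (- (norm x)\<^sup>2 / 4)"
definition gauss_grad :: "'a::euclidean_space \<Rightarrow> 'a" where "gauss_grad x = (- gauss x / 2) *\<^sub>R x"

lemma gauss_has_derivative: "(gauss has_derivative (\<lambda>h. gauss_grad x \<bullet> h)) (at x)"
  unfolding gauss_def[abs_def] gauss_grad_def power2_norm_eq_inner
  by (auto intro!: derivative_eq_intros simp: inner_commute)

lemma gauss_grad_has_derivative:
  "(gauss_grad has_derivative (\<lambda>h. (- gauss x / 2) *\<^sub>R h - ((gauss_grad x \<bullet> h) / 2) *\<^sub>R x)) (at x)"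
proof -
  have "((\<lambda>x. (- 1/2 * gauss x) *\<^sub>R x) has_derivative
      (\<lambda>h. (- 1/2 * gauss x) *\<^sub>R h + (- 1/2 * (gauss_grad x \<bullet> h)) *\<^sub>R x)) (at x)"
    by (intro has_derivative_scaleR has_derivative_mult_right gauss_has_derivative has_derivative_ident)
  then show ?thesis by (simp add: gauss_grad_def[abs_def])
qed

lemma gauss_le: "norm (gauss x) \<le> exp (- (norm x)\<^sup>2 / 8)" by (simp add: gauss_def)
lemma gauss_nonneg: "gauss x \<ge> 0" by (simp add: gauss_def)

lemma norm_gauss_grad_le: "norm (gauss_grad x) \<le> 3 * exp (- (norm x)\<^sup>2 / 8)"
proof -
  have "norm (gauss_grad x) = (norm x * exp (- (norm x)\<^sup>2 / 4)) / 2" by (simp add: gauss_grad_def gauss_def)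
  then show ?thesis using mult_exp4_le[of "norm x"] exp_gt_zero[of "- (norm x)\<^sup>2 / 8"] by linarith
qed

lemma norm_gauss_hess_le:
  "norm ((- gauss x / 2) *\<^sub>R h - ((gauss_grad x \<bullet> h) / 2) *\<^sub>R x) \<le> 3 * exp (- (norm x)\<^sup>2 / 8) * norm h"
proof -
  have "norm ((- gauss x / 2) *\<^sub>R h - ((gauss_grad x \<bullet> h) / 2) *\<^sub>R x) \<le>
      gauss x / 2 * norm h + \<bar>gauss_grad x \<bullet> h\<bar> / 2 * norm x"
    using norm_triangle_ineq4[of "(- gauss x / 2) *\<^sub>R h" "((gauss_grad x \<bullet> h) / 2) *\<^sub>R x"] gauss_nonneg[of x] by simp
  also have "\<dots> \<le> gauss x / 2 * norm h + norm (gauss_grad x) * norm h / 2 * norm x"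
    by (intro add_left_mono mult_right_mono divide_right_mono Cauchy_Schwarz_ineq2) auto
  also have "norm (gauss_grad x) = gauss x / 2 * norm x" using gauss_nonneg[of x] by (simp add: gauss_grad_def)
  also have "gauss x / 2 * norm h + gauss x / 2 * norm x * norm h / 2 * norm x =
      (gauss x / 2 + (norm x)\<^sup>2 * gauss x / 4) * norm h" by (simp add: power2_eq_square algebra_simps)
  also have "\<dots> \<le> (3 * exp (- (norm x)\<^sup>2 / 8)) * norm h"
  proof (intro mult_right_mono)
    have "(norm x)\<^sup>2 * gauss x \<le> 8 * exp (- (norm x)\<^sup>2 / 8)" using power2_mult_exp4_le[of "norm x"] by (simp add: gauss_def)
    moreover have "gauss x \<le> exp (- (norm x)\<^sup>2 / 8)" using gauss_le[of x] by simp
    ultimately show "gauss x / 2 + (norm x)\<^sup>2 * gauss x / 4 \<le> 3 * exp (- (norm x)\<^sup>2 / 8)"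
      using exp_gt_zero[of "- (norm x)\<^sup>2 / 8"] by linarith
  qed simp
  finally show ?thesis .
qed

lemma gauss_holder:
  assumes "0 \<le> a" "a \<le> 1"
  shows "\<bar>gauss x - gauss y\<bar> \<le> 6 * norm (x - y) powr a * (exp (- (norm x)\<^sup>2 / 16) + exp (- (norm y)\<^sup>2 / 16))"
proof -
  have "norm (gauss_grad x \<bullet> h) \<le> 3 * exp (- (norm x)\<^sup>2 / 8) * norm h" for x h :: 'a
    using Cauchy_Schwarz_ineq2[of "gauss_grad x" h] mult_right_mono[OF norm_gauss_grad_le[of x], of "norm h"] by simp
  moreover have "norm (gauss x) \<le> 3 * exp (- (norm x)\<^sup>2 / 8)" for x :: 'a using gauss_le[of x] exp_gt_zero[of "- (norm x)\<^sup>2 / 8"] by linarith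
  ultimately show ?thesis
    using holder_of_gauss_derivative[OF gauss_has_derivative, of 3 a x y] assms by simp
qed

lemma gauss_grad_holder:
  assumes "0 \<le> a" "a \<le> 1"
  shows "norm (gauss_grad x - gauss_grad y) \<le> 6 * norm (x - y) powr a * (exp (- (norm x)\<^sup>2 / 16) + exp (- (norm y)\<^sup>2 / 16))"
  using holder_of_gauss_derivative[OF gauss_grad_has_derivative norm_gauss_hess_le norm_gauss_grad_le, of a x y] assms
  by simp

text \<open>The same dichotomy at second order: for short v the gradient is Lipschitz along the
  segment with a Gaussian constant, for long v the three terms are estimated separately, using that
  1 and |v| are at most |v|^(1 + a).\<close>

lemma gauss_taylor:
  fixes x v :: "'a::euclidean_space"
  assumes "0 \<le> a" "a \<le> 1"
  shows "\<bar>gauss (x + v) - gauss x - gauss_grad x \<bullet> v\<bar> \<le> 6 * norm v powr (1 + a) * (exp (- (norm x)\<^sup>2 / 16) + exp (- (norm (x + v))\<^sup>2 / 16))"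
proof (cases "norm v \<le> 1")
  case True
  define S where "S = closed_segment x (x + v)"
  have "norm (gauss (x + v) - gauss x - gauss_grad x \<bullet> ((x + v) - x)) \<le> norm ((x + v) - x) * (norm v * (6 * exp (- (norm x)\<^sup>2 / 16)))"
  proof (rule differentiable_bound_linearization[where S=S and f'="\<lambda>x h. gauss_grad x \<bullet> h"])
    show "x + t *\<^sub>R (x + v - x) \<in> S" if "t \<in> {0..1}" for t
      using that unfolding S_def closed_segment_image_interval by (auto simp: algebra_simps intro!: image_eqI[of _ _ t])
    show "(gauss has_derivative (\<bullet>) (gauss_grad x)) (at x within S)" for x :: 'a
      using gauss_has_derivative has_derivative_at_withinI by blast
    show "x \<in> S" by (simp add: S_def)
    fix y assume "y \<in> S"
    then obtain t where t: "0 \<le> t" "t \<le> 1" "y = x + t *\<^sub>R v"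
      unfolding S_def closed_segment_image_interval by (auto simp: algebra_simps)
    have "norm (gauss_grad (x + t *\<^sub>R v) - gauss_grad x) \<le> norm (t *\<^sub>R v) * (3 * (2 * exp (- (norm x)\<^sup>2 / 16)))"
    proof (rule differentiable_bound_segment[where G=UNIV, OF _ has_derivative_at_withinI[OF gauss_grad_has_derivative]])
      fix s :: real assume s: "s \<in> {0..1}"
      have tv: "norm (t *\<^sub>R v) \<le> 1" using t True mult_mono[of t 1 "norm v" 1] by auto
      show "onorm (\<lambda>h. (- gauss (x + s *\<^sub>R t *\<^sub>R v) / 2) *\<^sub>R h - (gauss_grad (x + s *\<^sub>R t *\<^sub>R v) \<bullet> h / 2) *\<^sub>R (x + s *\<^sub>R t *\<^sub>R v))
         \<le> 3 * (2 * exp (- (norm x)\<^sup>2 / 16))"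
        by (rule order_trans[OF onorm_le[OF norm_gauss_hess_le]])
           (rule mult_left_mono[OF gauss_segment_le[OF tv]], use s in auto)
    qed auto
    also have "\<dots> \<le> norm v * (3 * (2 * exp (- (norm x)\<^sup>2 / 16)))"
      using t by (intro mult_right_mono) (auto simp: mult_left_le_one_le)
    finally have b: "norm (gauss_grad y - gauss_grad x) \<le> norm v * (6 * exp (- (norm x)\<^sup>2 / 16))" using t by simp
    show "onorm ((\<bullet>) (gauss_grad y) - (\<bullet>) (gauss_grad x)) \<le> norm v * (6 * exp (- (norm x)\<^sup>2 / 16))"
    proof (rule onorm_le)
      fix h
      have "norm (((\<bullet>) (gauss_grad y) - (\<bullet>) (gauss_grad x)) h) = \<bar>(gauss_grad y - gauss_grad x) \<bullet> h\<bar>" by (simp add: inner_diff_left)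
      also have "\<dots> \<le> norm (gauss_grad y - gauss_grad x) * norm h" by (rule Cauchy_Schwarz_ineq2)
      also have "\<dots> \<le> norm v * (6 * exp (- (norm x)\<^sup>2 / 16)) * norm h" using b by (intro mult_right_mono) auto
      finally show "norm (((\<bullet>) (gauss_grad y) - (\<bullet>) (gauss_grad x)) h) \<le> norm v * (6 * exp (- (norm x)\<^sup>2 / 16)) * norm h" .
    qed
  qed
  also have "\<dots> = norm v powr 2 * (6 * exp (- (norm x)\<^sup>2 / 16))" by (simp add: power2_eq_square)
  also have "\<dots> \<le> norm v powr (1 + a) * (6 * exp (- (norm x)\<^sup>2 / 16))"
    using assms True by (intro mult_right_mono powr_mono') auto
  also have "\<dots> \<le> 6 * norm v powr (1 + a) * (exp (- (norm x)\<^sup>2 / 16) + exp (- (norm (x + v))\<^sup>2 / 16))"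
    unfolding distrib_left by simp
  finally show ?thesis by simp
next
  case False
  have e: "exp (- (norm x)\<^sup>2 / 8) \<le> exp (- (norm x)\<^sup>2 / 16)" for x :: 'a by (simp add: field_simps)
  have p1: "1 \<le> norm v powr (1 + a)" using False assms by (intro ge_one_powr_ge_zero) auto
  have p2: "norm v \<le> norm v powr (1 + a)" using False assms powr_mono[of 1 "1 + a" "norm v"] by auto
  have "\<bar>gauss (x + v) - gauss x - gauss_grad x \<bullet> v\<bar> \<le> gauss (x + v) + gauss x + \<bar>gauss_grad x \<bullet> v\<bar>"
    using gauss_nonneg[of x] gauss_nonneg[of "x + v"] by linarith
  also have "\<dots> \<le> gauss (x + v) + gauss x + norm (gauss_grad x) * norm v"
    by (intro add_left_mono Cauchy_Schwarz_ineq2)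
  also have "\<dots> \<le> exp (- (norm (x + v))\<^sup>2 / 16) * norm v powr (1 + a) + exp (- (norm x)\<^sup>2 / 16) * norm v powr (1 + a) +
     (3 * exp (- (norm x)\<^sup>2 / 16)) * norm v powr (1 + a)"
  proof (intro add_mono)
    show "gauss (x + v) \<le> exp (- (norm (x + v))\<^sup>2 / 16) * norm v powr (1 + a)"
      "gauss x \<le> exp (- (norm x)\<^sup>2 / 16) * norm v powr (1 + a)"
    proof -
      have "gauss w \<le> exp (- (norm w)\<^sup>2 / 16) * norm v powr (1 + a)" for w :: 'a
      proof -
        have "gauss w \<le> exp (- (norm w)\<^sup>2 / 16)" using order_trans[OF gauss_le[of w] e] by simp
        from mult_mono[OF this p1] show ?thesis by simp
      qed
      then show "gauss (x + v) \<le> exp (- (norm (x + v))\<^sup>2 / 16) * norm v powr (1 + a)"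
        "gauss x \<le> exp (- (norm x)\<^sup>2 / 16) * norm v powr (1 + a)" by auto
    qed
    show "norm (gauss_grad x) * norm v \<le> (3 * exp (- (norm x)\<^sup>2 / 16)) * norm v powr (1 + a)"
      using order_trans[OF norm_gauss_grad_le mult_left_mono[OF e, of 3]] p2 by (intro mult_mono) auto
  qed
  also have "\<dots> \<le> 6 * norm v powr (1 + a) * (exp (- (norm x)\<^sup>2 / 16) + exp (- (norm (x + v))\<^sup>2 / 16))"
    by (simp add: algebra_simps)
  finally show ?thesis .
qed

text \<open>The comparison weights for the kernels. Shifts, differences and factors |y| each widen
  the Gaussian, from 4 to 8, 16 and finally 32, so the width is a parameter.\<close>

definition heat_weight :: "real \<Rightarrow> real \<Rightarrow> 'a::euclidean_space \<times> real \<Rightarrow> real" where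
  "heat_weight \<sigma> m = (\<lambda>(y, t). if t > 0 then t powr (- m) * exp (- (norm y)\<^sup>2 / (\<sigma> * t)) else 0)"

definition heat_grad :: "real \<Rightarrow> 'a::euclidean_space \<times> real \<Rightarrow> 'a" where
  "heat_grad m z = (- heat_power (m + 1) z / 2) *\<^sub>R fst z"

lemma heat_weight_nonneg: "heat_weight \<sigma> m z \<ge> 0"
  by (auto simp: heat_weight_def split: prod.splits)

lemma heat_weight_mono: "0 < \<sigma> \<Longrightarrow> \<sigma> \<le> \<sigma>' \<Longrightarrow> heat_weight \<sigma> m z \<le> heat_weight \<sigma>' m z"
  by (cases z) (auto simp: heat_weight_def intro!: mult_left_mono divide_left_mono mult_right_mono)

lemma heat_power_eq_gauss: "t > 0 \<Longrightarrow> heat_power m (y, t) = t powr (- m) * gauss ((1 / sqrt t) *\<^sub>R y)"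
  by (simp add: heat_power_def gauss_def power_mult_distrib power_divide)

lemma heat_grad_eq_gauss:
  assumes "t > 0" shows "heat_grad m (y, t) = t powr (- m - 1/2) *\<^sub>R gauss_grad ((1 / sqrt t) *\<^sub>R y)"
proof -
  have "t powr (- (m + 1)) = t powr (- m - 1/2) * (1 / sqrt t)"
  proof -
    have "- m - 1/2 - 1/2 = - (m + 1)" by simp
    then show ?thesis using powr_diff_half[OF assms, of "- m - 1/2"] by (simp only:) simp
  qed
  then show ?thesis using assms by (simp add: heat_grad_def heat_power_eq_gauss gauss_grad_def)
qed

lemma exp_scaled: "t > 0 \<Longrightarrow> exp (- (norm ((1 / sqrt t) *\<^sub>R y))\<^sup>2 / \<sigma>) = exp (- (norm y)\<^sup>2 / (\<sigma> * t))"
  by (simp add: power_mult_distrib power_divide mult.commute)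

lemma norm_scaled_powr: "t > 0 \<Longrightarrow> norm ((1 / sqrt t) *\<^sub>R y) powr a = norm y powr a * t powr (- a / 2)"
proof -
  assume t: "t > 0"
  have "norm ((1 / sqrt t) *\<^sub>R y) = norm y * (1 / sqrt t)" using t by simp
  moreover have "(1 / sqrt t) powr a = t powr (- a / 2)"
    using t by (simp add: powr_half_sqrt[symmetric] powr_minus_divide[symmetric] powr_powr)
  ultimately show ?thesis using t by (simp only:) (subst powr_mult, auto)
qed

text \<open>Parabolic scaling: at time t the kernel is t^(-m) times the profile at y / sqrt t, so a
  power |y - y'|^a costs t^(-a/2), which is recorded in the exponent of the weight. The gradient and
  Taylor estimates below follow the same pattern.\<close>

lemma heat_power_holder_space:
  assumes "0 \<le> a" "a \<le> 1"
  shows "\<bar>heat_power m (y, t) - heat_power m (y', t)\<bar>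
    \<le> 6 * norm (y - y') powr a * (heat_weight 16 (m + a/2) (y, t) + heat_weight 16 (m + a/2) (y', t))"
proof (cases "t > 0")
  case True
  have "\<bar>heat_power m (y, t) - heat_power m (y', t)\<bar> = t powr (- m) * \<bar>gauss ((1 / sqrt t) *\<^sub>R y) - gauss ((1 / sqrt t) *\<^sub>R y')\<bar>"
    using True by (simp add: heat_power_eq_gauss abs_mult flip: right_diff_distrib)
  also have "\<dots> \<le> t powr (- m) * (6 * norm ((1 / sqrt t) *\<^sub>R y - (1 / sqrt t) *\<^sub>R y') powr a * (exp (- (norm ((1 / sqrt t) *\<^sub>R y))\<^sup>2 / 16) + exp (- (norm ((1 / sqrt t) *\<^sub>R y'))\<^sup>2 / 16)))"
    by (intro mult_left_mono gauss_holder assms) auto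
  also have "\<dots> = 6 * norm (y - y') powr a * (t powr (- m) * t powr (- a / 2)) * (exp (- (norm y)\<^sup>2 / (16 * t)) + exp (- (norm y')\<^sup>2 / (16 * t)))"
    unfolding scaleR_diff_right[symmetric] norm_scaled_powr[OF True] exp_scaled[OF True] by (simp add: algebra_simps)
  also have "t powr (- m) * t powr (- a / 2) = t powr (- (m + a/2))" by (simp flip: powr_add)
  finally show ?thesis using True by (simp add: heat_weight_def algebra_simps)
qed (simp add: heat_power_def heat_weight_def)

lemma heat_grad_holder_space:
  assumes "0 \<le> a" "a \<le> 1"
  shows "norm (heat_grad m (y, t) - heat_grad m (y', t))
    \<le> 6 * norm (y - y') powr a * (heat_weight 16 (m + 1/2 + a/2) (y, t) + heat_weight 16 (m + 1/2 + a/2) (y', t))"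
proof (cases "t > 0")
  case True
  have "norm (heat_grad m (y, t) - heat_grad m (y', t)) = t powr (- m - 1/2) * norm (gauss_grad ((1 / sqrt t) *\<^sub>R y) - gauss_grad ((1 / sqrt t) *\<^sub>R y'))"
    using True by (simp only: heat_grad_eq_gauss scaleR_diff_right[symmetric] norm_scaleR) simp
  also have "\<dots> \<le> t powr (- m - 1/2) * (6 * norm ((1 / sqrt t) *\<^sub>R y - (1 / sqrt t) *\<^sub>R y') powr a * (exp (- (norm ((1 / sqrt t) *\<^sub>R y))\<^sup>2 / 16) + exp (- (norm ((1 / sqrt t) *\<^sub>R y'))\<^sup>2 / 16)))"
    by (intro mult_left_mono gauss_grad_holder assms) auto
  also have "\<dots> = 6 * norm (y - y') powr a * (t powr (- m - 1/2) * t powr (- a / 2)) * (exp (- (norm y)\<^sup>2 / (16 * t)) + exp (- (norm y')\<^sup>2 / (16 * t)))"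
    unfolding scaleR_diff_right[symmetric] norm_scaled_powr[OF True] exp_scaled[OF True] by (simp add: algebra_simps)
  also have "t powr (- m - 1/2) * t powr (- a / 2) = t powr (- (m + 1/2 + a/2))" by (simp flip: powr_add)
  finally show ?thesis using True by (simp add: heat_weight_def algebra_simps)
qed (simp add: heat_power_def heat_grad_def heat_weight_def)

lemma heat_power_taylor_space:
  assumes "0 \<le> a" "a \<le> 1"
  shows "\<bar>heat_power m (y + v, t) - heat_power m (y, t) - heat_grad m (y, t) \<bullet> v\<bar>
    \<le> 6 * norm v powr (1 + a) * (heat_weight 16 (m + 1/2 + a/2) (y, t) + heat_weight 16 (m + 1/2 + a/2) (y + v, t))"
proof (cases "t > 0")
  case True
  let ?s = "1 / sqrt t"
  have e: "t powr (- m - 1/2) * X = t powr (- m) * (?s * X)" for X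
    using powr_diff_half[OF True, of "- m"] by simp
  have "heat_power m (y + v, t) - heat_power m (y, t) - heat_grad m (y, t) \<bullet> v
     = t powr (- m) * (gauss (?s *\<^sub>R y + ?s *\<^sub>R v) - gauss (?s *\<^sub>R y) - gauss_grad (?s *\<^sub>R y) \<bullet> (?s *\<^sub>R v))"
    using True e[of "gauss_grad (?s *\<^sub>R y) \<bullet> v"] by (simp add: heat_power_eq_gauss heat_grad_eq_gauss scaleR_add_right[symmetric] right_diff_distrib)
  then have "\<bar>heat_power m (y + v, t) - heat_power m (y, t) - heat_grad m (y, t) \<bullet> v\<bar> =
     t powr (- m) * \<bar>gauss (?s *\<^sub>R y + ?s *\<^sub>R v) - gauss (?s *\<^sub>R y) - gauss_grad (?s *\<^sub>R y) \<bullet> (?s *\<^sub>R v)\<bar>"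
    by (simp add: abs_mult)
  also have "\<dots> \<le> t powr (- m) * (6 * norm (?s *\<^sub>R v) powr (1 + a) * (exp (- (norm (?s *\<^sub>R y))\<^sup>2 / 16) + exp (- (norm (?s *\<^sub>R y + ?s *\<^sub>R v))\<^sup>2 / 16)))"
    by (intro mult_left_mono gauss_taylor assms) auto
  also have "\<dots> = 6 * norm v powr (1 + a) * (t powr (- m) * t powr (- (1 + a) / 2)) * (exp (- (norm y)\<^sup>2 / (16 * t)) + exp (- (norm (y + v))\<^sup>2 / (16 * t)))"
    unfolding scaleR_add_right[symmetric] norm_scaled_powr[OF True] exp_scaled[OF True] by (simp add: algebra_simps)
  also have "t powr (- m) * t powr (- (1 + a) / 2) = t powr (- (m + 1/2 + a/2))"
  proof -
    have "- m + - (1 + a) / 2 = - (m + 1/2 + a/2)" by (simp add: field_simps)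
    then show ?thesis by (metis powr_add)
  qed
  finally show ?thesis using True by (simp add: heat_weight_def algebra_simps)
qed (simp add: heat_power_def heat_grad_def heat_weight_def)

lemma heat_power_le_weight: "heat_power m z \<le> heat_weight 16 m z"
  by (cases z) (auto simp: heat_power_def heat_weight_def field_simps)

lemma heat_power_has_real_derivative_time:
  assumes "s > 0"
  shows "((\<lambda>s. heat_power m (y, s)) has_real_derivative
     (- m * heat_power (m + 1) (y, s) + (norm y)\<^sup>2 / 4 * heat_power (m + 2) (y, s))) (at s)"
proof -
  have 1: "((\<lambda>s. (y, s)) has_derivative (\<lambda>h. (0, h))) (at s)"
    by (auto intro!: derivative_eq_intros)
  have 2: "(heat_power m has_derivative heat_power_deriv m (y, s)) (at (y, s))"
    using assms by (intro heat_power_has_derivative) (auto simp: zero_prod_def)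
  show ?thesis using has_derivative_compose[OF 1 2]
    by (simp add: has_field_derivative_def heat_power_deriv_def mult_commute_abs)
qed

lemma heat_power_time_derivative_le:
  assumes "s > 0" "m \<ge> 0"
  shows "\<bar>- m * heat_power (m + 1) (y, s) + (norm y)\<^sup>2 / 4 * heat_power (m + 2) (y, s)\<bar> \<le> (m + 2) * heat_weight 8 (m + 1) (y, s)"
proof -
  have p: "s powr (- (m + 2)) = s powr (- (m + 1)) / s" using assms powr_diff[of s "-(m+1)" 1] by (simp add: algebra_simps)
  have "(norm y)\<^sup>2 / 4 * heat_power (m + 2) (y, s) = s powr (- (m + 1)) * ((norm y / sqrt s)\<^sup>2 * exp (- (norm y / sqrt s)\<^sup>2 / 4)) / 4"
    using assms unfolding heat_power_def prod.case p by (simp add: power_divide mult.commute[of 4 s])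
  also have "\<dots> \<le> s powr (- (m + 1)) * (8 * exp (- (norm y / sqrt s)\<^sup>2 / 8)) / 4"
    by (intro divide_right_mono mult_left_mono power2_mult_exp4_le) auto
  also have "\<dots> = 2 * heat_weight 8 (m + 1) (y, s)"
    using assms by (simp add: heat_weight_def power_divide)
  finally have 1: "(norm y)\<^sup>2 / 4 * heat_power (m + 2) (y, s) \<le> 2 * heat_weight 8 (m + 1) (y, s)" .
  have "heat_power (m + 1) (y, s) \<le> heat_weight 8 (m + 1) (y, s)"
    using assms by (auto simp: heat_power_def heat_weight_def field_simps)
  then have 2: "m * heat_power (m + 1) (y, s) \<le> m * heat_weight 8 (m + 1) (y, s)" using assms by (intro mult_left_mono) auto
  have "\<bar>- m * heat_power (m + 1) (y, s) + (norm y)\<^sup>2 / 4 * heat_power (m + 2) (y, s)\<bar> \<le>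
     m * heat_power (m + 1) (y, s) + (norm y)\<^sup>2 / 4 * heat_power (m + 2) (y, s)"
    using heat_power_nonneg[of "m + 1" "(y, s)"] heat_power_nonneg[of "m + 2" "(y, s)"] assms
    by (intro abs_leI) (auto intro: mult_nonneg_nonneg add_nonneg_nonneg)
  then show ?thesis using 1 2 by (simp add: algebra_simps)
qed

text \<open>If the two times are comparable, the mean value theorem applies. Otherwise each of them,
  if positive, is at most twice their distance, and each value separately is absorbed by |t - t'|^b.
  The second case includes times before 0, where the kernel vanishes.\<close>

lemma heat_power_holder_time:
  assumes "0 \<le> b" "b \<le> 1" "m \<ge> 0"
  shows "\<bar>heat_power m (y, t) - heat_power m (y, t')\<bar>
    \<le> (m + 2) * \<bar>t - t'\<bar> powr b * (heat_weight 16 (m + b) (y, t) + heat_weight 16 (m + b) (y, t'))"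
proof -
  have *: "\<bar>heat_power m (y, t) - heat_power m (y, t')\<bar>
    \<le> (m + 2) * \<bar>t - t'\<bar> powr b * (heat_weight 16 (m + b) (y, t) + heat_weight 16 (m + b) (y, t'))"
    if tt: "t < t'" for t t' :: real
  proof -
    let ?d = "\<bar>t - t'\<bar>"
    have single: "heat_power m (y, s) \<le> 2 * ?d powr b * heat_weight 16 (m + b) (y, s)" if "s > 0 \<longrightarrow> s \<le> 2 * ?d" for s
    proof (cases "s > 0")
      case True
      have "s powr b \<le> (2 * ?d) powr b" using True that assms by (intro powr_mono2) auto
      also have "\<dots> = 2 powr b * ?d powr b" by (simp add: powr_mult)
      also have "\<dots> \<le> 2 * ?d powr b" using assms powr_mono[of b 1 2] by (intro mult_right_mono) auto
      finally have "heat_weight 16 (m + b) (y, s) * s powr b \<le> heat_weight 16 (m + b) (y, s) * (2 * ?d powr b)"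
        by (intro mult_left_mono heat_weight_nonneg)
      moreover have "heat_weight 16 (m + b) (y, s) * s powr b = heat_weight 16 m (y, s)"
        using True by (simp add: heat_weight_def powr_diff powr_minus powr_add field_simps)
      ultimately show ?thesis using heat_power_le_weight[of m "(y, s)"] by (simp add: mult.commute)
    qed (simp add: heat_power_def heat_weight_def)
    show ?thesis
    proof (cases "t > 0 \<and> t' < 2 * t")
      case False
      then have "t > 0 \<longrightarrow> t \<le> 2 * ?d" "t' > 0 \<longrightarrow> t' \<le> 2 * ?d" using that by auto
      note single[OF this(1)] single[OF this(2)]
      then have "\<bar>heat_power m (y, t) - heat_power m (y, t')\<bar>
        \<le> 2 * (?d powr b * (heat_weight 16 (m + b) (y, t) + heat_weight 16 (m + b) (y, t')))"
        using heat_power_nonneg[of m "(y, t)"] heat_power_nonneg[of m "(y, t')"] by (simp add: algebra_simps)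
      also have "\<dots> \<le> (m + 2) * (?d powr b * (heat_weight 16 (m + b) (y, t) + heat_weight 16 (m + b) (y, t')))"
        using assms heat_weight_nonneg by (intro mult_right_mono mult_nonneg_nonneg add_nonneg_nonneg) auto
      finally show ?thesis by (simp only: mult.assoc)
    next
      case True
      obtain s where s: "t < s" "s < t'" "heat_power m (y, t') - heat_power m (y, t) =
        (t' - t) * (- m * heat_power (m + 1) (y, s) + (norm y)\<^sup>2 / 4 * heat_power (m + 2) (y, s))"
      proof -
        have "\<exists>s>t. s < t' \<and> heat_power m (y, t') - heat_power m (y, t) =
          (t' - t) * (- m * heat_power (m + 1) (y, s) + (norm y)\<^sup>2 / 4 * heat_power (m + 2) (y, s))"
          by (rule MVT2[OF tt]) (rule heat_power_has_real_derivative_time, use True in auto)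
        then show ?thesis using that by blast
      qed
      have sp: "s > 0" using s True by auto
      \<comment> \<open>As t < s < 2 t, passing from s to t doubles the width of the Gaussian, from
        8 to 16.\<close>
      have w: "heat_weight 8 (m + 1) (y, s) \<le> heat_weight 16 (m + 1) (y, t)"
      proof -
        have "(norm y)\<^sup>2 / (16 * t) \<le> (norm y)\<^sup>2 / (8 * s)" using s True by (intro divide_left_mono) auto
        moreover have "s powr (- (m + 1)) \<le> t powr (- (m + 1))" using s True assms by (intro powr_mono2') auto
        ultimately show ?thesis using s True sp unfolding heat_weight_def by (auto intro!: mult_mono)
      qed
      have "\<bar>heat_power m (y, t) - heat_power m (y, t')\<bar> = ?d * \<bar>- m * heat_power (m + 1) (y, s) + (norm y)\<^sup>2 / 4 * heat_power (m + 2) (y, s)\<bar>"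
        using s(3) by (subst abs_minus_commute) (simp only: abs_mult abs_minus_commute[of t t'])
      also have "\<dots> \<le> ?d * ((m + 2) * heat_weight 16 (m + 1) (y, t))"
        using order_trans[OF heat_power_time_derivative_le[OF sp assms(3), of y] mult_left_mono[OF w, of "m + 2"]] assms
        by (intro mult_left_mono) auto
      also have "\<dots> = (m + 2) * ?d powr b * (?d powr (1 - b) * heat_weight 16 (m + 1) (y, t))"
        using that by (simp add: powr_diff)
      also have "\<dots> \<le> (m + 2) * ?d powr b * (t powr (1 - b) * heat_weight 16 (m + 1) (y, t))"
        using that True assms heat_weight_nonneg[of 16 "m+1" "(y,t)"] by (intro mult_left_mono mult_right_mono powr_mono2) auto
      also have "t powr (1 - b) * heat_weight 16 (m + 1) (y, t) = heat_weight 16 (m + b) (y, t)"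
      proof -
        have "1 - b + - (m + 1) = - (m + b)" by simp
        then have "t powr (1 - b) * t powr (- (m + 1)) = t powr (- (m + b))" by (metis powr_add)
        then show ?thesis using True unfolding heat_weight_def prod.case by (simp add: mult.assoc[symmetric])
      qed
      also have "(m + 2) * ?d powr b * \<dots> \<le> (m + 2) * ?d powr b * (heat_weight 16 (m + b) (y, t) + heat_weight 16 (m + b) (y, t'))"
        using assms heat_weight_nonneg[of 16 "m+b" "(y,t')"] by (intro mult_left_mono) auto
      finally show ?thesis .
    qed
  qed
  consider "t < t'" | "t = t'" | "t' < t" by linarith
  then show ?thesis
  proof cases
    case 3
    from *[OF this] show ?thesis by (simp only: abs_minus_commute[of t t'] abs_minus_commute[of "heat_power m (y, t)"] add.commute)
  qed (use * in auto)
qed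

text \<open>Against the Gaussian a factor |y| is worth sqrt t, again at the price of a doubled
  width.\<close>

lemma norm_mult_heat_weight_le: "norm y * heat_weight 16 (m + 1/2) (y, t) \<le> 20 * heat_weight 32 m (y, t)"
proof (cases "t > 0")
  case True
  have p: "t powr (- (m + 1/2)) = t powr (- m) / sqrt t" using True powr_diff[of t "-m" "1/2"] by (simp add: powr_half_sqrt)
  have e: "exp (- (norm y)\<^sup>2 / (16 * t)) = exp (- (norm y / (2 * sqrt t))\<^sup>2 / 4)" using True by (simp add: power_divide power_mult_distrib field_simps)
  have e2: "exp (- (norm y)\<^sup>2 / (32 * t)) = exp (- (norm y / (2 * sqrt t))\<^sup>2 / 8)" using True by (simp add: power_divide power_mult_distrib field_simps)
  have "norm y * heat_weight 16 (m + 1/2) (y, t) = t powr (- m) * (2 * (norm y / (2 * sqrt t) * exp (- (norm y / (2 * sqrt t))\<^sup>2 / 4)))"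
    using True unfolding heat_weight_def prod.case p e by simp
  also have "\<dots> \<le> t powr (- m) * (2 * (5 * exp (- (norm y / (2 * sqrt t))\<^sup>2 / 8)))"
    by (intro mult_left_mono mult_exp4_le) auto
  also have "\<dots> \<le> 20 * heat_weight 32 m (y, t)" using True unfolding heat_weight_def prod.case e2 by simp
  finally show ?thesis .
qed (simp add: heat_weight_def)

lemma norm_heat_grad_le: "norm (heat_grad m z) \<le> 20 * heat_weight 32 (m + 1/2) z"
proof (cases z)
  case (Pair y t)
  have "norm (heat_grad m z) = norm y * heat_power (m + 1) z / 2" using heat_power_nonneg[of "m+1" z] by (simp add: heat_grad_def Pair)
  also have "\<dots> \<le> norm y * heat_weight 16 (m + 1/2 + 1/2) z"
  proof -
    have "norm y * heat_power (m + 1) z \<le> norm y * heat_weight 16 (m + 1) z"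
      by (intro mult_left_mono heat_power_le_weight norm_ge_zero)
    moreover have "0 \<le> norm y * heat_power (m + 1) z" by (intro mult_nonneg_nonneg heat_power_nonneg norm_ge_zero)
    ultimately have "norm y * heat_power (m + 1) z / 2 \<le> norm y * heat_weight 16 (m + 1) z" by linarith
    then show ?thesis by (simp add: add.assoc)
  qed
  also have "\<dots> \<le> 20 * heat_weight 32 (m + 1/2) z" unfolding Pair by (rule norm_mult_heat_weight_le)
  finally show ?thesis .
qed

lemma heat_grad_holder_time:
  assumes "0 \<le> b" "b \<le> 1" "m \<ge> 0"
  shows "norm (heat_grad m (y, t) - heat_grad m (y, t'))
    \<le> 10 * (m + 3) * \<bar>t - t'\<bar> powr b * (heat_weight 32 (m + 1/2 + b) (y, t) + heat_weight 32 (m + 1/2 + b) (y, t'))"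
proof -
  have "norm (heat_grad m (y, t) - heat_grad m (y, t')) = norm y / 2 * \<bar>heat_power (m + 1) (y, t) - heat_power (m + 1) (y, t')\<bar>"
    unfolding heat_grad_def fst_conv scaleR_diff_left[symmetric] norm_scaleR by (simp add: field_simps abs_minus_commute)
  also have "\<dots> \<le> norm y / 2 * ((m + 1 + 2) * \<bar>t - t'\<bar> powr b * (heat_weight 16 (m + 1 + b) (y, t) + heat_weight 16 (m + 1 + b) (y, t')))"
    by (intro mult_left_mono heat_power_holder_time) (use assms in auto)
  also have "\<dots> = (m + 3) / 2 * \<bar>t - t'\<bar> powr b * (norm y * heat_weight 16 (m + 1/2 + b + 1/2) (y, t) + norm y * heat_weight 16 (m + 1/2 + b + 1/2) (y, t'))"
    by (simp add: algebra_simps add_divide_distrib)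
  also have "\<dots> \<le> (m + 3) / 2 * \<bar>t - t'\<bar> powr b * (20 * heat_weight 32 (m + 1/2 + b) (y, t) + 20 * heat_weight 32 (m + 1/2 + b) (y, t'))"
    using assms by (intro mult_left_mono add_mono norm_mult_heat_weight_le) auto
  also have "\<dots> = 10 * (m + 3) * \<bar>t - t'\<bar> powr b * (heat_weight 32 (m + 1/2 + b) (y, t) + heat_weight 32 (m + 1/2 + b) (y, t'))"
    by (simp add: algebra_simps add_divide_distrib)
  finally show ?thesis .
qed

section \<open>Integrability of the kernels\<close>

lemma nn_integral_abs_powr_le:
  assumes "0 \<le> k" "k < 1" "R \<ge> 0"
  shows "(\<integral>\<^sup>+s. indicator {c - R..c + R} s * inverse (ennreal (\<bar>s - c\<bar> powr k)) \<partial>lborel)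
     \<le> ennreal (2 * (R powr (1 - k) / (1 - k)))"
proof -
  have half: "(\<integral>\<^sup>+s. indicator {0..R} s * inverse (ennreal (s powr k)) \<partial>lborel) = ennreal (R powr (1 - k) / (1 - k))"
  proof -
    have "(\<integral>\<^sup>+s. indicator {0..R} s * inverse (ennreal (s powr k)) \<partial>lborel) =
      (\<integral>\<^sup>+s. ennreal (indicator {0..R} s * s powr (- k)) \<partial>lborel)"
    proof (rule nn_integral_cong_AE, rule AE_mp[OF AE_lborel_singleton[of 0]], rule AE_I2, rule impI)
      fix s :: real assume "s \<noteq> 0"
      then show "indicator {0..R} s * inverse (ennreal (s powr k)) = ennreal (indicator {0..R} s * s powr (- k))"
        by (auto simp: indicator_def inverse_ennreal powr_minus)
    qed
    also have "\<dots> = ennreal (R powr (1 - k) / (1 - k))"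
      using nn_integral_has_integral_lebesgue[OF _ has_integral_powr_from_0[of "- k" R]] assms
      by (simp add: add.commute)
    finally show ?thesis .
  qed
  have right: "(\<integral>\<^sup>+s. indicator {c..c + R} s * inverse (ennreal (\<bar>s - c\<bar> powr k)) \<partial>lborel) = ennreal (R powr (1 - k) / (1 - k))"
    by (subst nn_integral_real_affine[of _ 1 c], simp, simp)
       (auto simp: half[symmetric] intro!: nn_integral_cong split: split_indicator)
  have left: "(\<integral>\<^sup>+s. indicator {c - R..c} s * inverse (ennreal (\<bar>s - c\<bar> powr k)) \<partial>lborel) = ennreal (R powr (1 - k) / (1 - k))"
    by (subst nn_integral_real_affine[of _ "-1" c], simp, simp)
       (auto simp: half[symmetric] intro!: nn_integral_cong split: split_indicator)
  have "(\<integral>\<^sup>+s. indicator {c - R..c + R} s * inverse (ennreal (\<bar>s - c\<bar> powr k)) \<partial>lborel)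
     \<le> (\<integral>\<^sup>+s. indicator {c..c + R} s * inverse (ennreal (\<bar>s - c\<bar> powr k)) + indicator {c - R..c} s * inverse (ennreal (\<bar>s - c\<bar> powr k)) \<partial>lborel)"
    by (intro nn_integral_mono) (auto split: split_indicator)
  also have "\<dots> = ennreal (R powr (1 - k) / (1 - k)) + ennreal (R powr (1 - k) / (1 - k))"
    by (subst nn_integral_add) (auto simp: left right)
  also have "\<dots> = ennreal (2 * (R powr (1 - k) / (1 - k)))"
    using assms by (subst ennreal_plus[symmetric]) auto
  finally show ?thesis .
qed

text \<open>An integrable substitute for the Gaussian: it factors into coordinates, and each
  |y_j|^(-2b) is locally integrable for b < 1/2. In \<open>ennreal\<close> the inverse of 0 is
  infinite, so the bounds below hold at every point, without exceptional sets.\<close>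

definition sing_prod :: "real \<Rightarrow> 'a::euclidean_space set \<Rightarrow> 'a \<Rightarrow> ennreal" where
  "sing_prod b J y = (\<Prod>j\<in>J. inverse (ennreal (\<bar>y \<bullet> j\<bar> powr (2 * b))))"

lemma borel_measurable_sing_prod [measurable]: "sing_prod b J \<in> borel_measurable borel"
  unfolding sing_prod_def[abs_def] by measurable

text \<open>In a direction j the factor exp (- y_j^2 / (\<sigma> t)) is at most (b \<sigma> t)^b
  |y_j|^(-2b). Each direction spent in this way improves the power of t by \<open>b\<close>; the
  directions outside \<open>J\<close> are estimated by 1.\<close>

lemma heat_weight_le_sing_prod:
  fixes y :: "'a::euclidean_space" and b \<sigma> m t :: real
  assumes "J \<subseteq> Basis" "b > 0" "\<sigma> > 0" "t > 0"
  shows "ennreal (heat_weight \<sigma> m (y, t)) \<le>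
    ennreal ((b * \<sigma>) powr (b * card J) * t powr (b * card J - m)) * sing_prod b J y"
proof -
  have fin: "finite J" by (rule finite_subset[OF assms(1) finite_Basis])
  have one: "ennreal (exp (- (y \<bullet> j)\<^sup>2 / (\<sigma> * t))) \<le> ennreal ((b * \<sigma> * t) powr b) * inverse (ennreal (\<bar>y \<bullet> j\<bar> powr (2 * b)))" for j
  proof (cases "y \<bullet> j = 0")
    case True
    have "(b * \<sigma> * t) powr b > 0" using assms by simp
    then show ?thesis using True by (simp add: ennreal_mult_top ennreal_top_mult)
  next
    case False
    let ?q = "(y \<bullet> j)\<^sup>2 / (\<sigma> * t)"
    have q: "?q > 0" using False assms by simp
    have "(\<bar>y \<bullet> j\<bar> powr (2 * b)) = ((y \<bullet> j)\<^sup>2) powr b"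
      using False powr_powr[of "\<bar>y \<bullet> j\<bar>" 2 b] by (simp add: powr_numeral)
    then have "?q powr b = \<bar>y \<bullet> j\<bar> powr (2 * b) / (\<sigma> * t) powr b"
      using assms False by (simp add: powr_divide)
    with powr_mult_exp_le[of ?q b] q assms False
    have "exp (- ?q) \<le> (b * \<sigma> * t) powr b / \<bar>y \<bullet> j\<bar> powr (2 * b)"
      by (simp add: powr_mult field_simps)
    then show ?thesis using False
      by (simp add: inverse_ennreal divide_inverse flip: ennreal_mult)
  qed
  have "(norm y)\<^sup>2 = (\<Sum>j\<in>Basis. (y \<bullet> j)\<^sup>2)"
    by (simp only: power2_norm_eq_inner) (subst euclidean_inner, simp add: power2_eq_square)
  also have "\<dots> \<ge> (\<Sum>j\<in>J. (y \<bullet> j)\<^sup>2)" using assms by (intro sum_mono2) auto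
  finally have "exp (- (norm y)\<^sup>2 / (\<sigma> * t)) \<le> exp (\<Sum>j\<in>J. - (y \<bullet> j)\<^sup>2 / (\<sigma> * t))"
    using assms by (simp add: sum_negf divide_right_mono flip: sum_divide_distrib)
  also have "\<dots> = (\<Prod>j\<in>J. exp (- (y \<bullet> j)\<^sup>2 / (\<sigma> * t)))" using fin by (rule exp_sum)
  finally have "ennreal (exp (- (norm y)\<^sup>2 / (\<sigma> * t))) \<le> (\<Prod>j\<in>J. ennreal (exp (- (y \<bullet> j)\<^sup>2 / (\<sigma> * t))))"
    by (simp add: prod_ennreal ennreal_leI)
  also have "\<dots> \<le> (\<Prod>j\<in>J. ennreal ((b * \<sigma> * t) powr b) * inverse (ennreal (\<bar>y \<bullet> j\<bar> powr (2 * b))))"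
    by (rule prod_mono_ennreal) (rule one)
  also have "\<dots> = ennreal ((b * \<sigma> * t) powr b) ^ card J * sing_prod b J y"
    by (simp add: prod.distrib sing_prod_def)
  also have "ennreal ((b * \<sigma> * t) powr b) ^ card J = ennreal ((b * \<sigma> * t) powr (b * card J))"
    using assms by (simp add: ennreal_power powr_power mult.commute)
  finally have "ennreal (t powr (- m)) * ennreal (exp (- (norm y)\<^sup>2 / (\<sigma> * t))) \<le>
     ennreal (t powr (- m)) * (ennreal ((b * \<sigma> * t) powr (b * card J)) * sing_prod b J y)"
    by (intro mult_left_mono) auto
  also have "\<dots> = ennreal ((b * \<sigma>) powr (b * card J) * t powr (b * card J - m)) * sing_prod b J y"
  proof -
    have "t powr (- m) * (b * \<sigma> * t) powr (b * card J) = (b * \<sigma>) powr (b * card J) * t powr (b * card J - m)"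
      using assms by (simp add: powr_mult powr_diff powr_minus divide_inverse ac_simps)
    then show ?thesis by (simp only: mult.assoc[symmetric] ennreal_mult[symmetric] powr_ge_zero)
  qed
  finally show ?thesis using assms by (simp add: heat_weight_def ennreal_mult)
qed

text \<open>The Gaussian is split into two equal halves. One pays for the singularities in all
  coordinates, the other turns the remaining negative power t^(-k) into |y|^(-2k), so that t
  disappears from the bound.\<close>

lemma heat_weight_far_le:
  fixes y :: "'a::euclidean_space"
    and b \<sigma> m k t :: real
  assumes "b > 0" "\<sigma> > 0" "y \<noteq> 0" and k: "k = m - b * DIM('a)" "k > 0"
  shows "ennreal (heat_weight \<sigma> m (y, t)) \<le>
    ennreal ((2 * \<sigma> * k) powr k * (b * (2 * \<sigma>)) powr (b * DIM('a)) * norm y powr (- (2 * k))) * sing_prod b Basis y"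
proof (cases "t > 0")
  case True
  let ?q = "(norm y)\<^sup>2 / (2 * \<sigma> * t)"
  have q: "?q > 0" using assms True by simp
  have "norm y powr (2 * k) = ((norm y)\<^sup>2) powr k" using assms powr_powr[of "norm y" 2 k] by (simp add: powr_numeral)
  then have "?q powr k = norm y powr (2 * k) / (2 * \<sigma> * t) powr k" using assms True by (simp add: powr_divide)
  moreover have "exp (- ?q) * ?q powr k \<le> k powr k" using powr_mult_exp_le[of ?q k] q k by (simp add: mult.commute)
  ultimately have "exp (- ?q) * (norm y powr (2 * k) / (2 * \<sigma> * t) powr k) \<le> k powr k" by (simp only:)
  moreover have "(2 * \<sigma> * t) powr k > 0" using assms(2) True by simp
  ultimately have "exp (- ?q) * norm y powr (2 * k) \<le> k powr k * (2 * \<sigma> * t) powr k"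
    by (simp only: times_divide_eq_right pos_divide_le_eq)
  then have "exp (- ?q) \<le> k powr k * (2 * \<sigma> * t) powr k * norm y powr (- (2 * k))"
    using assms(3) by (simp add: powr_minus field_simps)
  also have "k powr k * (2 * \<sigma> * t) powr k = (2 * \<sigma> * k) powr k * t powr k"
    using k assms True by (simp add: powr_mult)
  finally have e: "exp (- ?q) \<le> (2 * \<sigma> * k) powr k * t powr k * norm y powr (- (2 * k))" .
  have "heat_weight \<sigma> m (y, t) = exp (- ?q) * heat_weight (2 * \<sigma>) m (y, t)"
  proof -
    have "- (norm y)\<^sup>2 / (\<sigma> * t) = - ?q + (- (norm y)\<^sup>2 / (2 * \<sigma> * t))" using assms True by (simp add: field_simps)
    then have "exp (- (norm y)\<^sup>2 / (\<sigma> * t)) = exp (- ?q) * exp (- (norm y)\<^sup>2 / (2 * \<sigma> * t))"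
      by (simp only: exp_add)
    then show ?thesis using True by (simp add: heat_weight_def)
  qed
  also have "\<dots> \<le> ((2 * \<sigma> * k) powr k * t powr k * norm y powr (- (2 * k))) * heat_weight (2 * \<sigma>) m (y, t)"
    by (intro mult_right_mono e heat_weight_nonneg)
  finally have "ennreal (heat_weight \<sigma> m (y, t)) \<le>
     ennreal ((2 * \<sigma> * k) powr k * t powr k * norm y powr (- (2 * k))) * ennreal (heat_weight (2 * \<sigma>) m (y, t))"
    by (simp add: ennreal_leI heat_weight_nonneg flip: ennreal_mult)
  also have "\<dots> \<le> ennreal ((2 * \<sigma> * k) powr k * t powr k * norm y powr (- (2 * k))) *
     (ennreal ((b * (2 * \<sigma>)) powr (b * DIM('a)) * t powr (b * DIM('a) - m)) * sing_prod b Basis y)"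
    using heat_weight_le_sing_prod[of Basis b "2 * \<sigma>" t m y] assms True by (intro mult_left_mono) auto
  also have "\<dots> = ennreal ((2 * \<sigma> * k) powr k * (b * (2 * \<sigma>)) powr (b * DIM('a)) * norm y powr (- (2 * k))) * sing_prod b Basis y"
  proof -
    have "t powr k * t powr (b * DIM('a) - m) = 1" using True k by (simp flip: powr_add)
    then have eq: "((2 * \<sigma> * k) powr k * t powr k * norm y powr (- (2 * k))) * ((b * (2 * \<sigma>)) powr (b * DIM('a)) * t powr (b * DIM('a) - m))
       = (2 * \<sigma> * k) powr k * (b * (2 * \<sigma>)) powr (b * DIM('a)) * norm y powr (- (2 * k)) * 1"
      by algebra
    then show ?thesis unfolding mult.assoc[symmetric, of "ennreal _"]
      by (subst ennreal_mult[symmetric], simp, simp, simp only: eq mult_1_right)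
  qed
  finally show ?thesis .
qed (simp add: heat_weight_def)

lemma nn_integral_sing_prod_le:
  fixes J :: "'a::euclidean_space set"
  assumes "J \<subseteq> Basis" "0 \<le> b" "b < 1/2" "R \<ge> 0"
  shows "(\<integral>\<^sup>+y. (\<Prod>j\<in>Basis. indicator {- R..R} (y \<bullet> j)) * sing_prod b J y \<partial>lborel)
    \<le> ennreal (2 * R) ^ (DIM('a) - card J) * ennreal (2 * (R powr (1 - 2 * b) / (1 - 2 * b))) ^ card J"
proof -
  define f where "f j s = (indicator {- R..R} s :: ennreal) * (if j \<in> J then inverse (ennreal (\<bar>s\<bar> powr (2 * b))) else 1)" for j :: 'a and s :: real
  have fin: "finite J" by (rule finite_subset[OF assms(1) finite_Basis])
  have m: "f j \<in> borel_measurable borel" for j unfolding f_def by measurable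
  have "(\<Prod>j\<in>Basis. indicator {- R..R} (y \<bullet> j)) * sing_prod b J y = (\<Prod>j\<in>Basis. f j (y \<bullet> j))" for y
  proof -
    have "sing_prod b J y = (\<Prod>j\<in>Basis. if j \<in> J then inverse (ennreal (\<bar>y \<bullet> j\<bar> powr (2 * b))) else 1)"
      using assms(1) by (simp add: sing_prod_def prod.If_cases Int_absorb1)
    then show ?thesis by (simp add: f_def prod.distrib)
  qed
  then have "(\<integral>\<^sup>+y. (\<Prod>j\<in>Basis. indicator {- R..R} (y \<bullet> j)) * sing_prod b J y \<partial>lborel) = (\<Prod>j\<in>Basis. \<integral>\<^sup>+s. f j s \<partial>lborel)"
    using nn_integral_lborel_prod[of f, OF m] by simp
  also have "\<dots> \<le> (\<Prod>j\<in>Basis. if j \<in> J then ennreal (2 * (R powr (1 - 2 * b) / (1 - 2 * b))) else ennreal (2 * R))"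
  proof (rule prod_mono_ennreal)
    fix j :: 'a
    show "(\<integral>\<^sup>+s. f j s \<partial>lborel) \<le> (if j \<in> J then ennreal (2 * (R powr (1 - 2 * b) / (1 - 2 * b))) else ennreal (2 * R))"
      using nn_integral_abs_powr_le[of "2 * b" R 0] assms by (auto simp: f_def)
  qed
  also have "\<dots> = (\<Prod>j\<in>J. ennreal (2 * (R powr (1 - 2 * b) / (1 - 2 * b)))) * (\<Prod>j\<in>Basis - J. ennreal (2 * R))"
    using assms(1) by (simp add: prod.If_cases Int_absorb1 Diff_eq)
  also have "\<dots> = ennreal (2 * R) ^ (DIM('a) - card J) * ennreal (2 * (R powr (1 - 2 * b) / (1 - 2 * b))) ^ card J"
    using assms(1) fin by (simp add: card_Diff_subset mult.commute)
  finally show ?thesis .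
qed

text \<open>Radius 2 leaves room for two points: the truncated kernels are supported in radius
  \<rho> <= 1 and are compared at distance at most 1, so both arguments lie in this ball unless both
  kernels vanish. The width 32 is the largest one in the pointwise estimates.\<close>

definition cut_weight :: "real \<Rightarrow> 'a::euclidean_space \<times> real \<Rightarrow> real" where
  "cut_weight m z = (if norm z \<le> 2 then heat_weight 32 m z else 0)"

lemma borel_measurable_heat_weight [measurable]: "heat_weight \<sigma> m \<in> borel_measurable borel"
  unfolding heat_weight_def[abs_def] case_prod_beta borel_prod[symmetric] by measurable

lemma borel_measurable_heat_power [measurable]: "heat_power m \<in> borel_measurable borel"
  unfolding heat_power_def[abs_def] case_prod_beta borel_prod[symmetric] by measurable

lemma borel_measurable_heat_grad [measurable]: "heat_grad m \<in> borel_measurable borel"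
proof -
  have "fst \<in> borel_measurable (borel :: ('a \<times> real) measure)" unfolding borel_prod[symmetric] by measurable
  then show ?thesis unfolding heat_grad_def[abs_def] by measurable
qed

lemma borel_measurable_cut_weight [measurable]: "cut_weight m \<in> borel_measurable borel"
  unfolding cut_weight_def[abs_def] by measurable

lemma cut_weight_nonneg: "cut_weight m z \<ge> 0" by (simp add: cut_weight_def heat_weight_nonneg)

lemma norm_le_coords:
  fixes y :: "'a::euclidean_space" assumes "norm (y, t :: real) \<le> R"
  shows "(\<Prod>j\<in>Basis. indicator {- R..R} (y \<bullet> j)) = (1 :: ennreal)" "\<bar>t\<bar> \<le> R" "norm y \<le> R"
proof -
  show n: "norm y \<le> R" using norm_fst_le[of y t] assms by simp
  show "\<bar>t\<bar> \<le> R" using norm_snd_le[of t y] assms by simp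
  show "(\<Prod>j\<in>Basis. indicator {- R..R} (y \<bullet> j)) = (1 :: ennreal)"
  proof (rule prod.neutral, rule ballI)
    fix j :: 'a assume "j \<in> Basis"
    then have "\<bar>y \<bullet> j\<bar> \<le> R" using Basis_le_norm[of j y] n by linarith
    then show "indicator {- R..R} (y \<bullet> j) = (1 :: ennreal)" by (auto simp: indicator_def)
  qed
qed

text \<open>Integrating out y turns t^(-m) into t^(n/2 - m), which explains the threshold. In the
  proof the Gaussian is replaced by \<open>sing_prod\<close> with b slightly below 1/2, so that
  everything is a product of one-dimensional integrals.\<close>

lemma integrable_cut_weight:
  assumes "m < DIM('a) / 2 + 1"
  shows "integrable lborel (cut_weight m :: 'a::euclidean_space \<times> real \<Rightarrow> real)"
proof -
  let ?n = "real DIM('a)"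
  \<comment> \<open>\<open>b\<close> has to exceed (m - 1)/n, so that the remaining power b n - m of
    t is above -1, and to stay positive and below 1/2 for the coordinate singularities. It is taken
    halfway.\<close>
  define X where "X = (m - 1) / ?n"
  define b where "b = (max 0 X + 1/2) / 2"
  have n: "?n > 0" by simp
  have l: "X < 1/2" using assms n by (simp add: X_def field_simps)
  have b: "b > 0" "b < 1/2" and bm: "b > X" using l by (auto simp: b_def max_def)
  have bn: "b * ?n - m > -1" using bm n by (simp add: X_def field_simps)
  \<comment> \<open>Only the positive part is a singularity; a nonnegative power of t is bounded on
    t <= 2.\<close>
  define k where "k = max 0 (m - b * ?n)"
  have k: "0 \<le> k" "k < 1" using bn by (auto simp: k_def)
  define C where "C = (b * 32) powr (b * ?n) * 2 powr (k - m + b * ?n)"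
  have pw: "ennreal (cut_weight m z) \<le> ennreal C * (((\<Prod>j\<in>Basis. indicator {- 2..2} (fst z \<bullet> j)) * sing_prod b Basis (fst z)) *
       (indicator {0 - 2..0 + 2} (snd z) * inverse (ennreal (\<bar>snd z - 0\<bar> powr k))))" for z :: "'a \<times> real"
  proof (cases "norm z \<le> 2 \<and> snd z > 0")
    case True
    obtain y t where z: "z = (y, t)" by (cases z)
    have t: "t > 0" "t \<le> 2" using True z norm_le_coords(2)[of y t 2] by auto
    have "ennreal (cut_weight m z) \<le> ennreal ((b * 32) powr (b * ?n) * t powr (b * ?n - m)) * sing_prod b Basis y"
      using heat_weight_le_sing_prod[of Basis b 32 t m y] True t b by (simp add: cut_weight_def z)
    also have "\<dots> \<le> ennreal (C * t powr (- k)) * sing_prod b Basis y"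
    proof (intro mult_right_mono ennreal_leI)
      have "t powr (b * ?n - m) = t powr (k - m + b * ?n) * t powr (- k)" using t by (simp flip: powr_add)
      also have "\<dots> \<le> 2 powr (k - m + b * ?n) * t powr (- k)"
        using t by (intro mult_right_mono powr_mono2) (auto simp: k_def)
      finally show "(b * 32) powr (b * ?n) * t powr (b * ?n - m) \<le> C * t powr (- k)"
        unfolding C_def mult.assoc by (intro mult_left_mono) auto
    qed auto
    also have "ennreal (C * t powr (- k)) = ennreal C * inverse (ennreal (\<bar>t - 0\<bar> powr k))"
      using t by (simp add: C_def ennreal_mult' inverse_ennreal powr_minus)
    finally show ?thesis using True t norm_le_coords(1)[of y t 2] by (simp add: z ac_simps)
  next
    case False
    then have "cut_weight m z = 0" by (cases z) (auto simp: cut_weight_def heat_weight_def)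
    then show ?thesis by simp
  qed
  define A where "A y = (\<Prod>j\<in>Basis. indicator {- 2..2} (y \<bullet> j)) * sing_prod b Basis y" for y :: 'a
  define B where "B t = indicator {0 - 2..0 + 2} t * inverse (ennreal (\<bar>t - 0\<bar> powr k))" for t :: real
  have A[measurable]: "A \<in> borel_measurable borel" unfolding A_def by measurable
  have B[measurable]: "B \<in> borel_measurable borel" unfolding B_def by measurable
  have "(\<integral>\<^sup>+z. ennreal (cut_weight m z) \<partial>(lborel :: ('a \<times> real) measure)) \<le> (\<integral>\<^sup>+z. ennreal C * (A (fst z) * B (snd z)) \<partial>lborel)"
    by (intro nn_integral_mono) (use pw in \<open>simp add: A_def B_def\<close>)
  also have "\<dots> = (\<integral>\<^sup>+z. ennreal C * (A (fst z) * B (snd z)) \<partial>(lborel \<Otimes>\<^sub>M lborel))" by (simp add: lborel_prod)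
  also have "\<dots> = (\<integral>\<^sup>+y. \<integral>\<^sup>+t. ennreal C * (A y * B t) \<partial>lborel \<partial>lborel)"
    by (subst lborel.nn_integral_fst[symmetric]) auto
  also have "\<dots> = ennreal C * ((\<integral>\<^sup>+y. A y \<partial>lborel) * (\<integral>\<^sup>+t. B t \<partial>lborel))"
    by (simp add: nn_integral_cmult nn_integral_multc)
  also have "\<dots> \<le> ennreal C * ((ennreal (2 * 2) ^ (DIM('a) - card (Basis :: 'a set)) * ennreal (2 * (2 powr (1 - 2 * b) / (1 - 2 * b))) ^ card (Basis :: 'a set)) * ennreal (2 * (2 powr (1 - k) / (1 - k))))"
    unfolding A_def B_def
    by (intro mult_left_mono mult_mono nn_integral_sing_prod_le nn_integral_abs_powr_le) (use b k in auto)
  also have "\<dots> < \<infinity>" by (simp add: ennreal_mult_less_top power_less_top_ennreal)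
  finally have "(\<integral>\<^sup>+z. ennreal (cut_weight m z) \<partial>(lborel :: ('a \<times> real) measure)) < \<infinity>" .
  then show ?thesis by (intro integrableI_nonneg) (auto simp: cut_weight_nonneg)
qed

lemma cut_weight_exponent_mono:
  assumes "m \<le> m'" shows "cut_weight m z \<le> 2 powr (m' - m) * cut_weight m' z"
proof (cases z)
  case (Pair y t)
  show ?thesis
  proof (cases "norm z \<le> 2 \<and> t > 0")
    case True
    have t: "t > 0" "t \<le> 2" using True Pair norm_le_coords(2)[of y t 2] by auto
    have "t powr (- m) = t powr (m' - m) * t powr (- m')" using t by (simp flip: powr_add)
    also have "\<dots> \<le> 2 powr (m' - m) * t powr (- m')" using t assms by (intro mult_right_mono powr_mono2) auto
    finally have "t powr (- m) * exp (- (norm y)\<^sup>2 / (32 * t)) \<le> 2 powr (m' - m) * t powr (- m') * exp (- (norm y)\<^sup>2 / (32 * t))"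
      by (intro mult_right_mono) auto
    then show ?thesis using True by (simp add: cut_weight_def heat_weight_def Pair)
  qed (auto simp: cut_weight_def heat_weight_def Pair)
qed

section \<open>Reflections, translations and convolutions\<close>

lemma lborel_reflect:
  "distr lborel borel (\<lambda>w. z - w) = (lborel :: 'a::euclidean_space measure)"
proof -
  have "(lborel :: 'a measure) = density (distr lborel borel (\<lambda>x. z + (-1) *\<^sub>R x)) (\<lambda>_. ennreal (\<bar>-1::real\<bar> ^ DIM('a)))"
    by (rule lborel_affine) simp
  then show ?thesis by (simp add: density_1)
qed

lemma nn_integral_reflect:
  fixes f :: "'a::euclidean_space \<Rightarrow> ennreal"
  assumes [measurable]: "f \<in> borel_measurable borel"
  shows "(\<integral>\<^sup>+w. f (z - w) \<partial>lborel) = (\<integral>\<^sup>+w. f w \<partial>lborel)"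
  by (subst (2) lborel_reflect[of z, symmetric]) (simp add: nn_integral_distr)

lemma integrable_reflect:
  fixes f :: "'a::euclidean_space \<Rightarrow> 'b::{banach, second_countable_topology}"
  assumes "integrable lborel f" shows "integrable lborel (\<lambda>w. f (z - w))"
proof -
  have "integrable (distr lborel borel (\<lambda>w. z - w)) f" using assms by (simp add: lborel_reflect)
  then show ?thesis by (subst (asm) integrable_distr_eq) (use assms borel_measurable_integrable in auto)
qed

lemma integral_reflect_lborel:
  fixes f :: "'a::euclidean_space \<Rightarrow> 'b::{banach, second_countable_topology}"
  assumes [measurable]: "f \<in> borel_measurable borel"
  shows "(\<integral>w. f (z - w) \<partial>lborel) = (\<integral>w. f w \<partial>lborel)"
  by (subst (2) lborel_reflect[of z, symmetric]) (simp add: integral_distr)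

lemma nn_integral_translate:
  fixes f :: "'a::euclidean_space \<Rightarrow> ennreal"
  assumes [measurable]: "f \<in> borel_measurable borel"
  shows "(\<integral>\<^sup>+w. f (w + z) \<partial>lborel) = (\<integral>\<^sup>+w. f w \<partial>lborel)"
  by (subst (2) lborel_distr_plus[of z, symmetric]) (simp add: nn_integral_distr add.commute)

lemma convolution_bound:
  fixes k \<omega> g :: "'a::euclidean_space \<Rightarrow> _"
  assumes "\<And>w. norm (k w :: 'b::{banach, second_countable_topology}) \<le> C * (\<omega> (z - w) + \<omega> (z' - w))"
    and "integrable lborel (\<omega> :: 'a \<Rightarrow> real)" and "\<And>w. \<bar>g w :: real\<bar> \<le> M" and "C \<ge> 0"
    and "\<And>w. \<omega> w \<ge> 0"
  shows "norm (\<integral>w. g w *\<^sub>R k w \<partial>lborel) \<le> 2 * M * C * (\<integral>w. \<omega> w \<partial>lborel)"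
proof -
  have M: "M \<ge> 0" using assms(3)[of undefined] by linarith
  have i: "integrable lborel (\<lambda>w. M * (C * (\<omega> (z - w) + \<omega> (z' - w))))"
    using integrable_reflect[OF assms(2)] by simp
  have "norm (\<integral>w. g w *\<^sub>R k w \<partial>lborel) \<le> (\<integral>w. M * (C * (\<omega> (z - w) + \<omega> (z' - w))) \<partial>lborel)"
  proof (cases "integrable lborel (\<lambda>w. g w *\<^sub>R k w)")
    case True
    show ?thesis
    proof (rule order_trans[OF integral_norm_bound], rule integral_mono[OF _ i])
      show "integrable lborel (\<lambda>w. norm (g w *\<^sub>R k w))" by (rule integrable_norm[OF True])
      show "norm (g w *\<^sub>R k w) \<le> M * (C * (\<omega> (z - w) + \<omega> (z' - w)))" for w
        unfolding norm_scaleR using assms(1,3) M by (intro mult_mono) auto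
    qed
  next
    \<comment> \<open>The Bochner integral is then 0 by convention, and the bound holds
      trivially.\<close>
    case False
    have "0 \<le> (\<integral>w. M * (C * (\<omega> (z - w) + \<omega> (z' - w))) \<partial>lborel)" using assms M by (intro integral_nonneg_AE) auto
    then show ?thesis using False by (simp add: not_integrable_integral_eq)
  qed
  also have "\<dots> = M * (C * ((\<integral>w. \<omega> (z - w) \<partial>lborel) + (\<integral>w. \<omega> (z' - w) \<partial>lborel)))"
    using integrable_reflect[OF assms(2)] by simp
  also have "\<dots> = 2 * M * C * (\<integral>w. \<omega> w \<partial>lborel)"
    using integral_reflect_lborel[of \<omega>] borel_measurable_integrable[OF assms(2)] by simp
  finally show ?thesis .
qed

section \<open>Truncated kernels\<close>

lemma continuous_compact_support_bounded:
  fixes f :: "'a::euclidean_space \<Rightarrow> real"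
  assumes "continuous_on UNIV f" "\<And>z. norm z > r \<Longrightarrow> f z = 0"
  obtains B where "B \<ge> 0" "\<And>z. \<bar>f z\<bar> \<le> B"
proof -
  have "compact (f ` cball 0 r)"
    by (rule compact_continuous_image) (auto intro: continuous_on_subset[OF assms(1)])
  then obtain B where B: "\<And>z. z \<in> cball 0 r \<Longrightarrow> norm (f z) \<le> B"
    using compact_imp_bounded bounded_iff by (metis imageI)
  show ?thesis
  proof (rule that[of "max 0 B"])
    show "\<bar>f z\<bar> \<le> max 0 B" for z
      using B[of z] assms(2)[of z] by (cases "norm z \<le> r") (auto simp: dist_norm le_max_iff_disj)
  qed simp
qed

lemma lipschitz_of_derivative_bound:
  fixes f :: "'a::euclidean_space \<Rightarrow> real"
  assumes "\<And>x. (f has_derivative f' x) (at x)" "\<And>x h. \<bar>f' x h\<bar> \<le> B * norm h"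
  shows "\<bar>f x - f y\<bar> \<le> B * norm (x - y)"
proof -
  have "norm (f x - f y) \<le> B * norm (x - y)"
    by (rule differentiable_bound[of UNIV f f'])
       (auto intro!: has_derivative_at_withinI assms(1) onorm_le simp: assms(2))
  then show ?thesis by simp
qed

lemma frechet_derivative_eq_zero_open:
  assumes "open S" "z \<in> S" "\<And>w. w \<in> S \<Longrightarrow> f w = c"
  shows "frechet_derivative f (at z) = (\<lambda>_. 0)"
proof -
  have "(f has_derivative (\<lambda>_. 0)) (at z)"
    by (rule has_derivative_transform_within_open[OF has_derivative_const assms(1,2)]) (use assms in auto)
  then show ?thesis using frechet_derivative_at by metis
qed

lemma compact_support_lipschitz:
  fixes f :: "'a::euclidean_space \<Rightarrow> real"
  assumes "C_k_on (Suc 0) UNIV f" "\<And>z. norm z > r \<Longrightarrow> f z = 0"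
  obtains B where "B \<ge> 0" "\<And>z. \<bar>f z\<bar> \<le> B" "\<And>z z'. \<bar>f z - f z'\<bar> \<le> B * norm (z - z')"
    "\<And>z. \<bar>frechet_derivative f (at z) h\<bar> \<le> B * norm h"
proof -
  have c: "continuous_on UNIV f" using C_k_on_SucD[OF assms(1)] by simp
  obtain B0 where B0: "B0 \<ge> 0" "\<And>z. \<bar>f z\<bar> \<le> B0"
    using continuous_compact_support_bounded[OF c] assms(2) by blast
  have "\<exists>B\<ge>0. \<forall>z. \<bar>frechet_derivative f (at z) b\<bar> \<le> B" if b: "b \<in> Basis" for b
  proof -
    have "frechet_derivative f (at z) b = 0" if "norm z > r" for z
      using frechet_derivative_eq_zero_open[of "- cball 0 r" z f 0] that assms(2) by (auto simp: open_Compl)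
    moreover have "continuous_on UNIV (\<lambda>z. frechet_derivative f (at z) b)" using assms(1) b by auto
    ultimately obtain B where "B \<ge> 0" "\<And>z. \<bar>frechet_derivative f (at z) b\<bar> \<le> B"
      using continuous_compact_support_bounded by blast
    then show ?thesis by blast
  qed
  then obtain Bb where Bb: "\<And>b. b \<in> Basis \<Longrightarrow> Bb b \<ge> 0"
    "\<And>b z. b \<in> Basis \<Longrightarrow> \<bar>frechet_derivative f (at z) b\<bar> \<le> Bb b" by metis
  define B1 where "B1 = sum Bb Basis"
  have B1: "B1 \<ge> 0" unfolding B1_def using Bb(1) by (rule sum_nonneg)
  have d: "\<bar>frechet_derivative f (at z) h\<bar> \<le> B1 * norm h" for z h
  proof -
    have lin: "linear (frechet_derivative f (at z))"
      using C_k_on_has_derivative[OF assms(1)] has_derivative_linear by auto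
    have "frechet_derivative f (at z) h = frechet_derivative f (at z) (\<Sum>b\<in>Basis. (h \<bullet> b) *\<^sub>R b)"
      by (simp add: euclidean_representation)
    also have "\<dots> = (\<Sum>b\<in>Basis. (h \<bullet> b) * frechet_derivative f (at z) b)"
      by (simp add: linear_sum[OF lin] linear_cmul[OF lin])
    also have "\<bar>\<dots>\<bar> \<le> (\<Sum>b\<in>Basis. \<bar>(h \<bullet> b) * frechet_derivative f (at z) b\<bar>)" by (rule sum_abs)
    also have "\<dots> \<le> (\<Sum>b\<in>Basis. norm h * Bb b)"
      unfolding abs_mult using Bb by (intro sum_mono mult_mono Basis_le_norm) auto
    also have "\<dots> = B1 * norm h" unfolding B1_def sum_distrib_left[symmetric] by (rule mult.commute)
    finally show ?thesis .
  qed
  have l: "\<bar>f z - f z'\<bar> \<le> B1 * norm (z - z')" for z z'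
    by (rule lipschitz_of_derivative_bound[OF C_k_on_has_derivative[OF assms(1)] d]) auto
  show ?thesis
  proof (rule that[of "max B0 B1"])
    show "\<bar>f z\<bar> \<le> max B0 B1" for z using B0(2)[of z] by linarith
    show "\<bar>f z - f z'\<bar> \<le> max B0 B1 * norm (z - z')" for z z'
      by (rule order_trans[OF l mult_right_mono]) auto
    show "\<bar>frechet_derivative f (at z) h\<bar> \<le> max B0 B1 * norm h" for z
      by (rule order_trans[OF d mult_right_mono]) auto
  qed (use B0 in auto)
qed

lemma norm_le_sum_components:
  fixes v :: "'a::euclidean_space" assumes "\<And>b. b \<in> Basis \<Longrightarrow> \<bar>v \<bullet> b\<bar> \<le> B b"
  shows "norm v \<le> sum B Basis"
  using norm_le_l1[of v] sum_mono[of Basis "\<lambda>b. \<bar>v \<bullet> b\<bar>" B] assms by (meson order_trans)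

text \<open>A C^2 function of compact support with a single constant \<open>L\<close> for all its
  bounds. It is instantiated with the cutoff and with \<open>heat_error\<close>. The gradient is a
  vector in space-time whose first component is the spatial part.\<close>

locale smooth_bump =
  fixes e :: "'a::euclidean_space \<Rightarrow> real" and De :: "'a \<Rightarrow> 'a" and r L :: real
  assumes L_nonneg: "L \<ge> 0"
    and has_derivative: "\<And>z. (e has_derivative (\<lambda>h. De z \<bullet> h)) (at z)"
    and continuous_De: "continuous_on UNIV De"
    and support: "\<And>z. norm z > r \<Longrightarrow> e z = 0"
    and support_De: "\<And>z. norm z > r \<Longrightarrow> De z = 0"
    and bound: "\<And>z. \<bar>e z\<bar> \<le> L"
    and bound_De: "\<And>z. norm (De z) \<le> L"
    and lipschitz: "\<And>z z'. \<bar>e z - e z'\<bar> \<le> L * norm (z - z')"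
    and lipschitz_De: "\<And>z z'. norm (De z - De z') \<le> L * norm (z - z')"
begin

lemma taylor: "\<bar>e (z + h) - e z - De z \<bullet> h\<bar> \<le> L * (norm h)\<^sup>2"
proof -
  have "norm (e (z + h) - e z - De z \<bullet> ((z + h) - z)) \<le> norm ((z + h) - z) * (L * norm h)"
  proof (rule differentiable_bound_linearization[where S="closed_segment z (z + h)" and f'="\<lambda>x h. De x \<bullet> h"])
    show "z + t *\<^sub>R (z + h - z) \<in> closed_segment z (z + h)" if "t \<in> {0..1}" for t
      using that unfolding closed_segment_image_interval by (auto simp: algebra_simps intro!: image_eqI[of _ _ t])
    show "(e has_derivative (\<bullet>) (De x)) (at x within closed_segment z (z + h))" for x
      using has_derivative has_derivative_at_withinI by blast
    fix y assume "y \<in> closed_segment z (z + h)"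
    then obtain t where t: "0 \<le> t" "t \<le> 1" "y = z + t *\<^sub>R h"
      unfolding closed_segment_image_interval by (auto simp: algebra_simps)
    have "norm (De y - De z) \<le> L * norm (t *\<^sub>R h)" using lipschitz_De[of y z] t by simp
    also have "\<dots> \<le> L * norm h" using t L_nonneg by (intro mult_left_mono) (auto simp: mult_left_le_one_le)
    finally have b: "norm (De y - De z) \<le> L * norm h" .
    show "onorm ((\<bullet>) (De y) - (\<bullet>) (De z)) \<le> L * norm h"
    proof (rule onorm_le)
      fix k
      have "norm (((\<bullet>) (De y) - (\<bullet>) (De z)) k) = \<bar>(De y - De z) \<bullet> k\<bar>" by (simp add: inner_diff_left)
      also have "\<dots> \<le> norm (De y - De z) * norm k" by (rule Cauchy_Schwarz_ineq2)
      also have "\<dots> \<le> L * norm h * norm k" using b by (intro mult_right_mono) auto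
      finally show "norm (((\<bullet>) (De y) - (\<bullet>) (De z)) k) \<le> L * norm h * norm k" .
    qed
  qed simp
  then show ?thesis by (simp add: power2_eq_square algebra_simps)
qed

lemma continuous: "continuous_on UNIV e"
  by (auto intro!: continuous_at_imp_continuous_on has_derivative_continuous has_derivative)

lemma measurable_e [measurable]: "e \<in> borel_measurable borel"
  by (rule borel_measurable_continuous_onI[OF continuous])

lemma measurable_De [measurable]: "De \<in> borel_measurable borel"
  by (rule borel_measurable_continuous_onI[OF continuous_De])

end

lemma smooth_bump_exists:
  fixes e :: "'a::euclidean_space \<Rightarrow> real"
  assumes "C_k_on 2 UNIV e" "\<And>z. norm z > r \<Longrightarrow> e z = 0"
  shows "\<exists>De L. smooth_bump e De r L"
proof -
  define De where "De z = (\<Sum>b\<in>Basis. frechet_derivative e (at z) b *\<^sub>R b)" for z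
  have C1: "C_k_on (Suc 0) UNIV e" and C2: "\<And>b. b \<in> Basis \<Longrightarrow> C_k_on (Suc 0) UNIV (\<lambda>z. frechet_derivative e (at z) b)"
    using assms(1) C_k_on_SucD[of "Suc 0" UNIV e] by (auto simp: numeral_2_eq_2)
  have Deb: "De z \<bullet> b = frechet_derivative e (at z) b" if "b \<in> Basis" for z b
    using that by (simp add: De_def inner_sum_left inner_Basis if_distrib cong: if_cong)
  have hd: "(e has_derivative frechet_derivative e (at z)) (at z)" for z using C_k_on_has_derivative[OF C1] by simp
  have Deh: "De z \<bullet> h = frechet_derivative e (at z) h" for z h
  proof -
    have lin: "linear (frechet_derivative e (at z))" using hd has_derivative_linear by auto
    have "frechet_derivative e (at z) h = frechet_derivative e (at z) (\<Sum>b\<in>Basis. (h \<bullet> b) *\<^sub>R b)"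
      by (simp add: euclidean_representation)
    also have "\<dots> = (\<Sum>b\<in>Basis. (h \<bullet> b) * frechet_derivative e (at z) b)"
      by (simp add: linear_sum[OF lin] linear_cmul[OF lin])
    also have "\<dots> = De z \<bullet> h" by (subst euclidean_inner) (simp add: Deb mult.commute)
    finally show ?thesis by simp
  qed
  have hD: "(e has_derivative (\<lambda>h. De z \<bullet> h)) (at z)" for z using hd[of z] unfolding Deh .
  have sD: "De z = 0" if "norm z > r" for z
    using frechet_derivative_eq_zero_open[of "- cball 0 r" z e 0] that assms(2) by (auto simp: open_Compl De_def)
  obtain B0 where B0: "B0 \<ge> 0" "\<And>z. \<bar>e z\<bar> \<le> B0" "\<And>z z'. \<bar>e z - e z'\<bar> \<le> B0 * norm (z - z')"
    using compact_support_lipschitz[OF C1 assms(2)] by metis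
  have "\<exists>B\<ge>0. (\<forall>z. \<bar>De z \<bullet> b\<bar> \<le> B) \<and> (\<forall>z z'. \<bar>(De z - De z') \<bullet> b\<bar> \<le> B * norm (z - z'))" if b: "b \<in> Basis" for b
  proof -
    have "frechet_derivative e (at z) b = 0" if "norm z > r" for z using sD[OF that] Deb[OF b, of z] by simp
    then obtain B where "B \<ge> 0" "\<And>z. \<bar>frechet_derivative e (at z) b\<bar> \<le> B"
       "\<And>z z'. \<bar>frechet_derivative e (at z) b - frechet_derivative e (at z') b\<bar> \<le> B * norm (z - z')"
      using compact_support_lipschitz[OF C2[OF b]] by metis
    then show ?thesis using Deb[OF b] by (auto simp: inner_diff_left)
  qed
  then obtain Bb where Bb: "\<And>b. b \<in> Basis \<Longrightarrow> Bb b \<ge> 0" "\<And>b z. b \<in> Basis \<Longrightarrow> \<bar>De z \<bullet> b\<bar> \<le> Bb b"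
    "\<And>b z z'. b \<in> Basis \<Longrightarrow> \<bar>(De z - De z') \<bullet> b\<bar> \<le> Bb b * norm (z - z')" by metis
  define B1 where "B1 = sum Bb Basis"
  have n1: "norm (De z) \<le> B1" for z unfolding B1_def by (rule norm_le_sum_components[OF Bb(2)])
  have n2: "norm (De z - De z') \<le> B1 * norm (z - z')" for z z'
    unfolding B1_def sum_distrib_right by (rule norm_le_sum_components[OF Bb(3)])
  have cD: "continuous_on UNIV De"
    unfolding De_def using C_k_on_SucD[OF C2] by (auto intro!: continuous_intros)
  have "smooth_bump e De r (max B0 B1)"
  proof
    show "norm (De z - De z') \<le> max B0 B1 * norm (z - z')" for z z'
      by (rule order_trans[OF n2 mult_right_mono]) auto
    show "\<bar>e z - e z'\<bar> \<le> max B0 B1 * norm (z - z')" for z z'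
      by (rule order_trans[OF B0(3) mult_right_mono]) auto
    show "\<bar>e z\<bar> \<le> max B0 B1" for z using B0(2)[of z] by linarith
    show "norm (De z) \<le> max B0 B1" for z using n1[of z] by linarith
  qed (use B0 hD cD assms(2) sD in auto)
  then show ?thesis by blast
qed

lemma cut_weight_eq: "norm z \<le> 2 \<Longrightarrow> cut_weight m z = heat_weight 32 m z"
  by (simp add: cut_weight_def)

lemma heat_weight16_le_cut: "norm z \<le> 2 \<Longrightarrow> heat_weight 16 m z \<le> cut_weight m z"
  using heat_weight_mono[of 16 32 m z] by (simp add: cut_weight_def)

lemma heat_power_le_cut: "norm z \<le> 2 \<Longrightarrow> heat_power m z \<le> cut_weight m z"
  using heat_power_le_weight[of m z] heat_weight16_le_cut[of z m] by linarith

lemma norm_heat_grad_le_cut: "norm z \<le> 2 \<Longrightarrow> norm (heat_grad m z) \<le> 20 * cut_weight (m + 1/2) z"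
  using norm_heat_grad_le[of m z] by (simp add: cut_weight_def)

lemma cut_weight_exponent_mono2:
  assumes "m \<le> m'" "m' \<le> m + 1" shows "cut_weight m z \<le> 2 * cut_weight m' z"
proof -
  have "cut_weight m z \<le> 2 powr (m' - m) * cut_weight m' z" by (rule cut_weight_exponent_mono[OF assms(1)])
  also have "\<dots> \<le> 2 * cut_weight m' z"
    using assms powr_mono[of "m' - m" 1 2] by (intro mult_right_mono cut_weight_nonneg) auto
  finally show ?thesis .
qed

lemma norm_fst_le2: "norm (fst z) \<le> norm (z :: 'a::real_normed_vector \<times> 'b::real_normed_vector)"
  using norm_fst_le[of "fst z" "snd z"] by simp

section \<open>The truncated kernel and its spatial gradient\<close>

locale cut_kernel = smooth_bump \<eta> D\<eta> \<rho> L
  for \<eta> :: "'a::euclidean_space \<times> real \<Rightarrow> real" and D\<eta> :: "'a \<times> real \<Rightarrow> 'a \<times> real" and \<rho> L :: real +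
  fixes m :: real
  assumes rho: "0 < \<rho>" "\<rho> \<le> 1" and m_nonneg: "m \<ge> 0"
    and eta: "\<And>z. 0 \<le> \<eta> z" "\<And>z. \<eta> z \<le> 1"
begin

definition K :: "'a \<times> real \<Rightarrow> real" where "K z = heat_power m z * \<eta> z"
definition DK :: "'a \<times> real \<Rightarrow> 'a" where "DK z = \<eta> z *\<^sub>R heat_grad m z + heat_power m z *\<^sub>R fst (D\<eta> z)"

lemma K_nonneg: "K z \<ge> 0" by (simp add: K_def heat_power_nonneg eta)

lemma K_support: "norm z > \<rho> \<Longrightarrow> K z = 0" by (simp add: K_def support)

lemma DK_support: "norm z > \<rho> \<Longrightarrow> DK z = 0" by (simp add: DK_def support support_De)

lemma measurable_K [measurable]: "K \<in> borel_measurable borel"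
  unfolding K_def[abs_def] by measurable

lemma measurable_DK [measurable]: "DK \<in> borel_measurable borel"
proof -
  have [measurable]: "fst \<in> borel_measurable (borel :: ('a \<times> real) measure)" unfolding borel_prod[symmetric] by measurable
  show ?thesis unfolding DK_def[abs_def] by measurable
qed

lemma K_le: "K z \<le> cut_weight m z"
proof (cases "norm z > \<rho>")
  case False
  then have "heat_power m z * \<eta> z \<le> cut_weight m z * 1"
    using rho eta heat_power_le_cut[of z m] by (intro mult_mono) (auto simp: cut_weight_nonneg)
  then show ?thesis by (simp add: K_def)
qed (simp add: K_support cut_weight_nonneg)

lemma norm_DK_le: "norm (DK z) \<le> (20 + 2 * L) * cut_weight (m + 1/2) z"
proof (cases "norm z > \<rho>")
  case False
  have z: "norm z \<le> 2" using False rho by linarith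
  have "norm (DK z) \<le> \<eta> z * norm (heat_grad m z) + heat_power m z * norm (fst (D\<eta> z))"
    unfolding DK_def using norm_triangle_ineq[of "\<eta> z *\<^sub>R heat_grad m z"] eta heat_power_nonneg[of m z] by (metis abs_of_nonneg norm_scaleR)
  also have "\<dots> \<le> 1 * (20 * cut_weight (m + 1/2) z) + (2 * cut_weight (m + 1/2) z) * L"
    using eta norm_heat_grad_le_cut[OF z] order_trans[OF heat_power_le_cut[OF z] cut_weight_exponent_mono2[of m "m + 1/2" z]]
      order_trans[OF norm_fst_le2[of "D\<eta> z"]] bound_De[of z]
    by (intro add_mono mult_mono) (auto simp: cut_weight_nonneg)
  finally show ?thesis by (simp add: algebra_simps)
qed (simp add: DK_support cut_weight_nonneg L_nonneg)

lemma near_support: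
  assumes "norm (z - z') \<le> 1" "\<not> (norm z > \<rho> \<and> norm z' > \<rho>)"
  shows "norm z \<le> 2" "norm z' \<le> 2"
  using assms rho norm_triangle_ineq2[of z z'] norm_triangle_ineq3[of z z'] by linarith+

lemma eta_diff:
  assumes "norm (z - z') \<le> 1" "0 \<le> a" "a \<le> 1"
  shows "\<bar>\<eta> z - \<eta> z'\<bar> \<le> L * norm (z - z') powr a"
proof -
  have "norm (z - z') \<le> norm (z - z') powr a"
    using powr_mono'[of a 1 "norm (z - z')"] assms by auto
  then show ?thesis using lipschitz[of z z'] L_nonneg by (meson mult_left_mono order_trans)
qed

lemma D_eta_diff:
  assumes "norm (z - z') \<le> 1" "0 \<le> a" "a \<le> 1"
  shows "norm (fst (D\<eta> z) - fst (D\<eta> z')) \<le> L * norm (z - z') powr a"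
proof -
  have "norm (fst (D\<eta> z) - fst (D\<eta> z')) \<le> norm (D\<eta> z - D\<eta> z')"
    using norm_fst_le2[of "D\<eta> z - D\<eta> z'"] by simp
  moreover have "norm (z - z') \<le> norm (z - z') powr a"
    using powr_mono'[of a 1 "norm (z - z')"] assms by auto
  ultimately show ?thesis using lipschitz_De[of z z'] L_nonneg by (meson mult_left_mono order_trans)
qed

text \<open>The product rule for differences, shared by the estimates in space and in time. If both
  points lie outside the support there is nothing to show; otherwise both have norm at most 2, where
  the Gaussian weights are bounded by \<open>cut_weight\<close>.\<close>

lemma K_holder_aux:
  assumes d: "norm (z - z') \<le> 1" and a: "0 \<le> a" "a \<le> 1" and k: "m \<le> k" "k \<le> m + 1" and A: "A \<ge> 0"
    and J: "\<bar>heat_power m z - heat_power m z'\<bar> \<le> A * norm (z - z') powr a * (heat_weight 16 k z + heat_weight 16 k z')"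
  shows "\<bar>K z - K z'\<bar> \<le> (A + 2 * L) * norm (z - z') powr a * (cut_weight k z + cut_weight k z')"
proof (cases "norm z > \<rho> \<and> norm z' > \<rho>")
  case False
  note z = near_support[OF d False]
  let ?p = "norm (z - z') powr a"
  have "K z - K z' = (heat_power m z - heat_power m z') * \<eta> z + heat_power m z' * (\<eta> z - \<eta> z')"
    by (simp add: K_def algebra_simps)
  then have "\<bar>K z - K z'\<bar> \<le> \<bar>heat_power m z - heat_power m z'\<bar> * \<eta> z + heat_power m z' * \<bar>\<eta> z - \<eta> z'\<bar>"
    using abs_triangle_ineq[of "(heat_power m z - heat_power m z') * \<eta> z" "heat_power m z' * (\<eta> z - \<eta> z')"] eta heat_power_nonneg[of m z']
    by (simp add: abs_mult)
  also have "\<dots> \<le> (A * ?p * (cut_weight k z + cut_weight k z')) * 1 + (2 * cut_weight k z') * (L * ?p)"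
  proof (intro add_mono mult_mono)
    have "A * ?p * (heat_weight 16 k z + heat_weight 16 k z') \<le> A * ?p * (cut_weight k z + cut_weight k z')"
      using A by (intro mult_left_mono add_mono heat_weight16_le_cut z) auto
    then show "\<bar>heat_power m z - heat_power m z'\<bar> \<le> A * ?p * (cut_weight k z + cut_weight k z')" using J by linarith
    show "heat_power m z' \<le> 2 * cut_weight k z'"
      using heat_power_le_cut[OF z(2), of m] cut_weight_exponent_mono2[OF k, of z'] by linarith
    show "\<bar>\<eta> z - \<eta> z'\<bar> \<le> L * ?p" by (rule eta_diff[OF d a])
  qed (use A eta in \<open>auto simp: cut_weight_nonneg\<close>)
  also have "\<dots> \<le> (A + 2 * L) * ?p * (cut_weight k z + cut_weight k z')"
    using L_nonneg cut_weight_nonneg[of k z] by (simp add: algebra_simps)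
  finally show ?thesis .
qed (use A L_nonneg in \<open>simp add: K_support cut_weight_nonneg\<close>)

lemma K_holder_space:
  assumes "norm (y - y') \<le> 1" "0 \<le> a" "a \<le> 1"
  shows "\<bar>K (y, t) - K (y', t)\<bar> \<le> (6 + 2 * L) * norm (y - y') powr a * (cut_weight (m + a/2) (y, t) + cut_weight (m + a/2) (y', t))"
  using K_holder_aux[of "(y, t)" "(y', t)" a "m + a/2" 6] heat_power_holder_space[of a m y t y'] assms by simp

lemma K_holder_time:
  assumes "\<bar>t - t'\<bar> \<le> 1" "0 \<le> b" "b \<le> 1"
  shows "\<bar>K (y, t) - K (y, t')\<bar> \<le> (m + 2 + 2 * L) * \<bar>t - t'\<bar> powr b * (cut_weight (m + b) (y, t) + cut_weight (m + b) (y, t'))"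
  using K_holder_aux[of "(y, t)" "(y, t')" b "m + b" "m + 2"] heat_power_holder_time[of b m y t t'] assms m_nonneg by simp

text \<open>Two exponents occur because the kernel is less singular than its gradient:
  \<open>q\<close> belongs to the term in which the derivative falls on the cutoff, and is raised to
  \<open>k\<close> at the end.\<close>

lemma DK_holder_aux:
  assumes d: "norm (z - z') \<le> 1" and a: "0 \<le> a" "a \<le> 1" and k: "m + 1/2 \<le> k" "k \<le> m + 3/2" "q \<le> k" "k \<le> q + 1" and A: "A \<ge> 0" "B \<ge> 0"
    and J: "\<bar>heat_power m z - heat_power m z'\<bar> \<le> A * norm (z - z') powr a * (heat_weight 16 q z + heat_weight 16 q z')"
    and G: "norm (heat_grad m z - heat_grad m z') \<le> B * norm (z - z') powr a * (heat_weight 32 k z + heat_weight 32 k z')"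
  shows "norm (DK z - DK z') \<le> (B + 44 * L + 2 * L * A) * norm (z - z') powr a * (cut_weight k z + cut_weight k z')"
proof (cases "norm z > \<rho> \<and> norm z' > \<rho>")
  case False
  note z = near_support[OF d False]
  let ?p = "norm (z - z') powr a"
  let ?w = "cut_weight k z + cut_weight k z'"
  have w0: "cut_weight k z \<ge> 0" "cut_weight k z' \<ge> 0" by (rule cut_weight_nonneg)+
  have "DK z - DK z' = \<eta> z *\<^sub>R (heat_grad m z - heat_grad m z') + (\<eta> z - \<eta> z') *\<^sub>R heat_grad m z' +
     ((heat_power m z - heat_power m z') *\<^sub>R fst (D\<eta> z) + heat_power m z' *\<^sub>R (fst (D\<eta> z) - fst (D\<eta> z')))"
    by (simp add: DK_def algebra_simps)
  also have "norm \<dots> \<le> \<eta> z * norm (heat_grad m z - heat_grad m z') + \<bar>\<eta> z - \<eta> z'\<bar> * norm (heat_grad m z') +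
     (\<bar>heat_power m z - heat_power m z'\<bar> * norm (fst (D\<eta> z)) + heat_power m z' * norm (fst (D\<eta> z) - fst (D\<eta> z')))"
    using eta heat_power_nonneg[of m z']
    by (intro norm_triangle_le add_mono) (auto simp: abs_of_nonneg)
  also have "\<dots> \<le> 1 * (B * ?p * ?w) + (L * ?p) * (20 * (2 * cut_weight k z')) + ((A * ?p * (2 * ?w)) * L + (4 * cut_weight k z') * (L * ?p))"
  proof (intro add_mono mult_mono)
    show "\<eta> z \<le> 1" by (rule eta)
    show "norm (heat_grad m z - heat_grad m z') \<le> B * ?p * ?w" using G z by (simp add: cut_weight_eq)
    show "\<bar>\<eta> z - \<eta> z'\<bar> \<le> L * ?p" by (rule eta_diff[OF d a])
    show "norm (heat_grad m z') \<le> 20 * (2 * cut_weight k z')"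
      using norm_heat_grad_le_cut[OF z(2), of m] cut_weight_exponent_mono2[of "m + 1/2" k z'] k by linarith
    have "A * ?p * (heat_weight 16 q z + heat_weight 16 q z') \<le> A * ?p * (2 * cut_weight k z + 2 * cut_weight k z')"
      using A order_trans[OF heat_weight16_le_cut[OF z(1)] cut_weight_exponent_mono2[OF k(3,4)]]
         order_trans[OF heat_weight16_le_cut[OF z(2)] cut_weight_exponent_mono2[OF k(3,4)]]
      by (intro mult_left_mono add_mono) auto
    then show "\<bar>heat_power m z - heat_power m z'\<bar> \<le> A * ?p * (2 * ?w)" using J by (simp add: distrib_left)
    show "norm (fst (D\<eta> z)) \<le> L" using norm_fst_le2[of "D\<eta> z"] bound_De[of z] by simp
    have "cut_weight m z' \<le> 2 powr (k - m) * cut_weight k z'" using k by (intro cut_weight_exponent_mono) auto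
    also have "\<dots> \<le> 4 * cut_weight k z'"
      using k powr_mono[of "k - m" 2 2] by (intro mult_right_mono cut_weight_nonneg) auto
    finally show "heat_power m z' \<le> 4 * cut_weight k z'" using heat_power_le_cut[OF z(2), of m] by linarith
    show "norm (fst (D\<eta> z) - fst (D\<eta> z')) \<le> L * ?p" by (rule D_eta_diff[OF d a])
  qed (use A L_nonneg w0 in auto)
  also have "\<dots> = B * ?p * ?w + 44 * L * ?p * cut_weight k z' + 2 * L * A * ?p * ?w" by (simp add: algebra_simps)
  also have "\<dots> \<le> B * ?p * ?w + 44 * L * ?p * ?w + 2 * L * A * ?p * ?w"
    using A L_nonneg w0 by (intro add_mono mult_left_mono) auto
  finally show ?thesis by (simp add: algebra_simps)
qed (use A L_nonneg in \<open>simp add: DK_support cut_weight_nonneg\<close>)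

lemma DK_holder_space:
  assumes "norm (y - y') \<le> 1" "0 \<le> a" "a \<le> 1"
  shows "norm (DK (y, t) - DK (y', t)) \<le> (6 + 44 * L + 2 * L * 6) * norm (y - y') powr a * (cut_weight (m + 1/2 + a/2) (y, t) + cut_weight (m + 1/2 + a/2) (y', t))"
proof -
  have "6 * norm (y - y') powr a * (heat_weight 16 (m + 1/2 + a/2) (y, t) + heat_weight 16 (m + 1/2 + a/2) (y', t)) \<le>
     6 * norm (y - y') powr a * (heat_weight 32 (m + 1/2 + a/2) (y, t) + heat_weight 32 (m + 1/2 + a/2) (y', t))"
    by (intro mult_left_mono add_mono heat_weight_mono) auto
  then show ?thesis
    using DK_holder_aux[of "(y, t)" "(y', t)" a "m + 1/2 + a/2" "m + a/2" 6 6] heat_power_holder_space[of a m y t y']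
      heat_grad_holder_space[of a m y t y'] assms by simp
qed

lemma DK_holder_time:
  assumes "\<bar>t - t'\<bar> \<le> 1" "0 \<le> b" "b \<le> 1"
  shows "norm (DK (y, t) - DK (y, t')) \<le> (10 * (m + 3) + 44 * L + 2 * L * (m + 2)) * \<bar>t - t'\<bar> powr b * (cut_weight (m + 1/2 + b) (y, t) + cut_weight (m + 1/2 + b) (y, t'))"
proof -
  have n: "norm ((y, t) - (y, t')) = \<bar>t - t'\<bar>" by simp
  show ?thesis
    by (rule DK_holder_aux[of "(y, t)" "(y, t')" b "m + 1/2 + b" "m + b" "m + 2" "10 * (m + 3)", unfolded n,
          OF assms _ _ _ _ _ _ heat_power_holder_time[OF assms(2,3) m_nonneg] heat_grad_holder_time[OF assms(2,3) m_nonneg]])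
       (use assms m_nonneg in auto)
qed

lemma K_taylor_space:
  assumes v: "norm v \<le> 1" and a: "0 \<le> a" "a \<le> 1"
  shows "\<bar>K (y + v, t) - K (y, t) - DK (y, t) \<bullet> v\<bar> \<le> (6 + 42 * L) * norm v powr (1 + a) *
     (cut_weight (m + 1/2 + a/2) (y, t) + cut_weight (m + 1/2 + a/2) (y + v, t))"
proof (cases "norm (y + v, t) > \<rho> \<and> norm (y, t) > \<rho>")
  case False
  let ?z = "(y, t)" and ?z' = "(y + v, t)" and ?k = "m + 1/2 + a/2" and ?p = "norm v powr (1 + a)"
  have zz: "norm (?z' - ?z) \<le> 1" "norm (?z' - ?z) = norm v" using v by auto
  note z = near_support[OF zz(1) False]
  have w0: "cut_weight ?k ?z \<ge> 0" "cut_weight ?k ?z' \<ge> 0" by (rule cut_weight_nonneg)+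
  have p2: "(norm v)\<^sup>2 \<le> ?p" using powr_mono'[of "1 + a" 2 "norm v"] v a by (cases "v = 0") auto
  define P where "P = heat_power m ?z' - heat_power m ?z - heat_grad m ?z \<bullet> v"
  define Q where "Q = \<eta> (?z + (v, 0)) - \<eta> ?z - D\<eta> ?z \<bullet> (v, 0)"
  \<comment> \<open>Taylor expansion of a product: \<open>P\<close> and \<open>Q\<close> are the
    remainders of the two factors, and the mixed term is a product of two first-order quantities,
    hence quadratic in v.\<close>
  have "K ?z' - K ?z - DK ?z \<bullet> v = P * \<eta> ?z' + (heat_grad m ?z \<bullet> v) * (\<eta> ?z' - \<eta> ?z) + heat_power m ?z * Q"
    by (simp add: P_def Q_def K_def DK_def inner_left_distrib inner_prod_def algebra_simps)
  then have "\<bar>K ?z' - K ?z - DK ?z \<bullet> v\<bar> \<le> \<bar>P * \<eta> ?z'\<bar> + \<bar>(heat_grad m ?z \<bullet> v) * (\<eta> ?z' - \<eta> ?z)\<bar> + \<bar>heat_power m ?z * Q\<bar>"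
    by linarith
  also have "\<dots> = \<bar>P\<bar> * \<eta> ?z' + \<bar>heat_grad m ?z \<bullet> v\<bar> * \<bar>\<eta> ?z' - \<eta> ?z\<bar> + heat_power m ?z * \<bar>Q\<bar>"
    using eta(1)[of ?z'] heat_power_nonneg[of m ?z] by (simp add: abs_mult)
  also have "\<dots> \<le> (6 * ?p * (cut_weight ?k ?z + cut_weight ?k ?z')) * 1 +
     (20 * (2 * cut_weight ?k ?z) * norm v) * (L * norm v) + (2 * cut_weight ?k ?z) * (L * (norm v)\<^sup>2)"
  proof (intro add_mono mult_mono)
    have "6 * ?p * (heat_weight 16 ?k ?z + heat_weight 16 ?k ?z') \<le> 6 * ?p * (cut_weight ?k ?z + cut_weight ?k ?z')"
      by (intro mult_left_mono add_mono heat_weight16_le_cut z) auto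
    then show "\<bar>P\<bar> \<le> 6 * ?p * (cut_weight ?k ?z + cut_weight ?k ?z')"
      using heat_power_taylor_space[OF a, of m y v t] unfolding P_def by linarith
    have "norm (heat_grad m ?z) \<le> 20 * (2 * cut_weight ?k ?z)"
      using norm_heat_grad_le_cut[OF z(2), of m] cut_weight_exponent_mono2[of "m + 1/2" ?k ?z] a by linarith
    then show "\<bar>heat_grad m ?z \<bullet> v\<bar> \<le> 20 * (2 * cut_weight ?k ?z) * norm v"
      using Cauchy_Schwarz_ineq2[of "heat_grad m ?z" v] by (meson mult_right_mono norm_ge_zero order_trans)
    show "\<bar>\<eta> ?z' - \<eta> ?z\<bar> \<le> L * norm v" using lipschitz[of ?z' ?z] zz by simp
    show "heat_power m ?z \<le> 2 * cut_weight ?k ?z"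
      using heat_power_le_cut[OF z(2), of m] cut_weight_exponent_mono2[of m ?k ?z] a by linarith
    show "\<bar>Q\<bar> \<le> L * (norm v)\<^sup>2" using taylor[of ?z "(v, 0)"] unfolding Q_def by simp
  qed (use eta w0 in auto)
  also have "\<dots> = 6 * ?p * (cut_weight ?k ?z + cut_weight ?k ?z') + 42 * L * cut_weight ?k ?z * (norm v)\<^sup>2"
    by (simp add: algebra_simps power2_eq_square)
  also have "\<dots> \<le> 6 * ?p * (cut_weight ?k ?z + cut_weight ?k ?z') + 42 * L * (cut_weight ?k ?z + cut_weight ?k ?z') * ?p"
    using p2 L_nonneg w0 by (intro add_mono mult_mono) auto
  finally show ?thesis by (simp add: algebra_simps)
qed (use L_nonneg in \<open>simp add: K_support DK_support cut_weight_nonneg\<close>)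

end

section \<open>The Gaussian integral and the approximate identity\<close>

definition dir_deriv :: "'a::euclidean_space \<Rightarrow> ('a \<Rightarrow> real) \<Rightarrow> 'a \<Rightarrow> real" where
  "dir_deriv v f z = frechet_derivative f (at z) v"

lemma dir_deriv_eqI: "(f has_derivative f') (at z) \<Longrightarrow> dir_deriv v f z = f' v"
  unfolding dir_deriv_def using frechet_derivative_at by metis

lemma dir_deriv_local:
  assumes "(g has_derivative g') (at z)" "open S" "z \<in> S" "\<And>w. w \<in> S \<Longrightarrow> f w = g w"
  shows "dir_deriv v f z = g' v"
  using has_derivative_transform_within_open[OF assms(1-3), of f] assms(4) by (auto intro: dir_deriv_eqI)

lemma dir_deriv_zero_open: "open S \<Longrightarrow> z \<in> S \<Longrightarrow> (\<And>w. w \<in> S \<Longrightarrow> f w = 0) \<Longrightarrow> dir_deriv v f z = 0"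
  using dir_deriv_local[OF has_derivative_const, of S z f 0 v] by simp

lemma C_k_on_dir_deriv: "C_k_on (Suc k) S f \<Longrightarrow> b \<in> Basis \<Longrightarrow> C_k_on k S (dir_deriv b f)"
  by (simp add: dir_deriv_def[abs_def])

lemma integrable_exp_quadratic: "(\<integral>\<^sup>+s. ennreal (exp (- s\<^sup>2 / 4)) \<partial>lborel) < \<infinity>"
proof -
  have half: "(\<integral>\<^sup>+s. indicator {0..} s * ennreal (exp (- s)) \<partial>lborel) = ennreal 1"
  proof -
    have "indicator {0..} s * ennreal (exp (- s)) = ennreal (indicat_real {0..} s * exp (- s))" for s :: real
      by (auto split: split_indicator)
    then show ?thesis using nn_integral_has_integral_lebesgue[OF _ has_integral_exp_minus_to_infinity[of 1 0]] by simp
  qed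
  have half': "(\<integral>\<^sup>+s. indicator {..0} s * ennreal (exp s) \<partial>lborel) = ennreal 1"
  proof -
    have "indicator {..0} (- x) = (indicator {0..} x :: ennreal)" for x :: real by (auto split: split_indicator)
    then show ?thesis using half by (subst nn_integral_real_affine[of _ "-1" 0]) simp_all
  qed
  have "(\<integral>\<^sup>+s. ennreal (exp (- s\<^sup>2 / 4)) \<partial>lborel) \<le>
    (\<integral>\<^sup>+s. ennreal (exp 1) * (indicator {0..} s * ennreal (exp (- s)) + indicator {..0} s * ennreal (exp s)) \<partial>lborel)"
  proof (intro nn_integral_mono)
    fix s :: real
    have "\<bar>s\<bar> \<le> s\<^sup>2 / 4 + 1" using sum_squares_bound[of "\<bar>s\<bar>" 2] by (simp add: power2_eq_square)
    then have "exp (- s\<^sup>2 / 4) \<le> exp (1 + - \<bar>s\<bar>)" by simp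
    also have "\<dots> = exp 1 * exp (- \<bar>s\<bar>)" by (rule exp_add)
    finally have "ennreal (exp (- s\<^sup>2 / 4)) \<le> ennreal (exp 1) * ennreal (exp (- \<bar>s\<bar>))"
      by (simp add: ennreal_leI flip: ennreal_mult)
    also have "\<dots> \<le> ennreal (exp 1) * (indicator {0..} s * ennreal (exp (- s)) + indicator {..0} s * ennreal (exp s))"
      by (intro mult_left_mono) (auto split: split_indicator)
    finally show "ennreal (exp (- s\<^sup>2 / 4)) \<le> ennreal (exp 1) * (indicator {0..} s * ennreal (exp (- s)) + indicator {..0} s * ennreal (exp s))" .
  qed
  also have "\<dots> = ennreal (exp 1) * (ennreal 1 + ennreal 1)"
    by (subst nn_integral_cmult, simp, subst nn_integral_add) (auto simp: half half')
  also have "\<dots> < \<infinity>" by (simp add: ennreal_mult_less_top)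
  finally show ?thesis .
qed

lemma continuous_gauss: "continuous_on UNIV gauss"
  by (auto intro!: continuous_at_imp_continuous_on has_derivative_continuous gauss_has_derivative)

lemma borel_measurable_gauss [measurable]: "gauss \<in> borel_measurable borel"
  by (rule borel_measurable_continuous_onI[OF continuous_gauss])

lemma integrable_gauss: "integrable lborel (gauss :: 'a::euclidean_space \<Rightarrow> real)"
proof -
  have e: "ennreal (gauss x) = (\<Prod>b\<in>Basis. ennreal (exp (- (x \<bullet> b)\<^sup>2 / 4)))" for x :: 'a
  proof -
    have "(norm x)\<^sup>2 = (\<Sum>b\<in>Basis. (x \<bullet> b)\<^sup>2)"
      by (simp only: power2_norm_eq_inner) (subst euclidean_inner, simp add: power2_eq_square)
    then have "gauss x = exp (\<Sum>b\<in>Basis. - (x \<bullet> b)\<^sup>2 / 4)"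
      by (simp add: gauss_def sum_negf flip: sum_divide_distrib)
    also have "\<dots> = (\<Prod>b\<in>Basis. exp (- (x \<bullet> b)\<^sup>2 / 4))" by (rule exp_sum) simp
    finally show ?thesis by (simp add: prod_ennreal)
  qed
  have "(\<integral>\<^sup>+x. ennreal (gauss x) \<partial>(lborel :: 'a measure)) = (\<Prod>b\<in>(Basis :: 'a set). \<integral>\<^sup>+s. ennreal (exp (- s\<^sup>2 / 4)) \<partial>lborel)"
    unfolding e by (subst nn_integral_lborel_prod) auto
  also have "\<dots> < \<infinity>" using integrable_exp_quadratic by (simp add: power_less_top_ennreal)
  finally show ?thesis by (intro integrableI_nonneg) (auto simp: gauss_nonneg)
qed

text \<open>The value (4 \<pi>)^(n/2) is never evaluated, only its positivity matters; this is why
  \<open>heat_power\<close> can stay unnormalised.\<close>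

definition gauss_mass :: "'a::euclidean_space itself \<Rightarrow> real" where
  "gauss_mass _ = (\<integral>x. gauss x \<partial>(lborel :: 'a measure))"

lemma gauss_mass_pos: "gauss_mass TYPE('a::euclidean_space) > 0"
proof -
  have "gauss_mass TYPE('a) \<ge> 0" unfolding gauss_mass_def by (intro integral_nonneg_AE) (auto simp: gauss_nonneg)
  moreover have "gauss_mass TYPE('a) \<noteq> 0"
  proof
    assume "gauss_mass TYPE('a) = 0"
    then have "AE x in (lborel :: 'a measure). gauss x = 0"
      unfolding gauss_mass_def using integral_nonneg_eq_0_iff_AE[OF integrable_gauss] by (auto simp: gauss_nonneg)
    then have "AE x in (lborel :: 'a measure). False" by eventually_elim (simp add: gauss_def)
    then have "emeasure (lborel :: 'a measure) UNIV = 0" by (simp add: AE_iff_measurable[OF _ refl])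
    then show False by (simp add: emeasure_lborel_UNIV)
  qed
  ultimately show ?thesis by simp
qed

section \<open>The derivative of the step as a unit mass in time\<close>

definition smooth_step' :: "real \<Rightarrow> real" where "smooth_step' t = dir_deriv 1 smooth_step t"

lemma smooth_step_has_derivative: "(smooth_step has_derivative (\<lambda>h. h * smooth_step' t)) (at t)"
proof -
  have d: "(smooth_step has_derivative frechet_derivative smooth_step (at t)) (at t)"
    using C_k_on_has_derivative[OF C_k_on_smooth_step] by auto
  have "frechet_derivative smooth_step (at t) h = h * smooth_step' t" for h
    using linear_cmul[OF has_derivative_linear[OF d], of h 1] by (simp add: smooth_step'_def dir_deriv_def)
  then show ?thesis using d by presburger
qed

lemma C_k_on_smooth_step': "C_k_on k UNIV smooth_step'"
  unfolding smooth_step'_def[abs_def] using C_k_on_dir_deriv[OF C_k_on_smooth_step[of "Suc k"], of 1] by simp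

lemma smooth_step'_outside: "t < 0 \<or> t > 1 \<Longrightarrow> smooth_step' t = 0"
proof (elim disjE)
  assume "t < 0"
  then show ?thesis unfolding smooth_step'_def
    by (intro dir_deriv_zero_open[of "{..<0}"]) (auto simp: smooth_step_0)
next
  assume t: "t > 1"
  have "dir_deriv 1 smooth_step t = 0"
    by (rule dir_deriv_local[OF has_derivative_const[of 1], of "{1<..}"]) (use t in \<open>auto simp: smooth_step_1\<close>)
  then show ?thesis unfolding smooth_step'_def .
qed

lemma continuous_smooth_step': "continuous_on UNIV smooth_step'" using C_k_on_smooth_step'[of 0] by simp

lemma borel_measurable_smooth_step' [measurable]: "smooth_step' \<in> borel_measurable borel"
  by (rule borel_measurable_continuous_onI[OF continuous_smooth_step'])

lemma borel_measurable_smooth_step [measurable]: "smooth_step \<in> borel_measurable borel"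
  using C_k_on_smooth_step[of 0] by (intro borel_measurable_continuous_onI) simp

lemma smooth_step'_bounded: "\<exists>B\<ge>0. \<forall>t. \<bar>smooth_step' t\<bar> \<le> B"
proof -
  have "smooth_step' t = 0" if "norm t > 1" for t
    using that smooth_step'_outside[of t] by (auto simp: abs_real_def split: if_splits)
  from continuous_compact_support_bounded[OF continuous_smooth_step' this] show ?thesis by blast
qed

lemma smooth_step'_integral: "has_bochner_integral lborel smooth_step' 1"
proof -
  have "has_bochner_integral lborel (\<lambda>t. smooth_step' t * indicator {0..1} t) (smooth_step 1 - smooth_step 0)"
  proof (rule has_bochner_integral_FTC_Icc_real)
    show "(smooth_step has_real_derivative smooth_step' t) (at t)" for t
      using smooth_step_has_derivative[of t] by (simp add: has_field_derivative_def mult.commute[of _ "smooth_step' t"])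
    show "isCont smooth_step' t" for t using continuous_smooth_step' by (simp add: continuous_on_eq_continuous_at)
  qed auto
  moreover have "smooth_step' t * indicator {0..1} t = smooth_step' t" for t
    using smooth_step'_outside[of t] by (cases "t < 0 \<or> t > 1") (auto simp: indicator_def)
  ultimately show ?thesis by (simp add: smooth_step_0 smooth_step_1)
qed

lemma integral_scale_lborel:
  fixes f :: "'a::euclidean_space \<Rightarrow> real"
  assumes [measurable]: "f \<in> borel_measurable borel" and c: "c > 0"
  shows "(\<integral>x. f x \<partial>lborel) = c ^ DIM('a) * (\<integral>x. f (c *\<^sub>R x) \<partial>lborel)"
proof -
  have "(\<integral>x. f x \<partial>lborel) = (\<integral>x. f x \<partial>(density (distr lborel borel (\<lambda>x. 0 + c *\<^sub>R x)) (\<lambda>_. ennreal (\<bar>c\<bar> ^ DIM('a)))))"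
    using lborel_affine[of c "0 :: 'a"] c by simp
  also have "\<dots> = (\<integral>x. c ^ DIM('a) *\<^sub>R f (c *\<^sub>R x) \<partial>lborel)"
    using c by (subst integral_density) (auto simp: integral_distr)
  finally show ?thesis by simp
qed

text \<open>The rescaled derivative of the step is a unit mass on \<delta> <= t <= 2 \<delta>. The
  substitution y = sqrt t x turns the kernel into the fixed Gaussian profile, t = \<delta> (1 +
  \<theta>) fixes the time interval, and dominated convergence does the rest.\<close>

lemma heat_approximate_identity:
  fixes F :: "'a::euclidean_space \<times> real \<Rightarrow> real"
  assumes [measurable]: "F \<in> borel_measurable borel" and M: "\<And>w. \<bar>F w\<bar> \<le> M"
    and supp: "\<And>w. norm w > 2 \<Longrightarrow> F w = 0" and cont: "isCont F 0"
    and \<delta>: "\<And>j. \<delta> j > 0" "\<delta> \<longlonglongrightarrow> 0"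
  shows "(\<lambda>j. \<integral>w. heat_power (DIM('a) / 2) w * (smooth_step' (snd w / \<delta> j - 1) / \<delta> j) * F w \<partial>lborel)
     \<longlonglongrightarrow> gauss_mass TYPE('a) * F 0"
proof -
  let ?m = "DIM('a) / 2"
  have M0: "M \<ge> 0" using M[of 0] by linarith
  have [measurable]: "F \<in> borel_measurable (lborel \<Otimes>\<^sub>M lborel)" by (simp add: lborel_prod)
  have [measurable]: "heat_power ?m \<in> borel_measurable ((lborel :: 'a measure) \<Otimes>\<^sub>M lborel)"
    by (simp add: lborel_prod)
  obtain B where B: "B \<ge> 0" "\<And>t. \<bar>smooth_step' t\<bar> \<le> B" using smooth_step'_bounded by blast
  define G where "G t = (\<integral>x. gauss x * F (sqrt t *\<^sub>R x, t) \<partial>lborel)" for t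
  have [measurable]: "(\<lambda>(t, x). gauss x * F (sqrt t *\<^sub>R x, t)) \<in> borel_measurable (lborel \<Otimes>\<^sub>M lborel)"
    by measurable
  have G_meas[measurable]: "G \<in> borel_measurable borel"
    unfolding G_def[abs_def] by (rule lborel.borel_measurable_lebesgue_integral[of "\<lambda>t x. gauss x * F (sqrt t *\<^sub>R x, t)", simplified]) simp
  have G_bound: "\<bar>G t\<bar> \<le> gauss_mass TYPE('a) * M" for t
  proof -
    have "norm (G t) \<le> (\<integral>x. gauss x * M \<partial>(lborel :: 'a measure))"
      unfolding G_def
    proof (rule order_trans[OF integral_norm_bound], rule integral_mono)
      show "integrable lborel (\<lambda>x. norm (gauss x * F (sqrt t *\<^sub>R x, t)))"
        by (rule Bochner_Integration.integrable_bound[OF integrable_mult_left[OF integrable_gauss, of M]])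
           (auto simp: abs_mult gauss_nonneg M M0 intro!: mult_mono)
      show "norm (gauss x * F (sqrt t *\<^sub>R x, t)) \<le> gauss x * M" for x :: 'a
        using M by (simp add: abs_mult gauss_nonneg mult_left_mono)
    qed (use integrable_gauss in auto)
    then show ?thesis by (simp add: gauss_mass_def)
  qed
  have G_lim: "(\<lambda>j. G (\<delta> j * (1 + \<theta>))) \<longlonglongrightarrow> gauss_mass TYPE('a) * F 0" for \<theta>
  proof -
    have t0: "(\<lambda>j. \<delta> j * (1 + \<theta>)) \<longlonglongrightarrow> 0" using tendsto_mult_right[OF \<delta>(2), of "1 + \<theta>"] by simp
    have "(\<lambda>j. (sqrt (\<delta> j * (1 + \<theta>)) *\<^sub>R x, \<delta> j * (1 + \<theta>))) \<longlonglongrightarrow> 0" for x :: 'a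
      using tendsto_Pair[OF tendsto_scaleR[OF tendsto_real_sqrt[OF t0] tendsto_const[of x]] t0] by (simp add: zero_prod_def)
    then have "(\<lambda>j. gauss x * F (sqrt (\<delta> j * (1 + \<theta>)) *\<^sub>R x, \<delta> j * (1 + \<theta>))) \<longlonglongrightarrow> gauss x * F 0" for x :: 'a
      by (intro tendsto_mult tendsto_const isCont_tendsto_compose[OF cont])
    then have "(\<lambda>j. G (\<delta> j * (1 + \<theta>))) \<longlonglongrightarrow> (\<integral>x. gauss x * F 0 \<partial>(lborel :: 'a measure))"
      unfolding G_def
      by (intro integral_dominated_convergence[where w="\<lambda>x. gauss x * M"])
         (use integrable_gauss M in \<open>auto simp: abs_mult gauss_nonneg mult_left_mono\<close>)
    then show ?thesis by (simp add: gauss_mass_def)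
  qed
  have eq: "(\<integral>w. heat_power ?m w * (smooth_step' (snd w / \<delta> j - 1) / \<delta> j) * F w \<partial>lborel) =
     (\<integral>\<theta>. smooth_step' \<theta> * G (\<delta> j * (1 + \<theta>)) \<partial>lborel)" for j
  proof -
    let ?d = "\<delta> j"
    have d: "?d > 0" by (rule \<delta>)
    define H where "H w = heat_power ?m w * (smooth_step' (snd w / ?d - 1) / ?d) * F w" for w
    have [measurable]: "snd \<in> borel_measurable (borel :: ('a \<times> real) measure)" unfolding borel_prod[symmetric] by measurable
    have Hm[measurable]: "H \<in> borel_measurable borel" unfolding H_def[abs_def] by measurable
    have int: "integrable lborel H"
    proof (rule Bochner_Integration.integrable_bound[where f="\<lambda>w. cut_weight ?m w * ((B / ?d) * M)"])
      show "integrable lborel (\<lambda>w::'a \<times> real. cut_weight ?m w * (B / ?d * M))"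
        using integrable_cut_weight[of ?m, where 'a='a] by simp
      have "norm (H w) \<le> cut_weight ?m w * ((B / ?d) * M)" for w
      proof (cases "norm w > 2")
        case False
        have "norm (H w) = heat_power ?m w * ((\<bar>smooth_step' (snd w / ?d - 1)\<bar> / ?d) * \<bar>F w\<bar>)"
          using d by (simp add: H_def abs_mult heat_power_nonneg)
        also have "\<dots> \<le> cut_weight ?m w * ((B / ?d) * M)"
          using False d B M by (intro mult_mono divide_right_mono heat_power_le_cut) (auto simp: cut_weight_nonneg)
        finally show ?thesis .
      qed (use supp M0 B d in \<open>simp add: H_def cut_weight_nonneg\<close>)
      then have "norm (H w) \<le> norm (cut_weight ?m w * ((B / ?d) * M))" for w
        by (metis abs_ge_self order_trans real_norm_def)
      then show "AE w in lborel. norm (H w) \<le> norm (cut_weight ?m w * ((B / ?d) * M))" by (intro AE_I2)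
    qed auto
    have inner: "(\<integral>y. H (y, t) \<partial>lborel) = smooth_step' (t / ?d - 1) / ?d * G t" for t
    proof (cases "t > 0")
      case True
      have st: "sqrt t ^ DIM('a) = t powr ?m" using True
        by (simp add: powr_half_sqrt[symmetric] powr_realpow[symmetric] powr_powr)
      have [measurable]: "(\<lambda>y. H (y, t)) \<in> borel_measurable borel"
        using measurable_compose[OF _ Hm, of "\<lambda>y. (y, t)" borel] by (simp add: borel_prod[symmetric])
      have "(\<integral>y. H (y, t) \<partial>lborel) = sqrt t ^ DIM('a) * (\<integral>x. H (sqrt t *\<^sub>R x, t) \<partial>lborel)"
        by (rule integral_scale_lborel) (use True in auto)
      also have "\<dots> = (\<integral>x. (sqrt t ^ DIM('a)) * H (sqrt t *\<^sub>R x, t) \<partial>lborel)" by simp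
      also have "\<dots> = (\<integral>x. (smooth_step' (t / ?d - 1) / ?d) * (gauss x * F (sqrt t *\<^sub>R x, t)) \<partial>lborel)"
      proof (rule Bochner_Integration.integral_cong[OF refl])
        fix x :: 'a
        have "heat_power ?m (sqrt t *\<^sub>R x, t) = t powr (- ?m) * gauss x"
          using True by (simp add: heat_power_eq_gauss)
        moreover have "t powr ?m * t powr (- ?m) = 1" using True by (simp flip: powr_add)
        moreover have "A * (A' * g * p * q) = p * (g * q)" if "A * A' = 1" for A A' g p q :: real
          using that by algebra
        ultimately show "(sqrt t ^ DIM('a)) * H (sqrt t *\<^sub>R x, t) = (smooth_step' (t / ?d - 1) / ?d) * (gauss x * F (sqrt t *\<^sub>R x, t))"
          unfolding st H_def snd_conv by presburger
      qed
      finally show ?thesis by (simp add: G_def)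
    next
      case False
      then have "smooth_step' (t / ?d - 1) = 0" using d by (intro smooth_step'_outside) (simp add: divide_less_eq)
      then show ?thesis by (simp add: H_def)
    qed
    have "(\<integral>w. H w \<partial>lborel) = (\<integral>w. H w \<partial>(lborel \<Otimes>\<^sub>M lborel))" by (simp add: lborel_prod)
    also have "\<dots> = (\<integral>t. \<integral>y. H (y, t) \<partial>lborel \<partial>lborel)"
      using lborel_pair.integral_snd[of "\<lambda>y t. H (y, t)"] int by (simp add: lborel_prod)
    also have "\<dots> = (\<integral>t. smooth_step' (t / ?d - 1) / ?d * G t \<partial>lborel)" by (simp add: inner)
    also have "\<dots> = ?d * (\<integral>\<theta>. smooth_step' ((?d + ?d * \<theta>) / ?d - 1) / ?d * G (?d + ?d * \<theta>) \<partial>lborel)"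
      using lborel_integral_real_affine[of ?d "\<lambda>t. smooth_step' (t / ?d - 1) / ?d * G t" ?d] d by simp
    also have "\<dots> = (\<integral>\<theta>. ?d * (smooth_step' ((?d + ?d * \<theta>) / ?d - 1) / ?d * G (?d + ?d * \<theta>)) \<partial>lborel)" by simp
    also have "\<dots> = (\<integral>\<theta>. smooth_step' \<theta> * G (?d * (1 + \<theta>)) \<partial>lborel)"
    proof (rule Bochner_Integration.integral_cong[OF refl])
      fix \<theta> :: real
      have "(?d + ?d * \<theta>) / ?d - 1 = \<theta>" using d by (simp add: field_simps)
      then show "?d * (smooth_step' ((?d + ?d * \<theta>) / ?d - 1) / ?d * G (?d + ?d * \<theta>)) = smooth_step' \<theta> * G (?d * (1 + \<theta>))"
        using d by (simp add: distrib_left)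
    qed
    finally show ?thesis unfolding H_def .
  qed
  have "(\<lambda>j. \<integral>\<theta>. smooth_step' \<theta> * G (\<delta> j * (1 + \<theta>)) \<partial>lborel) \<longlonglongrightarrow> (\<integral>\<theta>. smooth_step' \<theta> * (gauss_mass TYPE('a) * F 0) \<partial>lborel)"
  proof (rule integral_dominated_convergence[where w="\<lambda>\<theta>. \<bar>smooth_step' \<theta>\<bar> * (gauss_mass TYPE('a) * M)"])
    show "integrable lborel (\<lambda>\<theta>. \<bar>smooth_step' \<theta>\<bar> * (gauss_mass TYPE('a) * M))"
      using smooth_step'_integral by (auto simp: has_bochner_integral_iff)
    show "AE \<theta> in lborel. (\<lambda>j. smooth_step' \<theta> * G (\<delta> j * (1 + \<theta>))) \<longlonglongrightarrow> smooth_step' \<theta> * (gauss_mass TYPE('a) * F 0)"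
      using G_lim by (auto intro!: tendsto_mult)
    show "AE \<theta> in lborel. norm (smooth_step' \<theta> * G (\<delta> j * (1 + \<theta>))) \<le> \<bar>smooth_step' \<theta>\<bar> * (gauss_mass TYPE('a) * M)" for j
      using G_bound by (auto simp: abs_mult intro!: mult_left_mono)
  qed auto
  also have "(\<integral>\<theta>. smooth_step' \<theta> * (gauss_mass TYPE('a) * F 0) \<partial>lborel) = gauss_mass TYPE('a) * F 0"
    using smooth_step'_integral by (simp add: has_bochner_integral_iff)
  finally show ?thesis unfolding eq .
qed

text \<open>A function of |z|^2, hence smooth at the origin as well; it is 1 up to radius \<rho>/2
  and 0 beyond \<rho>, in the Euclidean norm of space-time.\<close>

definition cutoff :: "real \<Rightarrow> 'a::euclidean_space \<Rightarrow> real" where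
  "cutoff \<rho> z = smooth_step (2 - 2 * (z \<bullet> z) / \<rho>\<^sup>2)"

lemma cutoff_eq_1: "norm z \<le> \<rho> / 2 \<Longrightarrow> \<rho> > 0 \<Longrightarrow> cutoff \<rho> z = 1"
proof -
  assume a: "norm z \<le> \<rho> / 2" "\<rho> > 0"
  then have "(norm z)\<^sup>2 \<le> (\<rho> / 2)\<^sup>2" by (intro power_mono) auto
  then have "z \<bullet> z \<le> \<rho>\<^sup>2 / 4" by (simp add: power2_norm_eq_inner power_divide)
  then have "2 * (z \<bullet> z) \<le> \<rho>\<^sup>2" using zero_le_power2[of \<rho>] by linarith
  then show ?thesis unfolding cutoff_def using a by (intro smooth_step_1) (simp add: field_simps)
qed

lemma cutoff_eq_0: "norm z > \<rho> \<Longrightarrow> \<rho> > 0 \<Longrightarrow> cutoff \<rho> z = 0"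
proof -
  assume a: "norm z > \<rho>" "\<rho> > 0"
  then have "\<rho>\<^sup>2 \<le> (norm z)\<^sup>2" by (intro power_mono) auto
  then have "\<rho>\<^sup>2 \<le> z \<bullet> z" by (simp add: power2_norm_eq_inner)
  then show ?thesis unfolding cutoff_def using a by (intro smooth_step_0) (simp add: field_simps)
qed

lemma C_k_on_cutoff: "C_k_on k UNIV (cutoff \<rho> :: 'a::euclidean_space \<Rightarrow> real)"
proof -
  have sq: "C_k_on k UNIV (\<lambda>z::'a. z \<bullet> z)"
  proof -
    have "z \<bullet> z = (\<Sum>i\<in>Basis. (z \<bullet> i) * (z \<bullet> i))" for z :: 'a by (rule euclidean_inner)
    moreover have "C_k_on k UNIV (\<lambda>z::'a. z \<bullet> i)" for i :: 'a
      by (intro C_k_on_bounded_linear bounded_linear_intros) auto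
    ultimately show ?thesis by (auto intro!: C_k_on_sum C_k_on_mult)
  qed
  have "C_k_on k UNIV (\<lambda>z::'a. smooth_step (2 - (2 / \<rho>\<^sup>2) * (z \<bullet> z)))"
    by (rule C_k_on_compose[OF _ _ _ C_k_on_diff[OF _ C_k_on_const C_k_on_cmult[OF _ sq]] C_k_on_smooth_step]) auto
  then show ?thesis by (simp add: cutoff_def[abs_def])
qed

lemma cutoff_bounds: "0 \<le> cutoff \<rho> z" "cutoff \<rho> z \<le> 1"
  by (simp_all add: cutoff_def smooth_step_nonneg smooth_step_le_1)

lemma cutoff_bump_exists: "\<rho> > 0 \<Longrightarrow> \<exists>D\<eta> L. smooth_bump (cutoff \<rho> :: 'a::euclidean_space \<Rightarrow> real) D\<eta> \<rho> L"
  by (rule smooth_bump_exists) (auto simp: C_k_on_cutoff cutoff_eq_0)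

section \<open>The representation formula\<close>

text \<open>Applying the heat operator to the fundamental solution times the cutoff leaves, besides a point
  mass, the following smooth function.\<close>

definition heat_error :: "real \<Rightarrow> 'a::euclidean_space \<times> real \<Rightarrow> real" where
  "heat_error \<rho> z = heat_power (DIM('a) / 2) z * (dir_deriv (0, 1) (cutoff \<rho>) z
       - (\<Sum>b\<in>Basis. dir_deriv (b, 0) (dir_deriv (b, 0) (cutoff \<rho>)) z))
     + (\<Sum>b\<in>Basis. (fst z \<bullet> b) * heat_power (DIM('a) / 2 + 1) z * dir_deriv (b, 0) (cutoff \<rho>) z)"

lemma C_k_on_dir_deriv_cutoff: "b \<in> Basis \<Longrightarrow> C_k_on k UNIV (dir_deriv b (cutoff \<rho>))"
  by (rule C_k_on_dir_deriv[OF C_k_on_cutoff])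

lemma dir_deriv_cutoff_near:
  assumes "norm z < \<rho> / 2" shows "dir_deriv v (cutoff \<rho>) z = 0"
proof -
  have r: "\<rho> > 0" using assms norm_ge_zero[of z] by linarith
  show ?thesis
    by (rule dir_deriv_local[OF has_derivative_const[of 1], of "ball 0 (\<rho> / 2)"])
       (use assms r in \<open>auto intro: cutoff_eq_1\<close>)
qed

lemma dir_deriv_cutoff_far:
  assumes "norm z > \<rho>" "\<rho> > 0" shows "dir_deriv v (cutoff \<rho>) z = 0"
  by (rule dir_deriv_zero_open[of "- cball 0 \<rho>"]) (use assms in \<open>auto intro: cutoff_eq_0 simp: open_Compl\<close>)

lemma dir_deriv2_cutoff_near:
  assumes "norm z < \<rho> / 2" shows "dir_deriv v (dir_deriv w (cutoff \<rho>)) z = 0"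
  by (rule dir_deriv_zero_open[of "ball 0 (\<rho> / 2)"]) (use assms in \<open>auto intro: dir_deriv_cutoff_near\<close>)

lemma dir_deriv2_cutoff_far:
  assumes "norm z > \<rho>" "\<rho> > 0" shows "dir_deriv v (dir_deriv w (cutoff \<rho>)) z = 0"
  by (rule dir_deriv_zero_open[of "- cball 0 \<rho>"]) (use assms in \<open>auto intro: dir_deriv_cutoff_far simp: open_Compl\<close>)

lemma heat_error_support: "norm z > \<rho> \<Longrightarrow> \<rho> > 0 \<Longrightarrow> heat_error \<rho> z = 0"
  by (simp add: heat_error_def dir_deriv_cutoff_far dir_deriv2_cutoff_far)

lemma heat_error_past: "snd z \<le> 0 \<Longrightarrow> heat_error \<rho> z = 0"
  by (cases z) (simp add: heat_error_def heat_power_def)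

text \<open>Every term contains a derivative of the cutoff, and these vanish near the origin, where
  the kernel is singular.\<close>

lemma C_k_on_heat_error:
  assumes "\<rho> > 0" shows "C_k_on k UNIV (heat_error \<rho> :: 'a::euclidean_space \<times> real \<Rightarrow> real)"
proof -
  have o: "open (- {0 :: 'a \<times> real})" by (rule open_Compl) simp
  have d: "C_k_on k (- {0}) (dir_deriv b (cutoff \<rho>) :: 'a \<times> real \<Rightarrow> real)" if "b \<in> Basis" for b
    using C_k_on_subset[OF C_k_on_dir_deriv_cutoff[OF that]] by auto
  have d2: "C_k_on k (- {0}) (dir_deriv b (dir_deriv b (cutoff \<rho>)) :: 'a \<times> real \<Rightarrow> real)" if "b \<in> Basis" for b
    using C_k_on_subset[OF C_k_on_dir_deriv[OF C_k_on_dir_deriv_cutoff[OF that] that]] by auto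
  have l: "C_k_on k (- {0}) (\<lambda>z::'a \<times> real. fst z \<bullet> b)" for b
    by (intro C_k_on_bounded_linear o bounded_linear_intros)
  have 1: "C_k_on k (- {0}) (heat_error \<rho> :: 'a \<times> real \<Rightarrow> real)"
    unfolding heat_error_def[abs_def]
    by (intro C_k_on_add[OF o] C_k_on_mult[OF o] C_k_on_diff[OF o] C_k_on_sum[OF o] C_k_on_heat_power l d d2) (auto simp: Basis_prod_def)
  have 2: "C_k_on k (ball 0 (\<rho> / 2)) (heat_error \<rho> :: 'a \<times> real \<Rightarrow> real)"
  proof -
    have "heat_error \<rho> z = 0" if "z \<in> ball 0 (\<rho> / 2)" for z :: "'a \<times> real"
      using that by (simp add: heat_error_def dir_deriv_cutoff_near dir_deriv2_cutoff_near)
    then show ?thesis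
      using C_k_on_cong[of "ball 0 (\<rho> / 2)" "heat_error \<rho> :: 'a \<times> real \<Rightarrow> real" "\<lambda>_. 0"] C_k_on_const by auto
  qed
  have "- {0} \<union> ball 0 (\<rho> / 2) = (UNIV :: ('a \<times> real) set)" using assms by auto
  then show ?thesis using C_k_on_Un[OF o _ 1 2] by simp
qed

lemma heat_error_bump_exists:
  "\<rho> > 0 \<Longrightarrow> \<exists>D L. smooth_bump (heat_error \<rho> :: 'a::euclidean_space \<times> real \<Rightarrow> real) D \<rho> L"
  by (rule smooth_bump_exists) (auto simp: C_k_on_heat_error heat_error_support)

lemma C_k_on_differentiable: "C_k_on (Suc k) S f \<Longrightarrow> x \<in> S \<Longrightarrow> f differentiable (at x)"
  by simp

text \<open>The truncated kernel is singular at the origin and so is not a test function; the step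
  removes everything before time \<delta>, and with it the singularity.\<close>

definition regularized_kernel :: "real \<Rightarrow> real \<Rightarrow> 'a::euclidean_space \<times> real \<Rightarrow> real" where
  "regularized_kernel \<rho> \<delta> z = heat_power (DIM('a) / 2) z * cutoff \<rho> z * smooth_step (snd z / \<delta> - 1)"

lemma C_k_on_time_step: "C_k_on k UNIV (\<lambda>z::'a::euclidean_space \<times> real. smooth_step (snd z / \<delta> - 1))"
proof -
  have "C_k_on k UNIV (\<lambda>z::'a \<times> real. smooth_step ((1 / \<delta>) * snd z - 1))"
    by (rule C_k_on_compose[OF _ _ _ C_k_on_diff[OF _ C_k_on_cmult[OF _ C_k_on_bounded_linear[OF _ bounded_linear_snd]] C_k_on_const] C_k_on_smooth_step]) auto
  then show ?thesis by simp
qed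

lemma regularized_kernel_early: "\<delta> > 0 \<Longrightarrow> snd z < \<delta> \<Longrightarrow> regularized_kernel \<rho> \<delta> z = 0"
  by (simp add: regularized_kernel_def smooth_step_0 field_simps)

lemma open_early: "open {z :: 'a::euclidean_space \<times> real. snd z < \<delta>}"
  by (rule open_Collect_less) (auto intro!: continuous_intros)

lemma open_late: "open {z :: 'a::euclidean_space \<times> real. snd z > \<delta>}"
  by (rule open_Collect_less) (auto intro!: continuous_intros)

lemma C_k_on_regularized_kernel:
  assumes "\<delta> > 0" shows "C_k_on k UNIV (regularized_kernel \<rho> \<delta> :: 'a::euclidean_space \<times> real \<Rightarrow> real)"
proof -
  have o: "open (- {0 :: 'a \<times> real})" by (rule open_Compl) simp
  have 1: "C_k_on k (- {0}) (regularized_kernel \<rho> \<delta> :: 'a \<times> real \<Rightarrow> real)"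
    unfolding regularized_kernel_def[abs_def]
    by (intro C_k_on_mult[OF o] C_k_on_heat_power C_k_on_subset[OF C_k_on_cutoff] C_k_on_subset[OF C_k_on_time_step]) auto
  have 2: "C_k_on k {z. snd z < \<delta>} (regularized_kernel \<rho> \<delta> :: 'a \<times> real \<Rightarrow> real)"
    by (rule iffD2[OF C_k_on_cong[OF open_early] C_k_on_const[of k _ 0]])
       (use assms regularized_kernel_early in auto)
  have "- {0} \<union> {z. snd z < \<delta>} = (UNIV :: ('a \<times> real) set)" using assms by auto
  then show ?thesis using C_k_on_Un[OF o open_early 1 2] by simp
qed

text \<open>With exponent n/2 the kernel solves the heat equation for t > 0, so only terms with a
  derivative on the cutoff or on the step survive. The derivative of the step produces the
  approximate identity, the derivatives of the cutoff produce \<open>heat_error\<close>.\<close>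

lemma heat_operator_regularized_kernel:
  fixes z :: "'a::euclidean_space \<times> real"
  assumes \<delta>: "\<delta> > 0"
  shows "dir_deriv (0, 1) (regularized_kernel \<rho> \<delta>) z
      - (\<Sum>b\<in>Basis. dir_deriv (b, 0) (dir_deriv (b, 0) (regularized_kernel \<rho> \<delta>)) z)
    = heat_power (DIM('a) / 2) z * cutoff \<rho> z * (smooth_step' (snd z / \<delta> - 1) / \<delta>)
      + heat_error \<rho> z * smooth_step (snd z / \<delta> - 1)"
\<comment> \<open>For t <= 0 both sides vanish, because the regularised kernel is identically 0
  before time \<delta>. The computation takes place in the open half-space t > 0.\<close>
proof (cases "snd z > 0")
  case False
  then have e: "snd z < \<delta>" using \<delta> by simp
  have d0: "dir_deriv v (regularized_kernel \<rho> \<delta>) w = 0" if "snd w < \<delta>" for v and w :: "'a \<times> real"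
    by (rule dir_deriv_zero_open[OF open_early]) (use that regularized_kernel_early[OF \<delta>] in auto)
  have d1: "dir_deriv w (dir_deriv v (regularized_kernel \<rho> \<delta>)) z = 0" for v w :: "'a \<times> real"
    by (rule dir_deriv_zero_open[OF open_early[of \<delta>]]) (use e d0 in auto)
  have "heat_power (DIM('a) / 2) z = 0" using False by (cases z) (simp add: heat_power_def)
  then show ?thesis using False e by (simp add: d0 d1 heat_error_past)
next
  case True
  let ?m = "DIM('a) / 2"
  let ?\<eta> = "cutoff \<rho> :: 'a \<times> real \<Rightarrow> real"
  define J where "J = (heat_power ?m :: 'a \<times> real \<Rightarrow> real)"
  define J1 where "J1 = (heat_power (?m + 1) :: 'a \<times> real \<Rightarrow> real)"
  define P where "P = (\<lambda>z :: 'a \<times> real. smooth_step (snd z / \<delta> - 1))"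
  define p where "p = (\<lambda>z :: 'a \<times> real. smooth_step' (snd z / \<delta> - 1) / \<delta>)"
  have P: "(P has_derivative (\<lambda>h. snd h * p w)) (at w)" for w
  proof -
    have "((\<lambda>z::'a \<times> real. snd z / \<delta> - 1) has_derivative (\<lambda>h. snd h / \<delta>)) (at w)"
      using \<delta> by (auto intro!: derivative_eq_intros)
    from has_derivative_compose[OF this smooth_step_has_derivative] show ?thesis by (simp add: P_def p_def)
  qed
  have N: "(?\<eta> has_derivative frechet_derivative ?\<eta> (at w)) (at w)" for w
    using C_k_on_has_derivative[OF C_k_on_cutoff[of "Suc 0"]] by auto
  have J: "(J has_derivative heat_power_deriv ?m w) (at w)" if "snd w > 0" for w
    unfolding J_def by (rule heat_power_has_derivative) (use that in auto)
  have J1: "(J1 has_derivative heat_power_deriv (?m + 1) w) (at w)" if "snd w > 0" for w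
    unfolding J1_def by (rule heat_power_has_derivative) (use that in auto)
  have kd: "regularized_kernel \<rho> \<delta> = (\<lambda>w. J w * ?\<eta> w * P w)" by (simp add: regularized_kernel_def J_def P_def fun_eq_iff)
  have d1: "dir_deriv v (regularized_kernel \<rho> \<delta>) w =
     J w * ?\<eta> w * (snd v * p w) + (J w * dir_deriv v ?\<eta> w + heat_power_deriv ?m w v * ?\<eta> w) * P w" if "snd w > 0" for v w
    unfolding kd using dir_deriv_eqI[OF has_derivative_mult[OF has_derivative_mult[OF J[OF that] N] P]] by (simp add: dir_deriv_def)
  have db: "dir_deriv (b, 0) (regularized_kernel \<rho> \<delta>) w =
     (J w * dir_deriv (b, 0) ?\<eta> w + (- 1/2 * ((fst w \<bullet> b) * J1 w)) * ?\<eta> w) * P w" if "snd w > 0" for b w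
    using d1[OF that, of "(b, 0)"] by (simp add: heat_power_deriv_def J1_def)
  have dbb: "dir_deriv (b, 0) (dir_deriv (b, 0) (regularized_kernel \<rho> \<delta>)) z =
     (J z * dir_deriv (b, 0) (dir_deriv (b, 0) ?\<eta>) z - (fst z \<bullet> b) * J1 z * dir_deriv (b, 0) ?\<eta> z
       + ((fst z \<bullet> b)\<^sup>2 / 4 * heat_power (?m + 2) z - J1 z / 2) * ?\<eta> z) * P z" if b: "b \<in> Basis" for b
  proof -
    have Nb: "(dir_deriv (b, 0) ?\<eta> has_derivative frechet_derivative (dir_deriv (b, 0) ?\<eta>) (at z)) (at z)"
      by (rule C_k_on_has_derivative[OF C_k_on_dir_deriv_cutoff]) (use b in \<open>auto simp: Basis_prod_def\<close>)
    have l: "((\<lambda>w::'a \<times> real. fst w \<bullet> b) has_derivative (\<lambda>h. fst h \<bullet> b)) (at z)"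
      by (intro bounded_linear_imp_has_derivative bounded_linear_intros)
    note B = has_derivative_mult_right[OF has_derivative_mult[OF l J1[OF True]], of "- 1/2"]
    note D = has_derivative_mult[OF has_derivative_add[OF has_derivative_mult[OF J[OF True] Nb] has_derivative_mult[OF B N]] P]
    have m2: "?m + 1 + 1 = ?m + 2" by simp
    have "dir_deriv (b, 0) (dir_deriv (b, 0) (regularized_kernel \<rho> \<delta>)) z =
       (J z * dir_deriv (b, 0) ?\<eta> z + - 1 / 2 * (fst z \<bullet> b * J1 z) * ?\<eta> z) * (snd (b, 0::real) * p z) +
       (J z * frechet_derivative (dir_deriv (b, 0) ?\<eta>) (at z) (b, 0) + heat_power_deriv ?m z (b, 0) * dir_deriv (b, 0) ?\<eta> z +
        (- 1 / 2 * (fst z \<bullet> b * J1 z) * frechet_derivative ?\<eta> (at z) (b, 0) +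
         - 1 / 2 * (fst z \<bullet> b * heat_power_deriv (?m + 1) z (b, 0) + fst (b, 0::real) \<bullet> b * J1 z) * ?\<eta> z)) * P z"
      by (rule dir_deriv_local[OF D open_late[of 0]]) (use True db in auto)
    also have "\<dots> = (J z * dir_deriv (b, 0) (dir_deriv (b, 0) ?\<eta>) z - (fst z \<bullet> b) * J1 z * dir_deriv (b, 0) ?\<eta> z
       + ((fst z \<bullet> b)\<^sup>2 / 4 * heat_power (?m + 2) z - J1 z / 2) * ?\<eta> z) * P z"
      using b unfolding heat_power_deriv_def m2 J1_def[symmetric] dir_deriv_def
      by (simp add: algebra_simps power2_eq_square add_divide_distrib diff_divide_distrib)
    finally show ?thesis .
  qed
  define X where "X = (\<Sum>b\<in>Basis. dir_deriv (b, 0) (dir_deriv (b, 0) ?\<eta>) z)"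
  define Y where "Y = (\<Sum>b\<in>Basis. (fst z \<bullet> b) * J1 z * dir_deriv (b, 0) ?\<eta> z)"
  have sq: "(\<Sum>b\<in>Basis. (fst z \<bullet> b)\<^sup>2) = (norm (fst z))\<^sup>2"
    by (simp only: power2_norm_eq_inner) (subst (2) euclidean_inner, simp add: power2_eq_square)
  have "(\<Sum>b\<in>Basis. dir_deriv (b, 0) (dir_deriv (b, 0) (regularized_kernel \<rho> \<delta>)) z) =
     (\<Sum>b\<in>Basis. (J z * dir_deriv (b, 0) (dir_deriv (b, 0) ?\<eta>) z - (fst z \<bullet> b) * J1 z * dir_deriv (b, 0) ?\<eta> z
       + ((fst z \<bullet> b)\<^sup>2 / 4 * heat_power (?m + 2) z - J1 z / 2) * ?\<eta> z) * P z)"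
    using dbb by simp
  also have "\<dots> = (J z * X - Y + ((norm (fst z))\<^sup>2 / 4 * heat_power (?m + 2) z - DIM('a) * (J1 z / 2)) * ?\<eta> z) * P z"
    unfolding sum_distrib_right[symmetric] sum.distrib sum_subtractf sum_distrib_left[symmetric] sum_divide_distrib[symmetric] X_def Y_def sq
    by simp
  finally have S: "(\<Sum>b\<in>Basis. dir_deriv (b, 0) (dir_deriv (b, 0) (regularized_kernel \<rho> \<delta>)) z) =
     (J z * X - Y + ((norm (fst z))\<^sup>2 / 4 * heat_power (?m + 2) z - DIM('a) * (J1 z / 2)) * ?\<eta> z) * P z" .
  have T: "dir_deriv (0, 1) (regularized_kernel \<rho> \<delta>) z = J z * ?\<eta> z * p z +
      (J z * dir_deriv (0, 1) ?\<eta> z + (- ?m * J1 z + (norm (fst z))\<^sup>2 / 4 * heat_power (?m + 2) z) * ?\<eta> z) * P z"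
    using d1[OF True, of "(0, 1)"] by (simp add: heat_power_deriv_def J1_def)
  have E: "heat_error \<rho> z = J z * (dir_deriv (0, 1) ?\<eta> z - X) + Y"
    by (simp add: heat_error_def X_def Y_def J_def J1_def)
  show ?thesis
    unfolding S T E unfolding J_def[symmetric] p_def[symmetric] P_def[symmetric]
    using p_def P_def by (simp add: J_def[symmetric] algebra_simps)
qed

lemma dir_deriv_reflect:
  assumes "f differentiable (at (z0 - w))"
  shows "dir_deriv v (\<lambda>w. f (z0 - w)) w = - dir_deriv v f (z0 - w)"
proof -
  have 1: "((\<lambda>w. z0 - w) has_derivative (\<lambda>h. - h)) (at w)" by (auto intro!: derivative_eq_intros)
  have 2: "(f has_derivative frechet_derivative f (at (z0 - w))) (at (z0 - w))" using assms frechet_derivative_works by blast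
  have "dir_deriv v (\<lambda>w. f (z0 - w)) w = frechet_derivative f (at (z0 - w)) (- v)"
    by (rule dir_deriv_eqI[OF has_derivative_compose[OF 1 2]])
  then show ?thesis using linear_neg[OF has_derivative_linear[OF 2]] by (simp add: dir_deriv_def)
qed

lemma test_function_regularized_kernel:
  assumes "\<delta> > 0" "\<rho> > 0" "cball z0 \<rho> \<subseteq> Q"
  shows "test_function Q (\<lambda>w. regularized_kernel \<rho> \<delta> (z0 - w))"
proof -
  have "C_k_on k UNIV (\<lambda>w. regularized_kernel \<rho> \<delta> (z0 + (- w)))" for k
    by (rule C_k_on_affine[OF _ _ _ _ C_k_on_regularized_kernel[OF assms(1)]]) (auto intro: bounded_linear_minus bounded_linear_ident)
  then have s: "C_k k (\<lambda>w. regularized_kernel \<rho> \<delta> (z0 - w))" for k by (simp add: C_k_eq_C_k_on_UNIV)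
  have "{w. regularized_kernel \<rho> \<delta> (z0 - w) \<noteq> 0} \<subseteq> cball z0 \<rho>"
    using cutoff_eq_0[of \<rho>] assms(2) by (force simp: regularized_kernel_def dist_norm)
  then have c: "closure {w. regularized_kernel \<rho> \<delta> (z0 - w) \<noteq> 0} \<subseteq> cball z0 \<rho>" by (rule closure_minimal) simp
  then have "compact (closure {w. regularized_kernel \<rho> \<delta> (z0 - w) \<noteq> 0})"
    by (meson bounded_cball bounded_subset closed_closure compact_eq_bounded_closed)
  then show ?thesis unfolding test_function_def using s c assms(3) by blast
qed

text \<open>The test function is the regularised kernel reflected about \<open>z0\<close>:
  reflection turns the adjoint operator of \<open>weak\<close> into the heat operator. As \<delta>
  tends to 0, the approximate identity yields \<open>u z0\<close>, and the step disappears from the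
  other two integrals.\<close>

theorem heat_representation:
  fixes u f :: "'a::euclidean_space \<times> real \<Rightarrow> real"
  assumes [measurable]: "u \<in> borel_measurable borel" "f \<in> borel_measurable borel" and f: "\<And>w. \<bar>f w\<bar> \<le> 1"
    and weak: "\<And>\<phi>. test_function Q \<phi> \<Longrightarrow>
      (\<integral>w. u w * (- dir_deriv (0, 1) \<phi> w - (\<Sum>b\<in>Basis. dir_deriv (b, 0) (dir_deriv (b, 0) \<phi>) w)) \<partial>lborel)
        = (\<integral>w. f w * \<phi> w \<partial>lborel)"
    and Q: "cball z0 \<rho> \<subseteq> Q" and \<rho>: "0 < \<rho>" "\<rho> \<le> 1"
    and M: "\<And>w. w \<in> cball z0 \<rho> \<Longrightarrow> \<bar>u w\<bar> \<le> M" and cont: "isCont u z0"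
  shows "gauss_mass TYPE('a) * u z0 =
     (\<integral>w. f w * (heat_power (DIM('a) / 2) (z0 - w) * cutoff \<rho> (z0 - w)) \<partial>lborel)
     - (\<integral>w. u w * heat_error \<rho> (z0 - w) \<partial>lborel)"
proof -
  let ?m = "DIM('a) / 2"
  define \<delta> where "\<delta> j = 1 / real (Suc j)" for j
  have \<delta>: "\<delta> j > 0" "\<delta> \<longlonglongrightarrow> 0" for j
    unfolding \<delta>_def using LIMSEQ_inverse_real_of_nat by (auto simp: inverse_eq_divide)
  define v g where "v w = u (z0 - w)" and "g w = f (z0 - w)" for w
  have [measurable]: "v \<in> borel_measurable borel" "g \<in> borel_measurable borel" unfolding v_def[abs_def] g_def[abs_def] by measurable
  have M0: "M \<ge> 0" using M[of z0] \<rho> by auto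
  have vM: "\<bar>v w\<bar> \<le> M" if "norm w \<le> \<rho>" for w using that by (auto simp: v_def dist_norm intro!: M)
  have [measurable]: "snd \<in> borel_measurable (borel :: ('a \<times> real) measure)" unfolding borel_prod[symmetric] by measurable
  obtain DE LE where "smooth_bump (heat_error \<rho> :: 'a \<times> real \<Rightarrow> real) DE \<rho> LE" using heat_error_bump_exists[OF \<rho>(1)] by blast
  then interpret E: smooth_bump "heat_error \<rho> :: 'a \<times> real \<Rightarrow> real" DE \<rho> LE .
  obtain B where B: "B \<ge> 0" "\<And>t. \<bar>smooth_step' t\<bar> \<le> B" using smooth_step'_bounded by blast
  have [measurable]: "cutoff \<rho> \<in> borel_measurable (borel :: ('a \<times> real) measure)"
    using C_k_on_cutoff[of 0 \<rho>] by (intro borel_measurable_continuous_onI) simp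
  define A where "A j w = heat_power ?m w * cutoff \<rho> w * (smooth_step' (snd w / \<delta> j - 1) / \<delta> j)" for j and w :: "'a \<times> real"
  define P where "P j w = smooth_step (snd w / \<delta> j - 1)" for j and w :: "'a \<times> real"
  have [measurable]: "A j \<in> borel_measurable borel" "P j \<in> borel_measurable borel" for j
    unfolding A_def[abs_def] P_def[abs_def] by measurable
  have [measurable]: "regularized_kernel \<rho> (\<delta> j) \<in> borel_measurable (borel :: ('a \<times> real) measure)" for j
    unfolding regularized_kernel_def[abs_def] by measurable
  have P01: "0 \<le> P j w" "P j w \<le> 1" for j w by (simp_all add: P_def smooth_step_nonneg smooth_step_le_1)
  \<comment> \<open>The step tends to 1 for positive times only; kernel and error term vanish at all
    other times.\<close>
  have P_lim: "(\<lambda>j. P j w) \<longlonglongrightarrow> 1" if "snd w > 0" for w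
  proof (rule tendsto_eventually)
    have "eventually (\<lambda>j. \<delta> j < snd w / 2) sequentially" using order_tendstoD(2)[OF \<delta>(2), of "snd w / 2"] that by simp
    then show "eventually (\<lambda>j. P j w = 1) sequentially"
    proof eventually_elim
      case (elim j)
      then show ?case unfolding P_def using \<delta>(1)[of j] by (intro smooth_step_1) (simp add: field_simps)
    qed
  qed
  have intA: "integrable lborel (\<lambda>w. v w * A j w)" for j
  proof (rule Bochner_Integration.integrable_bound[where f="\<lambda>w. cut_weight ?m w * ((B / \<delta> j) * M)"])
    show "integrable lborel (\<lambda>w::'a \<times> real. cut_weight ?m w * (B / \<delta> j * M))"
      using integrable_cut_weight[of ?m, where 'a='a] by simp
    have "norm (v w * A j w) \<le> cut_weight ?m w * ((B / \<delta> j) * M)" for w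
    proof (cases "norm w > \<rho>")
      case False
      have "norm (v w * A j w) = (heat_power ?m w * cutoff \<rho> w) * ((\<bar>smooth_step' (snd w / \<delta> j - 1)\<bar> / \<delta> j) * \<bar>v w\<bar>)"
        using \<delta>(1)[of j] by (simp add: A_def abs_mult heat_power_nonneg cutoff_bounds)
      also have "\<dots> \<le> (cut_weight ?m w * 1) * ((B / \<delta> j) * M)"
        using False \<rho> \<delta>(1)[of j] B vM cutoff_bounds
        by (intro mult_mono divide_right_mono heat_power_le_cut) (auto simp: cut_weight_nonneg heat_power_nonneg less_imp_le)
      finally show ?thesis by simp
    qed (use cutoff_eq_0[of \<rho> w] \<rho> M0 B \<delta>(1)[of j] in \<open>simp add: A_def cut_weight_nonneg\<close>)
    then have "norm (v w * A j w) \<le> norm (cut_weight ?m w * ((B / \<delta> j) * M))" for w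
      by (metis abs_ge_self order_trans real_norm_def)
    then show "AE w in lborel. norm (v w * A j w) \<le> norm (cut_weight ?m w * ((B / \<delta> j) * M))" by (intro AE_I2)
  qed auto
  have intI: "integrable lborel (\<lambda>w::'a \<times> real. M * LE * indicator (cball 0 \<rho>) w)"
    by (intro integrable_mult_right integrable_real_indicator) (use emeasure_bounded_finite[OF bounded_cball] in auto)
  have vE: "norm (v w * (heat_error \<rho> w * P j w)) \<le> M * LE * indicator (cball 0 \<rho>) w" for j w
  proof (cases "norm w > \<rho>")
    case False
    have "norm (v w * (heat_error \<rho> w * P j w)) \<le> M * (LE * 1)"
      unfolding real_norm_def abs_mult using False vM E.bound P01 M0 by (intro mult_mono) (auto simp: E.L_nonneg)
    then show ?thesis using False by simp
  qed (simp add: heat_error_support \<rho>)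
  have intE: "integrable lborel (\<lambda>w. v w * (heat_error \<rho> w * P j w))" for j
  proof (rule Bochner_Integration.integrable_bound[OF intI])
    show "AE w in lborel. norm (v w * (heat_error \<rho> w * P j w)) \<le> norm (M * LE * indicator (cball 0 \<rho>) w :: real)"
      by (rule AE_I2, rule order_trans[OF vE]) simp
  qed auto
  \<comment> \<open>The tested equation for the parameter \<delta> j, with the reflection undone by
    a change of variables; \<open>v\<close> and \<open>g\<close> are \<open>u\<close> and
    \<open>f\<close> seen from \<open>z0\<close>.\<close>
  have id: "(\<integral>w. v w * A j w \<partial>lborel) + (\<integral>w. v w * (heat_error \<rho> w * P j w) \<partial>lborel) =
      (\<integral>w. g w * regularized_kernel \<rho> (\<delta> j) w \<partial>lborel)" for j
  proof -
    let ?k = "regularized_kernel \<rho> (\<delta> j) :: 'a \<times> real \<Rightarrow> real"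
    let ?\<phi> = "\<lambda>w. ?k (z0 - w)"
    have C: "C_k_on k UNIV ?k" for k by (rule C_k_on_regularized_kernel[OF \<delta>(1)])
    have d1: "dir_deriv b ?\<phi> w = - dir_deriv b ?k (z0 - w)" for b w
      by (rule dir_deriv_reflect[OF C_k_on_differentiable[OF C]]) simp
    have d2: "dir_deriv b (dir_deriv b ?\<phi>) w = dir_deriv b (dir_deriv b ?k) (z0 - w)" if "b \<in> Basis" for b w
    proof -
      have "C_k_on (Suc 0) UNIV (dir_deriv b ?k)" using C_k_on_dir_deriv[OF C that] .
      then have df: "dir_deriv b ?k differentiable at x" for x by (rule C_k_on_differentiable) simp
      have "dir_deriv b ?\<phi> = (\<lambda>w. (\<lambda>x. - dir_deriv b ?k x) (z0 - w))" by (rule ext) (rule d1)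
      then have "dir_deriv b (dir_deriv b ?\<phi>) w = - dir_deriv b (\<lambda>x. - dir_deriv b ?k x) (z0 - w)"
        using dir_deriv_reflect[of "\<lambda>x. - dir_deriv b ?k x" z0 w b, OF differentiable_minus[OF df]] by simp
      also have "dir_deriv b (\<lambda>x. - dir_deriv b ?k x) (z0 - w) = - dir_deriv b (dir_deriv b ?k) (z0 - w)"
        using dir_deriv_eqI[OF has_derivative_minus[OF df[unfolded frechet_derivative_works]]] by (simp add: dir_deriv_def[of b "dir_deriv b ?k"])
      finally show ?thesis by simp
    qed
    have "- dir_deriv (0, 1) ?\<phi> w - (\<Sum>b\<in>Basis. dir_deriv (b, 0) (dir_deriv (b, 0) ?\<phi>) w) =
       A j (z0 - w) + heat_error \<rho> (z0 - w) * P j (z0 - w)" for w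
    proof -
      have "(\<Sum>b\<in>Basis. dir_deriv (b, 0) (dir_deriv (b, 0) ?\<phi>) w) = (\<Sum>b\<in>Basis. dir_deriv (b, 0) (dir_deriv (b, 0) ?k) (z0 - w))"
        by (rule sum.cong[OF refl], rule d2) (auto simp: Basis_prod_def)
      then show ?thesis using heat_operator_regularized_kernel[OF \<delta>(1), of \<rho> j "z0 - w"] by (simp add: d1 A_def P_def)
    qed
    with weak[OF test_function_regularized_kernel[OF \<delta>(1) \<rho>(1) Q], of j]
    have "(\<integral>w. u w * (A j (z0 - w) + heat_error \<rho> (z0 - w) * P j (z0 - w)) \<partial>lborel) = (\<integral>w. f w * ?k (z0 - w) \<partial>lborel)"
      by simp
    moreover have "(\<integral>w. u w * (A j (z0 - w) + heat_error \<rho> (z0 - w) * P j (z0 - w)) \<partial>lborel) =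
       (\<integral>w. v w * (A j w + heat_error \<rho> w * P j w) \<partial>lborel)"
      using integral_reflect_lborel[of "\<lambda>w. v w * (A j w + heat_error \<rho> w * P j w)" z0] by (simp add: v_def)
    moreover have "(\<integral>w. f w * ?k (z0 - w) \<partial>lborel) = (\<integral>w. g w * ?k w \<partial>lborel)"
      using integral_reflect_lborel[of "\<lambda>w. g w * ?k w" z0] by (simp add: g_def)
    ultimately show ?thesis using intA[of j] intE[of j] by (simp add: distrib_left)
  qed
  have L1: "(\<lambda>j. \<integral>w. v w * A j w \<partial>lborel) \<longlonglongrightarrow> gauss_mass TYPE('a) * u z0"
  proof -
    \<comment> \<open>\<open>v\<close> is known to be bounded only in radius \<rho>; the cutoff
      turns it into a bounded function on the whole space without changing its value at 0.\<close>
    define F where "F w = cutoff \<rho> w * v w" for w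
    have FM: "\<bar>F w\<bar> \<le> M" for w
    proof (cases "norm w > \<rho>")
      case False
      then have "\<bar>F w\<bar> \<le> 1 * M" unfolding F_def abs_mult using vM cutoff_bounds[of \<rho> w] by (intro mult_mono) auto
      then show ?thesis by simp
    qed (use cutoff_eq_0[of \<rho> w] \<rho> M0 in \<open>simp add: F_def\<close>)
    have cc: "isCont (cutoff \<rho> :: 'a \<times> real \<Rightarrow> real) 0"
    proof -
      have "continuous_on UNIV (cutoff \<rho> :: 'a \<times> real \<Rightarrow> real)" using C_k_on_cutoff[of 0 \<rho>, where 'a="'a \<times> real"] by simp
      then show ?thesis using continuous_on_eq_continuous_at[OF open_UNIV] by blast
    qed
    have cv: "isCont v 0" unfolding v_def[abs_def]
      by (rule isCont_o2[where g=u]) (use cont in \<open>auto intro!: continuous_intros\<close>)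
    have "(\<lambda>j. \<integral>w. heat_power ?m w * (smooth_step' (snd w / \<delta> j - 1) / \<delta> j) * F w \<partial>lborel) \<longlonglongrightarrow> gauss_mass TYPE('a) * F 0"
    proof (rule heat_approximate_identity[OF _ FM])
      show "F \<in> borel_measurable borel" unfolding F_def[abs_def] by measurable
      show "F w = 0" if "norm w > 2" for w using that cutoff_eq_0[of \<rho> w] \<rho> by (simp add: F_def)
      show "isCont F 0" unfolding F_def[abs_def] using cc cv by (rule continuous_mult)
    qed (use \<delta> in auto)
    moreover have "F 0 = u z0" using cutoff_eq_1[of "0 :: 'a \<times> real" \<rho>] \<rho> by (simp add: F_def v_def)
    moreover have "heat_power ?m w * (smooth_step' (snd w / \<delta> j - 1) / \<delta> j) * F w = v w * A j w" for j w
      by (simp add: F_def A_def)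
    ultimately show ?thesis by (simp only:)
  qed
  have L2: "(\<lambda>j. \<integral>w. v w * (heat_error \<rho> w * P j w) \<partial>lborel) \<longlonglongrightarrow> (\<integral>w. v w * heat_error \<rho> w \<partial>lborel)"
  proof (rule integral_dominated_convergence[OF _ _ intI])
    have "(\<lambda>j. v w * (heat_error \<rho> w * P j w)) \<longlonglongrightarrow> v w * heat_error \<rho> w" for w
    proof (cases "snd w > 0")
      case True
      then show ?thesis using tendsto_mult[OF tendsto_const[of "v w"] tendsto_mult[OF tendsto_const[of "heat_error \<rho> w"] P_lim[OF True]]] by simp
    next
      case False
      then have "heat_error \<rho> w = 0" by (intro heat_error_past) simp
      then show ?thesis by simp
    qed
    then show "AE w in lborel. (\<lambda>j. v w * (heat_error \<rho> w * P j w)) \<longlonglongrightarrow> v w * heat_error \<rho> w" by (intro AE_I2)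
    show "AE w in lborel. norm (v w * (heat_error \<rho> w * P j w)) \<le> M * LE * indicator (cball 0 \<rho>) w" for j
      by (rule AE_I2) (rule vE)
  qed auto
  have L3: "(\<lambda>j. \<integral>w. g w * regularized_kernel \<rho> (\<delta> j) w \<partial>lborel) \<longlonglongrightarrow> (\<integral>w. g w * (heat_power ?m w * cutoff \<rho> w) \<partial>lborel)"
  proof (rule integral_dominated_convergence[where w="cut_weight ?m"])
    show "integrable lborel (cut_weight ?m :: 'a \<times> real \<Rightarrow> real)" by (rule integrable_cut_weight) simp
    have "norm (g w * regularized_kernel \<rho> (\<delta> j) w) \<le> cut_weight ?m w" for j w
    proof (cases "norm w > \<rho>")
      case False
      have "norm (g w * regularized_kernel \<rho> (\<delta> j) w) = \<bar>g w\<bar> * (heat_power ?m w * cutoff \<rho> w * P j w)"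
        by (simp add: regularized_kernel_def abs_mult heat_power_nonneg cutoff_bounds P_def smooth_step_nonneg)
      also have "\<dots> \<le> 1 * (cut_weight ?m w * 1 * 1)"
        using False \<rho> f[of "z0 - w"]
        by (intro mult_mono heat_power_le_cut mult_nonneg_nonneg heat_power_nonneg cut_weight_nonneg cutoff_bounds P01) (auto simp: g_def)
      finally show ?thesis by simp
    qed (use cutoff_eq_0[of \<rho> w] \<rho> in \<open>simp add: regularized_kernel_def cut_weight_nonneg\<close>)
    then show "AE w in lborel. norm (g w * regularized_kernel \<rho> (\<delta> j) w) \<le> cut_weight ?m w" for j by (intro AE_I2)
    have "(\<lambda>j. g w * regularized_kernel \<rho> (\<delta> j) w) \<longlonglongrightarrow> g w * (heat_power ?m w * cutoff \<rho> w)" for w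
    proof (cases "snd w > 0")
      case True
      then show ?thesis
        using tendsto_mult[OF tendsto_const[of "g w * (heat_power ?m w * cutoff \<rho> w)"] P_lim[OF True]]
        by (simp add: regularized_kernel_def P_def mult.assoc)
    next
      case False
      then have "heat_power ?m w = 0" by (cases w) (simp add: heat_power_def)
      then show ?thesis by (simp add: regularized_kernel_def)
    qed
    then show "AE w in lborel. (\<lambda>j. g w * regularized_kernel \<rho> (\<delta> j) w) \<longlonglongrightarrow> g w * (heat_power ?m w * cutoff \<rho> w)" by (intro AE_I2)
  qed auto
  have "gauss_mass TYPE('a) * u z0 + (\<integral>w. v w * heat_error \<rho> w \<partial>lborel) = (\<integral>w. g w * (heat_power ?m w * cutoff \<rho> w) \<partial>lborel)"
    using LIMSEQ_unique[OF tendsto_add[OF L1 L2] L3[folded id]] .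
  moreover have "(\<integral>w. v w * heat_error \<rho> w \<partial>lborel) = (\<integral>w. u w * heat_error \<rho> (z0 - w) \<partial>lborel)"
    using integral_reflect_lborel[of "\<lambda>w. v w * heat_error \<rho> w" z0] by (simp add: v_def)
  moreover have "(\<integral>w. g w * (heat_power ?m w * cutoff \<rho> w) \<partial>lborel) = (\<integral>w. f w * (heat_power ?m (z0 - w) * cutoff \<rho> (z0 - w)) \<partial>lborel)"
    using integral_reflect_lborel[of "\<lambda>w. g w * (heat_power ?m w * cutoff \<rho> w)" z0] by (simp add: g_def)
  ultimately show ?thesis by simp
qed

section \<open>Heat potentials of bounded functions\<close>

context smooth_bump
begin

definition bump_conv :: "('a \<Rightarrow> real) \<Rightarrow> 'a \<Rightarrow> real" where
  "bump_conv g z = (\<integral>w. g w * e (z - w) \<partial>lborel)"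

definition bump_conv_grad :: "('a \<Rightarrow> real) \<Rightarrow> 'a \<Rightarrow> 'a" where
  "bump_conv_grad g z = (\<integral>w. g w *\<^sub>R De (z - w) \<partial>lborel)"

definition bump_const :: real where "bump_const = L * (\<integral>w. indicator (cball (0::'a) r) w \<partial>lborel)"

lemma integrable_ind_cball: "integrable lborel (indicator (cball (0::'a) r) :: 'a \<Rightarrow> real)"
  by (intro integrable_real_indicator) (use emeasure_bounded_finite[OF bounded_cball] in auto)

lemma bump_const_nonneg: "bump_const \<ge> 0"
  unfolding bump_const_def using L_nonneg by (intro mult_nonneg_nonneg integral_nonneg_AE) auto

lemma integrable_bump:
  assumes [measurable]: "g \<in> borel_measurable borel" and g: "\<And>w. \<bar>g w\<bar> \<le> M"
  shows "integrable lborel (\<lambda>w. g w * e (z - w))" "integrable lborel (\<lambda>w. g w *\<^sub>R De (z - w))"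
proof -
  have M0: "M \<ge> 0" using g[of undefined] by linarith
  have i: "integrable lborel (\<lambda>w. M * (L * indicator (cball 0 r) (z - w)) :: real)"
    using integrable_reflect[OF integrable_ind_cball, of z] by simp
  have "norm (g w * e (z - w)) \<le> M * (L * indicator (cball 0 r) (z - w))" for w
  proof (cases "norm (z - w) > r")
    case False
    have "norm (g w * e (z - w)) \<le> M * L" unfolding real_norm_def abs_mult using g bound L_nonneg M0 by (intro mult_mono) auto
    then show ?thesis using False by simp
  qed (simp add: support)
  then have "norm (g w * e (z - w)) \<le> norm (M * (L * indicator (cball 0 r) (z - w)) :: real)" for w
    by (metis abs_ge_self order_trans real_norm_def)
  then show "integrable lborel (\<lambda>w. g w * e (z - w))" by (intro Bochner_Integration.integrable_bound[OF i] AE_I2) auto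
  have "norm (g w *\<^sub>R De (z - w)) \<le> M * (L * indicator (cball 0 r) (z - w))" for w
  proof (cases "norm (z - w) > r")
    case False
    have "norm (g w *\<^sub>R De (z - w)) \<le> M * L" unfolding norm_scaleR using g bound_De L_nonneg M0 by (intro mult_mono) auto
    then show ?thesis using False by simp
  qed (simp add: support_De)
  then have "norm (g w *\<^sub>R De (z - w)) \<le> norm (M * (L * indicator (cball 0 r) (z - w)) :: real)" for w
    by (metis abs_ge_self order_trans real_norm_def)
  then show "integrable lborel (\<lambda>w. g w *\<^sub>R De (z - w))" by (intro Bochner_Integration.integrable_bound[OF i] AE_I2) auto
qed

text \<open>The difference of two shifted bumps is supported in two balls, which is the reason for
  the two centres and for the factor 2.\<close>

lemma bump_conv_estimate:
  fixes k :: "'a \<Rightarrow> 'b::{banach, second_countable_topology}"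
  assumes g: "\<And>w. \<bar>g w\<bar> \<le> M" and A: "A \<ge> 0"
    and k: "\<And>w. norm (k w) \<le> A * L" "\<And>w. norm (z - w) > r \<Longrightarrow> norm (z' - w) > r \<Longrightarrow> k w = 0"
  shows "norm (\<integral>w. g w *\<^sub>R k w \<partial>lborel) \<le> 2 * M * A * bump_const"
proof -
  have "norm (\<integral>w. g w *\<^sub>R k w \<partial>lborel) \<le> 2 * M * (A * L) * (\<integral>w. indicator (cball (0::'a) r) w \<partial>lborel)"
  proof (rule convolution_bound[OF _ integrable_ind_cball g, of _ _ z z'])
    show "norm (k w) \<le> A * L * (indicator (cball 0 r) (z - w) + indicator (cball 0 r) (z' - w))" for w
    proof (cases "norm (z - w) > r \<and> norm (z' - w) > r")
      case False
      then have "(1::real) \<le> indicator (cball 0 r) (z - w) + indicator (cball 0 r) (z' - w)" by (auto simp: indicator_def)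
      then have "A * L * 1 \<le> A * L * (indicator (cball 0 r) (z - w) + indicator (cball 0 r) (z' - w))"
        using A L_nonneg by (intro mult_left_mono) auto
      then show ?thesis using k(1)[of w] by simp
    qed (use k A L_nonneg in auto)
  qed (use A L_nonneg in auto)
  then show ?thesis by (simp add: bump_const_def ac_simps)
qed

lemma bump_conv_facts:
  assumes m[measurable]: "g \<in> borel_measurable borel" and g: "\<And>w. \<bar>g w\<bar> \<le> M"
  shows "norm (bump_conv_grad g z) \<le> 2 * M * bump_const"
    and "\<bar>bump_conv g z - bump_conv g z'\<bar> \<le> 2 * M * norm (z - z') * bump_const"
    and "norm (bump_conv_grad g z - bump_conv_grad g z') \<le> 2 * M * norm (z - z') * bump_const"
    and "\<bar>bump_conv g (z + h) - bump_conv g z - bump_conv_grad g z \<bullet> h\<bar> \<le> 2 * M * (norm h)\<^sup>2 * bump_const"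
proof -
  note i = integrable_bump[OF m g]
  show "norm (bump_conv_grad g z) \<le> 2 * M * bump_const"
    using bump_conv_estimate[OF g, where A=1 and k="\<lambda>w. De (z - w)" and z=z and z'=z] bound_De support_De by (simp add: bump_conv_grad_def)
  have "bump_conv g z - bump_conv g z' = (\<integral>w. g w *\<^sub>R (e (z - w) - e (z' - w)) \<partial>lborel)"
    unfolding bump_conv_def by (subst Bochner_Integration.integral_diff[symmetric]) (use i in \<open>simp_all add: right_diff_distrib\<close>)
  moreover have "norm (e (z - w) - e (z' - w)) \<le> norm (z - z') * L" for w
    using lipschitz[of "z - w" "z' - w"] by (simp add: mult.commute)
  ultimately show "\<bar>bump_conv g z - bump_conv g z'\<bar> \<le> 2 * M * norm (z - z') * bump_const"
    using bump_conv_estimate[OF g, where k="\<lambda>w. e (z - w) - e (z' - w)" and A="norm (z - z')" and z=z and z'=z'] support by simp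
  have "bump_conv_grad g z - bump_conv_grad g z' = (\<integral>w. g w *\<^sub>R (De (z - w) - De (z' - w)) \<partial>lborel)"
    unfolding bump_conv_grad_def by (subst Bochner_Integration.integral_diff[symmetric]) (use i in \<open>simp_all add: scaleR_diff_right\<close>)
  moreover have "norm (De (z - w) - De (z' - w)) \<le> norm (z - z') * L" for w
    using lipschitz_De[of "z - w" "z' - w"] by (simp add: mult.commute)
  ultimately show "norm (bump_conv_grad g z - bump_conv_grad g z') \<le> 2 * M * norm (z - z') * bump_const"
    using bump_conv_estimate[OF g, where k="\<lambda>w. De (z - w) - De (z' - w)" and A="norm (z - z')" and z=z and z'=z'] support_De by simp
  have ih: "integrable lborel (\<lambda>w. (g w *\<^sub>R De (z - w)) \<bullet> h)" by (rule integrable_inner_left) (rule i(2))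
  have "bump_conv_grad g z \<bullet> h = (\<integral>w. g w *\<^sub>R (De (z - w) \<bullet> h) \<partial>lborel)"
    unfolding bump_conv_grad_def by (subst integral_inner_left[symmetric]) (use i in simp_all)
  then have "bump_conv g (z + h) - bump_conv g z - bump_conv_grad g z \<bullet> h =
      (\<integral>w. g w * e (z + h - w) \<partial>lborel) - (\<integral>w. g w * e (z - w) \<partial>lborel) - (\<integral>w. g w *\<^sub>R (De (z - w) \<bullet> h) \<partial>lborel)"
    by (simp add: bump_conv_def)
  also have "\<dots> = (\<integral>w. (g w * e (z + h - w) - g w * e (z - w)) - g w *\<^sub>R (De (z - w) \<bullet> h) \<partial>lborel)"
    using i(1)[of "z + h"] i(1)[of z] ih by simp
  also have "\<dots> = (\<integral>w. g w *\<^sub>R (e (z + h - w) - e (z - w) - De (z - w) \<bullet> h) \<partial>lborel)"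
    by (rule Bochner_Integration.integral_cong) (simp_all add: algebra_simps)
  finally have d: "bump_conv g (z + h) - bump_conv g z - bump_conv_grad g z \<bullet> h =
     (\<integral>w. g w *\<^sub>R (e (z + h - w) - e (z - w) - De (z - w) \<bullet> h) \<partial>lborel)" .
  have "norm (e (z + h - w) - e (z - w) - De (z - w) \<bullet> h) \<le> (norm h)\<^sup>2 * L" for w
    using taylor[of "z - w" h] by (simp add: algebra_simps)
  then show "\<bar>bump_conv g (z + h) - bump_conv g z - bump_conv_grad g z \<bullet> h\<bar> \<le> 2 * M * (norm h)\<^sup>2 * bump_const"
    unfolding d using bump_conv_estimate[OF g zero_le_power2[of "norm h"], where k="\<lambda>w. e (z + h - w) - e (z - w) - De (z - w) \<bullet> h" and z=z and z'="z + h"]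
      support support_De by simp
qed

end

section \<open>Potentials of the truncated kernel\<close>

context cut_kernel
begin

definition potential :: "('a \<times> real \<Rightarrow> real) \<Rightarrow> 'a \<times> real \<Rightarrow> real" where
  "potential g z = (\<integral>w. g w * K (z - w) \<partial>lborel)"

definition potential_grad :: "('a \<times> real \<Rightarrow> real) \<Rightarrow> 'a \<times> real \<Rightarrow> 'a" where
  "potential_grad g z = (\<integral>w. g w *\<^sub>R DK (z - w) \<partial>lborel)"

definition weight_mass :: "real \<Rightarrow> real" where
  "weight_mass k = (\<integral>w. cut_weight k w \<partial>(lborel :: ('a \<times> real) measure))"

lemma weight_mass_nonneg: "weight_mass k \<ge> 0"
  unfolding weight_mass_def by (intro integral_nonneg_AE) (auto simp: cut_weight_nonneg)

lemma kernel_integrable: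
  assumes m: "m = DIM('a) / 2" and [measurable]: "g \<in> borel_measurable borel" and g: "\<And>w. \<bar>g w\<bar> \<le> 1"
  shows "integrable lborel (\<lambda>w. g w * K (z - w))" "integrable lborel (\<lambda>w. g w *\<^sub>R DK (z - w))"
proof -
  have i1: "integrable lborel (\<lambda>w. cut_weight m (z - w))"
    by (rule integrable_reflect[OF integrable_cut_weight]) (simp add: m)
  have i2: "integrable lborel (\<lambda>w. (20 + 2 * L) * cut_weight (m + 1/2) (z - w))"
    by (rule integrable_mult_right[OF integrable_reflect[OF integrable_cut_weight]]) (simp add: m)
  have "norm (g w * K (z - w)) \<le> norm (cut_weight m (z - w))" for w
  proof -
    have "norm (g w * K (z - w)) \<le> 1 * cut_weight m (z - w)"
      unfolding real_norm_def abs_mult abs_of_nonneg[OF K_nonneg] using g K_le K_nonneg by (intro mult_mono) auto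
    then show ?thesis using cut_weight_nonneg[of m "z - w"] by simp
  qed
  then show "integrable lborel (\<lambda>w. g w * K (z - w))" by (intro Bochner_Integration.integrable_bound[OF i1] AE_I2) auto
  have "norm (g w *\<^sub>R DK (z - w)) \<le> norm ((20 + 2 * L) * cut_weight (m + 1/2) (z - w))" for w
  proof -
    have "norm (g w *\<^sub>R DK (z - w)) \<le> 1 * ((20 + 2 * L) * cut_weight (m + 1/2) (z - w))"
      unfolding norm_scaleR using g norm_DK_le by (intro mult_mono) auto
    then show ?thesis by simp
  qed
  then show "integrable lborel (\<lambda>w. g w *\<^sub>R DK (z - w))" by (intro Bochner_Integration.integrable_bound[OF i2] AE_I2) auto
qed

text \<open>Each regularity estimate of the potential reduces to a kernel estimate whose weight
  exponent stays below n/2 + 1. The kernel itself uses n/2, which leaves one unit: a Hoelder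
  exponent below 1 in time, or one half for the gradient and a/2 < 1/2 for its modulus of continuity
  in space.\<close>

lemma potential_estimate:
  fixes k :: "'a \<times> real \<Rightarrow> 'b::{banach, second_countable_topology}"
  assumes m: "m = DIM('a) / 2" and g: "\<And>w. \<bar>g w\<bar> \<le> 1" and A: "A \<ge> 0" and q: "q < DIM('a) / 2 + 1"
    and k: "\<And>w. norm (k w) \<le> A * (cut_weight q (z - w) + cut_weight q (z' - w))"
  shows "norm (\<integral>w. g w *\<^sub>R k w \<partial>lborel) \<le> 2 * A * weight_mass q"
  using convolution_bound[OF k integrable_cut_weight[OF q] g A cut_weight_nonneg] by (simp add: weight_mass_def)

lemma potential_grad_bound:
  assumes m: "m = DIM('a) / 2" and g: "\<And>w. \<bar>g w\<bar> \<le> 1"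
  shows "norm (potential_grad g z) \<le> 2 * (20 + 2 * L) * weight_mass (m + 1/2)"
  unfolding potential_grad_def
proof (rule potential_estimate[OF m g])
  show "norm (DK (z - w)) \<le> (20 + 2 * L) * (cut_weight (m + 1/2) (z - w) + cut_weight (m + 1/2) (z - w))" for w
    by (rule order_trans[OF norm_DK_le mult_left_mono]) (use L_nonneg cut_weight_nonneg[of "m + 1/2" "z - w"] in auto)
qed (use m L_nonneg in auto)

lemma potential_holder_time:
  assumes m: "m = DIM('a) / 2" and gm: "g \<in> borel_measurable borel" and g: "\<And>w. \<bar>g w\<bar> \<le> 1"
    and t: "\<bar>t - t'\<bar> \<le> 1" and b: "0 \<le> b" "b < 1"
  shows "\<bar>potential g (x, t) - potential g (x, t')\<bar> \<le> 2 * (m + 2 + 2 * L) * weight_mass (m + b) * \<bar>t - t'\<bar> powr b"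
proof -
  note i = kernel_integrable(1)[OF m gm g]
  have "potential g (x, t) - potential g (x, t') = (\<integral>w. g w *\<^sub>R (K ((x, t) - w) - K ((x, t') - w)) \<partial>lborel)"
    unfolding potential_def by (subst Bochner_Integration.integral_diff[symmetric]) (use i in \<open>simp_all add: right_diff_distrib\<close>)
  also have "norm \<dots> \<le> 2 * ((m + 2 + 2 * L) * \<bar>t - t'\<bar> powr b) * weight_mass (m + b)"
  proof (rule potential_estimate[OF m g])
    show "norm (K ((x, t) - w) - K ((x, t') - w)) \<le> (m + 2 + 2 * L) * \<bar>t - t'\<bar> powr b * (cut_weight (m + b) ((x, t) - w) + cut_weight (m + b) ((x, t') - w))" for w
      using K_holder_time[of "t - snd w" "t' - snd w" b "x - fst w"] t b by (cases w) simp
  qed (use m b L_nonneg in auto)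
  finally show ?thesis by (simp only: real_norm_def ac_simps)
qed

lemma potential_grad_holder_time:
  assumes m: "m = DIM('a) / 2" and gm: "g \<in> borel_measurable borel" and g: "\<And>w. \<bar>g w\<bar> \<le> 1"
    and t: "\<bar>t - t'\<bar> \<le> 1" and b: "0 \<le> b" "b < 1/2"
  shows "norm (potential_grad g (x, t) - potential_grad g (x, t')) \<le>
    2 * (10 * (m + 3) + 44 * L + 2 * L * (m + 2)) * weight_mass (m + 1/2 + b) * \<bar>t - t'\<bar> powr b"
proof -
  note i = kernel_integrable(2)[OF m gm g]
  have "potential_grad g (x, t) - potential_grad g (x, t') = (\<integral>w. g w *\<^sub>R (DK ((x, t) - w) - DK ((x, t') - w)) \<partial>lborel)"
    unfolding potential_grad_def by (subst Bochner_Integration.integral_diff[symmetric]) (use i in \<open>simp_all add: scaleR_diff_right\<close>)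
  also have "norm \<dots> \<le> 2 * ((10 * (m + 3) + 44 * L + 2 * L * (m + 2)) * \<bar>t - t'\<bar> powr b) * weight_mass (m + 1/2 + b)"
  proof (rule potential_estimate[OF m g])
    show "norm (DK ((x, t) - w) - DK ((x, t') - w)) \<le> (10 * (m + 3) + 44 * L + 2 * L * (m + 2)) * \<bar>t - t'\<bar> powr b * (cut_weight (m + 1/2 + b) ((x, t) - w) + cut_weight (m + 1/2 + b) ((x, t') - w))" for w
      using DK_holder_time[of "t - snd w" "t' - snd w" b "x - fst w"] t b by (cases w) simp
  qed (use m b L_nonneg m_nonneg in \<open>auto intro!: mult_nonneg_nonneg add_nonneg_nonneg\<close>)
  finally show ?thesis by (simp only: real_norm_def ac_simps)
qed

lemma potential_grad_holder_space:
  assumes m: "m = DIM('a) / 2" and gm: "g \<in> borel_measurable borel" and g: "\<And>w. \<bar>g w\<bar> \<le> 1"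
    and x: "norm (x - x') \<le> 1" and a: "0 \<le> a" "a < 1"
  shows "norm (potential_grad g (x, t) - potential_grad g (x', t)) \<le>
    2 * (6 + 44 * L + 2 * L * 6) * weight_mass (m + 1/2 + a/2) * norm (x - x') powr a"
proof -
  note i = kernel_integrable(2)[OF m gm g]
  have "potential_grad g (x, t) - potential_grad g (x', t) = (\<integral>w. g w *\<^sub>R (DK ((x, t) - w) - DK ((x', t) - w)) \<partial>lborel)"
    unfolding potential_grad_def by (subst Bochner_Integration.integral_diff[symmetric]) (use i in \<open>simp_all add: scaleR_diff_right\<close>)
  also have "norm \<dots> \<le> 2 * ((6 + 44 * L + 2 * L * 6) * norm (x - x') powr a) * weight_mass (m + 1/2 + a/2)"
  proof (rule potential_estimate[OF m g])
    show "norm (DK ((x, t) - w) - DK ((x', t) - w)) \<le> (6 + 44 * L + 2 * L * 6) * norm (x - x') powr a * (cut_weight (m + 1/2 + a/2) ((x, t) - w) + cut_weight (m + 1/2 + a/2) ((x', t) - w))" for w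
      using DK_holder_space[of "x - fst w" "x' - fst w" a "t - snd w"] x a by (cases w) simp
  qed (use m a L_nonneg in auto)
  finally show ?thesis by (simp only: real_norm_def ac_simps)
qed

text \<open>No limit is exchanged with an integral: the candidate for the gradient is the integral
  of the gradient of the kernel, and the Taylor remainder of the kernel is integrated with its
  quantitative bound.\<close>

lemma potential_taylor:
  assumes m: "m = DIM('a) / 2" and gm: "g \<in> borel_measurable borel" and g: "\<And>w. \<bar>g w\<bar> \<le> 1"
    and v: "norm v \<le> 1" and a: "0 \<le> a" "a < 1"
  shows "\<bar>potential g (x + v, t) - potential g (x, t) - potential_grad g (x, t) \<bullet> v\<bar> \<le>
    2 * (6 + 42 * L) * weight_mass (m + 1/2 + a/2) * norm v powr (1 + a)"
proof -
  note i1 = kernel_integrable(1)[OF m gm g] and i2 = kernel_integrable(2)[OF m gm g]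
  let ?z = "(x, t)" and ?z' = "(x + v, t)"
  have ih: "integrable lborel (\<lambda>w. (g w *\<^sub>R DK (?z - w)) \<bullet> v)" by (rule integrable_inner_left) (rule i2)
  have "potential_grad g ?z \<bullet> v = (\<integral>w. g w *\<^sub>R (DK (?z - w) \<bullet> v) \<partial>lborel)"
    unfolding potential_grad_def by (subst integral_inner_left[symmetric]) (use i2 in simp_all)
  then have "potential g ?z' - potential g ?z - potential_grad g ?z \<bullet> v =
      (\<integral>w. g w * K (?z' - w) \<partial>lborel) - (\<integral>w. g w * K (?z - w) \<partial>lborel) - (\<integral>w. g w *\<^sub>R (DK (?z - w) \<bullet> v) \<partial>lborel)"
    by (simp add: potential_def)
  also have "\<dots> = (\<integral>w. (g w * K (?z' - w) - g w * K (?z - w)) - g w *\<^sub>R (DK (?z - w) \<bullet> v) \<partial>lborel)"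
    using i1[of ?z'] i1[of ?z] ih by simp
  also have "\<dots> = (\<integral>w. g w *\<^sub>R (K (?z' - w) - K (?z - w) - DK (?z - w) \<bullet> v) \<partial>lborel)"
    by (rule Bochner_Integration.integral_cong) (simp_all add: algebra_simps)
  finally have d: "potential g ?z' - potential g ?z - potential_grad g ?z \<bullet> v =
     (\<integral>w. g w *\<^sub>R (K (?z' - w) - K (?z - w) - DK (?z - w) \<bullet> v) \<partial>lborel)" .
  have "norm (\<integral>w. g w *\<^sub>R (K (?z' - w) - K (?z - w) - DK (?z - w) \<bullet> v) \<partial>lborel) \<le>
     2 * ((6 + 42 * L) * norm v powr (1 + a)) * weight_mass (m + 1/2 + a/2)"
  proof (rule potential_estimate[OF m g])
    show "norm (K (?z' - w) - K (?z - w) - DK (?z - w) \<bullet> v) \<le> (6 + 42 * L) * norm v powr (1 + a) * (cut_weight (m + 1/2 + a/2) (?z - w) + cut_weight (m + 1/2 + a/2) (?z' - w))" for w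
      using K_taylor_space[of v a "x - fst w" "t - snd w"] v a by (cases w) (simp add: algebra_simps)
  qed (use m a L_nonneg in auto)
  then show ?thesis unfolding d by (simp only: real_norm_def ac_simps)
qed

end

section \<open>The heat potential of a graph\<close>

text \<open>If the function has a zero, this is c. If not, it has constant sign by connectedness,
  and where it is positive its minimum point serves as c. In both cases a positive value is at least
  the expansion from c.\<close>

lemma monotone_distance_to_zero:
  fixes h :: "real \<Rightarrow> real"
  assumes "l \<ge> 0" "continuous_on {0..l} h"
    and exp: "\<And>x y. x \<in> {0..l} \<Longrightarrow> y \<in> {0..l} \<Longrightarrow> \<bar>h x - h y\<bar> \<ge> q * \<bar>x - y\<bar>"
  obtains c where "\<And>x. x \<in> {0..l} \<Longrightarrow> h x > 0 \<Longrightarrow> h x \<ge> q * \<bar>x - c\<bar>"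
proof (cases "\<exists>c\<in>{0..l}. h c = 0")
  case True
  then obtain c where c: "c \<in> {0..l}" "h c = 0" by blast
  show ?thesis
  proof (rule that)
    fix x assume "x \<in> {0..l}" "h x > 0" then show "h x \<ge> q * \<bar>x - c\<bar>" using exp[of x c] c by simp
  qed
next
  case False
  obtain c where c: "c \<in> {0..l}" "\<And>x. x \<in> {0..l} \<Longrightarrow> h c \<le> h x"
    using continuous_attains_inf[OF compact_Icc _ assms(2)] assms(1) by auto
  have conn: "connected (h ` {0..l})" using assms(2) by (intro connected_continuous_image) auto
  show ?thesis
  proof (rule that)
    fix x assume x: "x \<in> {0..l}" "h x > 0"
    have "h c > 0"
    proof (rule ccontr)
      assume "\<not> h c > 0"
      then have "0 \<in> h ` {0..l}"
        using connectedD_interval[OF conn, of "h c" "h x" 0] c x by auto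
      then show False using False by auto
    qed
    then show "h x \<ge> q * \<bar>x - c\<bar>" using exp[OF x(1) c(1)] c(2)[OF x(1)] by simp
  qed
qed

text \<open>The positive part of \<open>h\<close> dominates q |x - c|, so the integrand is compared
  with a power of the distance to one point, integrable since k < 1. No formula for \<open>h\<close>
  or its inverse enters.\<close>

lemma nn_integral_expanding_powr_le:
  fixes h :: "real \<Rightarrow> real"
  assumes "l > 0" "continuous_on {0..l} h" "q > 0" "0 \<le> k" "k < 1"
    and "\<And>x y. x \<in> {0..l} \<Longrightarrow> y \<in> {0..l} \<Longrightarrow> \<bar>h x - h y\<bar> \<ge> q * \<bar>x - y\<bar>"
    and g: "\<And>x. x \<in> {0..l} \<Longrightarrow> g x \<le> (if h x > 0 then ennreal (h x powr (- k)) else 0)"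
  shows "(\<integral>\<^sup>+x. indicator {0..l} x * g x \<partial>lborel) \<le> ennreal (q powr (- k) * (2 * (l powr (1 - k) / (1 - k))))"
proof -
  obtain c0 where c0: "\<And>x. x \<in> {0..l} \<Longrightarrow> h x > 0 \<Longrightarrow> h x \<ge> q * \<bar>x - c0\<bar>"
    using monotone_distance_to_zero[of l h q] assms by (metis less_imp_le)
  \<comment> \<open>Clamping does not increase the distance to points of the interval, and it
    ensures that [c - l, c + l] covers the interval.\<close>
  define c where "c = max 0 (min l c0)"
  have c: "c \<in> {0..l}" using assms(1) by (auto simp: c_def)
  have cc: "\<bar>x - c\<bar> \<le> \<bar>x - c0\<bar>" if "x \<in> {0..l}" for x using that by (auto simp: c_def)
  have "(\<integral>\<^sup>+x. indicator {0..l} x * g x \<partial>lborel) \<le>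
    (\<integral>\<^sup>+x. ennreal (q powr (- k)) * (indicator {c - l..c + l} x * inverse (ennreal (\<bar>x - c\<bar> powr k))) \<partial>lborel)"
  proof (rule nn_integral_mono)
    fix x
    show "indicator {0..l} x * g x \<le> ennreal (q powr (- k)) * (indicator {c - l..c + l} x * inverse (ennreal (\<bar>x - c\<bar> powr k)))"
    proof (cases "x \<in> {0..l} \<and> h x > 0")
      case True
      have hx: "h x \<ge> q * \<bar>x - c\<bar>"
      proof -
        have "q * \<bar>x - c\<bar> \<le> q * \<bar>x - c0\<bar>" using cc[of x] True assms(3) by (intro mult_left_mono) auto
        then show ?thesis using c0[of x] True by auto
      qed
      have "g x \<le> ennreal (h x powr (- k))" using g[of x] True by auto
      also have "\<dots> \<le> ennreal (q powr (- k)) * inverse (ennreal (\<bar>x - c\<bar> powr k))"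
      proof (cases "x = c")
        case True
        then show ?thesis using assms(3) by (simp add: ennreal_mult_top)
      next
        case False
        have "h x powr (- k) \<le> (q * \<bar>x - c\<bar>) powr (- k)" using hx False assms by (intro powr_mono2') auto
        also have "\<dots> = q powr (- k) * \<bar>x - c\<bar> powr (- k)" using assms by (simp add: powr_mult)
        finally show ?thesis using False by (simp add: inverse_ennreal powr_minus ennreal_leI flip: ennreal_mult)
      qed
      finally show ?thesis using True c by (auto simp: indicator_def)
    next
      case False
      then have "indicator {0..l} x * g x = 0" using g[of x] by (auto simp: indicator_def)
      then show ?thesis by (simp only: zero_le)
    qed
  qed
  also have "\<dots> = ennreal (q powr (- k)) * (\<integral>\<^sup>+x. indicator {c - l..c + l} x * inverse (ennreal (\<bar>x - c\<bar> powr k)) \<partial>lborel)"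
    by (rule nn_integral_cmult) simp
  also have "\<dots> \<le> ennreal (q powr (- k)) * ennreal (2 * (l powr (1 - k) / (1 - k)))"
    by (intro mult_left_mono nn_integral_abs_powr_le) (use assms in auto)
  also have "\<dots> = ennreal (q powr (- k) * (2 * (l powr (1 - k) / (1 - k))))"
    using assms by (subst ennreal_mult) auto
  finally show ?thesis .
qed

text \<open>Replaces an explicit splitting of the space into lines parallel to \<open>i\<close>: the
  integral is averaged over its translates along \<open>i\<close>, and the two integrations are
  exchanged.\<close>

lemma nn_integral_average_line:
  fixes F :: "'a::euclidean_space \<Rightarrow> ennreal"
  assumes [measurable]: "F \<in> borel_measurable borel" and l: "l > 0"
  shows "ennreal l * (\<integral>\<^sup>+y. F y \<partial>lborel) = (\<integral>\<^sup>+y. \<integral>\<^sup>+\<theta>. indicator {0..l} \<theta> * F (y + \<theta> *\<^sub>R i) \<partial>lborel \<partial>lborel)"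
proof -
  have "(\<integral>\<^sup>+\<theta>. indicator {0..l} \<theta> * (\<integral>\<^sup>+y. F y \<partial>lborel) \<partial>lborel) = ennreal l * (\<integral>\<^sup>+y. F y \<partial>lborel)"
    using l by (simp add: nn_integral_multc)
  then have "ennreal l * (\<integral>\<^sup>+y. F y \<partial>lborel) = (\<integral>\<^sup>+\<theta>. indicator {0..l} \<theta> * (\<integral>\<^sup>+y. F (y + \<theta> *\<^sub>R i) \<partial>lborel) \<partial>lborel)"
    by (simp add: nn_integral_translate)
  also have "\<dots> = (\<integral>\<^sup>+\<theta>. \<integral>\<^sup>+y. indicator {0..l} \<theta> * F (y + \<theta> *\<^sub>R i) \<partial>lborel \<partial>lborel)"
    by (simp add: nn_integral_cmult)
  also have "\<dots> = (\<integral>\<^sup>+y. \<integral>\<^sup>+\<theta>. indicator {0..l} \<theta> * F (y + \<theta> *\<^sub>R i) \<partial>lborel \<partial>lborel)"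
    by (rule lborel_pair.Fubini') measurable
  finally show ?thesis .
qed

lemma sing_prod_translate: "i \<in> Basis \<Longrightarrow> J \<subseteq> Basis - {i} \<Longrightarrow> sing_prod b J (y - \<theta> *\<^sub>R i) = sing_prod b J y"
  unfolding sing_prod_def
proof (rule prod.cong[OF refl])
  fix x assume "i \<in> Basis" "J \<subseteq> Basis - {i}" "x \<in> J"
  then have "i \<bullet> x = 0" using inner_not_same_Basis[of i x] by blast
  then show "inverse (ennreal (\<bar>(y - \<theta> *\<^sub>R i) \<bullet> x\<bar> powr (2 * b))) = inverse (ennreal (\<bar>y \<bullet> x\<bar> powr (2 * b)))"
    by (simp add: inner_diff_left)
qed

text \<open>Along a line in direction \<open>i\<close> the product over the other directions is
  constant, and the power of \<open>v\<close> is integrated by the expansion property. A segment of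
  length l meets the ball of radius l only if it starts within 2 l of \<open>z\<close>, which is
  where the hypotheses on \<open>v\<close> are made.\<close>

lemma nn_integral_near_le:
  fixes z i :: "'a::euclidean_space" and v :: "'a \<Rightarrow> real" and b k l q :: real
  assumes i: "i \<in> Basis" and l: "0 < l" "l \<le> 1" and b: "0 \<le> b" "b < 1/2" and k: "0 \<le> k" "k < 1" and q: "q > 0"
    and [measurable]: "v \<in> borel_measurable borel"
    and cont: "\<And>y. norm (z - y) \<le> 2 * l \<Longrightarrow> continuous_on {0..l} (\<lambda>\<theta>. v (y + \<theta> *\<^sub>R i))"
    and exp: "\<And>y \<theta> \<theta>'. norm (z - y) \<le> 2 * l \<Longrightarrow> \<theta> \<in> {0..l} \<Longrightarrow> \<theta>' \<in> {0..l} \<Longrightarrow> \<bar>v (y + \<theta> *\<^sub>R i) - v (y + \<theta>' *\<^sub>R i)\<bar> \<ge> q * \<bar>\<theta> - \<theta>'\<bar>"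
  shows "(\<integral>\<^sup>+y. indicator (cball z l) y * (sing_prod b (Basis - {i}) (z - y) * (if v y > 0 then ennreal (v y powr (- k)) else 0)) \<partial>lborel)
     \<le> ennreal (8 * q powr (- k) * (l powr (1 - k) / (1 - k)) * (4 / (1 - 2 * b)) ^ (DIM('a) - 1))"
proof -
  let ?J = "Basis - {i}"
  define \<phi> where "\<phi> y = (if v y > 0 then ennreal (v y powr (- k)) else 0)" for y
  have [measurable]: "\<phi> \<in> borel_measurable borel" unfolding \<phi>_def[abs_def] by measurable
  have [measurable]: "cball z l \<in> sets borel" by simp
  define F where "F y = indicator (cball z l) y * (sing_prod b ?J (z - y) * \<phi> y)" for y
  have [measurable]: "F \<in> borel_measurable borel" unfolding F_def[abs_def] by measurable
  define I where "I = q powr (- k) * (2 * (l powr (1 - k) / (1 - k)))"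
  have I0: "I \<ge> 0" unfolding I_def using k by auto
  define box where "box y = (\<Prod>j\<in>Basis. indicator {- (2 * l)..2 * l} (y \<bullet> j) :: ennreal)" for y :: 'a
  have [measurable]: "box \<in> borel_measurable borel" unfolding box_def[abs_def] by measurable
  have inner: "(\<integral>\<^sup>+\<theta>. indicator {0..l} \<theta> * F (y + \<theta> *\<^sub>R i) \<partial>lborel) \<le> box (z - y) * sing_prod b ?J (z - y) * ennreal I" for y
  proof (cases "norm (z - y) \<le> 2 * l")
    case True
    have box1: "box (z - y) = 1" using norm_le_coords(1)[of "z - y" 0 "2 * l"] True by (simp add: box_def)
    have Fe: "F (y + \<theta> *\<^sub>R i) \<le> sing_prod b ?J (z - y) * \<phi> (y + \<theta> *\<^sub>R i)" for \<theta>
      using sing_prod_translate[OF i order_refl, of b "z - y" \<theta>] by (auto simp: F_def indicator_def diff_diff_add)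
    have "(\<integral>\<^sup>+\<theta>. indicator {0..l} \<theta> * F (y + \<theta> *\<^sub>R i) \<partial>lborel) \<le>
       (\<integral>\<^sup>+\<theta>. sing_prod b ?J (z - y) * (indicator {0..l} \<theta> * \<phi> (y + \<theta> *\<^sub>R i)) \<partial>lborel)"
      using Fe by (intro nn_integral_mono) (auto simp: indicator_def)
    also have "\<dots> = sing_prod b ?J (z - y) * (\<integral>\<^sup>+\<theta>. indicator {0..l} \<theta> * \<phi> (y + \<theta> *\<^sub>R i) \<partial>lborel)"
      by (rule nn_integral_cmult) measurable
    also have "\<dots> \<le> sing_prod b ?J (z - y) * ennreal I"
      unfolding I_def
      by (intro mult_left_mono nn_integral_expanding_powr_le[OF l(1) cont[OF True] q k exp[OF True]]) (auto simp: \<phi>_def)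
    finally show ?thesis by (simp add: box1)
  next
    case False
    have F0: "F (y + \<theta> *\<^sub>R i) = 0" if "\<theta> \<in> {0..l}" for \<theta>
    proof -
      have "norm (z - y) \<le> norm (z - (y + \<theta> *\<^sub>R i)) + norm (\<theta> *\<^sub>R i)"
        using norm_triangle_ineq[of "z - (y + \<theta> *\<^sub>R i)" "\<theta> *\<^sub>R i"] by simp
      also have "norm (\<theta> *\<^sub>R i) \<le> l" using that i by simp
      finally have "norm (z - (y + \<theta> *\<^sub>R i)) > l" using False by simp
      then show ?thesis by (simp add: F_def dist_norm)
    qed
    have "(\<integral>\<^sup>+\<theta>. indicator {0..l} \<theta> * F (y + \<theta> *\<^sub>R i) \<partial>lborel) = (\<integral>\<^sup>+(\<theta>::real). 0 \<partial>lborel)"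
      by (rule nn_integral_cong) (auto simp: indicator_def F0)
    then show ?thesis by simp
  qed
  have "ennreal l * (\<integral>\<^sup>+y. F y \<partial>lborel) \<le> (\<integral>\<^sup>+y. box (z - y) * sing_prod b ?J (z - y) * ennreal I \<partial>lborel)"
    unfolding nn_integral_average_line[OF \<open>F \<in> borel_measurable borel\<close> l(1), of i] by (intro nn_integral_mono inner)
  also have "\<dots> = (\<integral>\<^sup>+y. box y * sing_prod b ?J y * ennreal I \<partial>lborel)"
    by (rule nn_integral_reflect[of "\<lambda>y. box y * sing_prod b ?J y * ennreal I"]) measurable
  also have "\<dots> = (\<integral>\<^sup>+y. box y * sing_prod b ?J y \<partial>lborel) * ennreal I"
    by (rule nn_integral_multc) measurable
  also have "\<dots> \<le> (ennreal (2 * (2 * l)) ^ (DIM('a) - card ?J) * ennreal (2 * ((2 * l) powr (1 - 2 * b) / (1 - 2 * b))) ^ card ?J) * ennreal I"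
    unfolding box_def by (intro mult_right_mono nn_integral_sing_prod_le) (use b l in auto)
  also have "\<dots> \<le> (ennreal (4 * l) * ennreal (4 / (1 - 2 * b)) ^ (DIM('a) - 1)) * ennreal I"
  proof -
    have c: "card ?J = DIM('a) - 1" "DIM('a) - card ?J = 1" using i DIM_positive[where 'a='a] by (auto simp: card_Diff_subset)
    have "(2 * l) powr (1 - 2 * b) \<le> 2 powr (1 - 2 * b)" using l b by (intro powr_mono2) auto
    also have "\<dots> \<le> 2 powr 1" using b by (intro powr_mono) auto
    finally have "2 * ((2 * l) powr (1 - 2 * b) / (1 - 2 * b)) \<le> 4 / (1 - 2 * b)" using b by (simp add: divide_right_mono)
    then have "ennreal (2 * ((2 * l) powr (1 - 2 * b) / (1 - 2 * b))) ^ (DIM('a) - 1) \<le> ennreal (4 / (1 - 2 * b)) ^ (DIM('a) - 1)"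
      by (intro power_mono ennreal_leI) auto
    then show ?thesis unfolding c by (intro mult_right_mono) (auto intro!: mult_mono)
  qed
  \<comment> \<open>The edge 4 l of the box in direction \<open>i\<close>, the only direction
    without a singularity, supplies the factor l that cancels against the averaging.\<close>
  also have "\<dots> = ennreal l * ennreal (4 * (4 / (1 - 2 * b)) ^ (DIM('a) - 1) * I)"
    using l b I0 by (simp add: ennreal_power ennreal_mult[symmetric] ac_simps)
  finally have "ennreal l * (\<integral>\<^sup>+y. F y \<partial>lborel) \<le> ennreal l * ennreal (4 * (4 / (1 - 2 * b)) ^ (DIM('a) - 1) * I)" .
  then have "(\<integral>\<^sup>+y. F y \<partial>lborel) \<le> ennreal (4 * (4 / (1 - 2 * b)) ^ (DIM('a) - 1) * I)"
    using l by (simp add: ennreal_mult_le_mult_iff)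
  then show ?thesis by (simp add: F_def \<phi>_def I_def ac_simps)
qed

text \<open>At distance more than l from \<open>z\<close> the weight is bounded independently of the
  time argument, so the bound is the same for every graph and depends on the radius only through
  l^(-2k).\<close>

lemma nn_integral_far_le:
  fixes z :: "'a::euclidean_space" and H :: "'a \<Rightarrow> real" and b k m l s :: real
  assumes b: "0 < b" "b < 1/2" and k: "k = m - b * DIM('a)" "k > 0" and l: "l > 0"
  shows "(\<integral>\<^sup>+y. indicator (- cball z l) y * ennreal (cut_weight m (z - y, s - H y)) \<partial>lborel) \<le>
     ennreal ((64 * k) powr k * (b * 64) powr (b * DIM('a)) * (4 / (1 - 2 * b)) ^ DIM('a) * l powr (- (2 * k)))"
proof -
  define C where "C = (64 * k) powr k * (b * 64) powr (b * DIM('a)) * l powr (- (2 * k))"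
  define box where "box y = (\<Prod>j\<in>Basis. indicator {- 2..2} (y \<bullet> j) :: ennreal)" for y :: 'a
  have [measurable]: "box \<in> borel_measurable borel" unfolding box_def[abs_def] by measurable
  have "(\<integral>\<^sup>+y. indicator (- cball z l) y * ennreal (cut_weight m (z - y, s - H y)) \<partial>lborel) \<le>
     (\<integral>\<^sup>+y. ennreal C * (box (z - y) * sing_prod b Basis (z - y)) \<partial>lborel)"
  proof (rule nn_integral_mono)
    fix y
    show "indicator (- cball z l) y * ennreal (cut_weight m (z - y, s - H y)) \<le> ennreal C * (box (z - y) * sing_prod b Basis (z - y))"
    proof (cases "norm (z - y) > l \<and> norm (z - y, s - H y) \<le> 2")
      case True
      have ne: "z - y \<noteq> 0" using True l by auto
      have box1: "box (z - y) = 1" using norm_le_coords(1)[of "z - y" "s - H y" 2] True by (simp add: box_def)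
      have "ennreal (cut_weight m (z - y, s - H y)) \<le>
        ennreal ((2 * 32 * k) powr k * (b * (2 * 32)) powr (b * DIM('a)) * norm (z - y) powr (- (2 * k))) * sing_prod b Basis (z - y)"
        using heat_weight_far_le[OF b(1) _ ne k, of 32 "s - H y"] True by (simp add: cut_weight_def)
      also have "\<dots> \<le> ennreal C * sing_prod b Basis (z - y)"
      proof (intro mult_right_mono ennreal_leI)
        have "norm (z - y) powr (- (2 * k)) \<le> l powr (- (2 * k))" using True k l by (intro powr_mono2') auto
        then show "(2 * 32 * k) powr k * (b * (2 * 32)) powr (b * DIM('a)) * norm (z - y) powr (- (2 * k)) \<le> C"
          unfolding C_def by (simp add: mult_left_mono)
      qed auto
      finally show ?thesis using True by (simp add: box1 dist_norm indicator_def)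
    next
      case False
      then have "indicator (- cball z l) y * ennreal (cut_weight m (z - y, s - H y)) = 0"
        by (auto simp: indicator_def dist_norm cut_weight_def)
      then show ?thesis by (simp only: zero_le)
    qed
  qed
  also have "\<dots> = (\<integral>\<^sup>+y. ennreal C * (box y * sing_prod b Basis y) \<partial>lborel)"
    by (rule nn_integral_reflect[of "\<lambda>y. ennreal C * (box y * sing_prod b Basis y)"]) measurable
  also have "\<dots> = ennreal C * (\<integral>\<^sup>+y. box y * sing_prod b Basis y \<partial>lborel)"
    by (rule nn_integral_cmult) measurable
  also have "\<dots> \<le> ennreal C * (ennreal (2 * 2) ^ (DIM('a) - card (Basis :: 'a set)) * ennreal (2 * (2 powr (1 - 2 * b) / (1 - 2 * b))) ^ card (Basis :: 'a set))"
    unfolding box_def by (intro mult_left_mono nn_integral_sing_prod_le) (use b in auto)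
  also have "\<dots> \<le> ennreal C * ennreal (4 / (1 - 2 * b)) ^ DIM('a)"
  proof (rule mult_left_mono)
    have "2 powr (1 - 2 * b) \<le> 2 powr 1" using b by (intro powr_mono) auto
    then have "2 * (2 powr (1 - 2 * b) / (1 - 2 * b)) \<le> 4 / (1 - 2 * b)" using b by (simp add: divide_right_mono)
    then show "ennreal (2 * 2) ^ (DIM('a) - card (Basis :: 'a set)) * ennreal (2 * (2 powr (1 - 2 * b) / (1 - 2 * b))) ^ card (Basis :: 'a set) \<le> ennreal (4 / (1 - 2 * b)) ^ DIM('a)"
      by (simp add: power_mono ennreal_leI)
  qed simp
  also have "\<dots> = ennreal ((64 * k) powr k * (b * 64) powr (b * DIM('a)) * (4 / (1 - 2 * b)) ^ DIM('a) * l powr (- (2 * k)))"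
    using b by (simp add: C_def ennreal_power ennreal_mult[symmetric] ac_simps)
  finally show ?thesis .
qed

text \<open>The size of the heat potential of the graph of \<open>H\<close>. Near \<open>z\<close> the factors of the Gaussian in
  the directions other than \<open>i\<close> are spent on integrable singularities; what remains is a
  power of \<open>s - H y\<close>, which is integrable in the direction \<open>i\<close> because \<open>v\<close>, and with it
  \<open>s - H\<close>, grows in that direction.\<close>

lemma nn_integral_graph_weight_le:
  fixes z i :: "'a::euclidean_space" and v H :: "'a \<Rightarrow> real" and b k m l s q B \<kappa> \<beta> :: real
  assumes i: "i \<in> Basis" and l: "0 < l" "l \<le> 1" and b: "0 < b" "b < 1/2"
    and \<kappa>: "\<kappa> = m - b * (real DIM('a) - 1)" "\<kappa> > 0" and \<beta>: "\<kappa> < \<beta>" and k: "k = m - b * DIM('a)" "k > 0"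
    and q: "q > 0" and B: "B > 0"
    and [measurable]: "v \<in> borel_measurable borel" "H \<in> borel_measurable borel"
    and cont: "\<And>y. norm (z - y) \<le> 2 * l \<Longrightarrow> continuous_on {0..l} (\<lambda>\<theta>. v (y + \<theta> *\<^sub>R i))"
    and exp: "\<And>y \<theta> \<theta>'. norm (z - y) \<le> 2 * l \<Longrightarrow> \<theta> \<in> {0..l} \<Longrightarrow> \<theta>' \<in> {0..l} \<Longrightarrow> \<bar>v (y + \<theta> *\<^sub>R i) - v (y + \<theta>' *\<^sub>R i)\<bar> \<ge> q * \<bar>\<theta> - \<theta>'\<bar>"
    and vH: "\<And>y. norm (z - y) \<le> l \<Longrightarrow> H y < s \<Longrightarrow> 0 < v y \<and> v y \<le> B * (s - H y) powr \<beta>"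
  shows "(\<integral>\<^sup>+y. ennreal (cut_weight m (z - y, s - H y)) \<partial>lborel) \<le>
    ennreal ((b * 32) powr (b * (real DIM('a) - 1)) * B powr (\<kappa> / \<beta>) * (8 * q powr (- (\<kappa> / \<beta>)) * (l powr (1 - \<kappa> / \<beta>) / (1 - \<kappa> / \<beta>)) * (4 / (1 - 2 * b)) ^ (DIM('a) - 1))
     + (64 * k) powr k * (b * 64) powr (b * DIM('a)) * (4 / (1 - 2 * b)) ^ DIM('a) * l powr (- (2 * k)))"
proof -
  let ?e = "\<kappa> / \<beta>"
  let ?J = "Basis - {i}"
  have \<beta>0: "\<beta> > 0" using \<kappa> \<beta> by simp
  have lam: "0 \<le> ?e" "?e < 1" using \<kappa> \<beta> \<beta>0 by auto
  have cJ: "card ?J = DIM('a) - 1" using i by (simp add: card_Diff_subset)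
  have cJr: "real (card ?J) = real DIM('a) - 1" using cJ DIM_positive[where 'a='a] by (simp add: of_nat_diff)
  define A where "A = (b * 32) powr (b * (real DIM('a) - 1)) * B powr ?e"
  define \<phi> where "\<phi> y = (if v y > 0 then ennreal (v y powr (- ?e)) else 0)" for y
  have [measurable]: "\<phi> \<in> borel_measurable borel" unfolding \<phi>_def[abs_def] by measurable
  have [measurable]: "cball z l \<in> sets borel" by simp
  have cm[measurable]: "(\<lambda>y. cut_weight m (z - y, s - H y)) \<in> borel_measurable borel"
    by (rule measurable_compose[OF _ borel_measurable_cut_weight]) (simp add: borel_prod[symmetric])
  have near: "indicator (cball z l) y * ennreal (cut_weight m (z - y, s - H y)) \<le> ennreal A * (indicator (cball z l) y * (sing_prod b ?J (z - y) * \<phi> y))" for y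
  proof (cases "norm (z - y) \<le> l \<and> H y < s")
    case True
    let ?t = "s - H y"
    have t: "?t > 0" using True by simp
    have v: "0 < v y" "v y \<le> B * ?t powr \<beta>" using vH True by auto
    have "ennreal (cut_weight m (z - y, ?t)) \<le> ennreal (heat_weight 32 m (z - y, ?t))"
      by (intro ennreal_leI) (simp add: cut_weight_def heat_weight_nonneg)
    also have "\<dots> \<le> ennreal ((b * 32) powr (b * card ?J) * ?t powr (b * card ?J - m)) * sing_prod b ?J (z - y)"
      by (rule heat_weight_le_sing_prod) (use b t in auto)
    also have "\<dots> \<le> ennreal (A * v y powr (- ?e)) * sing_prod b ?J (z - y)"
    proof (intro mult_right_mono ennreal_leI)
      have e: "b * card ?J - m = - \<kappa>" unfolding cJr \<kappa> by simp
      \<comment> \<open>The Hoelder bound v <= B t^\<beta> converts the remaining power of t into a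
        power of \<open>v\<close>. Its exponent \<kappa>/\<beta> is below 1 exactly because \<kappa>
        < \<beta>.\<close>
      have "?t powr (- \<kappa>) = (?t powr \<beta>) powr (- ?e)" using \<beta>0 by (simp add: powr_powr)
      also have "\<dots> \<le> (v y / B) powr (- ?e)"
        using v B lam t by (intro powr_mono2') (auto simp: divide_le_eq mult.commute)
      also have "\<dots> = B powr ?e * v y powr (- ?e)" using v B by (simp add: powr_divide powr_minus field_simps)
      finally have "?t powr (- \<kappa>) \<le> B powr ?e * v y powr (- ?e)" .
      from mult_left_mono[OF this, of "(b * 32) powr (b * (real DIM('a) - 1))"]
      show "(b * 32) powr (b * card ?J) * ?t powr (b * card ?J - m) \<le> A * v y powr (- ?e)"
        unfolding e unfolding cJr A_def by (simp add: mult.assoc)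
    qed auto
    finally have "ennreal (cut_weight m (z - y, ?t)) \<le> ennreal (A * v y powr (- ?e)) * sing_prod b ?J (z - y)" .
    then show ?thesis using True v by (simp add: A_def \<phi>_def dist_norm ennreal_mult' ac_simps)
  next
    case False
    then have "indicator (cball z l) y * ennreal (cut_weight m (z - y, s - H y)) = 0"
      by (auto simp: indicator_def dist_norm cut_weight_def heat_weight_def)
    then show ?thesis by (simp only: zero_le)
  qed
  have "(\<integral>\<^sup>+y. ennreal (cut_weight m (z - y, s - H y)) \<partial>lborel) =
     (\<integral>\<^sup>+y. indicator (cball z l) y * ennreal (cut_weight m (z - y, s - H y)) + indicator (- cball z l) y * ennreal (cut_weight m (z - y, s - H y)) \<partial>lborel)"
    by (rule nn_integral_cong) (simp split: split_indicator)
  also have "\<dots> = (\<integral>\<^sup>+y. indicator (cball z l) y * ennreal (cut_weight m (z - y, s - H y)) \<partial>lborel) +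
     (\<integral>\<^sup>+y. indicator (- cball z l) y * ennreal (cut_weight m (z - y, s - H y)) \<partial>lborel)"
    by (rule nn_integral_add) measurable
  also have "\<dots> \<le> ennreal (A * (8 * q powr (- ?e) * (l powr (1 - ?e) / (1 - ?e)) * (4 / (1 - 2 * b)) ^ (DIM('a) - 1))) +
     ennreal ((64 * k) powr k * (b * 64) powr (b * DIM('a)) * (4 / (1 - 2 * b)) ^ DIM('a) * l powr (- (2 * k)))"
  proof (rule add_mono)
    have "(\<integral>\<^sup>+y. indicator (cball z l) y * ennreal (cut_weight m (z - y, s - H y)) \<partial>lborel) \<le>
      (\<integral>\<^sup>+y. ennreal A * (indicator (cball z l) y * (sing_prod b ?J (z - y) * \<phi> y)) \<partial>lborel)"
      by (rule nn_integral_mono) (rule near)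
    also have "\<dots> = ennreal A * (\<integral>\<^sup>+y. indicator (cball z l) y * (sing_prod b ?J (z - y) * \<phi> y) \<partial>lborel)"
      by (rule nn_integral_cmult) measurable
    also have "\<dots> \<le> ennreal A * ennreal (8 * q powr (- ?e) * (l powr (1 - ?e) / (1 - ?e)) * (4 / (1 - 2 * b)) ^ (DIM('a) - 1))"
      unfolding \<phi>_def by (intro mult_left_mono nn_integral_near_le[OF i l _ b(2) lam q _ cont exp]) (use b in auto)
    also have "\<dots> = ennreal (A * (8 * q powr (- ?e) * (l powr (1 - ?e) / (1 - ?e)) * (4 / (1 - 2 * b)) ^ (DIM('a) - 1)))"
      by (rule ennreal_mult'[symmetric]) (simp add: A_def)
    finally show "(\<integral>\<^sup>+y. indicator (cball z l) y * ennreal (cut_weight m (z - y, s - H y)) \<partial>lborel) \<le>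
      ennreal (A * (8 * q powr (- ?e) * (l powr (1 - ?e) / (1 - ?e)) * (4 / (1 - 2 * b)) ^ (DIM('a) - 1)))" .
    show "(\<integral>\<^sup>+y. indicator (- cball z l) y * ennreal (cut_weight m (z - y, s - H y)) \<partial>lborel) \<le>
      ennreal ((64 * k) powr k * (b * 64) powr (b * DIM('a)) * (4 / (1 - 2 * b)) ^ DIM('a) * l powr (- (2 * k)))"
      by (rule nn_integral_far_le[OF b k l(1)])
  qed
  also have "\<dots> = ennreal (A * (8 * q powr (- ?e) * (l powr (1 - ?e) / (1 - ?e)) * (4 / (1 - 2 * b)) ^ (DIM('a) - 1)) +
     (64 * k) powr k * (b * 64) powr (b * DIM('a)) * (4 / (1 - 2 * b)) ^ DIM('a) * l powr (- (2 * k)))"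
    using b lam by (intro ennreal_plus[symmetric]) (auto simp: A_def)
  finally show ?thesis by (simp add: A_def)
qed

section \<open>Graph integrals as time derivatives of potentials\<close>

context cut_kernel
begin

text \<open>Formally the time derivative of the potential of the indicator of {s > H y}. Where the
  kernel is not integrable the value is 0 by convention and has no meaning; statements about it are
  therefore guarded by the extended real \<open>graph_weight\<close>.\<close>

definition graph_potential :: "('a \<Rightarrow> real) \<Rightarrow> 'a \<Rightarrow> real \<Rightarrow> real" where
  "graph_potential H x s = (\<integral>y. K (x - y, s - H y) \<partial>lborel)"

definition graph_weight :: "real \<Rightarrow> ('a \<Rightarrow> real) \<Rightarrow> 'a \<Rightarrow> real \<Rightarrow> ennreal" where
  "graph_weight k H x s = (\<integral>\<^sup>+y. ennreal (cut_weight k (x - y, s - H y)) \<partial>lborel)"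

lemma measurable_graph_kernel:
  assumes [measurable]: "H \<in> borel_measurable borel" "h \<in> borel_measurable (borel :: ('a \<times> real) measure)"
  shows "(\<lambda>y. h (x - y, s - H y)) \<in> borel_measurable borel"
  by (rule measurable_compose[OF _ assms(2)]) (simp add: borel_prod[symmetric])

text \<open>For fixed y the kernel is integrated over \<sigma> < t - H y, where \<sigma> = t - s.
  Raising t from t1 to t2 adds a strip, and the shift by H y turns it into the interval [t1, t2) for
  all y at once. In \<open>ennreal\<close> the integrations may be exchanged even if the graph
  integral is infinite.\<close>

lemma potential_time_increment:
  assumes m: "m = DIM('a) / 2" and f[measurable]: "f \<in> borel_measurable borel" and f1: "\<And>w. \<bar>f w\<bar> \<le> 1"
    and H[measurable]: "H \<in> borel_measurable borel" and t: "t1 \<le> t2"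
    and fH: "\<And>y s t. t1 \<le> t \<Longrightarrow> t \<le> t2 \<Longrightarrow> norm (x - y, t - s) \<le> \<rho> \<Longrightarrow> f (y, s) = (if H y < s then 1 else 0)"
  shows "ennreal (potential f (x, t2)) = ennreal (potential f (x, t1)) +
    (\<integral>\<^sup>+s. indicator {t1..<t2} s * (\<integral>\<^sup>+y. ennreal (K (x - y, s - H y)) \<partial>lborel) \<partial>lborel)"
proof -
  have Kp[measurable]: "(\<lambda>w. K w) \<in> borel_measurable (borel \<Otimes>\<^sub>M borel)" by (simp add: borel_prod)
  have eq: "ennreal (potential f (x, t)) = (\<integral>\<^sup>+y. \<integral>\<^sup>+\<sigma>. ennreal (K (x - y, \<sigma>)) * indicator {..<t - H y} \<sigma> \<partial>lborel \<partial>lborel)"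
    if tt: "t1 \<le> t" "t \<le> t2" for t
  proof -
    \<comment> \<open>Beyond radius \<rho> nothing is known about \<open>f\<close>, but there the
      kernel vanishes.\<close>
    have ind: "f w * K ((x, t) - w) = K ((x, t) - w) * indicator {w. H (fst w) < snd w} w" for w
    proof (cases "norm ((x, t) - w) > \<rho>")
      case False
      then show ?thesis using fH[OF tt, of "fst w" "snd w"] by (cases w) (simp add: indicator_def)
    qed (simp add: K_support)
    have [measurable]: "(\<lambda>w. K ((x, t) - w) * indicator {w. H (fst w) < snd w} w) \<in> borel_measurable (lborel \<Otimes>\<^sub>M lborel)"
    proof -
      have "(\<lambda>w. K ((x, t) - w)) \<in> borel_measurable borel" by measurable
      then have 1: "(\<lambda>w. K ((x, t) - w)) \<in> borel_measurable (borel \<Otimes>\<^sub>M borel)" by (simp add: borel_prod)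
      have "{w \<in> space (borel \<Otimes>\<^sub>M borel). H (fst w) < snd w} \<in> sets (borel \<Otimes>\<^sub>M borel)" by measurable
      then have 2: "{w. H (fst w) < snd w} \<in> sets (borel \<Otimes>\<^sub>M borel)" by (simp add: space_pair_measure)
      show ?thesis using borel_measurable_times[OF 1 borel_measurable_indicator[OF 2]] by simp
    qed
    have "ennreal (potential f (x, t)) = (\<integral>\<^sup>+w. ennreal (f w * K ((x, t) - w)) \<partial>lborel)"
      unfolding potential_def
      by (rule nn_integral_eq_integral[symmetric, OF kernel_integrable(1)[OF m f f1]])
         (intro AE_I2, simp add: ind K_nonneg)
    also have "\<dots> = (\<integral>\<^sup>+w. ennreal (K ((x, t) - w) * indicator {w. H (fst w) < snd w} w) \<partial>(lborel \<Otimes>\<^sub>M lborel))"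
      unfolding lborel_prod ind ..
    also have "\<dots> = (\<integral>\<^sup>+y. \<integral>\<^sup>+s. ennreal (K ((x, t) - (y, s)) * indicator {w. H (fst w) < snd w} (y, s)) \<partial>lborel \<partial>lborel)"
      by (rule lborel.nn_integral_fst[symmetric]) measurable
    also have "\<dots> = (\<integral>\<^sup>+y. \<integral>\<^sup>+\<sigma>. ennreal (K (x - y, \<sigma>)) * indicator {..<t - H y} \<sigma> \<partial>lborel \<partial>lborel)"
    proof (rule nn_integral_cong)
      fix y
      have [measurable]: "(\<lambda>\<sigma>. ennreal (K (x - y, \<sigma>)) * indicator {..<t - H y} \<sigma>) \<in> borel_measurable borel" by measurable
      have "(\<integral>\<^sup>+s. ennreal (K ((x, t) - (y, s)) * indicator {w. H (fst w) < snd w} (y, s)) \<partial>lborel) =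
         (\<integral>\<^sup>+s. (\<lambda>\<sigma>. ennreal (K (x - y, \<sigma>)) * indicator {..<t - H y} \<sigma>) (t - s) \<partial>lborel)"
        by (rule nn_integral_cong) (auto simp: indicator_def)
      also have "\<dots> = (\<integral>\<^sup>+\<sigma>. ennreal (K (x - y, \<sigma>)) * indicator {..<t - H y} \<sigma> \<partial>lborel)"
        by (rule nn_integral_reflect) measurable
      finally show "(\<integral>\<^sup>+s. ennreal (K ((x, t) - (y, s)) * indicator {w. H (fst w) < snd w} (y, s)) \<partial>lborel) =
        (\<integral>\<^sup>+\<sigma>. ennreal (K (x - y, \<sigma>)) * indicator {..<t - H y} \<sigma> \<partial>lborel)" .
    qed
    finally show ?thesis .
  qed
  have "ennreal (potential f (x, t2)) = (\<integral>\<^sup>+y. (\<integral>\<^sup>+\<sigma>. ennreal (K (x - y, \<sigma>)) * indicator {..<t1 - H y} \<sigma> \<partial>lborel) +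
     (\<integral>\<^sup>+s. indicator {t1..<t2} s * ennreal (K (x - y, s - H y)) \<partial>lborel) \<partial>lborel)"
    unfolding eq[OF t order_refl]
  proof (rule nn_integral_cong)
    fix y
    have [measurable]: "(\<lambda>\<sigma>. K (x - y, \<sigma>)) \<in> borel_measurable borel" by measurable
    have "(\<integral>\<^sup>+\<sigma>. ennreal (K (x - y, \<sigma>)) * indicator {..<t2 - H y} \<sigma> \<partial>lborel) =
      (\<integral>\<^sup>+\<sigma>. ennreal (K (x - y, \<sigma>)) * indicator {..<t1 - H y} \<sigma> + ennreal (K (x - y, \<sigma>)) * indicator {t1 - H y..<t2 - H y} \<sigma> \<partial>lborel)"
      using t by (intro nn_integral_cong) (auto simp: indicator_def)
    also have "\<dots> = (\<integral>\<^sup>+\<sigma>. ennreal (K (x - y, \<sigma>)) * indicator {..<t1 - H y} \<sigma> \<partial>lborel) +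
       (\<integral>\<^sup>+\<sigma>. ennreal (K (x - y, \<sigma>)) * indicator {t1 - H y..<t2 - H y} \<sigma> \<partial>lborel)"
      by (rule nn_integral_add) measurable
    also have "(\<integral>\<^sup>+\<sigma>. ennreal (K (x - y, \<sigma>)) * indicator {t1 - H y..<t2 - H y} \<sigma> \<partial>lborel) =
       (\<integral>\<^sup>+s. (\<lambda>\<sigma>. ennreal (K (x - y, \<sigma>)) * indicator {t1 - H y..<t2 - H y} \<sigma>) (s + - H y) \<partial>lborel)"
      by (rule nn_integral_translate[symmetric]) measurable
    also have "\<dots> = (\<integral>\<^sup>+s. indicator {t1..<t2} s * ennreal (K (x - y, s - H y)) \<partial>lborel)"
      by (rule nn_integral_cong) (auto simp: indicator_def)
    finally show "(\<integral>\<^sup>+\<sigma>. ennreal (K (x - y, \<sigma>)) * indicator {..<t2 - H y} \<sigma> \<partial>lborel) =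
      (\<integral>\<^sup>+\<sigma>. ennreal (K (x - y, \<sigma>)) * indicator {..<t1 - H y} \<sigma> \<partial>lborel) +
      (\<integral>\<^sup>+s. indicator {t1..<t2} s * ennreal (K (x - y, s - H y)) \<partial>lborel)" .
  qed
  also have "\<dots> = (\<integral>\<^sup>+y. (\<integral>\<^sup>+\<sigma>. ennreal (K (x - y, \<sigma>)) * indicator {..<t1 - H y} \<sigma> \<partial>lborel) \<partial>lborel) +
     (\<integral>\<^sup>+y. (\<integral>\<^sup>+s. indicator {t1..<t2} s * ennreal (K (x - y, s - H y)) \<partial>lborel) \<partial>lborel)"
  proof (rule nn_integral_add)
    have "(\<lambda>(y, \<sigma>). ennreal (K (x - y, \<sigma>)) * indicator {..<t1 - H y} \<sigma>) = (\<lambda>(y, \<sigma>). ennreal (K (x - y, \<sigma>)) * indicator {w. snd w < t1 - H (fst w)} (y, \<sigma>))"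
      by (auto simp: indicator_def fun_eq_iff)
    moreover have "\<dots> \<in> borel_measurable (borel \<Otimes>\<^sub>M borel)"
    proof -
      have "{w \<in> space (borel \<Otimes>\<^sub>M borel). snd w < t1 - H (fst w)} \<in> sets (borel \<Otimes>\<^sub>M borel)" by measurable
      then have [measurable]: "{w. snd w < t1 - H (fst w)} \<in> sets (borel \<Otimes>\<^sub>M borel)" by (simp add: space_pair_measure)
      show ?thesis by measurable
    qed
    ultimately have [measurable]: "(\<lambda>(y, \<sigma>). ennreal (K (x - y, \<sigma>)) * indicator {..<t1 - H y} \<sigma>) \<in> borel_measurable (borel \<Otimes>\<^sub>M borel)" by simp
    show "(\<lambda>y. \<integral>\<^sup>+\<sigma>. ennreal (K (x - y, \<sigma>)) * indicator {..<t1 - H y} \<sigma> \<partial>lborel) \<in> borel_measurable lborel" by measurable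
    show "(\<lambda>y. \<integral>\<^sup>+s. indicator {t1..<t2} s * ennreal (K (x - y, s - H y)) \<partial>lborel) \<in> borel_measurable lborel" by measurable
  qed
  also have "(\<integral>\<^sup>+y. (\<integral>\<^sup>+\<sigma>. ennreal (K (x - y, \<sigma>)) * indicator {..<t1 - H y} \<sigma> \<partial>lborel) \<partial>lborel) = ennreal (potential f (x, t1))"
    using eq[OF order_refl t] by simp
  also have "(\<integral>\<^sup>+y. (\<integral>\<^sup>+s. indicator {t1..<t2} s * ennreal (K (x - y, s - H y)) \<partial>lborel) \<partial>lborel) =
     (\<integral>\<^sup>+s. (\<integral>\<^sup>+y. indicator {t1..<t2} s * ennreal (K (x - y, s - H y)) \<partial>lborel) \<partial>lborel)"
    by (rule lborel_pair.Fubini'[symmetric]) measurable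
  also have "\<dots> = (\<integral>\<^sup>+s. indicator {t1..<t2} s * (\<integral>\<^sup>+y. ennreal (K (x - y, s - H y)) \<partial>lborel) \<partial>lborel)"
    by (intro nn_integral_cong nn_integral_cmult) measurable
  finally show ?thesis .
qed

lemma integrable_graph_weight:
  assumes [measurable]: "H \<in> borel_measurable borel" and "graph_weight k H x s \<le> ennreal A" "A \<ge> 0"
  shows "integrable lborel (\<lambda>y. cut_weight k (x - y, s - H y))" "(\<integral>y. cut_weight k (x - y, s - H y) \<partial>lborel) \<le> A"
proof -
  have [measurable]: "(\<lambda>y. cut_weight k (x - y, s - H y)) \<in> borel_measurable borel"
    by (rule measurable_graph_kernel) measurable
  show i: "integrable lborel (\<lambda>y. cut_weight k (x - y, s - H y))"
  proof (rule integrableI_nonneg)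
    show "(\<integral>\<^sup>+y. ennreal (cut_weight k (x - y, s - H y)) \<partial>lborel) < \<infinity>"
      using assms(2) unfolding graph_weight_def by (rule order.strict_trans1) simp
  qed (auto simp: cut_weight_nonneg)
  show "(\<integral>y. cut_weight k (x - y, s - H y) \<partial>lborel) \<le> A"
    using assms(2,3) unfolding graph_weight_def
    by (subst (asm) nn_integral_eq_integral[OF i]) (auto simp: cut_weight_nonneg)
qed

lemma integrable_graph_kernel:
  assumes [measurable]: "H \<in> borel_measurable borel" and k: "m \<le> k" "k \<le> m + 1" and "graph_weight k H x s \<le> ennreal A" "A \<ge> 0"
  shows "integrable lborel (\<lambda>y. K (x - y, s - H y))"
    and "(\<integral>\<^sup>+y. ennreal (K (x - y, s - H y)) \<partial>lborel) = ennreal (graph_potential H x s)"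
proof -
  have [measurable]: "(\<lambda>y. K (x - y, s - H y)) \<in> borel_measurable borel"
    by (rule measurable_graph_kernel) measurable
  have b: "norm (K z) \<le> norm (2 * cut_weight k z)" for z
    using order_trans[OF K_le[of z] cut_weight_exponent_mono2[OF k, of z]] K_nonneg[of z] by simp
  show i: "integrable lborel (\<lambda>y. K (x - y, s - H y))"
  proof (rule Bochner_Integration.integrable_bound[OF integrable_mult_right[OF integrable_graph_weight(1)[OF assms(1,4,5)], of 2]])
    show "AE y in lborel. norm (K (x - y, s - H y)) \<le> norm (2 * cut_weight k (x - y, s - H y))"
      by (rule AE_I2) (rule b)
  qed auto
  show "(\<integral>\<^sup>+y. ennreal (K (x - y, s - H y)) \<partial>lborel) = ennreal (graph_potential H x s)"
    unfolding graph_potential_def by (rule nn_integral_eq_integral[OF i]) (auto simp: K_nonneg)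
qed

lemma graph_potential_diff_le:
  assumes H[measurable]: "H \<in> borel_measurable borel" and k: "m \<le> k" "k \<le> m + 1"
    and A: "graph_weight k H x s \<le> ennreal A" "graph_weight k H x' s' \<le> ennreal A" "A \<ge> 0" and C: "C \<ge> 0"
    and le: "\<And>y. \<bar>K (x - y, s - H y) - K (x' - y, s' - H y)\<bar> \<le> C * (cut_weight k (x - y, s - H y) + cut_weight k (x' - y, s' - H y))"
  shows "\<bar>graph_potential H x s - graph_potential H x' s'\<bar> \<le> 2 * C * A"
proof -
  note i = integrable_graph_kernel(1)[OF H k A(1,3)] integrable_graph_kernel(1)[OF H k A(2,3)]
  note w = integrable_graph_weight[OF H A(1,3)] integrable_graph_weight[OF H A(2,3)]
  have "graph_potential H x s - graph_potential H x' s' = (\<integral>y. K (x - y, s - H y) - K (x' - y, s' - H y) \<partial>lborel)"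
    unfolding graph_potential_def using i by simp
  also have "\<bar>\<dots>\<bar> \<le> (\<integral>y. \<bar>K (x - y, s - H y) - K (x' - y, s' - H y)\<bar> \<partial>lborel)" by (rule integral_abs_bound)
  also have "\<dots> \<le> (\<integral>y. C * (cut_weight k (x - y, s - H y) + cut_weight k (x' - y, s' - H y)) \<partial>lborel)"
    by (rule integral_mono) (use i w le in auto)
  also have "\<dots> = C * ((\<integral>y. cut_weight k (x - y, s - H y) \<partial>lborel) + (\<integral>y. cut_weight k (x' - y, s' - H y) \<partial>lborel))"
    using w by simp
  also have "\<dots> \<le> C * (A + A)" using w C by (intro mult_left_mono add_mono) auto
  finally show ?thesis by simp
qed

text \<open>The path leads from (x, s) in space to (x', s) and then in time to (x', s'), so the
  weight has to be controlled at three points. The exponents 2 \<gamma> and \<gamma> reflect the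
  parabolic scaling; both cost \<gamma> in the weight.\<close>

lemma graph_potential_holder:
  assumes H: "H \<in> borel_measurable borel" and \<gamma>: "0 < \<gamma>" "\<gamma> \<le> 1/2"
    and A: "graph_weight (m + \<gamma>) H x s \<le> ennreal A" "graph_weight (m + \<gamma>) H x' s \<le> ennreal A" "graph_weight (m + \<gamma>) H x' s' \<le> ennreal A" "A \<ge> 0"
    and d: "norm (x - x') \<le> 1" "\<bar>s - s'\<bar> \<le> 1"
  shows "\<bar>graph_potential H x s - graph_potential H x' s'\<bar> \<le>
    2 * A * ((6 + 2 * L) * norm (x - x') powr (2 * \<gamma>) + (m + 2 + 2 * L) * \<bar>s - s'\<bar> powr \<gamma>)"
proof -
  have k: "m \<le> m + \<gamma>" "m + \<gamma> \<le> m + 1" using \<gamma> by auto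
  have "\<bar>graph_potential H x s - graph_potential H x' s\<bar> \<le> 2 * ((6 + 2 * L) * norm (x - x') powr (2 * \<gamma>)) * A"
  proof (rule graph_potential_diff_le[OF H k A(1,2,4)])
    show "\<bar>K (x - y, s - H y) - K (x' - y, s - H y)\<bar> \<le> (6 + 2 * L) * norm (x - x') powr (2 * \<gamma>) * (cut_weight (m + \<gamma>) (x - y, s - H y) + cut_weight (m + \<gamma>) (x' - y, s - H y))" for y
      using K_holder_space[of "x - y" "x' - y" "2 * \<gamma>" "s - H y"] d \<gamma> by simp
  qed (use L_nonneg in auto)
  moreover have "\<bar>graph_potential H x' s - graph_potential H x' s'\<bar> \<le> 2 * ((m + 2 + 2 * L) * \<bar>s - s'\<bar> powr \<gamma>) * A"
  proof (rule graph_potential_diff_le[OF H k A(2,3,4)])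
    show "\<bar>K (x' - y, s - H y) - K (x' - y, s' - H y)\<bar> \<le> (m + 2 + 2 * L) * \<bar>s - s'\<bar> powr \<gamma> * (cut_weight (m + \<gamma>) (x' - y, s - H y) + cut_weight (m + \<gamma>) (x' - y, s' - H y))" for y
      using K_holder_time[of "s - H y" "s' - H y" \<gamma> "x' - y"] d \<gamma> by simp
  qed (use L_nonneg m_nonneg in auto)
  ultimately have "\<bar>graph_potential H x s - graph_potential H x' s'\<bar> \<le>
     2 * ((6 + 2 * L) * norm (x - x') powr (2 * \<gamma>)) * A + 2 * ((m + 2 + 2 * L) * \<bar>s - s'\<bar> powr \<gamma>) * A" by linarith
  then show ?thesis by (simp add: algebra_simps)
qed

lemma potential_increment_bounds:
  assumes m: "m = DIM('a) / 2" and f: "f \<in> borel_measurable borel" and f1: "\<And>w. \<bar>f w\<bar> \<le> 1"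
    and H: "H \<in> borel_measurable borel" and t: "t1 \<le> t2"
    and fH: "\<And>y s t. t1 \<le> t \<Longrightarrow> t \<le> t2 \<Longrightarrow> norm (x - y, t - s) \<le> \<rho> \<Longrightarrow> f (y, s) = (if H y < s then 1 else 0)"
    and k: "m \<le> k" "k \<le> m + 1" and A: "\<And>s. s \<in> {t1..<t2} \<Longrightarrow> graph_weight k H x s \<le> ennreal A" "A \<ge> 0"
    and w: "\<And>s. s \<in> {t1..<t2} \<Longrightarrow> \<bar>graph_potential H x s - w\<bar> \<le> e" and w0: "w \<ge> 0" and e: "e \<ge> 0"
  shows "\<bar>potential f (x, t2) - potential f (x, t1) - w * (t2 - t1)\<bar> \<le> e * (t2 - t1)"
proof -
  let ?P = "potential f"
  let ?W = "\<lambda>s. \<integral>\<^sup>+y. ennreal (K (x - y, s - H y)) \<partial>lborel"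
  have W: "?W s = ennreal (graph_potential H x s)" if "s \<in> {t1..<t2}" for s
    using integrable_graph_kernel(2)[OF H k A(1)[OF that] A(2)] .
  have gp: "graph_potential H x s \<ge> 0" for s unfolding graph_potential_def by (intro integral_nonneg_AE) (auto simp: K_nonneg)
  have P0: "?P (x, t1) \<ge> 0" and P2: "?P (x, t2) \<ge> 0"
  proof -
    have "?P (x, t) \<ge> 0" if tt: "t1 \<le> t" "t \<le> t2" for t
  proof -
    have "0 \<le> f w * K ((x, t) - w)" for w
    proof (cases "norm ((x, t) - w) > \<rho>")
      case False
      then show ?thesis using fH[OF tt, of "fst w" "snd w"] K_nonneg by (cases w) simp
    qed (simp add: K_support)
    then show ?thesis unfolding potential_def by (intro integral_nonneg_AE AE_I2)
  qed
    from this[OF order_refl t] this[OF t order_refl] show "?P (x, t1) \<ge> 0" "?P (x, t2) \<ge> 0" by auto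
  qed
  have inc: "ennreal (?P (x, t2)) = ennreal (?P (x, t1)) + (\<integral>\<^sup>+s. indicator {t1..<t2} s * ?W s \<partial>lborel)"
    by (rule potential_time_increment[OF m f f1 H t fH])
  have "(\<integral>\<^sup>+s. indicator {t1..<t2} s * ?W s \<partial>lborel) \<le> (\<integral>\<^sup>+s. ennreal (w + e) * indicator {t1..<t2} s \<partial>lborel)"
  proof (rule nn_integral_mono)
    fix s show "indicator {t1..<t2} s * ?W s \<le> ennreal (w + e) * indicator {t1..<t2} s"
      using W[of s] w[of s] by (auto simp: indicator_def abs_le_iff intro!: ennreal_leI)
  qed
  also have "\<dots> = ennreal ((w + e) * (t2 - t1))" using t w0 e by (simp add: nn_integral_cmult_indicator ennreal_mult)
  finally have up: "(\<integral>\<^sup>+s. indicator {t1..<t2} s * ?W s \<partial>lborel) \<le> ennreal ((w + e) * (t2 - t1))" .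
  \<comment> \<open>A negative lower bound has no counterpart in \<open>ennreal\<close>, so it is
    truncated at 0; the graph integral is nonnegative.\<close>
  have "ennreal (max 0 (w - e) * (t2 - t1)) = (\<integral>\<^sup>+s. ennreal (max 0 (w - e)) * indicator {t1..<t2} s \<partial>lborel)"
    using t by (simp add: nn_integral_cmult_indicator ennreal_mult)
  also have "\<dots> \<le> (\<integral>\<^sup>+s. indicator {t1..<t2} s * ?W s \<partial>lborel)"
  proof (rule nn_integral_mono)
    fix s show "ennreal (max 0 (w - e)) * indicator {t1..<t2} s \<le> indicator {t1..<t2} s * ?W s"
      using W[of s] w[of s] gp[of s] by (auto simp: indicator_def abs_le_iff intro!: ennreal_leI)
  qed
  finally have lo: "ennreal (max 0 (w - e) * (t2 - t1)) \<le> (\<integral>\<^sup>+s. indicator {t1..<t2} s * ?W s \<partial>lborel)" .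
  have "ennreal (?P (x, t2)) \<le> ennreal (?P (x, t1)) + ennreal ((w + e) * (t2 - t1))"
    unfolding inc by (intro add_left_mono up)
  also have "\<dots> = ennreal (?P (x, t1) + (w + e) * (t2 - t1))" using P0 t w0 e by (intro ennreal_plus[symmetric]) auto
  finally have 1: "?P (x, t2) \<le> ?P (x, t1) + (w + e) * (t2 - t1)"
    using P0 t w0 e by (subst (asm) ennreal_le_iff) auto
  have "ennreal (?P (x, t1) + max 0 (w - e) * (t2 - t1)) = ennreal (?P (x, t1)) + ennreal (max 0 (w - e) * (t2 - t1))"
    using P0 t by (intro ennreal_plus) auto
  also have "\<dots> \<le> ennreal (?P (x, t2))" unfolding inc by (intro add_left_mono lo)
  finally have 2: "?P (x, t1) + max 0 (w - e) * (t2 - t1) \<le> ?P (x, t2)"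
    using P2 by (simp add: ennreal_le_iff)
  have "(w - e) * (t2 - t1) \<le> max 0 (w - e) * (t2 - t1)" using t by (intro mult_right_mono) auto
  then show ?thesis using 1 2 by (simp add: abs_le_iff algebra_simps)
qed

end

section \<open>Regularity of the graph\<close>

lemma has_derivative_of_powr_bound:
  fixes f :: "'a::real_normed_vector \<Rightarrow> real"
  assumes "bounded_linear f'" "\<delta> > 0" "\<gamma> > 0"
    and b: "\<And>y. norm (y - x) < \<delta> \<Longrightarrow> \<bar>f y - f x - f' (y - x)\<bar> \<le> K * norm (y - x) powr (1 + \<gamma>)"
  shows "(f has_derivative f') (at x)"
  unfolding has_derivative_at_alt
proof (intro conjI allI impI)
  fix e :: real assume e: "e > 0"
  define K' where "K' = \<bar>K\<bar> + 1"
  define d where "d = min \<delta> ((e / K') powr (1 / \<gamma>))"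
  have K': "K' > 0" by (simp add: K'_def)
  have d: "d > 0" using assms(2) e K' by (simp add: d_def)
  have "norm (f y - f x - f' (y - x)) \<le> e * norm (y - x)" if y: "norm (y - x) < d" for y
  proof (cases "y = x")
    case False
    then have n: "norm (y - x) > 0" by simp
    have "norm (y - x) powr \<gamma> \<le> ((e / K') powr (1 / \<gamma>)) powr \<gamma>"
      using y assms(3) by (intro powr_mono2) (auto simp: d_def)
    also have "\<dots> = e / K'" using e K' assms(3) by (simp add: powr_powr)
    finally have p: "K' * norm (y - x) powr \<gamma> \<le> e" using K' by (simp add: field_simps)
    have "\<bar>f y - f x - f' (y - x)\<bar> \<le> K * norm (y - x) powr (1 + \<gamma>)" using y by (intro b) (simp add: d_def)
    also have "\<dots> \<le> K' * norm (y - x) powr (1 + \<gamma>)" by (intro mult_right_mono) (auto simp: K'_def)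
    also have "\<dots> = (K' * norm (y - x) powr \<gamma>) * norm (y - x)" using n by (simp add: powr_add)
    also have "\<dots> \<le> e * norm (y - x)" using p by (intro mult_right_mono) auto
    finally show ?thesis by simp
  qed (use linear_0[OF bounded_linear.linear[OF assms(1)]] in simp)
  then show "\<exists>d>0. \<forall>y. norm (y - x) < d \<longrightarrow> norm (f y - f x - f' (y - x)) \<le> e * norm (y - x)" using d by blast
qed (rule assms(1))

text \<open>The derivative \<open>D\<close> of \<open>u\<close> in space is under control everywhere, its derivative \<open>W\<close> in time
  only where the weight \<open>V\<close> of the graph is, with constants proportional to \<open>V\<close>. The latter may be
  infinite where \<open>D\<close> vanishes.\<close>

locale regular_graph =
  fixes u :: "'a::euclidean_space \<times> real \<Rightarrow> real" and D :: "'a \<times> real \<Rightarrow> 'a"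
    and H :: "'a \<Rightarrow> real" and W :: "'a \<Rightarrow> real \<Rightarrow> real" and V :: "'a \<Rightarrow> real \<Rightarrow> ennreal"
    and x0 :: 'a and t0 r \<rho> c C \<alpha> a \<beta> \<gamma> :: real
  assumes \<alpha>: "0 < \<alpha>" "\<alpha> < 1" and a_eq: "a = (1 + \<alpha>) / 2" and \<beta>_eq: "\<beta> = (7 + \<alpha>) / 8" and \<gamma>_eq: "\<gamma> = \<alpha> / 2"
    and r: "0 < r" "r \<le> 1/4" "0 < \<rho>" "\<rho> \<le> 1/4" and c: "c > 0" and C: "C \<ge> 1"
    and u_meas: "u \<in> borel_measurable borel" and H_meas: "H \<in> borel_measurable borel"
    and V_def: "V = (\<lambda>x s. \<integral>\<^sup>+y. ennreal (cut_weight (DIM('a) / 2 + \<gamma>) (x - y, s - H y)) \<partial>lborel)"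
    and taylor: "\<And>x x' t. x \<in> ball x0 r \<Longrightarrow> x' \<in> ball x0 r \<Longrightarrow> \<bar>t - t0\<bar> < \<rho> \<Longrightarrow>
       \<bar>u (x', t) - u (x, t) - D (x, t) \<bullet> (x' - x)\<bar> \<le> C * norm (x' - x) powr (1 + a)"
    and D_space: "\<And>x x' t. x \<in> ball x0 r \<Longrightarrow> x' \<in> ball x0 r \<Longrightarrow> \<bar>t - t0\<bar> < \<rho> \<Longrightarrow>
       norm (D (x, t) - D (x', t)) \<le> C * norm (x - x') powr a"
    and D_time: "\<And>x t t'. x \<in> ball x0 r \<Longrightarrow> \<bar>t - t0\<bar> < \<rho> \<Longrightarrow> \<bar>t' - t0\<bar> < \<rho> \<Longrightarrow>
       norm (D (x, t) - D (x, t')) \<le> C * \<bar>t - t'\<bar> powr (a / 2)"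
    and D_bound: "\<And>x t. x \<in> ball x0 r \<Longrightarrow> \<bar>t - t0\<bar> < \<rho> \<Longrightarrow> norm (D (x, t)) \<le> C"
    and holder_time: "\<And>x t t'. x \<in> ball x0 r \<Longrightarrow> \<bar>t - t0\<bar> < \<rho> \<Longrightarrow> \<bar>t' - t0\<bar> < \<rho> \<Longrightarrow>
       \<bar>u (x, t) - u (x, t')\<bar> \<le> C * \<bar>t - t'\<bar> powr \<beta>"
    and growth: "\<And>x t t'. x \<in> ball x0 r \<Longrightarrow> \<bar>t - t0\<bar> < \<rho> \<Longrightarrow> \<bar>t' - t0\<bar> < \<rho> \<Longrightarrow> t \<le> t' \<Longrightarrow>
       u (x, t') - u (x, t) \<ge> c * (t' - t)"
    and H_range: "\<And>x. x \<in> ball x0 r \<Longrightarrow> \<bar>H x - t0\<bar> < \<rho> / 2"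
    and H_zero: "\<And>x. x \<in> ball x0 r \<Longrightarrow> u (x, H x) = 0"
    and W_holder: "\<And>x x' s s' A. x \<in> ball x0 r \<Longrightarrow> x' \<in> ball x0 r \<Longrightarrow> \<bar>s - t0\<bar> < \<rho> \<Longrightarrow> \<bar>s' - t0\<bar> < \<rho> \<Longrightarrow> A \<ge> 1 \<Longrightarrow>
       V x s \<le> ennreal A \<Longrightarrow> V x' s \<le> ennreal A \<Longrightarrow> V x' s' \<le> ennreal A \<Longrightarrow>
       \<bar>W x s - W x' s'\<bar> \<le> C * A * (norm (x - x') powr (2 * \<gamma>) + \<bar>s - s'\<bar> powr \<gamma>)"
    and W_increment: "\<And>x t1 t2 A. x \<in> ball x0 r \<Longrightarrow> \<bar>t1 - t0\<bar> < \<rho> \<Longrightarrow> \<bar>t2 - t0\<bar> < \<rho> \<Longrightarrow> t1 \<le> t2 \<Longrightarrow> A \<ge> 1 \<Longrightarrow>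
       (\<And>s. s \<in> {t1..t2} \<Longrightarrow> V x s \<le> ennreal A) \<Longrightarrow>
       \<bar>u (x, t2) - u (x, t1) - W x t1 * (t2 - t1)\<bar> \<le> C * A * (t2 - t1) powr (1 + \<gamma>)"
begin

text \<open>\<open>a\<close> is the midpoint of \<alpha> and 1, which gives \<gamma> <= a / 2.
  \<open>\<beta>\<close> is the midpoint of (3 + \<alpha>)/4 and 1, where (3 + \<alpha>)/4 bounds
  the power of t that is left over in \<open>weight_near\<close>.\<close>

lemma exponents: "1/2 < a" "a < 1" "0 < \<gamma>" "\<gamma> < 1/2" "\<gamma> \<le> a / 2" "2 * \<gamma> \<le> a" "0 < \<beta>" "\<beta> < 1" "0 < a"
  using \<alpha> by (auto simp: a_eq \<beta>_eq \<gamma>_eq field_simps)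

definition LH :: real where "LH = 2 * C / c + 1"

lemma LH: "LH \<ge> 1" using C c by (simp add: LH_def)

lemma in_range: "\<bar>s - t0\<bar> < \<rho> / 2 \<Longrightarrow> \<bar>s - t0\<bar> < \<rho>" using r by linarith

lemma norm_diff_ball: "x \<in> ball x0 r \<Longrightarrow> x' \<in> ball x0 r \<Longrightarrow> norm (x - x') < 1"
proof -
  assume "x \<in> ball x0 r" "x' \<in> ball x0 r"
  then have "dist x x' < r + r" using dist_triangle_less_add[of x x0 r x' r] by (simp add: dist_commute)
  then show ?thesis using r by (simp add: dist_norm)
qed

lemma H_via_u:
  assumes "x \<in> ball x0 r" "\<bar>s - t0\<bar> < \<rho>" shows "c * \<bar>s - H x\<bar> \<le> \<bar>u (x, s)\<bar>"
proof (cases "s \<le> H x")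
  case True
  then show ?thesis using growth[OF assms(1,2) in_range[OF H_range[OF assms(1)]]] H_zero[OF assms(1)] by (auto simp: abs_if)
next
  case False
  then show ?thesis using growth[OF assms(1) in_range[OF H_range[OF assms(1)]] assms(2)] H_zero[OF assms(1)] by (auto simp: abs_if)
qed

text \<open>Taylor's formula at (x, H x) bounds \<open>u\<close> at (x', H x), and growth in time
  converts a value of \<open>u\<close> into a distance from the graph. Where \<open>D\<close>
  vanishes, this already shows that \<open>H\<close> has derivative 0.\<close>

lemma H_taylor:
  assumes "x \<in> ball x0 r" "x' \<in> ball x0 r"
  shows "c * \<bar>H x' - H x\<bar> \<le> norm (D (x, H x)) * norm (x' - x) + C * norm (x' - x) powr (1 + a)"
proof -
  have "\<bar>u (x', H x) - D (x, H x) \<bullet> (x' - x)\<bar> \<le> C * norm (x' - x) powr (1 + a)"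
    using taylor[OF assms in_range[OF H_range[OF assms(1)]]] H_zero[OF assms(1)] by simp
  moreover have "\<bar>D (x, H x) \<bullet> (x' - x)\<bar> \<le> norm (D (x, H x)) * norm (x' - x)" by (rule Cauchy_Schwarz_ineq2)
  moreover have "c * \<bar>H x - H x'\<bar> \<le> \<bar>u (x', H x)\<bar>" by (rule H_via_u[OF assms(2) in_range[OF H_range[OF assms(1)]]])
  ultimately show ?thesis by (simp add: abs_minus_commute)
qed

lemma H_lipschitz:
  assumes "x \<in> ball x0 r" "x' \<in> ball x0 r"
  shows "\<bar>H x' - H x\<bar> \<le> LH * norm (x' - x)"
proof -
  let ?d = "norm (x' - x)"
  have d1: "?d \<le> 1" using norm_diff_ball[OF assms(2,1)] by simp
  have "?d powr (1 + a) \<le> ?d powr 1" using exponents d1 by (intro powr_mono') auto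
  then have p: "?d powr (1 + a) \<le> ?d" by simp
  have "c * \<bar>H x' - H x\<bar> \<le> C * ?d + C * ?d"
  proof -
    have "norm (D (x, H x)) * ?d \<le> C * ?d"
      by (intro mult_right_mono D_bound assms in_range H_range) auto
    moreover have "C * ?d powr (1 + a) \<le> C * ?d" using p C by (intro mult_left_mono) auto
    ultimately show ?thesis using H_taylor[OF assms] by linarith
  qed
  then have "\<bar>H x' - H x\<bar> \<le> 2 * C / c * ?d" using c by (simp add: field_simps)
  also have "\<dots> \<le> LH * ?d" by (intro mult_right_mono) (auto simp: LH_def)
  finally show ?thesis .
qed

lemma line_derivative:
  assumes "y + \<theta> *\<^sub>R i \<in> ball x0 r" "\<bar>s - t0\<bar> < \<rho>" "norm i = 1"
  shows "((\<lambda>\<theta>. u (y + \<theta> *\<^sub>R i, s)) has_real_derivative D (y + \<theta> *\<^sub>R i, s) \<bullet> i) (at \<theta>)"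
proof -
  obtain \<delta> where \<delta>: "\<delta> > 0" "ball (y + \<theta> *\<^sub>R i) \<delta> \<subseteq> ball x0 r"
    by (rule openE[OF open_ball assms(1)])
  have "((\<lambda>\<theta>. u (y + \<theta> *\<^sub>R i, s)) has_derivative (*) (D (y + \<theta> *\<^sub>R i, s) \<bullet> i)) (at \<theta>)"
  proof (rule has_derivative_of_powr_bound[OF bounded_linear_mult_right \<delta>(1), of a])
    fix \<theta>' :: real assume t: "norm (\<theta>' - \<theta>) < \<delta>"
    have e: "(y + \<theta>' *\<^sub>R i) - (y + \<theta> *\<^sub>R i) = (\<theta>' - \<theta>) *\<^sub>R i" by (simp add: algebra_simps)
    have "dist (y + \<theta> *\<^sub>R i) (y + \<theta>' *\<^sub>R i) < \<delta>"
    proof -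
      have "norm ((\<theta>' - \<theta>) *\<^sub>R i) < \<delta>" using t assms(3) by (simp only: norm_scaleR) simp
      then show ?thesis by (metis dist_commute dist_norm e)
    qed
    then have "y + \<theta>' *\<^sub>R i \<in> ball x0 r" using \<delta>(2) by (meson mem_ball subsetD)
    from taylor[OF assms(1) this assms(2)]
    show "\<bar>u (y + \<theta>' *\<^sub>R i, s) - u (y + \<theta> *\<^sub>R i, s) - D (y + \<theta> *\<^sub>R i, s) \<bullet> i * (\<theta>' - \<theta>)\<bar> \<le> C * norm (\<theta>' - \<theta>) powr (1 + a)"
      unfolding e using assms(3) by (simp add: mult.commute)
  qed (use exponents in auto)
  then show ?thesis by (simp add: has_field_derivative_def)
qed

text \<open>The mean value theorem on the segment; \<open>\<sigma>\<close> is the constant sign of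
  the directional derivative, so that decreasing \<open>u\<close> is covered too.\<close>

lemma line_growth:
  assumes i: "norm i = 1" and s: "\<bar>s - t0\<bar> < \<rho>"
    and seg: "\<And>\<theta>. \<theta> \<in> {0..l} \<Longrightarrow> y + \<theta> *\<^sub>R i \<in> ball x0 r \<and> \<sigma> * (D (y + \<theta> *\<^sub>R i, s) \<bullet> i) \<ge> q"
    and \<sigma>: "\<bar>\<sigma>\<bar> = 1"
  shows "continuous_on {0..l} (\<lambda>\<theta>. u (y + \<theta> *\<^sub>R i, s))"
    and "\<theta> \<in> {0..l} \<Longrightarrow> \<theta>' \<in> {0..l} \<Longrightarrow> \<bar>u (y + \<theta> *\<^sub>R i, s) - u (y + \<theta>' *\<^sub>R i, s)\<bar> \<ge> q * \<bar>\<theta> - \<theta>'\<bar>"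
proof -
  have d: "((\<lambda>\<theta>. u (y + \<theta> *\<^sub>R i, s)) has_real_derivative D (y + \<theta> *\<^sub>R i, s) \<bullet> i) (at \<theta>)" if "\<theta> \<in> {0..l}" for \<theta>
    using line_derivative[OF _ s i] seg[OF that] by blast
  show "continuous_on {0..l} (\<lambda>\<theta>. u (y + \<theta> *\<^sub>R i, s))"
    by (intro continuous_at_imp_continuous_on ballI) (rule DERIV_isCont[OF d])
  have *: "\<bar>u (y + \<theta> *\<^sub>R i, s) - u (y + \<theta>' *\<^sub>R i, s)\<bar> \<ge> q * \<bar>\<theta> - \<theta>'\<bar>"
    if "\<theta> \<in> {0..l}" "\<theta>' \<in> {0..l}" "\<theta> < \<theta>'" for \<theta> \<theta>'
  proof -
    have "\<exists>z>\<theta>. z < \<theta>' \<and> u (y + \<theta>' *\<^sub>R i, s) - u (y + \<theta> *\<^sub>R i, s) = (\<theta>' - \<theta>) * (D (y + z *\<^sub>R i, s) \<bullet> i)"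
      by (rule MVT2[OF that(3)]) (rule d, use that in auto)
    then obtain z where z: "\<theta> < z" "z < \<theta>'" "u (y + \<theta>' *\<^sub>R i, s) - u (y + \<theta> *\<^sub>R i, s) = (\<theta>' - \<theta>) * (D (y + z *\<^sub>R i, s) \<bullet> i)" by blast
    have "q \<le> \<sigma> * (D (y + z *\<^sub>R i, s) \<bullet> i)" using seg[of z] z that by auto
    also have "\<dots> \<le> \<bar>\<sigma> * (D (y + z *\<^sub>R i, s) \<bullet> i)\<bar>" by simp
    also have "\<dots> = \<bar>D (y + z *\<^sub>R i, s) \<bullet> i\<bar>" using \<sigma> by (simp add: abs_mult)
    finally have "q * (\<theta>' - \<theta>) \<le> \<bar>D (y + z *\<^sub>R i, s) \<bullet> i\<bar> * (\<theta>' - \<theta>)" using that by (intro mult_right_mono) auto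
    also have "\<dots> = \<bar>u (y + \<theta> *\<^sub>R i, s) - u (y + \<theta>' *\<^sub>R i, s)\<bar>"
      using z(3) that by (subst abs_minus_commute) (simp add: abs_mult mult.commute)
    finally show ?thesis using that by simp
  qed
  show "\<bar>u (y + \<theta> *\<^sub>R i, s) - u (y + \<theta>' *\<^sub>R i, s)\<bar> \<ge> q * \<bar>\<theta> - \<theta>'\<bar>" if "\<theta> \<in> {0..l}" "\<theta>' \<in> {0..l}"
    using *[OF that] *[OF that(2,1)] by (cases \<theta> \<theta>' rule: linorder_cases) (auto simp: abs_minus_commute)
qed

text \<open>With p <= C, the second and third entries give 5 \<kappa> p^(1/a) <= r/2 and \<kappa>
  p^(2/a) <= \<rho>/2, so that neighbourhoods of graph points over \<open>ball x0 (r / 2)\<close>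
  stay in the domain. The last entry keeps the variation of \<open>D\<close> below p/(2n), half of
  what its largest component is bound to have.\<close>

definition \<kappa> :: real where
  "\<kappa> = min 1 (min (r / (10 * C powr (1 / a))) (min (\<rho> / (2 * C powr (2 / a))) ((1 / (12 * DIM('a) * C)) powr (2 / a))))"

lemma \<kappa>: "0 < \<kappa>" "\<kappa> \<le> 1" "\<kappa> * C powr (1 / a) \<le> r / 10" "\<kappa> * C powr (2 / a) \<le> \<rho> / 2"
  "6 * C * \<kappa> powr (a / 2) \<le> 1 / (2 * DIM('a))"
proof -
  have Cp: "C powr (1 / a) > 0" "C powr (2 / a) > 0" using C by auto
  show "0 < \<kappa>" using r C Cp by (simp add: \<kappa>_def)
  show "\<kappa> \<le> 1" by (simp add: \<kappa>_def)
  have "\<kappa> \<le> r / (10 * C powr (1 / a))" by (simp add: \<kappa>_def)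
  then show "\<kappa> * C powr (1 / a) \<le> r / 10" using Cp by (simp add: field_simps)
  have "\<kappa> \<le> \<rho> / (2 * C powr (2 / a))" by (simp add: \<kappa>_def)
  then show "\<kappa> * C powr (2 / a) \<le> \<rho> / 2" using Cp by (simp add: field_simps)
  have "\<kappa> powr (a / 2) \<le> ((1 / (12 * DIM('a) * C)) powr (2 / a)) powr (a / 2)"
    using exponents \<open>0 < \<kappa>\<close> by (intro powr_mono2) (auto simp: \<kappa>_def)
  also have "\<dots> = 1 / (12 * DIM('a) * C)" using exponents C by (simp add: powr_powr)
  finally have "6 * C * \<kappa> powr (a / 2) \<le> 6 * C * (1 / (12 * DIM('a) * C))" using C by (intro mult_left_mono) auto
  then show "6 * C * \<kappa> powr (a / 2) \<le> 1 / (2 * DIM('a))" using C by simp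
qed

text \<open>On the set where \<open>D\<close> does not change much compared with its size \<open>p\<close> at a point of the graph,
  the weight is at most of order \<open>1 / p\<close>.\<close>

definition near :: "'a \<Rightarrow> 'a \<Rightarrow> real \<Rightarrow> bool" where
  "near x z s \<longleftrightarrow> norm (z - x) \<le> \<kappa> * norm (D (x, H x)) powr (1 / a) \<and> \<bar>s - H x\<bar> \<le> \<kappa> * norm (D (x, H x)) powr (2 / a)"

lemma scale:
  assumes x: "x \<in> ball x0 (r / 2)"
  defines "p \<equiv> norm (D (x, H x))"
  shows "x \<in> ball x0 r" "p \<le> C" "\<kappa> * p powr (1 / a) \<le> r / 10" "\<kappa> * p powr (2 / a) \<le> \<rho> / 2"
proof -
  show xr: "x \<in> ball x0 r" using x r by auto
  show p: "p \<le> C" unfolding p_def using D_bound[OF xr in_range[OF H_range[OF xr]]] .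
  have "p powr (1 / a) \<le> C powr (1 / a)" "p powr (2 / a) \<le> C powr (2 / a)"
    using p exponents by (auto intro!: powr_mono2 simp: p_def)
  then have "\<kappa> * p powr (1 / a) \<le> \<kappa> * C powr (1 / a)" "\<kappa> * p powr (2 / a) \<le> \<kappa> * C powr (2 / a)"
    using \<kappa>(1) by (auto intro: mult_left_mono)
  then show "\<kappa> * p powr (1 / a) \<le> r / 10" "\<kappa> * p powr (2 / a) \<le> \<rho> / 2" using \<kappa>(3,4) by linarith+
qed

text \<open>\<open>D\<close> has exponent a in space and a/2 in time, so over the radius \<kappa>
  p^(1/a) and the time \<kappa> p^(2/a) it varies by a small multiple of p. The factor 5 makes room
  for the segments in \<open>weight_near\<close>, which reach out to 4 times the radius.\<close>

lemma near_domain: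
  assumes x: "x \<in> ball x0 (r / 2)" and y: "norm (y - x) \<le> 5 * (\<kappa> * norm (D (x, H x)) powr (1 / a))"
    and s: "\<bar>s - H x\<bar> \<le> \<kappa> * norm (D (x, H x)) powr (2 / a)"
  shows "y \<in> ball x0 r" "\<bar>s - t0\<bar> < \<rho>"
    and "norm (D (y, s) - D (x, H x)) \<le> norm (D (x, H x)) / (2 * DIM('a))"
proof -
  let ?p = "norm (D (x, H x))"
  note sc = scale[OF x]
  have "dist x0 y \<le> dist x0 x + dist x y" by (rule dist_triangle)
  also have "dist x y \<le> r / 2" using y sc(3) by (simp add: dist_norm norm_minus_commute)
  finally show yr: "y \<in> ball x0 r" using x by auto
  show st: "\<bar>s - t0\<bar> < \<rho>" using s sc(4) H_range[OF sc(1)] by linarith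
  have "norm (D (y, s) - D (x, H x)) \<le> norm (D (y, s) - D (x, s)) + norm (D (x, s) - D (x, H x))"
    using norm_triangle_ineq[of "D (y, s) - D (x, s)" "D (x, s) - D (x, H x)"] by simp
  also have "\<dots> \<le> C * norm (y - x) powr a + C * \<bar>s - H x\<bar> powr (a / 2)"
    by (intro add_mono D_space D_time yr sc st in_range[OF H_range])
  also have "\<dots> \<le> C * (5 * (\<kappa> powr (a / 2) * ?p)) + C * (\<kappa> powr (a / 2) * ?p)"
  proof (intro add_mono mult_left_mono)
    have "norm (y - x) powr a \<le> (5 * (\<kappa> * ?p powr (1 / a))) powr a" using y exponents by (intro powr_mono2) auto
    also have "\<dots> = 5 powr a * (\<kappa> powr a * ?p)" using \<kappa>(1) exponents by (simp add: powr_mult powr_powr)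
    also have "\<dots> \<le> 5 * (\<kappa> powr (a / 2) * ?p)"
    proof (intro mult_mono)
      show "5 powr a \<le> 5" using exponents powr_mono[of a 1 5] by simp
      show "\<kappa> powr a \<le> \<kappa> powr (a / 2)" using \<kappa> exponents by (intro powr_mono') auto
    qed auto
    finally show "norm (y - x) powr a \<le> 5 * (\<kappa> powr (a / 2) * ?p)" .
    have "\<bar>s - H x\<bar> powr (a / 2) \<le> (\<kappa> * ?p powr (2 / a)) powr (a / 2)" using s exponents by (intro powr_mono2) auto
    also have "\<dots> = \<kappa> powr (a / 2) * ?p" using \<kappa>(1) exponents by (simp add: powr_mult powr_powr)
    finally show "\<bar>s - H x\<bar> powr (a / 2) \<le> \<kappa> powr (a / 2) * ?p" .
  qed (use C in auto)
  also have "\<dots> = (6 * C * \<kappa> powr (a / 2)) * ?p" by (simp add: algebra_simps)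
  also have "\<dots> \<le> (1 / (2 * DIM('a))) * ?p" using \<kappa>(5) by (intro mult_right_mono) auto
  finally show "norm (D (y, s) - D (x, H x)) \<le> ?p / (2 * DIM('a))" by simp
qed

text \<open>A vector of norm p has a component of size at least p/n. Nearby this component keeps its
  sign and half of that size, so y \<longmapsto> \<open>u (y, s)\<close> can serve as the function
  growing in that direction. The near part of the weight is then at most of order p^(-e) with e < 1,
  and the far part is of order l^(-a) with l = \<kappa> p^(1/a), that is, 1/p.\<close>

lemma weight_near:
  obtains A where "A \<ge> C" "\<And>x z s. x \<in> ball x0 (r / 2) \<Longrightarrow> D (x, H x) \<noteq> 0 \<Longrightarrow> near x z s \<Longrightarrow> V z s \<le> ennreal (A / norm (D (x, H x)))"
proof -
  let ?n = "real DIM('a)"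
  have n: "?n \<ge> 1" using DIM_positive[where 'a='a] by linarith
  \<comment> \<open>Chosen so that b n = n/2 - (1 - \<alpha>)/4. The far exponent 2 k then equals a,
    which makes the far part exactly of order 1/p.\<close>
  define b where "b = 1/2 - (1 - \<alpha>) / (4 * ?n)"
  define m where "m = ?n / 2 + \<gamma>"
  define k where "k = m - b * ?n"
  define \<mu> where "\<mu> = m - b * (?n - 1)"
  have an: "(1 - \<alpha>) / (4 * ?n) > 0" "(1 - \<alpha>) / (4 * ?n) < 1/4"
  proof -
    have "1 - \<alpha> < ?n" using \<alpha> n by linarith
    then show "(1 - \<alpha>) / (4 * ?n) < 1/4" using n by (simp add: divide_less_eq)
  qed (use \<alpha> n in auto)
  have b: "0 < b" "b < 1/2" unfolding b_def using an by linarith+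
  have bn: "b * ?n = ?n / 2 - (1 - \<alpha>) / 4"   proof -
    have "x / (4 * y) * y = x / 4" if "y \<noteq> 0" for x y :: real using that by simp
    from this[of ?n "1 - \<alpha>"] show ?thesis using n by (simp add: b_def left_diff_distrib)
  qed
  have k2: "2 * k = a" by (simp add: k_def m_def bn \<gamma>_eq a_eq field_simps)
  have k0: "k > 0" using k2 exponents by linarith
  have \<mu>e: "\<mu> = k + b" by (simp add: \<mu>_def k_def algebra_simps)
  \<comment> \<open>Thus \<mu> = (1 + \<alpha>)/4 + b is below (3 + \<alpha>)/4, hence below
    \<beta>; here the Hoelder exponent of \<open>u\<close> in time has to be close to 1.\<close>
  have "k = (1 + \<alpha>) / 4" using k2 a_eq by (simp add: field_simps)
  moreover have "\<beta> = 7/8 + \<alpha> / 8" using \<beta>_eq by (simp add: add_divide_distrib)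
  moreover have "(1 + \<alpha>) / 4 = 1/4 + \<alpha> / 4" by (simp add: add_divide_distrib)
  ultimately have \<mu>: "\<mu> > 0" "\<mu> < \<beta>" using \<mu>e b \<alpha> by linarith+
  define e where "e = \<mu> / \<beta>"
  have e: "0 < e" "e < 1" using \<mu> exponents by (auto simp: e_def)
  define c1 where "c1 = (b * 32) powr (b * (?n - 1)) * C powr e * 8 * (1 / (1 - e)) * (4 / (1 - 2 * b)) ^ (DIM('a) - 1)"
  define c2 where "c2 = (64 * k) powr k * (b * 64) powr (b * ?n) * (4 / (1 - 2 * b)) ^ DIM('a)"
  have c12: "c1 \<ge> 0" "c2 \<ge> 0" using b e by (auto simp: c1_def c2_def)
  define A where "A = C + c1 * ((2 * ?n) powr e * C powr (1 - e)) + c2 * \<kappa> powr (- a)"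
  have "V z s \<le> ennreal (A / norm (D (x, H x)))"
    if x: "x \<in> ball x0 (r / 2)" and Dx: "D (x, H x) \<noteq> 0" and nr: "near x z s" for x z s
  proof -
    define p where "p = norm (D (x, H x))"
    have p: "p > 0" "p \<le> C" using Dx scale(2)[OF x] by (auto simp: p_def)
    define l where "l = \<kappa> * p powr (1 / a)"
    have l: "0 < l" "l \<le> 1" using \<kappa>(1) p scale(3)[OF x] r by (auto simp: l_def p_def)
    have nz: "norm (z - x) \<le> l" "\<bar>s - H x\<bar> \<le> \<kappa> * p powr (2 / a)" using nr by (auto simp: near_def l_def p_def)
    have dom: "y \<in> ball x0 r" "\<bar>s - t0\<bar> < \<rho>" "norm (D (y, s) - D (x, H x)) \<le> p / (2 * ?n)" if "norm (y - x) \<le> 5 * l" for y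
      using near_domain[OF x _ nz(2)[unfolded p_def], of y] that by (auto simp: l_def p_def)
    have s: "\<bar>s - t0\<bar> < \<rho>" using dom(2)[of x] l by simp
    have "\<exists>i\<in>Basis. \<bar>D (x, H x) \<bullet> i\<bar> \<ge> p / ?n"
    proof (rule ccontr)
      assume "\<not> ?thesis"
      then have "(\<Sum>i\<in>Basis. \<bar>D (x, H x) \<bullet> i\<bar>) < (\<Sum>i\<in>(Basis :: 'a set). p / ?n)" by (intro sum_strict_mono) auto
      also have "\<dots> = p" using n by simp
      finally show False using norm_le_l1[of "D (x, H x)"] by (simp add: p_def)
    qed
    then obtain i where i: "i \<in> Basis" "\<bar>D (x, H x) \<bullet> i\<bar> \<ge> p / ?n" by blast
    have i1: "norm i = 1" using i by simp
    define \<sigma> where "\<sigma> = (if D (x, H x) \<bullet> i \<ge> 0 then 1 else - 1 :: real)"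
    have \<sigma>: "\<bar>\<sigma>\<bar> = 1" "\<sigma> * (D (x, H x) \<bullet> i) \<ge> p / ?n" using i(2) by (auto simp: \<sigma>_def)
    define q where "q = p / (2 * ?n)"
    have q: "q > 0" using p n by (simp add: q_def)
    have seg: "y + \<theta> *\<^sub>R i \<in> ball x0 r \<and> \<sigma> * (D (y + \<theta> *\<^sub>R i, s) \<bullet> i) \<ge> q"
      if y: "norm (z - y) \<le> 2 * l" and t: "\<theta> \<in> {0..l}" for y \<theta>
    proof -
      have "norm (y + \<theta> *\<^sub>R i - x) \<le> norm (y - z) + norm (z - x) + norm (\<theta> *\<^sub>R i)"
        using norm_triangle_ineq[of "y - x" "\<theta> *\<^sub>R i"] norm_triangle_ineq[of "y - z" "z - x"] by (simp add: algebra_simps)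
      also have "\<dots> \<le> 2 * l + l + l" using y nz t i1 by (intro add_mono) (auto simp: norm_minus_commute)
      finally have w: "norm (y + \<theta> *\<^sub>R i - x) \<le> 5 * l" using l by simp
      have "\<bar>(D (y + \<theta> *\<^sub>R i, s) - D (x, H x)) \<bullet> i\<bar> \<le> p / (2 * ?n)"
        using Cauchy_Schwarz_ineq2[of "D (y + \<theta> *\<^sub>R i, s) - D (x, H x)" i] dom(3)[OF w] i1 by simp
      then have "\<bar>\<sigma> * ((D (y + \<theta> *\<^sub>R i, s) - D (x, H x)) \<bullet> i)\<bar> \<le> p / (2 * ?n)" using \<sigma>(1) by (simp add: abs_mult)
      then have "\<bar>\<sigma> * (D (y + \<theta> *\<^sub>R i, s) \<bullet> i) - \<sigma> * (D (x, H x) \<bullet> i)\<bar> \<le> q" by (simp add: inner_diff_left right_diff_distrib q_def)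
      moreover have "p / ?n = 2 * q" by (simp add: q_def)
      ultimately show ?thesis using \<sigma>(2) dom(1)[OF w] by linarith
    qed
    have "V z s \<le> ennreal ((b * 32) powr (b * (?n - 1)) * C powr (\<mu> / \<beta>) * (8 * q powr (- (\<mu> / \<beta>)) * (l powr (1 - \<mu> / \<beta>) / (1 - \<mu> / \<beta>)) * (4 / (1 - 2 * b)) ^ (DIM('a) - 1))
        + (64 * k) powr k * (b * 64) powr (b * ?n) * (4 / (1 - 2 * b)) ^ DIM('a) * l powr (- (2 * k)))"
      unfolding V_def m_def[symmetric]
    proof (rule nn_integral_graph_weight_le[OF i(1) l b \<mu>_def \<mu> k_def k0 q, where v="\<lambda>y. u (y, s)"])
      show "C > 0" using C by simp
      show "(\<lambda>y. u (y, s)) \<in> borel_measurable borel"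
        by (rule measurable_compose[OF _ u_meas]) (simp add: borel_prod[symmetric])
      show "continuous_on {0..l} (\<lambda>\<theta>. u (y + \<theta> *\<^sub>R i, s))" if "norm (z - y) \<le> 2 * l" for y
        by (rule line_growth(1)[OF i1 s seg[OF that] \<sigma>(1)])
      show "q * \<bar>\<theta> - \<theta>'\<bar> \<le> \<bar>u (y + \<theta> *\<^sub>R i, s) - u (y + \<theta>' *\<^sub>R i, s)\<bar>"
        if "norm (z - y) \<le> 2 * l" "\<theta> \<in> {0..l}" "\<theta>' \<in> {0..l}" for y \<theta> \<theta>'
        by (rule line_growth(2)[OF i1 s seg[OF that(1)] \<sigma>(1) that(2,3)])
      show "0 < u (y, s) \<and> u (y, s) \<le> C * (s - H y) powr \<beta>" if "norm (z - y) \<le> l" "H y < s" for y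
      proof -
        have "norm (y - x) \<le> norm (z - y) + norm (z - x)" using norm_triangle_ineq4[of "z - x" "z - y"] by simp
        then have w: "norm (y - x) \<le> 5 * l" using that nz l by linarith
        have yr: "y \<in> ball x0 r" by (rule dom(1)[OF w])
        have "c * (s - H y) > 0" using c that by simp
        then have "u (y, s) > 0" using growth[OF yr in_range[OF H_range[OF yr]] s] H_zero[OF yr] that by force
        moreover have "\<bar>u (y, s) - u (y, H y)\<bar> \<le> C * \<bar>s - H y\<bar> powr \<beta>"
          by (rule holder_time[OF yr s in_range[OF H_range[OF yr]]])
        ultimately show ?thesis using H_zero[OF yr] that by simp
      qed
    qed (use H_meas in auto)
    also have "\<dots> = ennreal (c1 * (q powr (- e) * l powr (1 - e)) + c2 * l powr (- a))"
      unfolding k2[symmetric] e_def[symmetric] by (simp add: c1_def c2_def ac_simps)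
    also have "\<dots> \<le> ennreal (A / p)"
    proof (rule ennreal_leI)
      \<comment> \<open>The power of l is at most 1 and is dropped; p^(-e) = p^(1 - e) / p is then
        weakened to C^(1 - e) / p, the order of the far part.\<close>
      have "q powr (- e) * l powr (1 - e) \<le> q powr (- e) * 1"
        using l e powr_mono2[of "1 - e" l 1] by (intro mult_left_mono) auto
      also have "\<dots> = (2 * ?n) powr e * (p powr (1 - e) / p)"
        using p n by (simp add: q_def powr_divide powr_minus powr_diff field_simps)
      also have "\<dots> \<le> (2 * ?n) powr e * (C powr (1 - e) / p)"
        using p e by (intro mult_left_mono divide_right_mono powr_mono2) auto
      finally have 1: "q powr (- e) * l powr (1 - e) \<le> (2 * ?n) powr e * C powr (1 - e) / p" by simp
      have 2: "l powr (- a) = \<kappa> powr (- a) / p"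
      proof -
        have "(p powr (1 / a)) powr (- a) = p powr (- 1)" using exponents by (simp add: powr_powr)
        also have "\<dots> = 1 / p" using p powr_minus_divide[of p 1] by simp
        finally show ?thesis unfolding l_def using \<kappa>(1) p by (simp only: powr_mult) simp
      qed
      have "c1 * (q powr (- e) * l powr (1 - e)) + c2 * l powr (- a) \<le> c1 * ((2 * ?n) powr e * C powr (1 - e) / p) + c2 * (\<kappa> powr (- a) / p)"
        unfolding 2 using 1 c12 by (intro add_right_mono mult_left_mono) auto
      also have "\<dots> = (A - C) / p" by (simp add: A_def add_divide_distrib)
      also have "\<dots> \<le> A / p" using C p by (intro divide_right_mono) auto
      finally show "c1 * (q powr (- e) * l powr (1 - e)) + c2 * l powr (- a) \<le> A / p" .
    qed
    finally show ?thesis by (simp add: p_def)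
  qed
  moreover have "A \<ge> C" using c12 by (simp add: A_def)
  ultimately show ?thesis using that by blast
qed

end

section \<open>Expansion along the graph and the modulus of continuity of its gradient\<close>

context regular_graph
begin

lemma near_refl: "near x x (H x)"
  using \<kappa>(1) by (simp add: near_def)

lemma near_segment:
  assumes "near x y (H x)" "\<bar>H y - H x\<bar> \<le> \<kappa> * norm (D (x, H x)) powr (2 / a)" "min (H x) (H y) \<le> s" "s \<le> max (H x) (H y)"
  shows "near x y s" "near x x s"
proof -
  have "\<bar>s - H x\<bar> \<le> \<bar>H y - H x\<bar>" using assms(3,4) by (auto simp: min_def max_def split: if_splits)
  then show "near x y s" "near x x s" using assms \<kappa>(1) by (auto simp: near_def)
qed

lemma near_ranges:
  assumes "x \<in> ball x0 (r / 2)" "near x z s"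
  shows "z \<in> ball x0 r" "\<bar>s - t0\<bar> < \<rho>" "norm (D (z, s) - D (x, H x)) \<le> norm (D (x, H x)) / (2 * DIM('a))"
proof -
  have "norm (z - x) \<le> 5 * (\<kappa> * norm (D (x, H x)) powr (1 / a))"
    using assms(2) \<kappa>(1) by (auto simp: near_def intro: order_trans)
  then show "z \<in> ball x0 r" "\<bar>s - t0\<bar> < \<rho>" "norm (D (z, s) - D (x, H x)) \<le> norm (D (x, H x)) / (2 * DIM('a))"
    using near_domain[OF assms(1), of z s] assms(2) by (auto simp: near_def)
qed

lemma H_diff_powr:
  assumes "x \<in> ball x0 r" "x' \<in> ball x0 r" "\<gamma> \<le> e" "e \<le> 1"
  shows "\<bar>H x' - H x\<bar> powr e \<le> LH * norm (x' - x) powr \<gamma>"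
proof -
  let ?d = "norm (x' - x)"
  have d1: "?d \<le> 1" using norm_diff_ball[OF assms(2,1)] by simp
  have e0: "e > 0" using assms exponents by simp
  have "\<bar>H x' - H x\<bar> powr e \<le> (LH * ?d) powr e" using H_lipschitz[OF assms(1,2)] e0 by (intro powr_mono2) auto
  also have "\<dots> = LH powr e * ?d powr e" using LH by (simp add: powr_mult)
  also have "\<dots> \<le> LH * ?d powr \<gamma>"
    using LH e0 assms d1 powr_mono[of e 1 LH] exponents by (intro mult_mono powr_mono') auto
  finally show ?thesis .
qed

lemma weight_at_least_one:
  assumes "x \<in> ball x0 (r / 2)" "D (x, H x) \<noteq> 0" "B \<ge> C" shows "B / norm (D (x, H x)) \<ge> 1"
  using scale(2)[OF assms(1)] assms by simp

text \<open>If \<open>W\<close> were below c, then over a short time after \<open>H x\<close> the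
  increment of \<open>u\<close> would be too small for the growth hypothesis.\<close>

lemma W_lower_bound:
  assumes B: "B \<ge> C" "\<And>x z s. x \<in> ball x0 (r / 2) \<Longrightarrow> D (x, H x) \<noteq> 0 \<Longrightarrow> near x z s \<Longrightarrow> V z s \<le> ennreal (B / norm (D (x, H x)))"
    and x: "x \<in> ball x0 (r / 2)" and Dx: "D (x, H x) \<noteq> 0"
  shows "W x (H x) \<ge> c"
proof (rule ccontr)
  let ?p = "norm (D (x, H x))" and ?w = "W x (H x)"
  assume "\<not> c \<le> ?w"
  then have gap: "c - ?w > 0" by simp
  note xr = scale(1)[OF x]
  define Q where "Q = B / ?p"
  have Q: "Q \<ge> 1" unfolding Q_def by (rule weight_at_least_one[OF x Dx B(1)])
  \<comment> \<open>Short enough to stay in the neighbourhood of the point, and to keep the relative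
    error C Q h^\<gamma> at no more than half of the gap.\<close>
  define h where "h = min (\<kappa> * ?p powr (2 / a)) (((c - ?w) / (2 * (C * Q))) powr (1 / \<gamma>))"
  have h: "h > 0" using \<kappa>(1) Dx gap C Q by (simp add: h_def)
  have nr: "near x x s" if "s \<in> {H x..H x + h}" for s using that \<kappa>(1) by (auto simp: near_def h_def)
  have "\<bar>u (x, H x + h) - u (x, H x) - ?w * (H x + h - H x)\<bar> \<le> C * Q * (H x + h - H x) powr (1 + \<gamma>)"
  proof (rule W_increment[OF xr _ _ _ Q])
    show "V x s \<le> ennreal Q" if "s \<in> {H x..H x + h}" for s unfolding Q_def by (rule B(2)[OF x Dx nr[OF that]])
    show "\<bar>H x - t0\<bar> < \<rho>" by (rule in_range[OF H_range[OF xr]])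
    show "\<bar>H x + h - t0\<bar> < \<rho>" by (rule near_ranges(2)[OF x nr]) (use h in auto)
  qed (use h in auto)
  moreover have "u (x, H x + h) - u (x, H x) \<ge> c * (H x + h - H x)"
    by (rule growth[OF xr in_range[OF H_range[OF xr]] near_ranges(2)[OF x nr]]) (use h in auto)
  ultimately have "c * h - ?w * h \<le> C * Q * h powr (1 + \<gamma>)" by (simp add: abs_le_iff)
  also have "h powr (1 + \<gamma>) = h powr \<gamma> * h" using h by (simp add: powr_add)
  finally have "(c - ?w) * h \<le> (C * Q * h powr \<gamma>) * h" by (simp add: algebra_simps)
  then have le: "c - ?w \<le> C * Q * h powr \<gamma>" using h by simp
  have "h powr \<gamma> \<le> (((c - ?w) / (2 * (C * Q))) powr (1 / \<gamma>)) powr \<gamma>"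
    using h exponents by (intro powr_mono2) (auto simp: h_def)
  also have "\<dots> = (c - ?w) / (2 * (C * Q))" using exponents gap C Q by (simp add: powr_powr)
  finally have "C * Q * h powr \<gamma> \<le> C * Q * ((c - ?w) / (2 * (C * Q)))" using C Q by (intro mult_left_mono) auto
  also have "\<dots> = (c - ?w) / 2" using C Q by simp
  finally show False using le gap by simp
qed

text \<open>Both (x, H x) and (y, H y) are zeros of \<open>u\<close>. From the first one moves in
  space to (y, H x) by Taylor's formula, and from there in time to the second by
  \<open>W_increment\<close>; then \<open>W\<close> at y is replaced by its value at (x, H x) by
  \<open>W_holder\<close>. The Lipschitz bound for \<open>H\<close> turns powers of the height
  difference into powers of the distance.\<close>

lemma graph_expansion:
  assumes B: "B \<ge> C" "\<And>x z s. x \<in> ball x0 (r / 2) \<Longrightarrow> D (x, H x) \<noteq> 0 \<Longrightarrow> near x z s \<Longrightarrow> V z s \<le> ennreal (B / norm (D (x, H x)))"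
    and x: "x \<in> ball x0 (r / 2)" and Dx: "D (x, H x) \<noteq> 0"
    and y: "near x y (H x)" "\<bar>H y - H x\<bar> \<le> \<kappa> * norm (D (x, H x)) powr (2 / a)"
  defines "Q \<equiv> B / norm (D (x, H x))"
  shows "\<bar>W x (H x) - W y (H y)\<bar> \<le> C * Q * ((1 + LH) * norm (y - x) powr \<gamma>)"
    and "\<bar>W x (H x) * (H y - H x) + D (x, H x) \<bullet> (y - x)\<bar> \<le> (3 * C * Q * LH\<^sup>2 + C) * norm (y - x) powr (1 + \<gamma>)"
proof -
  let ?d = "norm (y - x)" and ?h = "H y - H x" and ?w = "W x (H x)"
  note xr = scale(1)[OF x] and yr = near_ranges(1)[OF x y(1)]
  have Q: "Q \<ge> 1" unfolding Q_def by (rule weight_at_least_one[OF x Dx B(1)])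
  have d1: "?d \<le> 1" using norm_diff_ball[OF yr xr] by simp
  have CQ: "C * Q \<ge> 0" using C Q by simp
  have tx: "\<bar>H x - t0\<bar> < \<rho>" and ty: "\<bar>H y - t0\<bar> < \<rho>" by (rule in_range[OF H_range], fact)+
  have Vb: "V z s \<le> ennreal Q" if "near x z s" for z s unfolding Q_def by (rule B(2)[OF x Dx that])
  have Vy: "V y s \<le> ennreal Q" if "min (H x) (H y) \<le> s" "s \<le> max (H x) (H y)" for s
    by (rule Vb[OF near_segment(1)[OF y that]])
  have dg: "?d powr (2 * \<gamma>) \<le> ?d powr \<gamma>" using exponents d1 by (intro powr_mono') auto
  have hg: "\<bar>?h\<bar> powr \<gamma> \<le> LH * ?d powr \<gamma>" by (rule H_diff_powr[OF xr yr]) (use exponents in auto)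
  have hl: "\<bar>?h\<bar> \<le> LH * ?d" by (rule H_lipschitz[OF xr yr])
  have WW: "\<bar>?w - W y s\<bar> \<le> C * Q * ((1 + LH) * ?d powr \<gamma>)" if "s = H x \<or> s = H y" for s
  proof -
    have "\<bar>?w - W y s\<bar> \<le> C * Q * (norm (x - y) powr (2 * \<gamma>) + \<bar>H x - s\<bar> powr \<gamma>)"
      by (rule W_holder[OF xr yr tx _ Q Vb[OF near_refl] Vy Vy]) (use that tx ty in auto)
    also have "\<dots> \<le> C * Q * (?d powr \<gamma> + LH * ?d powr \<gamma>)"
    proof (intro mult_left_mono add_mono CQ)
      show "norm (x - y) powr (2 * \<gamma>) \<le> ?d powr \<gamma>" using dg by (simp add: norm_minus_commute)
      show "\<bar>H x - s\<bar> powr \<gamma> \<le> LH * ?d powr \<gamma>" using that hg LH by (auto simp: abs_minus_commute)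
    qed
    finally show ?thesis by (simp add: algebra_simps)
  qed
  show "\<bar>?w - W y (H y)\<bar> \<le> C * Q * ((1 + LH) * ?d powr \<gamma>)" by (rule WW) simp
  \<comment> \<open>\<open>W_increment\<close> expands from the earlier of its two times, so
    \<open>W\<close> is first taken at the lower of the two heights.\<close>
  define s where "s = min (H x) (H y)"
  have s: "s = H x \<or> s = H y" by (auto simp: s_def)
  have inc: "\<bar>u (y, H y) - u (y, H x) - W y s * ?h\<bar> \<le> C * Q * \<bar>?h\<bar> powr (1 + \<gamma>)"
  proof (cases "H x \<le> H y")
    case True
    then show ?thesis using W_increment[OF yr tx ty True Q Vy] by (auto simp: s_def min_def max_def)
  next
    case False
    then have le: "H y \<le> H x" by simp
    have "\<bar>u (y, H x) - u (y, H y) - W y (H y) * (H x - H y)\<bar> \<le> C * Q * (H x - H y) powr (1 + \<gamma>)"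
      by (rule W_increment[OF yr ty tx le Q Vy]) (use le in auto)
    moreover have "\<bar>u (y, H y) - u (y, H x) - W y (H y) * ?h\<bar> = \<bar>u (y, H x) - u (y, H y) - W y (H y) * (H x - H y)\<bar>"
      by (subst abs_minus_commute) (simp add: algebra_simps)
    ultimately show ?thesis using False by (simp add: s_def min_def)
  qed
  have pw: "?d powr (1 + \<gamma>) = ?d * ?d powr \<gamma>" by (cases "y = x") (simp_all add: powr_add)
  have "\<bar>?h\<bar> powr (1 + \<gamma>) = \<bar>?h\<bar> * \<bar>?h\<bar> powr \<gamma>" by (cases "?h = 0") (simp_all add: powr_add)
  also have "\<dots> \<le> (LH * ?d) * (LH * ?d powr \<gamma>)" using hl hg LH by (intro mult_mono) auto
  finally have hp: "\<bar>?h\<bar> powr (1 + \<gamma>) \<le> LH\<^sup>2 * ?d powr (1 + \<gamma>)" by (simp add: pw power2_eq_square algebra_simps)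
  have "\<bar>?w * ?h - W y s * ?h\<bar> = \<bar>?w - W y s\<bar> * \<bar>?h\<bar>" by (simp add: abs_mult flip: left_diff_distrib)
  also have "\<dots> \<le> (C * Q * ((1 + LH) * ?d powr \<gamma>)) * (LH * ?d)"
    using WW[OF s] hl CQ LH by (intro mult_mono) auto
  also have "\<dots> = C * Q * ((1 + LH) * LH) * ?d powr (1 + \<gamma>)" by (simp add: pw algebra_simps)
  also have "\<dots> \<le> C * Q * (2 * LH\<^sup>2) * ?d powr (1 + \<gamma>)"
  proof (intro mult_right_mono mult_left_mono CQ)
    show "(1 + LH) * LH \<le> 2 * LH\<^sup>2" using LH by (simp add: power2_eq_square algebra_simps)
  qed auto
  finally have wh: "\<bar>?w * ?h - W y s * ?h\<bar> \<le> C * Q * (2 * LH\<^sup>2) * ?d powr (1 + \<gamma>)" .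
  have "\<bar>u (y, H x) - u (x, H x) - D (x, H x) \<bullet> (y - x)\<bar> \<le> C * ?d powr (1 + a)" by (rule taylor[OF xr yr tx])
  also have "\<dots> \<le> C * ?d powr (1 + \<gamma>)" using C exponents d1 by (intro mult_left_mono powr_mono') auto
  finally have ty: "\<bar>u (y, H x) - D (x, H x) \<bullet> (y - x)\<bar> \<le> C * ?d powr (1 + \<gamma>)" using H_zero[OF xr] by simp
  have inc': "\<bar>- u (y, H x) - W y s * ?h\<bar> \<le> C * Q * (LH\<^sup>2 * ?d powr (1 + \<gamma>))"
    using order_trans[OF inc mult_left_mono[OF hp CQ]] H_zero[OF yr] by simp
  have "?w * ?h + D (x, H x) \<bullet> (y - x) = (?w * ?h - W y s * ?h) - (- u (y, H x) - W y s * ?h) - (u (y, H x) - D (x, H x) \<bullet> (y - x))"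
    by simp
  then have "\<bar>?w * ?h + D (x, H x) \<bullet> (y - x)\<bar> \<le>
    C * Q * (2 * LH\<^sup>2) * ?d powr (1 + \<gamma>) + C * Q * (LH\<^sup>2 * ?d powr (1 + \<gamma>)) + C * ?d powr (1 + \<gamma>)"
    using wh inc' ty by linarith
  then show "\<bar>?w * ?h + D (x, H x) \<bullet> (y - x)\<bar> \<le> (3 * C * Q * LH\<^sup>2 + C) * ?d powr (1 + \<gamma>)"
    by (simp add: algebra_simps)
qed

theorem graph_C1_holder: "C1_holder_on \<gamma> (ball x0 (r / 2)) H"
proof -
  obtain B where B: "B \<ge> C" "\<And>x z s. x \<in> ball x0 (r / 2) \<Longrightarrow> D (x, H x) \<noteq> 0 \<Longrightarrow> near x z s \<Longrightarrow> V z s \<le> ennreal (B / norm (D (x, H x)))"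
    using weight_near by blast
  have B0: "B \<ge> 1" using B(1) C by simp
  define w where "w x = W x (H x)" for x
  \<comment> \<open>Where \<open>D\<close> vanishes nothing is known about \<open>W\<close>, so the
    value 0 is prescribed instead of left to the quotient.\<close>
  define G where "G x = (if D (x, H x) = 0 then 0 else (- 1 / w x) *\<^sub>R D (x, H x))" for x
  have w: "w x \<ge> c" if "x \<in> ball x0 (r / 2)" "D (x, H x) \<noteq> 0" for x
    unfolding w_def by (rule W_lower_bound[OF B that])
  have deriv: "(H has_derivative (\<lambda>h. h \<bullet> G x)) (at x)" if x: "x \<in> ball x0 (r / 2)" for x
  proof (cases "D (x, H x) = 0")
    case True
    have "(H has_derivative (\<lambda>h. h \<bullet> 0)) (at x)"
    proof (rule has_derivative_of_powr_bound[of _ "r / 2" a _ _ "C / c"])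
      fix y assume y: "norm (y - x) < r / 2"
      have "dist x0 y \<le> dist x0 x + dist x y" by (rule dist_triangle)
      then have yr: "y \<in> ball x0 r" using x y by (simp add: dist_norm norm_minus_commute)
      show "\<bar>H y - H x - (y - x) \<bullet> 0\<bar> \<le> C / c * norm (y - x) powr (1 + a)"
        using H_taylor[OF scale(1)[OF x] yr] True c by (simp add: field_simps)
    qed (use r exponents in auto)
    then show ?thesis using True by (simp add: G_def)
  next
    case False
    let ?p = "norm (D (x, H x))"
    define \<delta> where "\<delta> = min (\<kappa> * ?p powr (1 / a)) (\<kappa> * ?p powr (2 / a) / LH)"
    have \<delta>: "\<delta> > 0" using \<kappa>(1) False LH by (simp add: \<delta>_def)
    define K where "K = 3 * C * (B / ?p) * LH\<^sup>2 + C"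
    show ?thesis
    proof (rule has_derivative_of_powr_bound[OF _ \<delta> exponents(3), of _ _ _ "K / c"])
      show "bounded_linear (\<lambda>h. h \<bullet> G x)" by (rule bounded_linear_inner_left)
      fix y assume y: "norm (y - x) < \<delta>"
      have ny: "near x y (H x)" using y \<kappa>(1) by (simp add: near_def \<delta>_def)
      have "\<bar>H y - H x\<bar> \<le> LH * norm (y - x)" by (rule H_lipschitz[OF scale(1)[OF x] near_ranges(1)[OF x ny]])
      also have "\<dots> \<le> \<kappa> * ?p powr (2 / a)" using y LH by (simp add: \<delta>_def field_simps)
      finally have hy: "\<bar>H y - H x\<bar> \<le> \<kappa> * ?p powr (2 / a)" .
      have wx: "w x \<ge> c" by (rule w[OF x False])
      have K0: "0 \<le> K * norm (y - x) powr (1 + \<gamma>)" using C B0 by (auto simp: K_def)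
      have "\<bar>w x * (H y - H x) + D (x, H x) \<bullet> (y - x)\<bar> \<le> K * norm (y - x) powr (1 + \<gamma>)"
        unfolding w_def K_def by (rule graph_expansion(2)[OF B x False ny hy])
      moreover have "w x * (H y - H x) + D (x, H x) \<bullet> (y - x) = w x * (H y - H x - (y - x) \<bullet> G x)"
        using wx c False by (simp add: G_def algebra_simps inner_commute)
      ultimately have "w x * \<bar>H y - H x - (y - x) \<bullet> G x\<bar> \<le> K * norm (y - x) powr (1 + \<gamma>)"
        using wx c by (simp add: abs_mult)
      moreover have "c * \<bar>H y - H x - (y - x) \<bullet> G x\<bar> \<le> w x * \<bar>H y - H x - (y - x) \<bullet> G x\<bar>"
        using wx by (intro mult_right_mono) auto
      ultimately show "\<bar>H y - H x - (y - x) \<bullet> G x\<bar> \<le> K / c * norm (y - x) powr (1 + \<gamma>)"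
        using c by (simp add: field_simps)
    qed
  qed
  have Gb: "norm (G x) \<le> norm (D (x, H x)) / c" if x: "x \<in> ball x0 (r / 2)" for x
  proof (cases "D (x, H x) = 0")
    case False
    have "norm (G x) = norm (D (x, H x)) / w x" using w[OF x False] c False by (simp add: G_def)
    also have "\<dots> \<le> norm (D (x, H x)) / c" using w[OF x False] c by (intro divide_left_mono) auto
    finally show ?thesis .
  qed (simp add: G_def)
  \<comment> \<open>At distance at most \<open>\<kappa>2\<close> p^(2/a) the neighbourhood
    conditions hold both for the point and for its height: for the height by the Lipschitz bound,
    for the point because p^(2/a) <= C^(1/a) p^(1/a).\<close>
  define \<kappa>2 where "\<kappa>2 = min (\<kappa> / LH) (\<kappa> / C powr (1 / a))"
  have \<kappa>2: "\<kappa>2 > 0" using \<kappa>(1) LH C by (simp add: \<kappa>2_def)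
  define M where "M = max (2 / c * \<kappa>2 powr (- a / 2)) (C * (1 + LH) / c + C * B * (1 + LH) / c\<^sup>2)"
  \<comment> \<open>The points are ordered by the size of \<open>D\<close>, so that the larger size
    p bounds both gradients when they are far apart; the symmetric form is recovered at the
    end.\<close>
  have holder: "norm (G x - G x') \<le> M * norm (x' - x) powr \<gamma>"
    if x: "x \<in> ball x0 (r / 2)" and x': "x' \<in> ball x0 (r / 2)" and le: "norm (D (x', H x')) \<le> norm (D (x, H x))" for x x'
  proof -
    let ?p = "norm (D (x, H x))" and ?d = "norm (x' - x)"
    note xr = scale(1)[OF x] and xr' = scale(1)[OF x']
    have d1: "?d \<le> 1" using norm_diff_ball[OF xr' xr] by simp
    show ?thesis
    proof (cases "?d \<le> \<kappa>2 * ?p powr (2 / a) \<and> D (x, H x) \<noteq> 0")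
      case False
      \<comment> \<open>Far case: either p = 0, or the distance d exceeds \<open>\<kappa>2\<close>
        p^(2/a), so that p is at most of order d^(a/2); then \<gamma> <= a/2 is used.\<close>
      have p: "?p \<le> \<kappa>2 powr (- a / 2) * ?d powr \<gamma>"
      proof (cases "D (x, H x) = 0")
        case nz: False
        then have "?p powr (2 / a) \<le> ?d / \<kappa>2" using False \<kappa>2 by (simp add: field_simps)
        then have "(?p powr (2 / a)) powr (a / 2) \<le> (?d / \<kappa>2) powr (a / 2)" using exponents by (intro powr_mono2) auto
        then have "?p \<le> (?d / \<kappa>2) powr (a / 2)" using exponents nz by (simp add: powr_powr)
        also have "\<dots> = \<kappa>2 powr (- a / 2) * ?d powr (a / 2)" using \<kappa>2 by (simp add: powr_divide powr_minus field_simps)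
        also have "\<dots> \<le> \<kappa>2 powr (- a / 2) * ?d powr \<gamma>" using exponents d1 by (intro mult_left_mono powr_mono') auto
        finally show ?thesis .
      qed simp
      have "norm (G x - G x') \<le> norm (G x) + norm (G x')" by (rule norm_triangle_ineq4)
      also have "\<dots> \<le> ?p / c + ?p / c"
        using Gb[OF x] order_trans[OF Gb[OF x'] divide_right_mono[OF le]] c by (intro add_mono) auto
      also have "\<dots> = 2 / c * ?p" by simp
      also have "\<dots> \<le> 2 / c * (\<kappa>2 powr (- a / 2) * ?d powr \<gamma>)" using p c by (intro mult_left_mono) auto
      also have "\<dots> = (2 / c * \<kappa>2 powr (- a / 2)) * ?d powr \<gamma>" by simp
      also have "\<dots> \<le> M * ?d powr \<gamma>" by (intro mult_right_mono) (auto simp: M_def)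
      finally show ?thesis .
    next
      case True
      then have Dx: "D (x, H x) \<noteq> 0" and dle: "?d \<le> \<kappa>2 * ?p powr (2 / a)" by auto
      have pC: "?p powr (1 / a) \<le> C powr (1 / a)" using scale(2)[OF x] exponents by (intro powr_mono2) auto
      have "?d \<le> (\<kappa> / C powr (1 / a)) * ?p powr (2 / a)"
        by (rule order_trans[OF dle]) (intro mult_right_mono, auto simp: \<kappa>2_def)
      also have "?p powr (2 / a) = ?p powr (1 / a) * ?p powr (1 / a)" using Dx by (simp flip: powr_add)
      also have "(\<kappa> / C powr (1 / a)) * (?p powr (1 / a) * ?p powr (1 / a)) = \<kappa> * ?p powr (1 / a) * (?p powr (1 / a) / C powr (1 / a))" by simp
      also have "\<dots> \<le> \<kappa> * ?p powr (1 / a) * 1" using pC C \<kappa>(1) by (intro mult_left_mono) auto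
      finally have near': "near x x' (H x)" using \<kappa>(1) by (simp add: near_def)
      have "\<bar>H x' - H x\<bar> \<le> LH * ?d" by (rule H_lipschitz[OF xr xr'])
      also have "\<dots> \<le> LH * ((\<kappa> / LH) * ?p powr (2 / a))"
        using LH by (intro mult_left_mono order_trans[OF dle] mult_right_mono) (auto simp: \<kappa>2_def)
      also have "\<dots> = \<kappa> * ?p powr (2 / a)" using LH by simp
      finally have hy: "\<bar>H x' - H x\<bar> \<le> \<kappa> * ?p powr (2 / a)" .
      have n: "real DIM('a) \<ge> 1" using DIM_positive[where 'a='a] by linarith
      \<comment> \<open>\<open>D\<close> changes by less than its own size, so it is nonzero at the
        second point too and the quotient formula holds at both.\<close>
      have "norm (D (x', H x') - D (x, H x)) \<le> ?p / (2 * DIM('a))"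
        by (rule near_ranges(3)[OF x near_segment(1)[OF near' hy]]) auto
      also have "\<dots> \<le> ?p / 2" using n by (intro divide_left_mono) auto
      also have "\<dots> < ?p" using Dx by simp
      finally have Dx': "D (x', H x') \<noteq> 0" by auto
      have ww: "w x \<ge> c" "w x' \<ge> c" by (rule w[OF x Dx], rule w[OF x' Dx'])
      have wd: "\<bar>w x - w x'\<bar> \<le> C * (B / ?p) * ((1 + LH) * ?d powr \<gamma>)"
        unfolding w_def by (rule graph_expansion(1)[OF B x Dx near' hy])
      have tx: "\<bar>H x - t0\<bar> < \<rho>" and tx': "\<bar>H x' - t0\<bar> < \<rho>" by (rule in_range[OF H_range], fact)+
      have "norm (D (x, H x) - D (x', H x')) \<le> norm (D (x, H x) - D (x', H x)) + norm (D (x', H x) - D (x', H x'))"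
        using norm_triangle_ineq[of "D (x, H x) - D (x', H x)" "D (x', H x) - D (x', H x')"] by simp
      also have "\<dots> \<le> C * norm (x - x') powr a + C * \<bar>H x - H x'\<bar> powr (a / 2)"
        by (intro add_mono D_space D_time xr xr' tx tx')
      also have "\<dots> \<le> C * ?d powr \<gamma> + C * (LH * ?d powr \<gamma>)"
      proof (intro add_mono mult_left_mono)
        show "norm (x - x') powr a \<le> ?d powr \<gamma>" unfolding norm_minus_commute[of x] using exponents d1 by (intro powr_mono') auto
        show "\<bar>H x - H x'\<bar> powr (a / 2) \<le> LH * ?d powr \<gamma>" unfolding abs_minus_commute[of "H x"]
          by (rule H_diff_powr[OF xr xr']) (use exponents in auto)
      qed (use C in auto)
      finally have Dd: "norm (D (x, H x) - D (x', H x')) \<le> C * (1 + LH) * ?d powr \<gamma>" by (simp add: algebra_simps)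
      \<comment> \<open>In the second term \<open>D (x, H x)\<close> has norm p, which cancels the
        1/p in the bound for the difference of \<open>w\<close>.\<close>
      have "G x - G x' = (1 / w x') *\<^sub>R (D (x', H x') - D (x, H x)) + ((w x - w x') / (w x * w x')) *\<^sub>R D (x, H x)"
        using Dx Dx' ww c by (simp add: G_def scaleR_diff_right diff_divide_distrib scaleR_diff_left algebra_simps)
      then have "norm (G x - G x') \<le> (1 / w x') * norm (D (x', H x') - D (x, H x)) + (\<bar>w x - w x'\<bar> / (w x * w x')) * ?p"
        using norm_triangle_ineq[of "(1 / w x') *\<^sub>R (D (x', H x') - D (x, H x))" "((w x - w x') / (w x * w x')) *\<^sub>R D (x, H x)"] ww c by simp
      also have "\<dots> \<le> (1 / c) * (C * (1 + LH) * ?d powr \<gamma>) + ((C * (B / ?p) * ((1 + LH) * ?d powr \<gamma>)) / (c * c)) * ?p"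
      proof (intro add_mono mult_mono)
        show "1 / w x' \<le> 1 / c" using ww c by (intro divide_left_mono) auto
        show "norm (D (x', H x') - D (x, H x)) \<le> C * (1 + LH) * ?d powr \<gamma>" using Dd by (simp add: norm_minus_commute)
        show "\<bar>w x - w x'\<bar> / (w x * w x') \<le> C * (B / ?p) * ((1 + LH) * ?d powr \<gamma>) / (c * c)"
          using wd ww c by (intro frac_le mult_mono) auto
      qed (use c C LH B0 in auto)
      also have "\<dots> = (C * (1 + LH) / c + C * B * (1 + LH) / c\<^sup>2) * ?d powr \<gamma>"
        using Dx c by (simp add: field_simps power2_eq_square)
      also have "\<dots> \<le> M * ?d powr \<gamma>" by (intro mult_right_mono) (auto simp: M_def)
      finally show ?thesis .
    qed
  qed
  have "dist (G x) (G x') \<le> M * dist x x' powr \<gamma>" if "x \<in> ball x0 (r / 2)" "x' \<in> ball x0 (r / 2)" for x x'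
    using holder[OF that] holder[OF that(2,1)] by (cases "norm (D (x', H x')) \<le> norm (D (x, H x))") (auto simp: dist_norm norm_minus_commute)
  then have "locally_holder_on \<gamma> (ball x0 (r / 2)) G" unfolding locally_holder_on_def by (meson subsetD)
  then show ?thesis unfolding C1_holder_on_def gderiv_def using deriv by blast
qed

end

section \<open>The free boundary\<close>

lemma abs_snd_le_norm: "\<bar>snd z\<bar> \<le> norm (z :: 'a::real_normed_vector \<times> real)"
  using norm_snd_le[of "snd z" "fst z"] by simp

lemma powr_ge_self_le_one: "0 \<le> d \<Longrightarrow> d \<le> 1 \<Longrightarrow> 0 < e \<Longrightarrow> e \<le> 1 \<Longrightarrow> (d::real) \<le> d powr e"
  using powr_mono'[of e 1 d] by auto

text \<open>The representation writes c0 u as the potential P of \<open>f\<close> minus a smooth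
  function S. Every assumption of \<open>regular_graph\<close> is the corresponding estimate for P
  plus a Lipschitz or quadratic bound for S; since all distances are at most 1, the latter is
  absorbed by any weaker power.\<close>

lemma regular_graph_of_representation:
  fixes u f ub :: "'a::euclidean_space \<times> real \<Rightarrow> real" and H :: "'a \<Rightarrow> real"
  assumes \<alpha>: "0 < \<alpha>" "\<alpha> < 1" and r: "0 < r" "r \<le> \<rho>" and \<rho>: "0 < \<rho>" "\<rho> \<le> 1/8" and c: "c > 0"
    and um: "u \<in> borel_measurable borel" and fm: "f \<in> borel_measurable borel" and ubm: "ub \<in> borel_measurable borel"
    and Hm: "H \<in> borel_measurable borel"
    and f1: "\<And>w. \<bar>f w\<bar> \<le> 1" and ub: "\<And>w. \<bar>ub w\<bar> \<le> M"
    and rep: "\<And>x t. x \<in> ball x0 r \<Longrightarrow> \<bar>t - t0\<bar> < \<rho> \<Longrightarrow> gauss_mass TYPE('a) * u (x, t) =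
       (\<integral>w. f w * (heat_power (DIM('a) / 2) ((x, t) - w) * cutoff \<rho> ((x, t) - w)) \<partial>lborel)
       - (\<integral>w. ub w * heat_error \<rho> ((x, t) - w) \<partial>lborel)"
    and fH: "\<And>x t y s. x \<in> ball x0 r \<Longrightarrow> \<bar>t - t0\<bar> < \<rho> \<Longrightarrow> norm (x - y, t - s) \<le> \<rho> \<Longrightarrow> f (y, s) = (if H y < s then 1 else 0)"
    and growth: "\<And>x t t'. x \<in> ball x0 r \<Longrightarrow> \<bar>t - t0\<bar> < \<rho> \<Longrightarrow> \<bar>t' - t0\<bar> < \<rho> \<Longrightarrow> t \<le> t' \<Longrightarrow> u (x, t') - u (x, t) \<ge> c * (t' - t)"
    and H_range: "\<And>x. x \<in> ball x0 r \<Longrightarrow> \<bar>H x - t0\<bar> < \<rho> / 2"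
    and H_zero: "\<And>x. x \<in> ball x0 r \<Longrightarrow> u (x, H x) = 0"
  shows "C1_holder_on (\<alpha> / 2) (ball x0 (r / 2)) H"
proof -
  let ?m = "real DIM('a) / 2"
  obtain D\<eta> L where bump: "smooth_bump (cutoff \<rho> :: 'a \<times> real \<Rightarrow> real) D\<eta> \<rho> L" using cutoff_bump_exists[OF \<rho>(1)] by blast
  interpret \<eta>: cut_kernel "cutoff \<rho> :: 'a \<times> real \<Rightarrow> real" D\<eta> \<rho> L ?m
  proof (intro cut_kernel.intro bump cut_kernel_axioms.intro)
  qed (use \<rho> cutoff_bounds in auto)
  obtain DE LE where bumpE: "smooth_bump (heat_error \<rho> :: 'a \<times> real \<Rightarrow> real) DE \<rho> LE" using heat_error_bump_exists[OF \<rho>(1)] by blast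
  interpret E: smooth_bump "heat_error \<rho> :: 'a \<times> real \<Rightarrow> real" DE \<rho> LE by (rule bumpE)
  define c0 where "c0 = gauss_mass TYPE('a)"
  have c0: "c0 > 0" unfolding c0_def by (rule gauss_mass_pos)
  define a where "a = (1 + \<alpha>) / 2"
  define \<beta> where "\<beta> = (7 + \<alpha>) / 8"
  define \<gamma> where "\<gamma> = \<alpha> / 2"
  have ex: "0 \<le> a" "a < 1" "0 \<le> a / 2" "a / 2 < 1 / 2" "0 \<le> \<beta>" "\<beta> < 1" "0 < \<gamma>" "\<gamma> \<le> 1/2" "0 < a" "0 < \<beta>" "2 * \<gamma> \<le> 1" "\<gamma> \<le> 1"
    using \<alpha> by (auto simp: a_def \<beta>_def \<gamma>_def)
  define P where "P = \<eta>.potential f"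
  define G where "G = \<eta>.potential_grad f"
  define S where "S = E.bump_conv ub"
  define Sg where "Sg = E.bump_conv_grad ub"
  have u: "c0 * u (x, t) = P (x, t) - S (x, t)" if "x \<in> ball x0 r" "\<bar>t - t0\<bar> < \<rho>" for x t
    using rep[OF that] by (simp add: c0_def P_def S_def \<eta>.potential_def \<eta>.K_def E.bump_conv_def)
  define D where "D z = (1 / c0) *\<^sub>R (G z - fst (Sg z))" for z
  \<comment> \<open>The graph integral stands for the time derivative of the potential; the smooth
    part contributes the time component of its gradient.\<close>
  define W where "W x s = (\<eta>.graph_potential H x s - snd (Sg (x, s))) / c0" for x s
  define V where "V = (\<lambda>x s. \<integral>\<^sup>+y. ennreal (cut_weight (?m + \<gamma>) (x - y, s - H y)) \<partial>lborel)"
  have Vg: "V x s = \<eta>.graph_weight (?m + \<gamma>) H x s" for x s by (simp add: V_def \<eta>.graph_weight_def)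
  define cT where "cT = 2 * (6 + 42 * L) * \<eta>.weight_mass (?m + 1/2 + a/2)"
  define cS where "cS = 2 * (6 + 44 * L + 2 * L * 6) * \<eta>.weight_mass (?m + 1/2 + a/2)"
  define cG where "cG = 2 * (10 * (?m + 3) + 44 * L + 2 * L * (?m + 2)) * \<eta>.weight_mass (?m + 1/2 + a/2)"
  define cB where "cB = 2 * (20 + 2 * L) * \<eta>.weight_mass (?m + 1/2)"
  define cH where "cH = 2 * (?m + 2 + 2 * L) * \<eta>.weight_mass (?m + \<beta>)"
  define cW where "cW = 2 * ((6 + 2 * L) + (?m + 2 + 2 * L))"
  define cQ where "cQ = 2 * M * E.bump_const"
  have M0: "M \<ge> 0" using ub[of undefined] by linarith
  have nn: "cT \<ge> 0" "cS \<ge> 0" "cG \<ge> 0" "cB \<ge> 0" "cH \<ge> 0" "cW \<ge> 0" "cQ \<ge> 0"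
    using \<eta>.L_nonneg \<eta>.weight_mass_nonneg E.bump_const_nonneg M0
    by (auto simp: cT_def cS_def cG_def cB_def cH_def cW_def cQ_def intro!: mult_nonneg_nonneg add_nonneg_nonneg)
  \<comment> \<open>A single constant dominating the sum of all the others after division by the
    mass; \<open>byC\<close> extracts whichever of them an estimate involves.\<close>
  define C where "C = 1 + (cT + cS + cG + cB + cH + cW + cQ) / c0"
  have C1: "C \<ge> 1" using nn c0 by (simp add: C_def)
  have Cle: "X / c0 \<le> C" if "X \<le> cT + cS + cG + cB + cH + cW + cQ" for X
    using that c0 divide_right_mono[OF that, of c0] by (simp add: C_def)
  have byC: "\<bar>y\<bar> \<le> C * q" if "c0 * \<bar>y\<bar> \<le> X * q" "X \<le> cT + cS + cG + cB + cH + cW + cQ" "q \<ge> 0" for X y q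
  proof -
    have "\<bar>y\<bar> \<le> X / c0 * q" using that(1) c0 by (simp add: field_simps)
    also have "\<dots> \<le> C * q" using Cle[OF that(2)] that(3) by (rule mult_right_mono)
    finally show ?thesis .
  qed
  have diam: "norm (x - x') \<le> 1" if "x \<in> ball x0 r" "x' \<in> ball x0 r" for x x'
  proof -
    have "dist x x' < r + r" using that dist_triangle_less_add[of x x0 r x' r] by (simp add: dist_commute)
    then show ?thesis using r \<rho> by (simp add: dist_norm)
  qed
  have diamt: "\<bar>t - t'\<bar> \<le> 1" if "\<bar>t - t0\<bar> < \<rho>" "\<bar>t' - t0\<bar> < \<rho>" for t t' using that \<rho> by linarith
  note Q = E.bump_conv_facts[OF ubm ub, folded S_def Sg_def]
  have Qf: "norm (fst (Sg z) - fst (Sg z')) \<le> cQ * norm (z - z')" "\<bar>snd (Sg z) - snd (Sg z')\<bar> \<le> cQ * norm (z - z')" for z z'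
  proof -
    have "norm (Sg z - Sg z') \<le> cQ * norm (z - z')" using Q(3)[of z z'] by (simp add: cQ_def ac_simps)
    moreover have "norm (fst (Sg z - Sg z')) \<le> norm (Sg z - Sg z')" by (rule norm_fst_le2)
    moreover have "\<bar>snd (Sg z - Sg z')\<bar> \<le> norm (Sg z - Sg z')" by (rule abs_snd_le_norm)
    ultimately show "norm (fst (Sg z) - fst (Sg z')) \<le> cQ * norm (z - z')" "\<bar>snd (Sg z) - snd (Sg z')\<bar> \<le> cQ * norm (z - z')" by auto
  qed
  have Dn: "c0 * norm (D z - D z') \<le> norm (G z - G z') + norm (fst (Sg z) - fst (Sg z'))" for z z'
  proof -
    have "c0 *\<^sub>R (D z - D z') = (G z - G z') - (fst (Sg z) - fst (Sg z'))"
      using c0 by (simp add: D_def scaleR_diff_right)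
    then have "c0 * norm (D z - D z') = norm ((G z - G z') - (fst (Sg z) - fst (Sg z')))" using c0 by (metis abs_of_pos norm_scaleR)
    then show ?thesis using norm_triangle_ineq4[of "G z - G z'"] by simp
  qed
  interpret R: regular_graph u D H W V x0 t0 r \<rho> c C \<alpha> a \<beta> \<gamma>
  proof
    show "V = (\<lambda>x s. \<integral>\<^sup>+y. ennreal (cut_weight (real DIM('a) / 2 + \<gamma>) (x - y, s - H y)) \<partial>lborel)" by (rule V_def)
    fix x x' :: 'a and t :: real
    assume x: "x \<in> ball x0 r" "x' \<in> ball x0 r" and t: "\<bar>t - t0\<bar> < \<rho>"
    define v where "v = x' - x"
    have v1: "norm v \<le> 1" using diam[OF x(2,1)] by (simp add: v_def)
    have x'e: "x' = x + v" by (simp add: v_def)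
    have "\<bar>P (x + v, t) - P (x, t) - G (x, t) \<bullet> v\<bar> \<le> cT * norm v powr (1 + a)"
      unfolding P_def G_def cT_def by (rule \<eta>.potential_taylor[OF refl fm f1 v1 ex(1,2)])
    moreover have "\<bar>S (x + v, t) - S (x, t) - fst (Sg (x, t)) \<bullet> v\<bar> \<le> cQ * norm v powr (1 + a)"
    proof -
      have "\<bar>S ((x, t) + (v, 0)) - S (x, t) - Sg (x, t) \<bullet> (v, 0)\<bar> \<le> 2 * M * (norm (v, 0::real))\<^sup>2 * E.bump_const" by (rule Q(4))
      moreover have "(norm v)\<^sup>2 \<le> norm v powr (1 + a)" using powr_mono'[of "1 + a" 2 "norm v"] v1 ex by (cases "v = 0") auto
      then have "cQ * (norm v)\<^sup>2 \<le> cQ * norm v powr (1 + a)" using nn by (intro mult_left_mono) auto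
      ultimately show ?thesis by (simp add: cQ_def inner_prod_def ac_simps)
    qed
    moreover have "c0 * (u (x + v, t) - u (x, t) - D (x, t) \<bullet> v) =
       (P (x + v, t) - P (x, t) - G (x, t) \<bullet> v) - (S (x + v, t) - S (x, t) - fst (Sg (x, t)) \<bullet> v)"
      using u[OF x(1) t] u[OF x(2) t] c0 unfolding x'e by (simp add: D_def inner_diff_left right_diff_distrib)
    ultimately have "\<bar>c0 * (u (x + v, t) - u (x, t) - D (x, t) \<bullet> v)\<bar> \<le> (cT + cQ) * norm v powr (1 + a)"
      by (simp add: algebra_simps)
    then show "\<bar>u (x', t) - u (x, t) - D (x, t) \<bullet> (x' - x)\<bar> \<le> C * norm (x' - x) powr (1 + a)"
      unfolding v_def[symmetric] unfolding x'e using c0 nn by (intro byC[of _ "cT + cQ"]) (auto simp: abs_mult)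
  next
    fix x x' :: 'a and t :: real
    assume x: "x \<in> ball x0 r" "x' \<in> ball x0 r" and t: "\<bar>t - t0\<bar> < \<rho>"
    have d1: "norm (x - x') \<le> 1" by (rule diam[OF x])
    have "norm (G (x, t) - G (x', t)) \<le> cS * norm (x - x') powr a"
      unfolding G_def cS_def by (rule \<eta>.potential_grad_holder_space[OF refl fm f1 d1 ex(1,2)])
    moreover have "norm (fst (Sg (x, t)) - fst (Sg (x', t))) \<le> cQ * norm (x - x') powr a"
      using Qf(1)[of "(x, t)" "(x', t)"] mult_left_mono[OF powr_ge_self_le_one[OF norm_ge_zero d1, of a], of cQ] ex nn by simp
    ultimately have "c0 * \<bar>norm (D (x, t) - D (x', t))\<bar> \<le> (cS + cQ) * norm (x - x') powr a"
      using Dn[of "(x, t)" "(x', t)"] by (simp add: algebra_simps)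
    then have "\<bar>norm (D (x, t) - D (x', t))\<bar> \<le> C * norm (x - x') powr a" using nn by (intro byC[of _ "cS + cQ"]) auto
    then show "norm (D (x, t) - D (x', t)) \<le> C * norm (x - x') powr a" by simp
  next
    fix x :: 'a and t t' :: real
    assume x: "x \<in> ball x0 r" and t: "\<bar>t - t0\<bar> < \<rho>" "\<bar>t' - t0\<bar> < \<rho>"
    have d1: "\<bar>t - t'\<bar> \<le> 1" by (rule diamt[OF t])
    have "norm (G (x, t) - G (x, t')) \<le> cG * \<bar>t - t'\<bar> powr (a / 2)"
      unfolding G_def cG_def by (rule \<eta>.potential_grad_holder_time[OF refl fm f1 d1 ex(3,4)])
    moreover have "norm (fst (Sg (x, t)) - fst (Sg (x, t'))) \<le> cQ * \<bar>t - t'\<bar> powr (a / 2)"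
      using Qf(1)[of "(x, t)" "(x, t')"] mult_left_mono[OF powr_ge_self_le_one[OF abs_ge_zero d1, of "a / 2"], of cQ] ex nn by simp
    ultimately have "c0 * \<bar>norm (D (x, t) - D (x, t'))\<bar> \<le> (cG + cQ) * \<bar>t - t'\<bar> powr (a / 2)"
      using Dn[of "(x, t)" "(x, t')"] by (simp add: algebra_simps)
    then have "\<bar>norm (D (x, t) - D (x, t'))\<bar> \<le> C * \<bar>t - t'\<bar> powr (a / 2)" using nn by (intro byC[of _ "cG + cQ"]) auto
    then show "norm (D (x, t) - D (x, t')) \<le> C * \<bar>t - t'\<bar> powr (a / 2)" by simp
  next
    fix x :: 'a and t :: real
    assume x: "x \<in> ball x0 r" and t: "\<bar>t - t0\<bar> < \<rho>"
    have "norm (G (x, t)) \<le> cB" unfolding G_def cB_def by (rule \<eta>.potential_grad_bound[OF refl f1])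
    moreover have "norm (fst (Sg (x, t))) \<le> cQ" using norm_fst_le2[of "Sg (x, t)"] Q(1)[of "(x, t)"] by (simp add: cQ_def)
    moreover have "c0 * norm (D (x, t)) = norm (G (x, t) - fst (Sg (x, t)))" using c0 by (simp add: D_def)
    ultimately have "c0 * \<bar>norm (D (x, t))\<bar> \<le> (cB + cQ) * 1" using norm_triangle_ineq4[of "G (x, t)" "fst (Sg (x, t))"] by simp
    then have "\<bar>norm (D (x, t))\<bar> \<le> C * 1" using nn by (intro byC[of _ "cB + cQ"]) auto
    then show "norm (D (x, t)) \<le> C" by simp
  next
    fix x :: 'a and t t' :: real
    assume x: "x \<in> ball x0 r" and t: "\<bar>t - t0\<bar> < \<rho>" "\<bar>t' - t0\<bar> < \<rho>"
    have d1: "\<bar>t - t'\<bar> \<le> 1" by (rule diamt[OF t])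
    have "\<bar>P (x, t) - P (x, t')\<bar> \<le> cH * \<bar>t - t'\<bar> powr \<beta>"
      unfolding P_def cH_def by (rule \<eta>.potential_holder_time[OF refl fm f1 d1 ex(5,6)])
    moreover have "\<bar>S (x, t) - S (x, t')\<bar> \<le> cQ * \<bar>t - t'\<bar> powr \<beta>"
      using Q(2)[of "(x, t)" "(x, t')"] mult_left_mono[OF powr_ge_self_le_one[OF abs_ge_zero d1, of \<beta>], of cQ] ex nn by (simp add: cQ_def ac_simps)
    moreover have "c0 * (u (x, t) - u (x, t')) = (P (x, t) - P (x, t')) - (S (x, t) - S (x, t'))"
      using u[OF x t(1)] u[OF x t(2)] by (simp add: right_diff_distrib)
    ultimately have "\<bar>c0 * (u (x, t) - u (x, t'))\<bar> \<le> (cH + cQ) * \<bar>t - t'\<bar> powr \<beta>" by (simp add: algebra_simps)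
    then show "\<bar>u (x, t) - u (x, t')\<bar> \<le> C * \<bar>t - t'\<bar> powr \<beta>"
      using c0 nn by (intro byC[of _ "cH + cQ"]) (auto simp: abs_mult)
  next
    fix x x' :: 'a and s s' A :: real
    assume x: "x \<in> ball x0 r" "x' \<in> ball x0 r" and s: "\<bar>s - t0\<bar> < \<rho>" "\<bar>s' - t0\<bar> < \<rho>" and A: "A \<ge> 1"
      and VA: "V x s \<le> ennreal A" "V x' s \<le> ennreal A" "V x' s' \<le> ennreal A"
    have A0: "A \<ge> 0" using A by simp
    have d1: "norm (x - x') \<le> 1" "\<bar>s - s'\<bar> \<le> 1" by (rule diam[OF x], rule diamt[OF s])
    let ?q = "norm (x - x') powr (2 * \<gamma>) + \<bar>s - s'\<bar> powr \<gamma>"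
    have "\<bar>\<eta>.graph_potential H x s - \<eta>.graph_potential H x' s'\<bar> \<le>
       2 * A * ((6 + 2 * L) * norm (x - x') powr (2 * \<gamma>) + (?m + 2 + 2 * L) * \<bar>s - s'\<bar> powr \<gamma>)"
      by (rule \<eta>.graph_potential_holder[OF Hm ex(7,8) VA[unfolded Vg] A0 d1])
    also have "\<dots> \<le> 2 * A * (((6 + 2 * L) + (?m + 2 + 2 * L)) * norm (x - x') powr (2 * \<gamma>) + ((6 + 2 * L) + (?m + 2 + 2 * L)) * \<bar>s - s'\<bar> powr \<gamma>)"
    proof -
      have "6 + 2 * L \<le> (6 + 2 * L) + (?m + 2 + 2 * L)" "?m + 2 + 2 * L \<le> (6 + 2 * L) + (?m + 2 + 2 * L)"
        using \<eta>.L_nonneg by simp_all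
      then show ?thesis using A0 by (intro mult_left_mono[OF add_mono[OF mult_right_mono mult_right_mono]]) simp_all
    qed
    also have "\<dots> = cW * (A * ?q)" by (simp add: cW_def algebra_simps)
    finally have 1: "\<bar>\<eta>.graph_potential H x s - \<eta>.graph_potential H x' s'\<bar> \<le> cW * (A * ?q)" .
    have "\<bar>snd (Sg (x, s)) - snd (Sg (x', s'))\<bar> \<le> cQ * norm ((x, s) - (x', s'))" by (rule Qf(2))
    also have "\<dots> \<le> cQ * (A * ?q)"
    proof (rule mult_left_mono)
      have "norm ((x, s) - (x', s')) \<le> norm (x - x') + \<bar>s - s'\<bar>" using norm_Pair_le[of "x - x'" "s - s'"] by simp
      also have "\<dots> \<le> ?q" using d1 ex by (intro add_mono powr_ge_self_le_one) auto
      also have "\<dots> \<le> A * ?q" using mult_right_mono[OF A, of ?q] by simp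
      finally show "norm ((x, s) - (x', s')) \<le> A * ?q" .
    qed (rule nn)
    finally have 2: "\<bar>snd (Sg (x, s)) - snd (Sg (x', s'))\<bar> \<le> cQ * (A * ?q)" .
    have "c0 * (W x s - W x' s') = (\<eta>.graph_potential H x s - \<eta>.graph_potential H x' s') - (snd (Sg (x, s)) - snd (Sg (x', s')))"
      using c0 by (simp add: W_def field_simps)
    then have "\<bar>c0 * (W x s - W x' s')\<bar> \<le> cW * (A * ?q) + cQ * (A * ?q)" using 1 2 by linarith
    then have "c0 * \<bar>W x s - W x' s'\<bar> \<le> (cW + cQ) * (A * ?q)" using c0 by (simp add: abs_mult distrib_right)
    then have "\<bar>W x s - W x' s'\<bar> \<le> C * (A * ?q)" using A nn by (intro byC[of _ "cW + cQ"]) auto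
    then show "\<bar>W x s - W x' s'\<bar> \<le> C * A * ?q" by (simp only: mult.assoc)
  next
    fix x :: 'a and t1 t2 A :: real
    assume x: "x \<in> ball x0 r" and t: "\<bar>t1 - t0\<bar> < \<rho>" "\<bar>t2 - t0\<bar> < \<rho>" and le: "t1 \<le> t2" and A: "A \<ge> 1"
      and VA: "\<And>s. s \<in> {t1..t2} \<Longrightarrow> V x s \<le> ennreal A"
    have A0: "A \<ge> 0" using A by simp
    let ?d = "t2 - t1" and ?w = "\<eta>.graph_potential H x t1"
    have d1: "?d \<le> 1" "0 \<le> ?d" using diamt[OF t] le by auto
    have w0: "?w \<ge> 0" unfolding \<eta>.graph_potential_def by (intro integral_nonneg_AE) (auto simp: \<eta>.K_nonneg)
    \<comment> \<open>The oscillation of the graph integral over [t1, t2], from its Hoelder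
      continuity in time at a fixed point of space.\<close>
    define e where "e = 2 * A * ((?m + 2 + 2 * L) * ?d powr \<gamma>)"
    have e0: "e \<ge> 0" using A \<eta>.L_nonneg by (auto simp: e_def)
    have pe: "\<bar>P (x, t2) - P (x, t1) - ?w * (t2 - t1)\<bar> \<le> e * (t2 - t1)"
      unfolding P_def
    proof (rule \<eta>.potential_increment_bounds[OF refl fm f1 Hm le, of x "?m + \<gamma>" A])
      show "f (y, s) = (if H y < s then 1 else 0)" if "t1 \<le> t'" "t' \<le> t2" "norm (x - y, t' - s) \<le> \<rho>" for y s t'
        using that t by (intro fH[OF x _ that(3)]) linarith
      show "\<eta>.graph_weight (?m + \<gamma>) H x s \<le> ennreal A" if "s \<in> {t1..<t2}" for s
        using VA[of s] that by (simp add: Vg)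
      show "\<bar>\<eta>.graph_potential H x s - ?w\<bar> \<le> e" if s: "s \<in> {t1..<t2}" for s
      proof -
        have "\<bar>\<eta>.graph_potential H x s - ?w\<bar> \<le> 2 * A * ((6 + 2 * L) * norm (x - x) powr (2 * \<gamma>) + (?m + 2 + 2 * L) * \<bar>s - t1\<bar> powr \<gamma>)"
          by (rule \<eta>.graph_potential_holder[OF Hm ex(7,8) _ _ _ A0]) (use VA[of s] VA[of t1] s d1 in \<open>auto simp: Vg\<close>)
        also have "\<dots> = 2 * A * ((?m + 2 + 2 * L) * \<bar>s - t1\<bar> powr \<gamma>)" by simp
        also have "\<dots> \<le> e" unfolding e_def using A s ex \<eta>.L_nonneg by (intro mult_left_mono powr_mono2) auto
        finally show ?thesis .
      qed
    qed (use ex A0 w0 e0 in auto)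
    have pw: "?d powr (1 + \<gamma>) = ?d * ?d powr \<gamma>" using d1 by (cases "?d = 0") (simp_all add: powr_add)
    have "e * ?d = 2 * (?m + 2 + 2 * L) * (A * ?d powr (1 + \<gamma>))" by (simp add: e_def pw ac_simps)
    also have "\<dots> \<le> cW * (A * ?d powr (1 + \<gamma>))" using A \<eta>.L_nonneg by (intro mult_right_mono) (auto simp: cW_def)
    finally have 1: "\<bar>P (x, t2) - P (x, t1) - ?w * ?d\<bar> \<le> cW * (A * ?d powr (1 + \<gamma>))" using pe by linarith
    have "\<bar>S ((x, t1) + (0, ?d)) - S (x, t1) - Sg (x, t1) \<bullet> (0, ?d)\<bar> \<le> 2 * M * (norm (0::'a, ?d))\<^sup>2 * E.bump_const" by (rule Q(4))
    then have "\<bar>S (x, t2) - S (x, t1) - snd (Sg (x, t1)) * ?d\<bar> \<le> cQ * ?d\<^sup>2" by (simp add: cQ_def inner_prod_def ac_simps)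
    also have "\<dots> \<le> cQ * (A * ?d powr (1 + \<gamma>))"
    proof (rule mult_left_mono)
      have "?d\<^sup>2 \<le> ?d powr (1 + \<gamma>)" unfolding pw power2_eq_square using d1 ex by (intro mult_left_mono powr_ge_self_le_one) auto
      also have "\<dots> \<le> A * ?d powr (1 + \<gamma>)" using mult_right_mono[OF A, of "?d powr (1 + \<gamma>)"] by simp
      finally show "?d\<^sup>2 \<le> A * ?d powr (1 + \<gamma>)" .
    qed (rule nn)
    finally have 2: "\<bar>S (x, t2) - S (x, t1) - snd (Sg (x, t1)) * ?d\<bar> \<le> cQ * (A * ?d powr (1 + \<gamma>))" .
    have cw: "c0 * W x t1 = ?w - snd (Sg (x, t1))" using c0 by (simp add: W_def)
    have "c0 * (u (x, t2) - u (x, t1) - W x t1 * ?d) = c0 * u (x, t2) - c0 * u (x, t1) - (c0 * W x t1) * ?d"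
      by (simp add: algebra_simps)
    also have "\<dots> = (P (x, t2) - P (x, t1) - ?w * ?d) - (S (x, t2) - S (x, t1) - snd (Sg (x, t1)) * ?d)"
      unfolding cw u[OF x t(1)] u[OF x t(2)] by (simp add: algebra_simps)
    finally have "\<bar>c0 * (u (x, t2) - u (x, t1) - W x t1 * ?d)\<bar> \<le> cW * (A * ?d powr (1 + \<gamma>)) + cQ * (A * ?d powr (1 + \<gamma>))"
      using 1 2 by linarith
    then have "c0 * \<bar>u (x, t2) - u (x, t1) - W x t1 * ?d\<bar> \<le> (cW + cQ) * (A * ?d powr (1 + \<gamma>))" using c0 by (simp add: abs_mult distrib_right)
    then have "\<bar>u (x, t2) - u (x, t1) - W x t1 * ?d\<bar> \<le> C * (A * ?d powr (1 + \<gamma>))" using A nn by (intro byC[of _ "cW + cQ"]) auto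
    then show "\<bar>u (x, t2) - u (x, t1) - W x t1 * ?d\<bar> \<le> C * A * ?d powr (1 + \<gamma>)" by (simp only: mult.assoc)
  next
    show "u (x, t') - u (x, t) \<ge> c * (t' - t)" if "x \<in> ball x0 r" "\<bar>t - t0\<bar> < \<rho>" "\<bar>t' - t0\<bar> < \<rho>" "t \<le> t'" for x t t'
      by (rule growth[OF that])
    show "\<bar>H x - t0\<bar> < \<rho> / 2" if "x \<in> ball x0 r" for x by (rule H_range[OF that])
    show "u (x, H x) = 0" if "x \<in> ball x0 r" for x by (rule H_zero[OF that])
  qed (use \<alpha> r \<rho> c C1 um Hm in \<open>auto simp: a_def \<beta>_def \<gamma>_def\<close>)
  show ?thesis using R.graph_C1_holder by (simp add: \<gamma>_def)
qed

section \<open>From weak derivatives to the tested equation\<close>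

lemma Lp_loc_mult_integrable:
  fixes g \<psi> :: "'a::euclidean_space \<Rightarrow> real"
  assumes Q: "open Q" and g: "Lp_loc 1 Q g" and \<psi>: "continuous_on UNIV \<psi>"
    and K: "compact K" "K \<subseteq> Q" "\<And>z. z \<notin> K \<Longrightarrow> \<psi> z = 0"
  shows "integrable (lebesgue_on Q) (\<lambda>z. g z * \<psi> z)"
proof -
  have Qm: "Q \<in> sets lebesgue" using Q by simp
  have gm: "g \<in> borel_measurable (lebesgue_on Q)" using g by (simp add: Lp_loc_def)
  have \<psi>m: "\<psi> \<in> borel_measurable (lebesgue_on Q)"
    using continuous_imp_measurable_on_sets_lebesgue[OF continuous_on_subset[OF \<psi>] Qm] by auto
  have m: "(\<lambda>z. g z * \<psi> z) \<in> borel_measurable (lebesgue_on Q)" by (rule borel_measurable_times[OF gm \<psi>m])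
  have "compact (\<psi> ` K)" by (rule compact_continuous_image[OF continuous_on_subset[OF \<psi>] K(1)]) simp
  then obtain B where B: "\<And>z. z \<in> K \<Longrightarrow> \<bar>\<psi> z\<bar> \<le> B"
    using compact_imp_bounded bounded_iff by (metis imageI real_norm_def)
  have gp: "\<bar>g z\<bar> powr 1 = \<bar>g z\<bar>" for z by simp
  have "set_integrable lebesgue K (\<lambda>z. \<bar>g z\<bar>)" using g K unfolding Lp_loc_def gp by blast
  then have iK: "integrable lebesgue (\<lambda>z. \<bar>B\<bar> * (indicator K z *\<^sub>R \<bar>g z\<bar>))"
    unfolding set_integrable_def by (rule integrable_mult_right)
  have "integrable lebesgue (\<lambda>z. indicator Q z *\<^sub>R (g z * \<psi> z))"
  proof (rule Bochner_Integration.integrable_bound[OF iK])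
    show "(\<lambda>z. indicator Q z *\<^sub>R (g z * \<psi> z)) \<in> borel_measurable lebesgue"
      using m by (subst (asm) borel_measurable_restrict_space_iff) (use Qm in auto)
    have "norm (indicator Q z *\<^sub>R (g z * \<psi> z)) \<le> norm (\<bar>B\<bar> * (indicator K z *\<^sub>R \<bar>g z\<bar>))" for z
    proof (cases "z \<in> K")
      case True
      then have "\<bar>\<psi> z\<bar> \<le> \<bar>B\<bar>" using B[of z] by linarith
      then have "\<bar>g z\<bar> * \<bar>\<psi> z\<bar> \<le> \<bar>g z\<bar> * \<bar>B\<bar>" by (intro mult_left_mono) auto
      then show ?thesis using True K(2) by (auto simp: abs_mult mult.commute)
    qed (simp add: K(3))
    then show "AE z in lebesgue. norm (indicator Q z *\<^sub>R (g z * \<psi> z)) \<le> norm (\<bar>B\<bar> * (indicator K z *\<^sub>R \<bar>g z\<bar>))" by (intro AE_I2)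
  qed
  then show ?thesis by (subst integrable_restrict_space) (use Qm in auto)
qed

text \<open>Weak derivatives are tested against the completed measure on Q, potentials are integrals
  over \<open>lborel\<close>; for Borel integrands the completion does not change the
  integral.\<close>

lemma lebesgue_on_integral_eq_lborel:
  fixes F :: "'a::euclidean_space \<Rightarrow> real"
  assumes "open Q" "(\<lambda>z. indicator Q z * F z) \<in> borel_measurable borel"
  shows "(LINT z|lebesgue_on Q. F z) = (\<integral>z. indicator Q z * F z \<partial>lborel)"
proof -
  have "(LINT z|lebesgue_on Q. F z) = (\<integral>z. indicator Q z *\<^sub>R F z \<partial>lebesgue)"
    by (rule integral_restrict_space) (use assms(1) in auto)
  also have "\<dots> = (\<integral>z. indicator Q z * F z \<partial>lborel)"
    using assms(2) by (simp add: integral_completion)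
  finally show ?thesis .
qed

lemma test_function_C_k_on: "test_function Q \<phi> \<Longrightarrow> C_k_on k UNIV \<phi>"
  by (simp add: test_function_def C_k_eq_C_k_on_UNIV)

lemma test_function_outside:
  assumes "test_function Q \<phi>" "z \<notin> closure {z. \<phi> z \<noteq> 0}"
  shows "\<phi> z = 0" "dir_deriv v \<phi> z = 0"
proof -
  show "\<phi> z = 0" using assms(2) closure_subset[of "{z. \<phi> z \<noteq> 0}"] by auto
  show "dir_deriv v \<phi> z = 0"
  proof (rule dir_deriv_zero_open[of "- closure {z. \<phi> z \<noteq> 0}"])
    show "\<phi> w = 0" if "w \<in> - closure {z. \<phi> z \<noteq> 0}" for w
      using that closure_subset[of "{z. \<phi> z \<noteq> 0}"] by auto
  qed (use assms(2) in auto)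
qed

lemma test_function_dir_deriv:
  assumes "test_function Q \<phi>" "b \<in> Basis" shows "test_function Q (dir_deriv b \<phi>)"
proof -
  have "{z. dir_deriv b \<phi> z \<noteq> 0} \<subseteq> closure {z. \<phi> z \<noteq> 0}" using test_function_outside(2)[OF assms(1)] by blast
  then have c: "closure {z. dir_deriv b \<phi> z \<noteq> 0} \<subseteq> closure {z. \<phi> z \<noteq> 0}" by (rule closure_minimal) simp
  have "C_k k (dir_deriv b \<phi>)" for k
    using C_k_on_dir_deriv[OF test_function_C_k_on[OF assms(1)] assms(2)] by (simp add: C_k_eq_C_k_on_UNIV)
  moreover have "compact (closure {z. dir_deriv b \<phi> z \<noteq> 0})"
    using c assms(1) unfolding test_function_def by (meson bounded_subset closed_closure compact_eq_bounded_closed)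
  ultimately show ?thesis using c assms(1) unfolding test_function_def by blast
qed

lemma Lp_loc_test_integrable:
  assumes "open Q" "Lp_loc 1 Q g" "test_function Q \<phi>"
  shows "integrable (lebesgue_on Q) (\<lambda>z. g z * \<phi> z)"
proof (rule Lp_loc_mult_integrable[OF assms(1,2)])
  show "continuous_on UNIV \<phi>" using test_function_C_k_on[OF assms(3), of 0] by simp
  show "compact (closure {z. \<phi> z \<noteq> 0})" "closure {z. \<phi> z \<noteq> 0} \<subseteq> Q" using assms(3) by (auto simp: test_function_def)
  show "\<phi> z = 0" if "z \<notin> closure {z. \<phi> z \<noteq> 0}" for z by (rule test_function_outside(1)[OF assms(3) that])
qed

lemma sum_Basis_vec: "(\<Sum>b\<in>(Basis :: (real^'n) set). h b) = (\<Sum>i\<in>UNIV. h (axis i 1))"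
proof -
  have B: "(Basis :: (real^'n) set) = range (\<lambda>i. axis i 1)" by (auto simp: Basis_vec_def)
  have "inj (\<lambda>i. axis i (1::real) :: real^'n)" by (auto simp: inj_def axis_eq_axis)
  then show ?thesis unfolding B by (subst sum.reindex) (simp_all add: comp_def)
qed

text \<open>Every derivative is moved to the test function, with one change of sign for the time
  derivative and two for each second derivative in space. Extending \<open>u\<close> by 0 outside Q
  makes it Borel on the whole space.\<close>

lemma strong_solution_weak_identity:
  fixes u :: "(real^'n) \<times> real \<Rightarrow> real"
  assumes Q: "open Q" and S: "strong_heat_solution Q f u" and fm: "f \<in> borel_measurable borel" and fQ: "\<And>z. z \<notin> Q \<Longrightarrow> f z = 0"
    and \<phi>: "test_function Q \<phi>"
  shows "(\<integral>w. (indicator Q w * u w) * (- dir_deriv (0, 1) \<phi> w - (\<Sum>b\<in>Basis. dir_deriv (b, 0) (dir_deriv (b, 0) \<phi>) w)) \<partial>lborel)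
    = (\<integral>w. f w * \<phi> w \<partial>lborel)"
proof -
  obtain ut Du D2u where w: "continuous_on Q u" "has_weak_deriv Q u (0, 1) ut"
    "\<And>i. has_weak_deriv Q u (axis i 1, 0) (Du i)" "\<And>i j. has_weak_deriv Q (Du i) (axis j 1, 0) (D2u i j)"
    "AE z in lebesgue_on Q. ut z - (\<Sum>i\<in>UNIV. D2u i i z) = f z"
    using S unfolding strong_heat_solution_def by blast
  have loc: "Lp_loc 1 Q u" "Lp_loc 1 Q ut" "\<And>i. Lp_loc 1 Q (D2u i i)"
    using w(2,4) unfolding has_weak_deriv_def by auto
  have b0: "(0, 1) \<in> (Basis :: ((real^'n) \<times> real) set)" and bi: "(axis i 1, 0) \<in> (Basis :: ((real^'n) \<times> real) set)" for i
    by (auto simp: Basis_prod_def axis_in_Basis_iff)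
  let ?d = "\<lambda>i. dir_deriv (axis i 1, 0) (dir_deriv (axis i 1, 0) \<phi>)"
  have t1: "test_function Q (dir_deriv (axis i 1, 0) \<phi>)" and t2: "test_function Q (?d i)" for i
    using test_function_dir_deriv[OF test_function_dir_deriv[OF \<phi> bi] bi] test_function_dir_deriv[OF \<phi> bi] by auto
  have t0: "test_function Q (dir_deriv (0, 1) \<phi>)" by (rule test_function_dir_deriv[OF \<phi> b0])
  have e0: "(LINT z|lebesgue_on Q. u z * dir_deriv (0, 1) \<phi> z) = - (LINT z|lebesgue_on Q. ut z * \<phi> z)"
    using w(2) \<phi> unfolding has_weak_deriv_def dir_deriv_def by blast
  have ei: "(LINT z|lebesgue_on Q. u z * ?d i z) = (LINT z|lebesgue_on Q. D2u i i z * \<phi> z)" for i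
  proof -
    have "(LINT z|lebesgue_on Q. u z * ?d i z) = - (LINT z|lebesgue_on Q. Du i z * dir_deriv (axis i 1, 0) \<phi> z)"
      using w(3)[of i] t1[of i] unfolding has_weak_deriv_def dir_deriv_def[of _ "dir_deriv (axis i 1, 0) \<phi>"] by blast
    also have "(LINT z|lebesgue_on Q. Du i z * dir_deriv (axis i 1, 0) \<phi> z) = - (LINT z|lebesgue_on Q. D2u i i z * \<phi> z)"
      using w(4)[of i i] \<phi> unfolding has_weak_deriv_def dir_deriv_def by blast
    finally show ?thesis by simp
  qed
  note int = Lp_loc_test_integrable[OF Q]
  note i = int[OF loc(1) t0] int[OF loc(1) t2] int[OF loc(2) \<phi>] int[OF loc(3) \<phi>]
  define \<Phi> where "\<Phi> w = - dir_deriv (0, 1) \<phi> w - (\<Sum>b\<in>Basis. dir_deriv (b, 0) (dir_deriv (b, 0) \<phi>) w)" for w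
  have \<Phi>: "\<Phi> w = - dir_deriv (0, 1) \<phi> w - (\<Sum>i\<in>UNIV. ?d i w)" for w by (simp add: \<Phi>_def sum_Basis_vec)
  have c: "continuous_on UNIV (dir_deriv (0, 1) \<phi>)" "continuous_on UNIV (?d i)" "continuous_on UNIV \<phi>" for i
    using test_function_C_k_on[OF t0, of 0] test_function_C_k_on[OF t2, of 0] test_function_C_k_on[OF \<phi>, of 0] by auto
  have um: "(\<lambda>z. indicator Q z * u z) \<in> borel_measurable borel"
    using borel_measurable_continuous_on_indicator[OF _ w(1)] Q by simp
  have \<Phi>m: "\<Phi> \<in> borel_measurable borel"
    unfolding \<Phi>[abs_def] using c by (intro borel_measurable_continuous_onI continuous_intros) auto
  have "(\<integral>w. (indicator Q w * u w) * \<Phi> w \<partial>lborel) = (LINT w|lebesgue_on Q. u w * \<Phi> w)"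
  proof (subst lebesgue_on_integral_eq_lborel[OF Q])
    have "(\<lambda>z. (indicator Q z * u z) * \<Phi> z) \<in> borel_measurable borel" by (rule borel_measurable_times[OF um \<Phi>m])
    then show "(\<lambda>z. indicator Q z * (u z * \<Phi> z)) \<in> borel_measurable borel" by (simp only: mult.assoc)
  qed (simp only: mult.assoc)
  also have "\<dots> = (LINT w|lebesgue_on Q. - (u w * dir_deriv (0, 1) \<phi> w) - (\<Sum>i\<in>UNIV. u w * ?d i w))"
    by (simp add: \<Phi> right_diff_distrib sum_distrib_left)
  also have "\<dots> = - (LINT w|lebesgue_on Q. u w * dir_deriv (0, 1) \<phi> w) - (\<Sum>i\<in>UNIV. LINT w|lebesgue_on Q. u w * ?d i w)"
    using i(1,2) by (subst Bochner_Integration.integral_diff) auto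
  also have "\<dots> = (LINT z|lebesgue_on Q. ut z * \<phi> z) - (\<Sum>i\<in>UNIV. LINT z|lebesgue_on Q. D2u i i z * \<phi> z)"
    by (simp add: e0 ei)
  also have "\<dots> = (LINT z|lebesgue_on Q. ut z * \<phi> z - (\<Sum>i\<in>UNIV. D2u i i z * \<phi> z))"
    using i(3,4) by (subst Bochner_Integration.integral_diff) auto
  also have "\<dots> = (LINT z|lebesgue_on Q. f z * \<phi> z)"
  proof (rule integral_cong_AE)
    show "(\<lambda>z. ut z * \<phi> z - (\<Sum>i\<in>UNIV. D2u i i z * \<phi> z)) \<in> borel_measurable (lebesgue_on Q)"
      using i(3,4) by (intro borel_measurable_diff borel_measurable_sum borel_measurable_integrable) auto
    have "(\<lambda>z. f z * \<phi> z) \<in> borel_measurable borel"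
      by (rule borel_measurable_times[OF fm borel_measurable_continuous_onI[OF c(3)]])
    then have "(\<lambda>z. f z * \<phi> z) \<in> borel_measurable lborel" by (simp only: measurable_lborel2)
    then have "(\<lambda>z. f z * \<phi> z) \<in> borel_measurable lebesgue" by (rule measurable_completion)
    then show "(\<lambda>z. f z * \<phi> z) \<in> borel_measurable (lebesgue_on Q)" by (rule measurable_restrict_space1)
    show "AE z in lebesgue_on Q. ut z * \<phi> z - (\<Sum>i\<in>UNIV. D2u i i z * \<phi> z) = f z * \<phi> z"
      using w(5) by eventually_elim (simp only: sum_distrib_right[symmetric] left_diff_distrib[symmetric])
  qed
  also have "\<dots> = (\<integral>w. f w * \<phi> w \<partial>lborel)"
  proof (subst lebesgue_on_integral_eq_lborel[OF Q])
    have e: "indicator Q z * (f z * \<phi> z) = f z * \<phi> z" for z using fQ[of z] by (cases "z \<in> Q") auto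
    show "(\<lambda>z. indicator Q z * (f z * \<phi> z)) \<in> borel_measurable borel"
      unfolding e by (rule borel_measurable_times[OF fm borel_measurable_continuous_onI[OF c(3)]])
    show "(\<integral>z. indicator Q z * (f z * \<phi> z) \<partial>lborel) = (\<integral>w. f w * \<phi> w \<partial>lborel)" unfolding e ..
  qed
  finally show ?thesis unfolding \<Phi>_def .
qed

text \<open>Above and below the given zero \<open>u\<close> has strict signs, which persist for
  nearby x; the intermediate value theorem yields a zero on each vertical segment, and growth makes
  it unique. Continuity of \<open>H\<close> follows from c |H y - H x| <= |u (y, H x)|, whose
  right-hand side tends to u (x, H x) = 0.\<close>

lemma increasing_zero_graph:
  fixes u :: "'a::euclidean_space \<times> real \<Rightarrow> real"
  assumes Q: "open Q" and cont: "continuous_on Q u" and c: "c > 0"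
    and growth: "\<And>x t1 t2. (x, t1) \<in> Q \<Longrightarrow> (x, t2) \<in> Q \<Longrightarrow> t1 \<le> t2 \<Longrightarrow> u (x, t2) - u (x, t1) \<ge> c * (t2 - t1)"
    and z: "(x0, t0) \<in> Q" "u (x0, t0) = 0"
  obtains R T H where "0 < R" "R \<le> T" "cball x0 R \<times> cball t0 T \<subseteq> Q" "continuous_on (ball x0 R) H"
    "\<And>x. x \<in> ball x0 R \<Longrightarrow> \<bar>H x - t0\<bar> < T" "H x0 = t0"
    "\<And>x t. x \<in> ball x0 R \<Longrightarrow> \<bar>t - t0\<bar> \<le> T \<Longrightarrow> (u (x, t) > 0 \<longleftrightarrow> H x < t) \<and> (u (x, t) = 0 \<longleftrightarrow> t = H x)"
proof -
  obtain e where e: "e > 0" "ball (x0, t0) e \<subseteq> Q" using openE[OF Q z(1)] by blast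
  define T where "T = e / 4"
  have T: "T > 0" using e by (simp add: T_def)
  have box: "(x, t) \<in> Q" if "norm (x - x0) \<le> T" "\<bar>t - t0\<bar> \<le> T" for x t
  proof -
    have "dist (x0, t0) (x, t) = norm (x - x0, t - t0)" using norm_minus_commute[of "(x0, t0)" "(x, t)"] by (simp add: dist_norm)
    also have "\<dots> \<le> norm (x - x0) + norm (t - t0)" by (rule norm_Pair_le)
    also have "\<dots> < e" using that e by (simp add: T_def)
    finally show ?thesis using e(2) by auto
  qed
  have cu: "isCont u w" if "w \<in> Q" for w using cont Q that continuous_on_eq_continuous_at by blast
  have cx: "isCont (\<lambda>x. u (x, t)) x" if "(x, t) \<in> Q" for x t
    by (rule isCont_o2[where g=u and f="\<lambda>x. (x, t)"]) (auto intro!: continuous_intros cu[OF that])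
  have top: "(x0, t0 + T) \<in> Q" "(x0, t0 - T) \<in> Q" using T by (auto intro: box)
  have cT: "c * T > 0" using c T by simp
  have "u (x0, t0 + T) \<ge> c * T" using growth[OF z(1) top(1)] z(2) T by simp
  with cT have "u (x0, t0 + T) > 0" by linarith
  then have ev1: "eventually (\<lambda>x. u (x, t0 + T) > 0) (at x0)"
    using cx[OF top(1)] unfolding isCont_def by (rule order_tendstoD(1)[rotated])
  have "- u (x0, t0 - T) \<ge> c * T" using growth[OF top(2) z(1)] z(2) T by simp
  with cT have "u (x0, t0 - T) < 0" by linarith
  then have ev2: "eventually (\<lambda>x. u (x, t0 - T) < 0) (at x0)"
    using cx[OF top(2)] unfolding isCont_def by (rule order_tendstoD(2)[rotated])
  obtain d where d: "d > 0" "\<And>x. x \<noteq> x0 \<Longrightarrow> dist x x0 < d \<Longrightarrow> u (x, t0 + T) > 0 \<and> u (x, t0 - T) < 0"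
    using eventually_conj[OF ev1 ev2] unfolding eventually_at by auto
  define R where "R = min T d"
  have R: "R > 0" "R \<le> T" using T d by (auto simp: R_def)
  have signs: "u (x, t0 + T) > 0" "u (x, t0 - T) < 0" if "x \<in> ball x0 R" for x
    using d(2)[of x] that \<open>u (x0, t0 + T) > 0\<close> \<open>u (x0, t0 - T) < 0\<close> by (auto simp: R_def dist_commute)
  have inQ: "(x, t) \<in> Q" if "x \<in> ball x0 R" "\<bar>t - t0\<bar> \<le> T" for x t
    using that R by (intro box) (auto simp: dist_norm norm_minus_commute)
  have "\<exists>h. \<bar>h - t0\<bar> < T \<and> u (x, h) = 0" if x: "x \<in> ball x0 R" for x
  proof -
    have "continuous_on {t0 - T..t0 + T} (\<lambda>t. u (x, t))"
    proof (rule continuous_at_imp_continuous_on, rule ballI)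
      fix t assume "t \<in> {t0 - T..t0 + T}"
      then have "(x, t) \<in> Q" using x by (intro inQ) auto
      then show "isCont (\<lambda>t. u (x, t)) t"
        by (intro isCont_o2[where g=u and f="\<lambda>t. (x, t)"]) (auto intro!: continuous_intros cu)
    qed
    from IVT'[OF _ _ _ this, of 0] obtain h where h: "t0 - T \<le> h" "h \<le> t0 + T" "u (x, h) = 0"
      using signs[OF x] T by force
    then have "h \<noteq> t0 - T" "h \<noteq> t0 + T" using signs[OF x] by auto
    then show ?thesis using h by (intro exI[of _ h]) auto
  qed
  then obtain H where H: "\<And>x. x \<in> ball x0 R \<Longrightarrow> \<bar>H x - t0\<bar> < T \<and> u (x, H x) = 0" by metis
  have pos: "(u (x, t) > 0 \<longleftrightarrow> H x < t) \<and> (u (x, t) = 0 \<longleftrightarrow> t = H x)" if x: "x \<in> ball x0 R" and t: "\<bar>t - t0\<bar> \<le> T" for x t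
  proof -
    have q: "(x, t) \<in> Q" "(x, H x) \<in> Q" using inQ[OF x] t H[OF x] by auto
    have "u (x, t) > 0" if "H x < t"
    proof -
      have "c * (t - H x) \<le> u (x, t)" using growth[OF q(2,1)] H[OF x] that by simp
      moreover have "c * (t - H x) > 0" using c that by simp
      ultimately show ?thesis by linarith
    qed
    moreover have "u (x, t) < 0" if "t < H x"
    proof -
      have "c * (H x - t) \<le> - u (x, t)" using growth[OF q] H[OF x] that by simp
      moreover have "c * (H x - t) > 0" using c that by simp
      ultimately show ?thesis by linarith
    qed
    ultimately show ?thesis using H[OF x] by (cases t "H x" rule: linorder_cases) auto
  qed
  have x0: "x0 \<in> ball x0 R" using R by simp
  have Hx0: "H x0 = t0" using pos[OF x0, of t0] z(2) T by auto
  have "continuous_on (ball x0 R) H"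
  proof (rule continuous_at_imp_continuous_on, rule ballI)
    fix x assume x: "x \<in> ball x0 R"
    have Hx: "(x, H x) \<in> Q" "\<bar>H x - t0\<bar> \<le> T" using inQ[OF x] H[OF x] by (auto simp: less_imp_le)
    have "((\<lambda>y. \<bar>u (y, H x)\<bar> / c) \<longlongrightarrow> \<bar>u (x, H x)\<bar> / c) (at x)"
      using cx[OF Hx(1)] c unfolding isCont_def by (intro tendsto_intros) auto
    then have lim: "((\<lambda>y. \<bar>u (y, H x)\<bar> / c) \<longlongrightarrow> 0) (at x)" using H[OF x] by simp
    have ev: "eventually (\<lambda>y. y \<in> ball x0 R) (at x)" using x by (rule eventually_at_in_open'[OF open_ball])
    have "((\<lambda>y. H y - H x) \<longlongrightarrow> 0) (at x)"
    proof (rule Lim_null_comparison[OF _ lim])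
      show "eventually (\<lambda>y. norm (H y - H x) \<le> \<bar>u (y, H x)\<bar> / c) (at x)"
        using ev
      proof eventually_elim
        case (elim y)
        have q: "(y, H x) \<in> Q" "(y, H y) \<in> Q" using inQ[OF elim] Hx(2) H[OF elim] by auto
        have "c * \<bar>H y - H x\<bar> \<le> \<bar>u (y, H x)\<bar>"
          using growth[OF q] growth[OF q(2,1)] H[OF elim] by (cases "H x \<le> H y") (auto simp: abs_if)
        then show ?case using c by (simp add: field_simps)
      qed
    qed
    then show "isCont H x" unfolding isCont_def by (rule LIM_zero_cancel)
  qed
  moreover have "cball x0 R \<times> cball t0 T \<subseteq> Q"
    using R by (auto intro!: box simp: dist_norm norm_minus_commute abs_minus_commute)
  ultimately show ?thesis using that[of R T H] R H pos Hx0 by blast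
qed

text \<open>A zero is the limit of the points straight above it, which are positive by growth.
  Conversely, a point in the closure of the positivity set cannot be negative by continuity, and a
  frontier point does not belong to this open set.\<close>

lemma free_boundary_eq_zero_set:
  fixes u :: "'a::euclidean_space \<times> real \<Rightarrow> real"
  assumes Q: "open Q" and cont: "continuous_on Q u" and c: "c > 0"
    and growth: "\<And>x t1 t2. (x, t1) \<in> Q \<Longrightarrow> (x, t2) \<in> Q \<Longrightarrow> t1 \<le> t2 \<Longrightarrow> u (x, t2) - u (x, t1) \<ge> c * (t2 - t1)"
  shows "open (positivity_set Q u)" "free_boundary Q u = {z \<in> Q. u z = 0}"
proof -
  have "positivity_set Q u = u -` {0<..} \<inter> Q" by (auto simp: positivity_set_def)
  then show o: "open (positivity_set Q u)" using continuous_open_preimage[OF cont Q open_greaterThan, of 0] by (simp add: Int_commute)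
  have fr: "frontier (positivity_set Q u) = closure (positivity_set Q u) - positivity_set Q u"
    using o by (simp add: frontier_def interior_open)
  show "free_boundary Q u = {z \<in> Q. u z = 0}"
  proof (intro equalityI subsetI)
    fix z assume "z \<in> free_boundary Q u"
    then have z: "z \<in> Q" "z \<in> closure (positivity_set Q u)" "z \<notin> positivity_set Q u" by (auto simp: free_boundary_def fr)
    have "\<not> u z < 0"
    proof
      assume neg: "u z < 0"
      have "open (Q \<inter> u -` {..<0})" by (rule continuous_open_preimage[OF cont Q open_lessThan])
      then have "(Q \<inter> u -` {..<0}) \<inter> positivity_set Q u \<noteq> {}"
        using z(1,2) neg open_Int_closure_eq_empty[of "Q \<inter> u -` {..<0}" "positivity_set Q u"] by blast
      then show False by (auto simp: positivity_set_def)
    qed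
    then show "z \<in> {z \<in> Q. u z = 0}" using z by (auto simp: positivity_set_def)
  next
    fix z assume zz: "z \<in> {z \<in> Q. u z = 0}"
    obtain x t where z: "z = (x, t)" by (cases z)
    have "z \<in> closure (positivity_set Q u)"
      unfolding closure_approachable
    proof (intro allI impI)
      fix \<epsilon> :: real assume \<epsilon>: "\<epsilon> > 0"
      obtain e where e: "e > 0" "ball z e \<subseteq> Q" using openE[OF Q, of z] zz by blast
      define h where "h = min \<epsilon> e / 2"
      have h: "h > 0" "h < \<epsilon>" "h < e" using \<epsilon> e by (auto simp: h_def)
      have "(x, t + h) \<in> ball z e" using h by (simp add: z dist_Pair_Pair dist_real_def)
      then have q: "(x, t + h) \<in> Q" using e by blast
      have "u (x, t + h) - u (x, t) \<ge> c * (t + h - t)" by (rule growth[OF _ q]) (use zz z h in auto)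
      moreover have "u (x, t) = 0" using zz z by simp
      ultimately have "u (x, t + h) > 0" using mult_pos_pos[OF c h(1)] by simp
      then have "(x, t + h) \<in> positivity_set Q u" using q by (simp add: positivity_set_def)
      moreover have "dist (x, t + h) z < \<epsilon>" using h by (simp add: z dist_Pair_Pair dist_real_def)
      ultimately show "\<exists>y\<in>positivity_set Q u. dist y z < \<epsilon>" by blast
    qed
    then have "z \<in> frontier (positivity_set Q u)" unfolding fr using zz by (auto simp: positivity_set_def)
    then show "z \<in> free_boundary Q u" using zz by (simp add: free_boundary_def)
  qed
qed

text \<open>The kernel estimates concern functions on the whole space, so all local data are
  truncated or extended in such a way that nothing changes within reach of a kernel of radius
  \<rho>.\<close>

lemma increasing_solution_local_graph:
  fixes u :: "'a::euclidean_space \<times> real \<Rightarrow> real"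
  assumes \<alpha>: "0 < \<alpha>" "\<alpha> < 1" and Q: "open Q" and cont: "continuous_on Q u" and c: "c > 0"
    and growth: "\<And>x t1 t2. (x, t1) \<in> Q \<Longrightarrow> (x, t2) \<in> Q \<Longrightarrow> t1 \<le> t2 \<Longrightarrow> u (x, t2) - u (x, t1) \<ge> c * (t2 - t1)"
    and weak: "\<And>\<phi>. test_function Q \<phi> \<Longrightarrow>
      (\<integral>w. (indicator Q w * u w) * (- dir_deriv (0, 1) \<phi> w - (\<Sum>b\<in>Basis. dir_deriv (b, 0) (dir_deriv (b, 0) \<phi>) w)) \<partial>lborel)
        = (\<integral>w. indicator (positivity_set Q u) w * \<phi> w \<partial>lborel)"
    and z: "(x0, t0) \<in> Q" "u (x0, t0) = 0"
  shows "\<exists>r a b H. r > 0 \<and> t0 \<in> {a<..<b} \<and> ball x0 r \<times> {a<..<b} \<subseteq> Q \<and> C1_holder_on (\<alpha> / 2) (ball x0 r) H \<and>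
     {z \<in> Q. u z = 0} \<inter> (ball x0 r \<times> {a<..<b}) = {(x, H x) | x. x \<in> ball x0 r}"
proof -
  obtain R T H where RT: "0 < R" "R \<le> T" and box: "cball x0 R \<times> cball t0 T \<subseteq> Q" and Hc: "continuous_on (ball x0 R) H"
    and HT: "\<And>x. x \<in> ball x0 R \<Longrightarrow> \<bar>H x - t0\<bar> < T" and H0: "H x0 = t0"
    and pos: "\<And>x t. x \<in> ball x0 R \<Longrightarrow> \<bar>t - t0\<bar> \<le> T \<Longrightarrow> (u (x, t) > 0 \<longleftrightarrow> H x < t) \<and> (u (x, t) = 0 \<longleftrightarrow> t = H x)"
    by (rule increasing_zero_graph[OF Q cont c _ z]) (rule growth, assumption, assumption, assumption,
      rule that, assumption, assumption, assumption, assumption, blast+)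
  have inQ: "(x, t) \<in> Q" if "norm (x - x0) \<le> R" "\<bar>t - t0\<bar> \<le> T" for x t
    using box that by (auto simp: dist_norm norm_minus_commute abs_minus_commute)
  \<comment> \<open>A kernel of radius \<rho> centred within \<rho> of x0 and of t0 sees only the
    box \<open>Bx\<close> of half-width 2 \<rho>, which has to lie well inside the region where the
    zero set is known to be a graph.\<close>
  define \<rho> where "\<rho> = min (1/8) (R / 4)"
  have \<rho>: "0 < \<rho>" "\<rho> \<le> 1/8" "4 * \<rho> \<le> R" "4 * \<rho> \<le> T" using RT by (auto simp: \<rho>_def min_def)
  have "isCont H x0" using Hc RT by (simp add: continuous_on_eq_continuous_at)
  then obtain d where d: "d > 0" "\<And>x. dist x x0 < d \<Longrightarrow> dist (H x) (H x0) < \<rho> / 2"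
    using \<rho>(1) unfolding continuous_at_eps_delta by (meson half_gt_zero)
  define r where "r = min \<rho> d"
  have r: "0 < r" "r \<le> \<rho>" using \<rho> d by (auto simp: r_def)
  have rR: "x \<in> ball x0 R" if "x \<in> ball x0 r" for x using that r \<rho> by auto
  have H_range: "\<bar>H x - t0\<bar> < \<rho> / 2" if "x \<in> ball x0 r" for x
    using d(2)[of x] that H0 by (simp add: r_def dist_commute[of x x0] dist_real_def)
  define U where "U w = indicator Q w * u w" for w
  define f :: "'a \<times> real \<Rightarrow> real" where "f = indicator (positivity_set Q u)"
  \<comment> \<open>\<open>H\<close> is continuous only on the ball; its extension by 0 is a Borel
    function, and the kernels see only points of the ball, where both agree.\<close>
  define Hg where "Hg x = indicator (ball x0 R) x * H x" for x
  define Bx where "Bx = cball x0 (2 * \<rho>) \<times> cball t0 (2 * \<rho>)"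
  \<comment> \<open>\<open>u\<close> need not be bounded on Q. Cutting it off outside a compact box
    makes it bounded and leaves the representation unchanged, since \<open>heat_error\<close> is
    supported in radius \<rho>.\<close>
  define ub where "ub w = indicator Bx w * U w" for w
  have Hg: "Hg x = H x" if "x \<in> ball x0 R" for x using that by (simp add: Hg_def)
  have UQ: "U w = u w" if "w \<in> Q" for w using that by (simp add: U_def)
  have Um: "U \<in> borel_measurable borel"
    unfolding U_def[abs_def] using borel_measurable_continuous_on_indicator[OF _ cont] Q by simp
  have "open (positivity_set Q u)" by (rule free_boundary_eq_zero_set(1)[OF Q cont c]) (rule growth)
  then have fm: "f \<in> borel_measurable borel" unfolding f_def by (intro borel_measurable_indicator) simp
  have Bxc: "compact Bx" unfolding Bx_def by (intro compact_Times compact_cball)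
  have BxQ: "Bx \<subseteq> Q" unfolding Bx_def using inQ \<rho> by (auto simp: dist_norm norm_minus_commute abs_minus_commute)
  have ubm: "ub \<in> borel_measurable borel"
    unfolding ub_def[abs_def] using Um Bxc by (intro borel_measurable_times borel_measurable_indicator) (auto dest: compact_imp_closed)
  have Hgm: "Hg \<in> borel_measurable borel"
    unfolding Hg_def[abs_def] using borel_measurable_continuous_on_indicator[OF _ Hc] by simp
  have "compact (u ` Bx)" by (rule compact_continuous_image[OF continuous_on_subset[OF cont BxQ] Bxc])
  then obtain M where M: "\<And>w. w \<in> Bx \<Longrightarrow> \<bar>u w\<bar> \<le> M" using compact_imp_bounded bounded_iff by (metis imageI real_norm_def)
  have M0: "M \<ge> 0" using M[of "(x0, t0)"] \<rho> by (auto simp: Bx_def)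
  have ubM: "\<bar>ub w\<bar> \<le> M" for w using M[of w] M0 BxQ by (cases "w \<in> Bx") (auto simp: ub_def UQ)
  have near: "(y, s) \<in> Bx" "y \<in> ball x0 R" "\<bar>s - t0\<bar> \<le> T" if "x \<in> ball x0 r" "\<bar>t - t0\<bar> < \<rho>" "norm (x - y, t - s) \<le> \<rho>" for x t y s
  proof -
    have n: "norm (x - y) \<le> \<rho>" "\<bar>t - s\<bar> \<le> \<rho>" using norm_le_coords(2,3)[OF that(3)] by auto
    have "dist x0 y \<le> dist x0 x + dist x y" by (rule dist_triangle)
    then have y: "dist x0 y < 2 * \<rho>" using that(1) r n(1) by (simp add: dist_norm)
    have s: "\<bar>s - t0\<bar> < 2 * \<rho>" using that(2) n(2) by linarith
    show "(y, s) \<in> Bx" using y s by (simp add: Bx_def dist_real_def abs_minus_commute)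
    show "y \<in> ball x0 R" "\<bar>s - t0\<bar> \<le> T" using y s \<rho> by auto
  qed
  have C1: "C1_holder_on (\<alpha> / 2) (ball x0 (r / 2)) Hg"
  proof (rule regular_graph_of_representation[OF \<alpha> r \<rho>(1,2) c Um fm ubm Hgm _ ubM])
    show "\<bar>f w\<bar> \<le> 1" for w by (simp add: f_def indicator_def)
    show "gauss_mass TYPE('a) * U (x, t) =
       (\<integral>w. f w * (heat_power (DIM('a) / 2) ((x, t) - w) * cutoff \<rho> ((x, t) - w)) \<partial>lborel)
       - (\<integral>w. ub w * heat_error \<rho> ((x, t) - w) \<partial>lborel)" if xt: "x \<in> ball x0 r" "\<bar>t - t0\<bar> < \<rho>" for x t
    proof -
      have sub: "w \<in> Bx" if "w \<in> cball (x, t) \<rho>" for w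
        using near(1)[OF xt, of "fst w" "snd w"] that by (cases w) (simp add: dist_norm)
      have "isCont U (x, t)"
      proof -
        have xQ: "(x, t) \<in> Q" using sub[of "(x, t)"] BxQ \<rho> by auto
        have "isCont u (x, t)" using cont Q xQ continuous_on_eq_continuous_at by blast
        moreover have "eventually (\<lambda>w. U w = u w) (nhds (x, t))"
          using eventually_nhds_in_open[OF Q xQ] by eventually_elim (rule UQ)
        ultimately show ?thesis using isCont_cong by blast
      qed
      then have "gauss_mass TYPE('a) * U (x, t) =
        (\<integral>w. f w * (heat_power (DIM('a) / 2) ((x, t) - w) * cutoff \<rho> ((x, t) - w)) \<partial>lborel)
         - (\<integral>w. U w * heat_error \<rho> ((x, t) - w) \<partial>lborel)"
      proof (intro heat_representation[OF Um fm, of Q])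
        show "\<bar>U w\<bar> \<le> M" if "w \<in> cball (x, t) \<rho>" for w using M[OF sub[OF that]] sub[OF that] BxQ by (auto simp: UQ)
        show "cball (x, t) \<rho> \<subseteq> Q" using sub BxQ by blast
      qed (use weak \<rho> in \<open>auto simp: U_def f_def indicator_def\<close>)
      moreover have "U w * heat_error \<rho> ((x, t) - w) = ub w * heat_error \<rho> ((x, t) - w)" for w
      proof (cases "w \<in> cball (x, t) \<rho>")
        case True
        then show ?thesis using sub[OF True] by (simp add: ub_def)
      next
        case False
        then show ?thesis using \<rho> by (simp add: heat_error_support dist_norm)
      qed
      ultimately show ?thesis by simp
    qed
    show "f (y, s) = (if Hg y < s then 1 else 0)" if "x \<in> ball x0 r" "\<bar>t - t0\<bar> < \<rho>" "norm (x - y, t - s) \<le> \<rho>" for x t y s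
      using pos[OF near(2,3)[OF that]] Hg[OF near(2)[OF that]] near(1)[OF that] BxQ by (auto simp: f_def positivity_set_def indicator_def)
    show "U (x, t') - U (x, t) \<ge> c * (t' - t)" if "x \<in> ball x0 r" "\<bar>t - t0\<bar> < \<rho>" "\<bar>t' - t0\<bar> < \<rho>" "t \<le> t'" for x t t'
    proof -
      have "(x, t) \<in> Q" "(x, t') \<in> Q" using that rR[OF that(1)] \<rho> by (auto intro!: inQ simp: dist_norm norm_minus_commute)
      then show ?thesis using growth that by (simp add: UQ)
    qed
    show "\<bar>Hg x - t0\<bar> < \<rho> / 2" if "x \<in> ball x0 r" for x using H_range[OF that] Hg[OF rR[OF that]] by simp
    show "U (x, Hg x) = 0" if x: "x \<in> ball x0 r" for x
    proof -
      have t: "\<bar>H x - t0\<bar> \<le> T" using HT[OF rR[OF x]] by simp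
      then have "(x, H x) \<in> Q" using rR[OF x] by (intro inQ) (auto simp: dist_norm norm_minus_commute)
      then show ?thesis using pos[OF rR[OF x] t] Hg[OF rR[OF x]] by (simp add: UQ)
    qed
  qed
  have rr: "x \<in> ball x0 r" if "x \<in> ball x0 (r / 2)" for x using that r by auto
  show ?thesis
  proof (intro exI conjI)
    show "r / 2 > 0" using r by simp
    show "t0 \<in> {t0 - \<rho><..<t0 + \<rho>}" using \<rho> by simp
    show sub: "ball x0 (r / 2) \<times> {t0 - \<rho><..<t0 + \<rho>} \<subseteq> Q"
      using r \<rho> by (auto intro!: inQ simp: dist_norm norm_minus_commute)
    show "C1_holder_on (\<alpha> / 2) (ball x0 (r / 2)) Hg" by (rule C1)
    have mem: "u (x, t) = 0 \<longleftrightarrow> t = Hg x" if "x \<in> ball x0 (r / 2)" "t \<in> {t0 - \<rho><..<t0 + \<rho>}" for x t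
      using pos[OF rR[OF rr[OF that(1)]], of t] Hg[OF rR[OF rr[OF that(1)]]] that(2) \<rho> by auto
    have rng: "Hg x \<in> {t0 - \<rho><..<t0 + \<rho>}" if "x \<in> ball x0 (r / 2)" for x
      using H_range[OF rr[OF that]] \<rho>(1) unfolding Hg[OF rR[OF rr[OF that]]] greaterThanLessThan_iff by linarith
    show "{z \<in> Q. u z = 0} \<inter> (ball x0 (r / 2) \<times> {t0 - \<rho><..<t0 + \<rho>}) = {(x, Hg x) | x. x \<in> ball x0 (r / 2)}"
      using mem rng sub by blast
  qed
qed

lemma open_parabolic_cylinder: "open (parabolic_cylinder r (x :: real^'n) t)"
proof -
  have "parabolic_cylinder r x t = {z. norm (x - fst z) + sqrt \<bar>t - snd z\<bar> < r}" by (auto simp: parabolic_cylinder_def)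
  moreover have "open {z :: (real^'n) \<times> real. norm (x - fst z) + sqrt \<bar>t - snd z\<bar> < r}"
    by (rule open_Collect_less) (auto intro!: continuous_intros)
  ultimately show ?thesis by simp
qed

theorem theorem1p1:
  fixes u :: "(real^'n) \<times> real \<Rightarrow> real" and c :: real
    and Q1 \<Gamma> :: "((real^'n) \<times> real) set"
  defines "Q1 \<equiv> parabolic_cylinder 1 0 0"
    and "\<Gamma> \<equiv> free_boundary Q1 u"
  assumes "c > 0"
    and "strong_heat_solution Q1 (indicator (positivity_set Q1 u)) u"
    and "\<And>x t1 t2. (x, t1) \<in> Q1 \<Longrightarrow> (x, t2) \<in> Q1 \<Longrightarrow> t1 \<le> t2 \<Longrightarrow>
           u (x, t2) - u (x, t1) \<ge> c * (t2 - t1)"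
  shows "\<forall>\<alpha>. 0 < \<alpha> \<and> \<alpha> < 1 \<longrightarrow>
           (\<forall>(x0, t0) \<in> \<Gamma>. \<exists>r a b H.
              r > 0 \<and> t0 \<in> {a<..<b} \<and> ball x0 r \<times> {a<..<b} \<subseteq> Q1 \<and>
              C1_holder_on (\<alpha> / 2) (ball x0 r) H \<and>
              \<Gamma> \<inter> (ball x0 r \<times> {a<..<b}) = {(x, H x) | x. x \<in> ball x0 r})"
proof (intro allI impI, clarify)
  fix \<alpha> :: real and x0 t0 assume \<alpha>: "0 < \<alpha>" "\<alpha> < 1" and z: "(x0, t0) \<in> \<Gamma>"
  have o: "open Q1" unfolding Q1_def by (rule open_parabolic_cylinder)
  have cont: "continuous_on Q1 u" using assms(4) by (simp add: strong_heat_solution_def)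
  have P: "open (positivity_set Q1 u)" by (rule free_boundary_eq_zero_set(1)[OF o cont assms(3)]) (rule assms(5))
  have \<Gamma>: "\<Gamma> = {z \<in> Q1. u z = 0}"
    unfolding \<Gamma>_def by (rule free_boundary_eq_zero_set(2)[OF o cont assms(3)]) (rule assms(5))
  show "\<exists>r a b H. r > 0 \<and> t0 \<in> {a<..<b} \<and> ball x0 r \<times> {a<..<b} \<subseteq> Q1 \<and>
              C1_holder_on (\<alpha> / 2) (ball x0 r) H \<and>
              \<Gamma> \<inter> (ball x0 r \<times> {a<..<b}) = {(x, H x) | x. x \<in> ball x0 r}"
    unfolding \<Gamma>
  proof (rule increasing_solution_local_graph[OF \<alpha> o cont assms(3)])
    show "u (x, t2) - u (x, t1) \<ge> c * (t2 - t1)" if "(x, t1) \<in> Q1" "(x, t2) \<in> Q1" "t1 \<le> t2" for x t1 t2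
      by (rule assms(5)[OF that])
    show "(x0, t0) \<in> Q1" "u (x0, t0) = 0" using z unfolding \<Gamma> by auto
    show "(\<integral>w. (indicator Q1 w * u w) * (- dir_deriv (0, 1) \<phi> w - (\<Sum>b\<in>Basis. dir_deriv (b, 0) (dir_deriv (b, 0) \<phi>) w)) \<partial>lborel)
        = (\<integral>w. indicator (positivity_set Q1 u) w * \<phi> w \<partial>lborel)" if "test_function Q1 \<phi>" for \<phi>
      by (rule strong_solution_weak_identity[OF o assms(4) _ _ that])
         (use P in \<open>auto simp: positivity_set_def intro!: borel_measurable_indicator\<close>)
  qed
qed

end
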